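(* Let $\mathcal{E}$ be a spatial Arveson system. Let $u$ be a normalised unit of $\mathcal{E}$ and let $\mathcal{F}$ be the product subsystem of $\mathcal{E}$ generated by $u$ and all its roots. Then the following hold. (a) $\mathcal{F}=\mathcal{E}^I$, the type I part of $\mathcal{E}$. (b) $R^{\mathcal{E}}_u=R^{\mathcal{E}^I}_u$. (c) $\operatorname{ind}\mathcal{E}=\dim R^{\mathcal{E}}_u$.
   Context: Inner products are linear in the second argument. A product system $\mathcal{E}$ is a family $(\mathcal{E}_t)_{t>0}$ of Hilbert spaces with unitary structure maps $B_{s,t}:\mathcal{E}_{s+t}\to\mathcal{E}_s\otimes\mathcal{E}_t$ ($s,t>0$) satisfying $(I_{\mathcal{E}_r}\otimes B_{s,t})B_{r,s+t}=(B_{r,s}\otimes I_{\mathcal{E}_t})B_{r+s,t}$. For $x\in\mathcal{E}_s$, $y\in\mathcal{E}_t$, write $x\cdot y:=B_{s,t}^*(x\otimes y)$. An Arveson system is a product system with every $\mathcal{E}_t$ separable, equipped with a measurable structure: a countable family of sections $(e^n)_{n\ge1}$ such that $(e^n_t)_n$ is total in $\mathcal{E}_t$ for each $t$, and $t\mapsto\langle e^m_t,e^n_t\rangle$ and $(s,t)\mapsto\langle e^l_{s+t},e^m_s\cdot e^n_t\rangle$ are measurable; a section $x$ is measurable if $t\mapsto\langle e^n_t,x_t\rangle$ is measurable for all $n$. A product subsystem of $\mathcal{E}$ is a family of closed subspaces $\mathcal{F}_t\subset\mathcal{E}_t$ with $B_{s,t}(\mathcal{F}_{s+t})=\mathcal{F}_s\otimes\mathcal{F}_t$;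 it is an Arveson system with measurable structure inherited from $\mathcal{E}$. The product subsystem generated by a collection of sections is the smallest product subsystem $\mathcal{F}$ such that $x_t\in\mathcal{F}_t$ for all $t>0$ and all sections $x$ in the collection. A unit is a nonzero measurable section $u$ with $u_{s+t}=u_s\cdot u_t$; it is normalised if $\|u_t\|=1$ for all $t$. $\mathcal{U}^{\mathcal{E}}$ is the set of units; $\mathcal{E}$ is spatial if $\mathcal{U}^{\mathcal{E}}\ne\emptyset$. The type I part $\mathcal{E}^I$ is the product subsystem generated by all units. For a normalised unit $u$, a root of $(\mathcal{E},u)$ is a measurable section $a$ with $a_{s+t}=a_s\cdot u_t+u_s\cdot a_t$ and $\langle u_t,a_t\rangle=0$ for all $s,t>0$. $R^{\mathcal{E}}_u$ is the space of roots, a Hilbert space under $\langle a,b\rangle:=\langle a_1,b_1\rangle$. $R^{\mathcal{E}^I}_u$ is the space of roots of $(\mathcal{E}^I,u)$, regarded as sections of $\mathcal{E}$. Index: for units $u,v$ there is $\gamma(u,v)\in\mathbb{C}$ with $\langle u_t,v_t\rangle=e^{t\gamma(u,v)}$ ($t>0$). On the space $V$ of finitely supported functions $f:\mathcal{U}^{\mathcal{E}}\to\mathbb{C}$ with $\sum_u f(u)=0$, the form $\langle f,g\rangle=\sum_{u,v}\gamma(u,v)\overline{f(u)}g(v)$ is nonnegative and sesquilinear; quotienting by its null space and completing gives the index space $\mathsf{k}(\mathcal{E})$, and $\operatorname{ind}\mathcal{E}:=\dim\mathsf{k}(\mathcal{E})$. *)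

theory Defs
  imports "HOL-Analysis.Analysis" "HOL-Algebra.Module"
begin

section \<open>Complex Hilbert spaces\<close>

text \<open>
  A complex inner product space is a module over the ring of complex numbers, in the sense of
  HOL-Algebra, together with a form that is linear in the second argument.  The fields
  \<^const>\<open>mult\<close> and \<^const>\<open>one\<close>, which the record of modules inherits from rings, play no role.
\<close>

definition complex_ring :: "complex ring" where
  "complex_ring = \<lparr>carrier = UNIV, mult = (*), one = 1, zero = 0, add = (+)\<rparr>"

lemma cring_complex_ring: "cring complex_ring"
  by (rule cringI, rule abelian_groupI, rule_tac [7] comm_monoidI)
     (auto simp: complex_ring_def algebra_simps intro: exI[of _ "- x" for x])

record 'a hspace = "(complex, 'a) module" +
  cip :: "'a \<Rightarrow> 'a \<Rightarrow> complex"

definition hnorm :: "'a hspace \<Rightarrow> 'a \<Rightarrow> real" where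
  "hnorm H x = sqrt (Re (cip H x x))"

text \<open>The library's \<^locale>\<open>Metric_space\<close> asks for a symmetric nonnegative function on the whole type.\<close>

definition hdist :: "'a hspace \<Rightarrow> 'a \<Rightarrow> 'a \<Rightarrow> real" where
  "hdist H x y = (if x \<in> carrier H \<and> y \<in> carrier H then hnorm H (x \<ominus>\<^bsub>H\<^esub> y) else 0)"

abbreviation htopology :: "'a hspace \<Rightarrow> 'a topology" where
  "htopology H \<equiv> Metric_space.mtopology (carrier H) (hdist H)"

locale hilbert_space = module complex_ring H for H :: "'a hspace" (structure) +
  assumes cip_add_right:
      "\<lbrakk>x \<in> carrier H; y \<in> carrier H; z \<in> carrier H\<rbrakk> \<Longrightarrow> cip H x (y \<oplus> z) = cip H x y + cip H x z"
    and cip_smult_right: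
      "\<lbrakk>x \<in> carrier H; y \<in> carrier H\<rbrakk> \<Longrightarrow> cip H x (c \<odot> y) = c * cip H x y"
    and cip_commute:
      "\<lbrakk>x \<in> carrier H; y \<in> carrier H\<rbrakk> \<Longrightarrow> cip H y x = cnj (cip H x y)"
    and cip_nonneg: "x \<in> carrier H \<Longrightarrow> 0 \<le> Re (cip H x x)"
    and cip_definite: "\<lbrakk>x \<in> carrier H; cip H x x = 0\<rbrakk> \<Longrightarrow> x = \<zero>"
    and complete: "Metric_space.mcomplete (carrier H) (hdist H)"

definition closed_subspace :: "'a hspace \<Rightarrow> 'a set \<Rightarrow> bool" where
  "closed_subspace H W \<longleftrightarrow> submodule W complex_ring H \<and> closedin (htopology H) W"

definition closed_span :: "'a hspace \<Rightarrow> 'a set \<Rightarrow> 'a set" where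
  "closed_span H S = \<Inter>{W. closed_subspace H W \<and> S \<subseteq> W}"

definition linear_map :: "'a hspace \<Rightarrow> 'b hspace \<Rightarrow> ('a \<Rightarrow> 'b) \<Rightarrow> bool" where
  "linear_map H K T \<longleftrightarrow> T \<in> carrier H \<rightarrow> carrier K \<and>
     (\<forall>x\<in>carrier H. \<forall>y\<in>carrier H. T (x \<oplus>\<^bsub>H\<^esub> y) = T x \<oplus>\<^bsub>K\<^esub> T y) \<and>
     (\<forall>c. \<forall>x\<in>carrier H. T (c \<odot>\<^bsub>H\<^esub> x) = c \<odot>\<^bsub>K\<^esub> T x)"

definition bounded_map :: "'a hspace \<Rightarrow> 'b hspace \<Rightarrow> ('a \<Rightarrow> 'b) \<Rightarrow> bool" where
  "bounded_map H K T \<longleftrightarrow> linear_map H K T \<and> (\<exists>C. \<forall>x\<in>carrier H. hnorm K (T x) \<le> C * hnorm H x)"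

definition unitary_map :: "'a hspace \<Rightarrow> 'b hspace \<Rightarrow> ('a \<Rightarrow> 'b) \<Rightarrow> bool" where
  "unitary_map H K T \<longleftrightarrow> linear_map H K T \<and> bij_betw T (carrier H) (carrier K) \<and>
     (\<forall>x\<in>carrier H. \<forall>y\<in>carrier H. cip K (T x) (T y) = cip H x y)"

definition hadjoint :: "'a hspace \<Rightarrow> 'b hspace \<Rightarrow> ('a \<Rightarrow> 'b) \<Rightarrow> 'b \<Rightarrow> 'a" where
  "hadjoint H K T y = (THE w. w \<in> carrier H \<and> (\<forall>z\<in>carrier H. cip H z w = cip K (T z) y))"

definition hproj :: "'a hspace \<Rightarrow> 'a set \<Rightarrow> 'a \<Rightarrow> 'a" where
  "hproj H W x = (THE p. p \<in> W \<and> (\<forall>y\<in>W. cip H y p = cip H y x))"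

definition orthonormal_basis :: "'a hspace \<Rightarrow> 'a set \<Rightarrow> bool" where
  "orthonormal_basis H S \<longleftrightarrow> S \<subseteq> carrier H \<and>
     (\<forall>x\<in>S. \<forall>y\<in>S. cip H x y = (if x = y then 1 else 0)) \<and> closed_span H S = carrier H"

text \<open>The Hilbert space dimension as a cardinal, to be compared by \<^const>\<open>ordIso\<close>.\<close>

definition hilbert_dim :: "'a hspace \<Rightarrow> 'a rel" where
  "hilbert_dim H = card_of (SOME S. orthonormal_basis H S)"


section \<open>Completions and tensor products\<close>

text \<open>
  The Hilbert space obtained from a space with a nonnegative, possibly degenerate, sesquilinear
  form by quotienting by the null space and completing: Cauchy sequences modulo sequences
  that tend to zero in the seminorm.
\<close>

definition cauchy_seqs :: "'a hspace \<Rightarrow> (nat \<Rightarrow> 'a) set" where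
  "cauchy_seqs V = {X. range X \<subseteq> carrier V \<and>
     (\<forall>e>0. \<exists>N. \<forall>m\<ge>N. \<forall>n\<ge>N. hdist V (X m) (X n) < e)}"

definition completion_rel :: "'a hspace \<Rightarrow> (nat \<Rightarrow> 'a) rel" where
  "completion_rel V = {(X, Y). X \<in> cauchy_seqs V \<and> Y \<in> cauchy_seqs V \<and>
     (\<lambda>n. hdist V (X n) (Y n)) \<longlonglongrightarrow> 0}"

definition completion_class :: "'a hspace \<Rightarrow> (nat \<Rightarrow> 'a) \<Rightarrow> (nat \<Rightarrow> 'a) set" where
  "completion_class V X = completion_rel V `` {X}"

definition hcompletion :: "'a hspace \<Rightarrow> (nat \<Rightarrow> 'a) set hspace" where
  "hcompletion V = \<lparr>
     carrier = cauchy_seqs V // completion_rel V,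
     mult = undefined, one = undefined,
     zero = completion_class V (\<lambda>n. \<zero>\<^bsub>V\<^esub>),
     add = (\<lambda>P Q. \<Union>X\<in>P. \<Union>Y\<in>Q. completion_class V (\<lambda>n. X n \<oplus>\<^bsub>V\<^esub> Y n)),
     smult = (\<lambda>c P. \<Union>X\<in>P. completion_class V (\<lambda>n. c \<odot>\<^bsub>V\<^esub> X n)),
     cip = (\<lambda>P Q. THE z. \<exists>X\<in>P. \<exists>Y\<in>Q. (\<lambda>n. cip V (X n) (Y n)) \<longlonglongrightarrow> z)\<rparr>"

text \<open>The finitely supported functions on \<open>X\<close>, with the form given by the matrix \<open>k\<close>.\<close>

definition free_space :: "'x set \<Rightarrow> ('x \<Rightarrow> 'x \<Rightarrow> complex) \<Rightarrow> ('x \<Rightarrow> complex) hspace" where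
  "free_space X k = \<lparr>
     carrier = {f. finite {x. f x \<noteq> 0} \<and> {x. f x \<noteq> 0} \<subseteq> X},
     mult = undefined, one = undefined,
     zero = (\<lambda>x. 0),
     add = (\<lambda>f g x. f x + g x),
     smult = (\<lambda>c f x. c * f x),
     cip = (\<lambda>f g. \<Sum>x | f x \<noteq> 0. \<Sum>y | g y \<noteq> 0. k x y * cnj (f x) * g y)\<rparr>"

text \<open>
  The Hilbert space tensor product.  The form on formal linear combinations of pairs is
  determined by \<open>\<langle>x \<otimes> y, x' \<otimes> y'\<rangle> = \<langle>x, x'\<rangle> \<langle>y, y'\<rangle>\<close>.  Its null space is
  spanned by the bilinearity relations, so that the quotient is the algebraic tensor product.
\<close>

type_synonym ('a, 'b) tensor = "(nat \<Rightarrow> 'a \<times> 'b \<Rightarrow> complex) set"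

definition free_tensor :: "'a hspace \<Rightarrow> 'b hspace \<Rightarrow> ('a \<times> 'b \<Rightarrow> complex) hspace" where
  "free_tensor H K = free_space (carrier H \<times> carrier K)
     (\<lambda>(x, y) (x', y'). cip H x x' * cip K y y')"

definition htensor :: "'a hspace \<Rightarrow> 'b hspace \<Rightarrow> ('a, 'b) tensor hspace" where
  "htensor H K = hcompletion (free_tensor H K)"

definition elem_tensor :: "'a hspace \<Rightarrow> 'b hspace \<Rightarrow> 'a \<Rightarrow> 'b \<Rightarrow> ('a, 'b) tensor" where
  "elem_tensor H K x y =
     completion_class (free_tensor H K) (\<lambda>n p. if p = (x, y) then 1 else 0)"

definition tensor_subspace :: "'a hspace \<Rightarrow> 'b hspace \<Rightarrow> 'a set \<Rightarrow> 'b set \<Rightarrow> ('a, 'b) tensor set" where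
  "tensor_subspace H K W Z = closed_span (htensor H K) {elem_tensor H K x y | x y. x \<in> W \<and> y \<in> Z}"

text \<open>The operator \<open>T \<otimes> S\<close> from \<open>H \<otimes> K\<close> to \<open>H' \<otimes> K'\<close>.\<close>

definition tensor_map ::
    "'a hspace \<Rightarrow> 'b hspace \<Rightarrow> 'c hspace \<Rightarrow> 'd hspace \<Rightarrow> ('a \<Rightarrow> 'c) \<Rightarrow> ('b \<Rightarrow> 'd) \<Rightarrow>
     ('a, 'b) tensor \<Rightarrow> ('c, 'd) tensor" where
  "tensor_map H K H' K' T S = (THE R.
     R \<in> extensional (carrier (htensor H K)) \<and>
     bounded_map (htensor H K) (htensor H' K') R \<and>
     (\<forall>x\<in>carrier H. \<forall>y\<in>carrier K. R (elem_tensor H K x y) = elem_tensor H' K' (T x) (S y)))"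

text \<open>The canonical identification of \<open>(H \<otimes> K) \<otimes> L\<close> with \<open>H \<otimes> (K \<otimes> L)\<close>.\<close>

definition tensor_assoc ::
    "'a hspace \<Rightarrow> 'b hspace \<Rightarrow> 'c hspace \<Rightarrow>
     (('a, 'b) tensor, 'c) tensor \<Rightarrow> ('a, ('b, 'c) tensor) tensor" where
  "tensor_assoc H K L = (THE R.
     R \<in> extensional (carrier (htensor (htensor H K) L)) \<and>
     bounded_map (htensor (htensor H K) L) (htensor H (htensor K L)) R \<and>
     (\<forall>x\<in>carrier H. \<forall>y\<in>carrier K. \<forall>z\<in>carrier L.
        R (elem_tensor (htensor H K) L (elem_tensor H K x y) z) =
        elem_tensor H (htensor K L) x (elem_tensor K L y z)))"


section \<open>Product systems and Arveson systems\<close>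

text \<open>
  All fibres live on one type.  Families indexed by the positive reals are functions on the
  type of reals of which only the values at \<open>t > 0\<close> matter; sections and subsystems are
  made extensional, so that equality is equality on the positive reals.
\<close>

record 'a product_system_data =
  fibre :: "real \<Rightarrow> 'a hspace"
  struct_map :: "real \<Rightarrow> real \<Rightarrow> 'a \<Rightarrow> ('a, 'a) tensor"

definition sys_prod ::
    "('a, 'm) product_system_data_scheme \<Rightarrow> real \<Rightarrow> real \<Rightarrow> 'a \<Rightarrow> 'a \<Rightarrow> 'a" where
  "sys_prod E s t x y =
     hadjoint (fibre E (s + t)) (htensor (fibre E s) (fibre E t)) (struct_map E s t)
       (elem_tensor (fibre E s) (fibre E t) x y)"

locale product_system =
  fixes E :: "('a, 'm) product_system_data_scheme"
  assumes hilbert_fibre: "t > 0 \<Longrightarrow> hilbert_space (fibre E t)"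
    and unitary_struct_map: "\<lbrakk>s > 0; t > 0\<rbrakk> \<Longrightarrow>
      unitary_map (fibre E (s + t)) (htensor (fibre E s) (fibre E t)) (struct_map E s t)"
    and coassoc: "\<lbrakk>r > 0; s > 0; t > 0; z \<in> carrier (fibre E (r + s + t))\<rbrakk> \<Longrightarrow>
      tensor_map (fibre E r) (fibre E (s + t)) (fibre E r) (htensor (fibre E s) (fibre E t))
        (\<lambda>x. x) (struct_map E s t) (struct_map E r (s + t) z) =
      tensor_assoc (fibre E r) (fibre E s) (fibre E t)
        (tensor_map (fibre E (r + s)) (fibre E t) (htensor (fibre E r) (fibre E s)) (fibre E t)
          (struct_map E r s) (\<lambda>x. x) (struct_map E (r + s) t z))"

record 'a arveson_data = "'a product_system_data" +
  base_section :: "nat \<Rightarrow> real \<Rightarrow> 'a"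

definition sections :: "('a, 'm) product_system_data_scheme \<Rightarrow> (real \<Rightarrow> 'a) set" where
  "sections E = (\<Pi>\<^sub>E t\<in>{0<..}. carrier (fibre E t))"

locale arveson_system = product_system E for E :: "('a, 'm) arveson_data_scheme" +
  assumes separable_fibre: "t > 0 \<Longrightarrow> separable_space (htopology (fibre E t))"
    and base_section: "base_section E n \<in> sections E"
    and base_section_total:
      "t > 0 \<Longrightarrow> closed_span (fibre E t) (range (\<lambda>n. base_section E n t)) = carrier (fibre E t)"
    and base_section_measurable:
      "(\<lambda>t. cip (fibre E t) (base_section E m t) (base_section E n t))
         \<in> borel_measurable (restrict_space borel {0<..})"
    and base_section_prod_measurable:
      "(\<lambda>(s, t). cip (fibre E (s + t)) (base_section E l (s + t))
           (sys_prod E s t (base_section E m s) (base_section E n t)))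
         \<in> borel_measurable (restrict_space borel ({0<..} \<times> {0<..}))"

definition measurable_sections :: "('a, 'm) arveson_data_scheme \<Rightarrow> (real \<Rightarrow> 'a) set" where
  "measurable_sections E = {x \<in> sections E.
     \<forall>n. (\<lambda>t. cip (fibre E t) (base_section E n t) (x t))
           \<in> borel_measurable (restrict_space borel {0<..})}"


section \<open>Product subsystems\<close>

definition product_subsystem ::
    "('a, 'm) product_system_data_scheme \<Rightarrow> (real \<Rightarrow> 'a set) \<Rightarrow> bool" where
  "product_subsystem E F \<longleftrightarrow> F \<in> extensional {0<..} \<and>
     (\<forall>t>0. closed_subspace (fibre E t) (F t)) \<and>
     (\<forall>s>0. \<forall>t>0. struct_map E s t ` F (s + t) =
        tensor_subspace (fibre E s) (fibre E t) (F s) (F t))"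

definition generated_subsystem ::
    "('a, 'm) product_system_data_scheme \<Rightarrow> (real \<Rightarrow> 'a) set \<Rightarrow> real \<Rightarrow> 'a set" where
  "generated_subsystem E S = (THE F.
     product_subsystem E F \<and> (\<forall>x\<in>S. \<forall>t>0. x t \<in> F t) \<and>
     (\<forall>G. product_subsystem E G \<and> (\<forall>x\<in>S. \<forall>t>0. x t \<in> G t) \<longrightarrow> (\<forall>t>0. F t \<subseteq> G t)))"

text \<open>
  A product subsystem as an Arveson system in its own right.  The restricted structure map
  takes values in the image of the canonical embedding of \<open>F s \<otimes> F t\<close> into
  \<open>E s \<otimes> E t\<close>, which is undone.  Projecting the sections that define the measurable
  structure onto \<open>F\<close> makes a section of \<open>F\<close> measurable iff it is measurable as a section
  of \<open>E\<close>.
\<close>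

definition subsystem_fibre ::
    "('a, 'm) product_system_data_scheme \<Rightarrow> (real \<Rightarrow> 'a set) \<Rightarrow> real \<Rightarrow> 'a hspace" where
  "subsystem_fibre E F t = (fibre E t)\<lparr>carrier := F t\<rparr>"

definition restrict_system ::
    "('a, 'm) arveson_data_scheme \<Rightarrow> (real \<Rightarrow> 'a set) \<Rightarrow> 'a arveson_data" where
  "restrict_system E F = \<lparr>
     fibre = subsystem_fibre E F,
     struct_map = (\<lambda>s t z.
       inv_into (carrier (htensor (subsystem_fibre E F s) (subsystem_fibre E F t)))
         (tensor_map (subsystem_fibre E F s) (subsystem_fibre E F t) (fibre E s) (fibre E t)
            (\<lambda>x. x) (\<lambda>x. x))
         (struct_map E s t z)),
     base_section = (\<lambda>n. \<lambda>t\<in>{0<..}. hproj (fibre E t) (F t) (base_section E n t))\<rparr>"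


section \<open>Units, roots and the index\<close>

definition units :: "('a, 'm) arveson_data_scheme \<Rightarrow> (real \<Rightarrow> 'a) set" where
  "units E = {u \<in> measurable_sections E.
     (\<exists>t>0. u t \<noteq> \<zero>\<^bsub>fibre E t\<^esub>) \<and>
     (\<forall>s>0. \<forall>t>0. u (s + t) = sys_prod E s t (u s) (u t))}"

definition normalised_unit :: "('a, 'm) arveson_data_scheme \<Rightarrow> (real \<Rightarrow> 'a) \<Rightarrow> bool" where
  "normalised_unit E u \<longleftrightarrow> u \<in> units E \<and> (\<forall>t>0. hnorm (fibre E t) (u t) = 1)"

definition spatial :: "('a, 'm) arveson_data_scheme \<Rightarrow> bool" where
  "spatial E \<longleftrightarrow> units E \<noteq> {}"

definition type_I_part :: "('a, 'm) arveson_data_scheme \<Rightarrow> real \<Rightarrow> 'a set" where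
  "type_I_part E = generated_subsystem E (units E)"

definition roots :: "('a, 'm) arveson_data_scheme \<Rightarrow> (real \<Rightarrow> 'a) \<Rightarrow> (real \<Rightarrow> 'a) set" where
  "roots E u = {a \<in> measurable_sections E.
     (\<forall>s>0. \<forall>t>0. a (s + t) =
        sys_prod E s t (a s) (u t) \<oplus>\<^bsub>fibre E (s + t)\<^esub> sys_prod E s t (u s) (a t)) \<and>
     (\<forall>t>0. cip (fibre E t) (u t) (a t) = 0)}"

definition root_space :: "('a, 'm) arveson_data_scheme \<Rightarrow> (real \<Rightarrow> 'a) \<Rightarrow> (real \<Rightarrow> 'a) hspace" where
  "root_space E u = \<lparr>
     carrier = roots E u,
     mult = undefined, one = undefined,
     zero = (\<lambda>t\<in>{0<..}. \<zero>\<^bsub>fibre E t\<^esub>),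
     add = (\<lambda>a b. \<lambda>t\<in>{0<..}. a t \<oplus>\<^bsub>fibre E t\<^esub> b t),
     smult = (\<lambda>c a. \<lambda>t\<in>{0<..}. c \<odot>\<^bsub>fibre E t\<^esub> a t),
     cip = (\<lambda>a b. cip (fibre E 1) (a 1) (b 1))\<rparr>"

definition covariance ::
    "('a, 'm) arveson_data_scheme \<Rightarrow> (real \<Rightarrow> 'a) \<Rightarrow> (real \<Rightarrow> 'a) \<Rightarrow> complex" where
  "covariance E u v = (THE g. \<forall>t>0. cip (fibre E t) (u t) (v t) = exp (of_real t * g))"

definition pre_index_space :: "('a, 'm) arveson_data_scheme \<Rightarrow> ((real \<Rightarrow> 'a) \<Rightarrow> complex) hspace" where
  "pre_index_space E = (free_space (units E) (covariance E))
     \<lparr>carrier := {f \<in> carrier (free_space (units E) (covariance E)). (\<Sum>u | f u \<noteq> 0. f u) = 0}\<rparr>"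

definition index_space ::
    "('a, 'm) arveson_data_scheme \<Rightarrow> (nat \<Rightarrow> (real \<Rightarrow> 'a) \<Rightarrow> complex) set hspace" where
  "index_space E = hcompletion (pre_index_space E)"

definition index ::
    "('a, 'm) arveson_data_scheme \<Rightarrow> (nat \<Rightarrow> (real \<Rightarrow> 'a) \<Rightarrow> complex) set rel" where
  "index E = hilbert_dim (index_space E)"

unbundle cardinal_syntax

end

theory Submission
  imports Defs
begin

text \<open>
  Roots are logarithms of units.  Let \<open>v\<close> be a unit with \<open>\<langle>u\<^sub>t, v\<^sub>t\<rangle> = 1\<close>.  The sums of the vectors
  \<open>u \<cdot> \<dots> \<cdot> u \<cdot> (v\<^sub>h - u\<^sub>h) \<cdot> u \<cdot> \<dots> \<cdot> u\<close> over the cells \<open>h\<close> of a partition of \<open>t\<close> converge to a root \<open>log v\<close>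
  as the partition gets finer.  Conversely, for a root \<open>a\<close> the products of the vectors \<open>u\<^sub>h + a\<^sub>h\<close>
  converge to a unit \<open>exp a\<close>.  Inner products of the approximants are explicit, which yields the
  convergence, the mutual inverseness of \<open>log\<close> and \<open>exp\<close>, and
  \<open>\<langle>v\<^sub>t, w\<^sub>t\<rangle> = exp (t \<langle>log v, log w\<rangle>)\<close>.  Every unit is a scalar exponential multiple of one with
  \<open>\<langle>u\<^sub>t, v\<^sub>t\<rangle> = 1\<close>; this uses that measurable multiplicative functions are exponentials and that
  two units are never orthogonal.

  Both approximations stay inside any product subsystem that contains \<open>u\<close>, so such a subsystem contains
  all units if and only if it contains all roots; this gives (a), and (b) follows.  For (c), write
  \<open>v\<close> as such a multiple of \<open>v'\<close>.  Then
  \<open>\<gamma>(v, w) = cnj (\<gamma>(u, v)) + \<gamma>(u, w) + \<langle>log v', log w'\<rangle>\<close>, where the first two terms cancel on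
  functions of total mass zero.  Hence \<open>f \<mapsto> (\<Sum>v. f(v) log v')\<close> is isometric on the space of such functions,
  and its range contains every root \<open>a\<close>, as the image of the difference of the point masses at
  \<open>exp a\<close> and \<open>u\<close>.
\<close>

section \<open>Hilbert spaces\<close>

text \<open>Two obstacles shape the argument. Tensor products are defined as completions of formal
  sums, and the operators on them by \<open>THE\<close>. Hence any Hilbert space with a total family
  of vectors that has the right Gram matrix is shown to be a model of such a completion. In
  particular \<open>H (s + t)\<close> is itself a model of the tensor product of \<open>H s\<close>
  and \<open>H t\<close>; once associativity is extracted from coassociativity, one works with a
  bilinear, associative multiplication \<open>prd\<close>. The other obstacle is convergence over
  partitions that are not nested. For logarithms, the real part of the inner product of any two
  approximants over t is at least the limit c t of their squared norms, so the excess of these norms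
  over c t controls the distance. For exponentials, the inner product of an approximant with a
  refinement equals its own squared norm, so the squared distance is a difference of squared norms.
  Separability enters through uncountable orthogonal families, which it excludes; measurability
  turns multiplicative functions of time into exponentials, and for this reason logarithms and
  exponentials have to be shown measurable too.\<close>

lemma complex_ring_simps [simp]:
  "carrier complex_ring = UNIV" "add complex_ring = (+)" "mult complex_ring = (*)"
  "one complex_ring = 1" "zero complex_ring = 0"
  by (simp_all add: complex_ring_def)

text \<open>Definiteness and completeness are dropped because the form on formal sums that is to be
  completed is degenerate; everything proved here, Cauchy-Schwarz included, applies before the null
  space is divided out.\<close>

locale pre_hilbert = module complex_ring H for H :: "'a hspace" (structure) +
  assumes cip_add_right:
      "\<lbrakk>x \<in> carrier H; y \<in> carrier H; z \<in> carrier H\<rbrakk> \<Longrightarrow> cip H x (y \<oplus> z) = cip H x y + cip H x z"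
    and cip_smult_right:
      "\<lbrakk>x \<in> carrier H; y \<in> carrier H\<rbrakk> \<Longrightarrow> cip H x (c \<odot> y) = c * cip H x y"
    and cip_commute:
      "\<lbrakk>x \<in> carrier H; y \<in> carrier H\<rbrakk> \<Longrightarrow> cip H y x = cnj (cip H x y)"
    and cip_nonneg: "x \<in> carrier H \<Longrightarrow> 0 \<le> Re (cip H x x)"

sublocale hilbert_space \<subseteq> pre?: pre_hilbert H
  by unfold_locales (rule cip_add_right cip_smult_right cip_commute cip_nonneg; assumption)+

lemma (in hilbert_space) pre_hilbert: "pre_hilbert H" ..

text \<open>Convergence in terms of \<open>hnorm\<close> alone, so that it is also meaningful for a
  degenerate form, where \<open>hdist\<close> is only a pseudometric.\<close>

definition hconv :: "'a hspace \<Rightarrow> (nat \<Rightarrow> 'a) \<Rightarrow> 'a \<Rightarrow> bool" where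
  "hconv H X x \<longleftrightarrow> range X \<subseteq> carrier H \<and> x \<in> carrier H \<and>
     (\<lambda>n. hnorm H (X n \<ominus>\<^bsub>H\<^esub> x)) \<longlonglongrightarrow> 0"

text \<open>The sum runs over the support of the coefficient function, which matches the elements of
  \<open>free_space\<close>: this is the linear map that sends the point mass at \<open>i\<close> to
  \<open>\<phi> i\<close>.\<close>

definition lincomb :: "'a hspace \<Rightarrow> ('i \<Rightarrow> 'a) \<Rightarrow> ('i \<Rightarrow> complex) \<Rightarrow> 'a" where
  "lincomb H \<phi> f = finsum H (\<lambda>i. f i \<odot>\<^bsub>H\<^esub> \<phi> i) {i. f i \<noteq> 0}"

text \<open>Evaluation at s = 1/c gives a - b/c >= 0. The factor b in both lower coefficients is the
  form in which the polynomial arises from the vectors x - s conj(z) y, with b the squared modulus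
  of z.\<close>

lemma quadratic_bound:
  fixes a b c :: real
  assumes "\<And>s. 0 \<le> a - 2 * b * s + b * c * s\<^sup>2" "0 \<le> c"
  shows "b \<le> a * c"
proof (cases "c = 0")
  case True
  show ?thesis
  proof (cases "b \<le> 0")
    case False
    \<comment> \<open>For c = 0 the polynomial is affine in s, and at this s it would equal
      -1.\<close>
    with assms(1)[of "(a + 1) / (2 * b)"] True show ?thesis by (simp add: field_simps)
  qed (use True in simp)
next
  case False
  with assms have "c > 0" by simp
  with assms(1)[of "1 / c"] show ?thesis by (simp add: field_simps power2_eq_square)
qed

context pre_hilbert
begin

lemma smult_carrier [simp, intro]: "x \<in> carrier H \<Longrightarrow> c \<odot> x \<in> carrier H"
  using smult_closed[of c x] by simp

lemma cip_zero_right [simp]: "x \<in> carrier H \<Longrightarrow> cip H x \<zero> = 0"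
  using cip_add_right[of x \<zero> \<zero>] by simp

lemma cip_minus_right: "\<lbrakk>x \<in> carrier H; y \<in> carrier H\<rbrakk> \<Longrightarrow> cip H x (\<ominus> y) = - cip H x y"
  using cip_add_right[of x y "\<ominus> y"] by (simp add: M.r_neg add_eq_0_iff)

lemma cip_diff_right:
  "\<lbrakk>x \<in> carrier H; y \<in> carrier H; z \<in> carrier H\<rbrakk> \<Longrightarrow> cip H x (y \<ominus> z) = cip H x y - cip H x z"
  by (simp add: a_minus_def cip_add_right cip_minus_right)

lemma cip_zero_left [simp]: "x \<in> carrier H \<Longrightarrow> cip H \<zero> x = 0"
  by (subst cip_commute) auto

lemma cip_add_left:
  "\<lbrakk>x \<in> carrier H; y \<in> carrier H; z \<in> carrier H\<rbrakk> \<Longrightarrow> cip H (y \<oplus> z) x = cip H y x + cip H z x"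
  by (subst (1 2 3) cip_commute) (auto simp: cip_add_right)

lemma cip_smult_left:
  "\<lbrakk>x \<in> carrier H; y \<in> carrier H\<rbrakk> \<Longrightarrow> cip H (c \<odot> y) x = cnj c * cip H y x"
  by (subst (1 2) cip_commute) (auto simp: cip_smult_right)

lemma cip_minus_left: "\<lbrakk>x \<in> carrier H; y \<in> carrier H\<rbrakk> \<Longrightarrow> cip H (\<ominus> y) x = - cip H y x"
  by (subst (1 2) cip_commute) (auto simp: cip_minus_right)

lemma cip_diff_left:
  "\<lbrakk>x \<in> carrier H; y \<in> carrier H; z \<in> carrier H\<rbrakk> \<Longrightarrow> cip H (y \<ominus> z) x = cip H y x - cip H z x"
  by (simp add: a_minus_def cip_add_left cip_minus_left)

lemmas cip_simps = cip_add_right cip_add_left cip_smult_right cip_smult_left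
  cip_diff_right cip_diff_left cip_minus_right cip_minus_left

lemma diff_carrier [simp, intro]: "\<lbrakk>x \<in> carrier H; y \<in> carrier H\<rbrakk> \<Longrightarrow> x \<ominus> y \<in> carrier H"
  by (rule M.minus_closed)

lemma minus_eq_smult: assumes "x \<in> carrier H" shows "\<ominus> x = (- 1) \<odot> x"
proof (rule M.minus_equality)
  show "(- 1) \<odot> x \<oplus> x = \<zero>"
    using smult_l_distr[of "-1" 1 x] smult_one[of x] smult_l_null[of x] assms by simp
qed (use assms in auto)

lemma diff_eq_smult: "\<lbrakk>x \<in> carrier H; y \<in> carrier H\<rbrakk> \<Longrightarrow> x \<ominus> y = x \<oplus> (- 1) \<odot> y"
  by (simp add: a_minus_def minus_eq_smult)

lemma Im_cip_self [simp]: "x \<in> carrier H \<Longrightarrow> Im (cip H x x) = 0"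
  using cip_commute[of x x] by (simp add: complex_eq_iff)

lemma hnorm_ge_0 [simp]: "x \<in> carrier H \<Longrightarrow> 0 \<le> hnorm H x"
  by (simp add: hnorm_def cip_nonneg)

lemma hnorm_sq: "x \<in> carrier H \<Longrightarrow> (hnorm H x)\<^sup>2 = Re (cip H x x)"
  by (simp add: hnorm_def cip_nonneg)

lemma cip_self: "x \<in> carrier H \<Longrightarrow> cip H x x = of_real ((hnorm H x)\<^sup>2)"
  by (simp add: hnorm_sq complex_eq_iff)

lemma Re_cip_commute: "\<lbrakk>x \<in> carrier H; y \<in> carrier H\<rbrakk> \<Longrightarrow> Re (cip H y x) = Re (cip H x y)"
  by (subst cip_commute) auto

lemma hnorm_sq_diff:
  assumes "x \<in> carrier H" "y \<in> carrier H"
  shows "(hnorm H (x \<ominus> y))\<^sup>2 = (hnorm H x)\<^sup>2 - 2 * Re (cip H x y) + (hnorm H y)\<^sup>2"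
  using assms Re_cip_commute[of x y] by (simp add: hnorm_sq cip_simps)

lemma hnorm_sq_add:
  assumes "x \<in> carrier H" "y \<in> carrier H"
  shows "(hnorm H (x \<oplus> y))\<^sup>2 = (hnorm H x)\<^sup>2 + 2 * Re (cip H x y) + (hnorm H y)\<^sup>2"
  using assms Re_cip_commute[of x y] by (simp add: hnorm_sq cip_simps)

lemma hnorm_sq_smult: "x \<in> carrier H \<Longrightarrow> (hnorm H (c \<odot> x))\<^sup>2 = (cmod c)\<^sup>2 * (hnorm H x)\<^sup>2"
  by (simp add: hnorm_sq cip_simps cmod_power2) (simp add: power2_eq_square algebra_simps)

lemma hnorm_smult: "x \<in> carrier H \<Longrightarrow> hnorm H (c \<odot> x) = cmod c * hnorm H x"
  by (rule power2_eq_imp_eq) (simp_all add: hnorm_sq_smult power_mult_distrib)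

lemma hnorm_zero [simp]: "hnorm H \<zero> = 0"
  by (simp add: hnorm_def)

lemma cauchy_schwarz:
  assumes x: "x \<in> carrier H" and y: "y \<in> carrier H"
  shows "cmod (cip H x y) \<le> hnorm H x * hnorm H y"
proof -
  let ?z = "cip H x y"
  have "(cmod ?z)\<^sup>2 \<le> (hnorm H x)\<^sup>2 * (hnorm H y)\<^sup>2"
  proof (rule quadratic_bound)
    fix s :: real
    \<comment> \<open>The factor conj(z) aligns the phases, so that the cross term becomes s times
      the squared modulus of z. The real parameter s is left free for
      \<open>quadratic_bound\<close>, which also copes with a vector y of seminorm zero.\<close>
    have "0 \<le> (hnorm H (x \<ominus> (of_real s * cnj ?z) \<odot> y))\<^sup>2" by simp
    also have "\<dots> = (hnorm H x)\<^sup>2 - 2 * (s * (cmod ?z)\<^sup>2) + (s * cmod ?z)\<^sup>2 * (hnorm H y)\<^sup>2"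
      using x y by (simp add: hnorm_sq_diff hnorm_sq_smult cip_simps norm_mult
         power_mult_distrib cmod_power2) (simp add: power2_eq_square algebra_simps)
    finally show "0 \<le> (hnorm H x)\<^sup>2 - 2 * (cmod ?z)\<^sup>2 * s + (cmod ?z)\<^sup>2 * (hnorm H y)\<^sup>2 * s\<^sup>2"
      by (simp add: algebra_simps power_mult_distrib)
  qed simp
  then show ?thesis
    by - (rule power2_le_imp_le, simp_all add: x y power_mult_distrib)
qed

lemma hnorm_add_le:
  assumes "x \<in> carrier H" "y \<in> carrier H"
  shows "hnorm H (x \<oplus> y) \<le> hnorm H x + hnorm H y"
proof (rule power2_le_imp_le)
  have "Re (cip H x y) \<le> hnorm H x * hnorm H y"
    using cauchy_schwarz[OF assms] complex_Re_le_cmod order_trans by blast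
  then show "(hnorm H (x \<oplus> y))\<^sup>2 \<le> (hnorm H x + hnorm H y)\<^sup>2"
    by (simp add: hnorm_sq_add assms power2_sum)
qed (use assms in simp)

lemma hnorm_minus_commute:
  assumes "x \<in> carrier H" "y \<in> carrier H"
  shows "hnorm H (x \<ominus> y) = hnorm H (y \<ominus> x)"
  by (rule power2_eq_imp_eq) (use assms Re_cip_commute[of x y] in \<open>auto simp: hnorm_sq_diff\<close>)

lemma hnorm_triangle:
  assumes "x \<in> carrier H" "y \<in> carrier H" "z \<in> carrier H"
  shows "hnorm H (x \<ominus> z) \<le> hnorm H (x \<ominus> y) + hnorm H (y \<ominus> z)"
proof -
  have "x \<ominus> z = (x \<ominus> y) \<oplus> (y \<ominus> z)"
    using assms by (simp add: a_minus_def M.a_assoc M.r_neg1)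
  then show ?thesis using hnorm_add_le[of "x \<ominus> y" "y \<ominus> z"] assms by simp
qed

lemma hnorm_triangle2:
  assumes "x \<in> carrier H" "y \<in> carrier H"
  shows "hnorm H x \<le> hnorm H y + hnorm H (x \<ominus> y)"
proof -
  have "x \<ominus> \<zero> = x" if "x \<in> carrier H" for x
    using that M.minus_equality[of \<zero> \<zero>] by (simp add: a_minus_def)
  then show ?thesis
    using hnorm_triangle[of x y \<zero>] assms by simp
qed

lemma hdist_eq: "\<lbrakk>x \<in> carrier H; y \<in> carrier H\<rbrakk> \<Longrightarrow> hdist H x y = hnorm H (x \<ominus> y)"
  by (simp add: hdist_def)

lemma diff_self [simp]: "x \<in> carrier H \<Longrightarrow> x \<ominus> x = \<zero>"
  by (simp add: a_minus_def M.r_neg)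

lemma diff_eq_zero_iff: assumes "x \<in> carrier H" "y \<in> carrier H" shows "x \<ominus> y = \<zero> \<longleftrightarrow> x = y"
proof
  assume *: "x \<ominus> y = \<zero>"
  have "x = (x \<ominus> y) \<oplus> y" using assms by (simp add: a_minus_def M.a_assoc M.l_neg)
  then show "x = y" using * assms by simp
qed (use assms in simp)

lemma diff_add_add:
  assumes "x \<in> carrier H" "y \<in> carrier H" "x' \<in> carrier H" "y' \<in> carrier H"
  shows "(x \<oplus> y) \<ominus> (x' \<oplus> y') = (x \<ominus> x') \<oplus> (y \<ominus> y')"
  using assms by (simp add: a_minus_def M.minus_add M.a_ac)

lemma smult_diff: "\<lbrakk>x \<in> carrier H; y \<in> carrier H\<rbrakk> \<Longrightarrow> c \<odot> (x \<ominus> y) = (c \<odot> x) \<ominus> (c \<odot> y)"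
  using smult_r_distr[of c x "(-1) \<odot> y"] smult_assoc1[of c "-1" y] smult_assoc1[of "-1" c y]
  by (simp add: diff_eq_smult)

lemma hconvI: "\<lbrakk>\<And>n. X n \<in> carrier H; x \<in> carrier H; (\<lambda>n. hnorm H (X n \<ominus> x)) \<longlonglongrightarrow> 0\<rbrakk> \<Longrightarrow> hconv H X x"
  by (auto simp: hconv_def)

lemma hconvD: assumes "hconv H X x"
  shows "X n \<in> carrier H" "x \<in> carrier H" "(\<lambda>n. hnorm H (X n \<ominus> x)) \<longlonglongrightarrow> 0"
  using assms by (auto simp: hconv_def)

lemma hconv_squeeze:
  assumes "\<And>n. X n \<in> carrier H" "x \<in> carrier H" "\<And>n. hnorm H (X n \<ominus> x) \<le> r n" "r \<longlonglongrightarrow> 0"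
  shows "hconv H X x"
  by (rule hconvI[OF assms(1,2)], rule tendsto_sandwich[OF _ _ tendsto_const assms(4)])
     (use assms in auto)

lemma hconv_const: "x \<in> carrier H \<Longrightarrow> hconv H (\<lambda>n. x) x"
  by (rule hconvI) auto

lemma hconv_add:
  assumes "hconv H X x" "hconv H Y y" shows "hconv H (\<lambda>n. X n \<oplus> Y n) (x \<oplus> y)"
proof (rule hconv_squeeze)
  note c = hconvD[OF assms(1)] hconvD[OF assms(2)]
  show "hnorm H (X n \<oplus> Y n \<ominus> (x \<oplus> y)) \<le> hnorm H (X n \<ominus> x) + hnorm H (Y n \<ominus> y)" for n
    using c by (simp add: diff_add_add hnorm_add_le)
  show "(\<lambda>n. hnorm H (X n \<ominus> x) + hnorm H (Y n \<ominus> y)) \<longlonglongrightarrow> 0"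
    using tendsto_add[OF c(3) c(6)] by simp
qed (use hconvD[OF assms(1)] hconvD[OF assms(2)] in auto)

lemma hconv_smult:
  assumes "hconv H X x" shows "hconv H (\<lambda>n. c \<odot> X n) (c \<odot> x)"
proof (rule hconv_squeeze)
  note d = hconvD[OF assms]
  show "hnorm H (c \<odot> X n \<ominus> c \<odot> x) \<le> cmod c * hnorm H (X n \<ominus> x)" for n
    using d by (simp add: hnorm_smult flip: smult_diff)
  show "(\<lambda>n. cmod c * hnorm H (X n \<ominus> x)) \<longlonglongrightarrow> 0"
    using tendsto_mult_left[OF d(3), of "cmod c"] by simp
qed (use hconvD[OF assms] in auto)

lemma hconv_diff:
  assumes "hconv H X x" "hconv H Y y" shows "hconv H (\<lambda>n. X n \<ominus> Y n) (x \<ominus> y)"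
  using hconv_add[OF assms(1) hconv_smult[OF assms(2), of "-1"]] hconvD[OF assms(1)] hconvD[OF assms(2)]
  by (simp add: diff_eq_smult)

lemma hconv_norm:
  assumes "hconv H X x" shows "(\<lambda>n. hnorm H (X n)) \<longlonglongrightarrow> hnorm H x"
proof (rule LIM_zero_cancel, rule tendsto_rabs_zero_cancel)
  note d = hconvD[OF assms]
  show "(\<lambda>n. \<bar>hnorm H (X n) - hnorm H x\<bar>) \<longlonglongrightarrow> 0"
  proof (rule tendsto_sandwich[OF _ _ tendsto_const d(3)])
    have "\<bar>hnorm H (X n) - hnorm H x\<bar> \<le> hnorm H (X n \<ominus> x)" for n
      using hnorm_triangle2[of "X n" x] hnorm_triangle2[of x "X n"] hnorm_minus_commute[of x "X n"] d
      by (simp add: abs_le_iff)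
    then show "\<forall>\<^sub>F n in sequentially. \<bar>hnorm H (X n) - hnorm H x\<bar> \<le> hnorm H (X n \<ominus> x)" by simp
  qed auto
qed

lemma cip_diff_le:
  assumes "x \<in> carrier H" "y \<in> carrier H" "x' \<in> carrier H" "y' \<in> carrier H"
  shows "cmod (cip H x y - cip H x' y') \<le> hnorm H (x \<ominus> x') * hnorm H y + hnorm H x' * hnorm H (y \<ominus> y')"
proof -
  have "cip H x y - cip H x' y' = cip H (x \<ominus> x') y + cip H x' (y \<ominus> y')"
    using assms by (simp add: cip_simps)
  then show ?thesis
    using norm_triangle_mono[OF cauchy_schwarz[of "x \<ominus> x'" y] cauchy_schwarz[of x' "y \<ominus> y'"]] assms by auto
qed

lemma hconv_cip:
  assumes "hconv H X x" "hconv H Y y" shows "(\<lambda>n. cip H (X n) (Y n)) \<longlonglongrightarrow> cip H x y"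
proof (rule LIM_zero_cancel, rule tendsto_norm_zero_cancel)
  note d = hconvD[OF assms(1)] and e = hconvD[OF assms(2)]
  have "(\<lambda>n. hnorm H (X n \<ominus> x) * hnorm H (Y n) + hnorm H x * hnorm H (Y n \<ominus> y)) \<longlonglongrightarrow> 0 * hnorm H y + hnorm H x * 0"
    by (intro tendsto_intros d e hconv_norm[OF assms(2)])
  then show "(\<lambda>n. cmod (cip H (X n) (Y n) - cip H x y)) \<longlonglongrightarrow> 0"
    using cip_diff_le[OF d(1) e(1) d(2) e(2)]
    by - (rule Lim_null_comparison[OF always_eventually, OF allI], simp_all)
qed

lemma lincomb:
  assumes "finite {i. f i \<noteq> 0}" "\<And>i. f i \<noteq> 0 \<Longrightarrow> \<phi> i \<in> carrier H"
  shows lincomb_closed: "lincomb H \<phi> f \<in> carrier H"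
    and cip_lincomb_right: "z \<in> carrier H \<Longrightarrow> cip H z (lincomb H \<phi> f) = (\<Sum>i | f i \<noteq> 0. f i * cip H z (\<phi> i))"
proof -
  have *: "finsum H (\<lambda>i. f i \<odot> \<phi> i) I \<in> carrier H \<and>
      (z \<in> carrier H \<longrightarrow> cip H z (finsum H (\<lambda>i. f i \<odot> \<phi> i) I) = (\<Sum>i\<in>I. f i * cip H z (\<phi> i)))"
    if "finite I" "I \<subseteq> {i. f i \<noteq> 0}" for I
    using that
  proof (induction I rule: finite_induct)
    case empty
    then show ?case by simp
  next
    case (insert i I)
    then have c: "(\<lambda>i. f i \<odot> \<phi> i) \<in> I \<rightarrow> carrier H" "\<phi> i \<in> carrier H"
      using assms(2) by auto
    show ?case using insert c
      by (subst M.finsum_insert) (auto simp: M.finsum_insert cip_add_right cip_smult_right)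
  qed
  show "lincomb H \<phi> f \<in> carrier H"
    "z \<in> carrier H \<Longrightarrow> cip H z (lincomb H \<phi> f) = (\<Sum>i | f i \<noteq> 0. f i * cip H z (\<phi> i))"
    using *[OF assms(1)] by (auto simp: lincomb_def)
qed

text \<open>Sums over supports cannot be combined when the supports differ; this form allows a
  common finite index set.\<close>

lemma cip_lincomb_right_superset:
  assumes "finite I" "{i. f i \<noteq> 0} \<subseteq> I" "\<And>i. f i \<noteq> 0 \<Longrightarrow> \<phi> i \<in> carrier H" "z \<in> carrier H"
  shows "cip H z (lincomb H \<phi> f) = (\<Sum>i\<in>I. f i * cip H z (\<phi> i))"
proof -
  have "finite {i. f i \<noteq> 0}" using assms finite_subset by blast
  then have "cip H z (lincomb H \<phi> f) = (\<Sum>i | f i \<noteq> 0. f i * cip H z (\<phi> i))"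
    using assms(3,4) by (rule cip_lincomb_right)
  also have "\<dots> = (\<Sum>i\<in>I. f i * cip H z (\<phi> i))"
    by (rule sum.mono_neutral_left) (use assms in auto)
  finally show ?thesis .
qed

lemma cip_lincomb_lincomb:
  assumes "finite {i. f i \<noteq> 0}" "\<And>i. f i \<noteq> 0 \<Longrightarrow> \<phi> i \<in> carrier H"
    and "finite {i. g i \<noteq> 0}" "\<And>i. g i \<noteq> 0 \<Longrightarrow> \<psi> i \<in> carrier H"
  shows "cip H (lincomb H \<phi> f) (lincomb H \<psi> g) =
    (\<Sum>i | f i \<noteq> 0. \<Sum>j | g j \<noteq> 0. cip H (\<phi> i) (\<psi> j) * cnj (f i) * g j)"
proof -
  have c: "lincomb H \<phi> f \<in> carrier H" "lincomb H \<psi> g \<in> carrier H"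
    by (rule lincomb_closed; use assms in auto)+
  have "cip H (lincomb H \<phi> f) (lincomb H \<psi> g) = cnj (cip H (lincomb H \<psi> g) (lincomb H \<phi> f))"
    by (rule cip_commute[OF c(2) c(1)])
  also have "\<dots> = (\<Sum>i | f i \<noteq> 0. cnj (f i) * cnj (cip H (lincomb H \<psi> g) (\<phi> i)))"
    by (subst cip_lincomb_right) (use assms c in auto)
  also have "\<dots> = (\<Sum>i | f i \<noteq> 0. cnj (f i) * cip H (\<phi> i) (lincomb H \<psi> g))"
    by (rule sum.cong[OF refl]) (use cip_commute[OF c(2)] assms in auto)
  also have "\<dots> = (\<Sum>i | f i \<noteq> 0. cnj (f i) * (\<Sum>j | g j \<noteq> 0. g j * cip H (\<phi> i) (\<psi> j)))"
    by (rule sum.cong[OF refl]) (subst cip_lincomb_right, use assms in auto)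
  finally show ?thesis by (simp add: sum_distrib_left mult_ac)
qed

end

section \<open>Closed subspaces, projections and density\<close>

context hilbert_space
begin

text \<open>Definiteness applied to the difference. Vector identities are checked below by taking
  inner products, after which \<open>cip_simps\<close> leaves only complex arithmetic.\<close>

lemma hilbert_eqI:
  assumes "x \<in> carrier H" "y \<in> carrier H" "\<And>z. z \<in> carrier H \<Longrightarrow> cip H z x = cip H z y"
  shows "x = y"
proof -
  have "cip H (x \<ominus> y) (x \<ominus> y) = 0" using assms by (subst cip_diff_right) auto
  then have "x \<ominus> y = \<zero>" using cip_definite assms by blast
  then show ?thesis using assms by (simp add: diff_eq_zero_iff)
qed

lemma hnorm_eq_0: "x \<in> carrier H \<Longrightarrow> hnorm H x = 0 \<longleftrightarrow> x = \<zero>"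
  using cip_self[of x] cip_definite[of x] by auto

lemma hnorm_diff_eq_0: "\<lbrakk>x \<in> carrier H; y \<in> carrier H\<rbrakk> \<Longrightarrow> hnorm H (x \<ominus> y) = 0 \<longleftrightarrow> x = y"
  by (simp add: hnorm_eq_0 diff_eq_zero_iff)

lemma Metric_space: "Metric_space (carrier H) (hdist H)"
proof
  show "0 \<le> hdist H x y" for x y by (auto simp: hdist_def)
  show "hdist H x y = hdist H y x" for x y by (auto simp: hdist_def hnorm_minus_commute)
  show "hdist H x y = 0 \<longleftrightarrow> x = y" if "x \<in> carrier H" "y \<in> carrier H" for x y
    using that by (simp add: hdist_def hnorm_diff_eq_0)
  show "hdist H x z \<le> hdist H x y + hdist H y z" if "x \<in> carrier H" "y \<in> carrier H" "z \<in> carrier H" for x y z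
    using that by (simp add: hdist_def hnorm_triangle)
qed

lemma hconv_unique:
  assumes "hconv H X x" "hconv H X y" shows "x = y"
proof -
  note d = hconvD[OF assms(1)] hconvD[OF assms(2)]
  have "(\<lambda>n. cip H z (X n)) \<longlonglongrightarrow> cip H z x" "(\<lambda>n. cip H z (X n)) \<longlonglongrightarrow> cip H z y" if "z \<in> carrier H" for z
    using hconv_cip[OF hconv_const[OF that] assms(1)] hconv_cip[OF hconv_const[OF that] assms(2)] by auto
  then show ?thesis using d by (intro hilbert_eqI) (auto intro: LIMSEQ_unique)
qed

lemma limitin_iff_hconv:
  assumes "range X \<subseteq> carrier H"
  shows "limitin (htopology H) X x sequentially \<longleftrightarrow> hconv H X x"
proof -
  interpret Metric_space "carrier H" "hdist H" by (rule Metric_space)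
  have "limitin mtopology X x sequentially \<longleftrightarrow> x \<in> carrier H \<and> (\<lambda>n. hdist H (X n) x) \<longlonglongrightarrow> 0"
    using assms limitin_metric_dist_null[of X x sequentially] by (simp add: range_subsetD)
  also have "\<dots> \<longleftrightarrow> hconv H X x"
    using assms by (auto simp: hconv_def hdist_def subset_iff)
  finally show ?thesis .
qed

lemma cauchy_hconv:
  assumes "\<And>n. X n \<in> carrier H" "\<And>e. e > 0 \<Longrightarrow> \<exists>N. \<forall>m\<ge>N. \<forall>n\<ge>N. hnorm H (X m \<ominus> X n) < e"
  shows "\<exists>x. hconv H X x"
proof -
  interpret Metric_space "carrier H" "hdist H" by (rule Metric_space)
  have "MCauchy X" unfolding MCauchy_def
  proof (intro conjI allI impI)
    fix e :: real assume "e > 0"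
    from assms(2)[OF this] show "\<exists>N. \<forall>n n'. N \<le> n \<longrightarrow> N \<le> n' \<longrightarrow> hdist H (X n) (X n') < e"
      by (simp add: hdist_eq assms(1))
  qed (use assms(1) in auto)
  with complete obtain x where "limitin mtopology X x sequentially" by (auto simp: mcomplete_def)
  then show ?thesis using limitin_iff_hconv[of X x] assms(1) by (simp add: image_subset_iff) blast
qed

lemma closed_subspace_iff:
  "closed_subspace H W \<longleftrightarrow> W \<subseteq> carrier H \<and> \<zero> \<in> W \<and> (\<forall>x\<in>W. \<forall>y\<in>W. x \<oplus> y \<in> W) \<and>
     (\<forall>c. \<forall>x\<in>W. c \<odot> x \<in> W) \<and> (\<forall>X x. (\<forall>n. X n \<in> W) \<and> hconv H X x \<longrightarrow> x \<in> W)"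
  (is "_ \<longleftrightarrow> ?R")
proof -
  interpret Metric_space "carrier H" "hdist H" by (rule Metric_space)
  have cl: "closedin (htopology H) W \<longleftrightarrow> W \<subseteq> carrier H \<and> (\<forall>X x. (\<forall>n. X n \<in> W) \<and> hconv H X x \<longrightarrow> x \<in> W)"
  proof (cases "W \<subseteq> carrier H")
    case True
    then have "(range X \<subseteq> W \<and> limitin (htopology H) X x sequentially) = ((\<forall>n. X n \<in> W) \<and> hconv H X x)" for X x
      using limitin_iff_hconv[of X x] by blast
    then show ?thesis unfolding metric_closedin_iff_sequentially_closed by presburger
  qed (simp add: metric_closedin_iff_sequentially_closed)
  have "submodule W complex_ring H \<longleftrightarrow> W \<subseteq> carrier H \<and> \<zero> \<in> W \<and> (\<forall>x\<in>W. \<forall>y\<in>W. x \<oplus> y \<in> W) \<and>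
     (\<forall>c. \<forall>x\<in>W. c \<odot> x \<in> W)" (is "?L \<longleftrightarrow> ?S")
  proof
    assume ?L
    then interpret submodule W complex_ring H .
    show ?S using subset one_closed m_closed smult_closed by auto
  next
    assume S: ?S
    show ?L
    proof (rule submoduleI)
      fix x assume "x \<in> W"
      then show "\<ominus> x \<in> W" using S minus_eq_smult[of x] by auto
    qed (use S in auto)
  qed
  with cl show ?thesis unfolding closed_subspace_def by blast
qed

lemma closed_subspaceI:
  assumes "W \<subseteq> carrier H" "\<zero> \<in> W" "\<And>x y. \<lbrakk>x \<in> W; y \<in> W\<rbrakk> \<Longrightarrow> x \<oplus> y \<in> W"
    "\<And>c x. x \<in> W \<Longrightarrow> c \<odot> x \<in> W" "\<And>X x. \<lbrakk>\<And>n. X n \<in> W; hconv H X x\<rbrakk> \<Longrightarrow> x \<in> W"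
  shows "closed_subspace H W"
  unfolding closed_subspace_iff
proof (intro conjI ballI allI impI; (elim conjE)?)
  fix X x assume "\<forall>n. X n \<in> W" "hconv H X x"
  then show "x \<in> W" using assms(5)[of X x] by simp
qed (use assms(1-4) in simp_all)

lemma closed_subspaceD:
  assumes "closed_subspace H W"
  shows "W \<subseteq> carrier H" "x \<in> W \<Longrightarrow> x \<in> carrier H" "\<zero> \<in> W"
    "\<lbrakk>x \<in> W; y \<in> W\<rbrakk> \<Longrightarrow> x \<oplus> y \<in> W" "x \<in> W \<Longrightarrow> c \<odot> x \<in> W"
    "\<lbrakk>\<And>n. X n \<in> W; hconv H X x\<rbrakk> \<Longrightarrow> x \<in> W"
proof -
  from assms have a: "W \<subseteq> carrier H" "\<zero> \<in> W" "\<forall>x\<in>W. \<forall>y\<in>W. x \<oplus> y \<in> W" "\<forall>c. \<forall>x\<in>W. c \<odot> x \<in> W"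
    and l: "\<forall>X x. (\<forall>n. X n \<in> W) \<and> hconv H X x \<longrightarrow> x \<in> W"
    unfolding closed_subspace_iff by presburger+
  show "W \<subseteq> carrier H" "x \<in> W \<Longrightarrow> x \<in> carrier H" "\<zero> \<in> W"
    "\<lbrakk>x \<in> W; y \<in> W\<rbrakk> \<Longrightarrow> x \<oplus> y \<in> W" "x \<in> W \<Longrightarrow> c \<odot> x \<in> W" using a by auto
  show "\<lbrakk>\<And>n. X n \<in> W; hconv H X x\<rbrakk> \<Longrightarrow> x \<in> W" using l[rule_format, of X x] by simp
qed

lemma closed_subspace_diff:
  assumes "closed_subspace H W" "x \<in> W" "y \<in> W" shows "x \<ominus> y \<in> W"
  using assms closed_subspaceD[OF assms(1)] by (simp add: diff_eq_smult)

lemma closed_subspace_carrier: "closed_subspace H (carrier H)"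
  by (rule closed_subspaceI) (simp_all add: hconvD(2))

lemma closed_subspace_Inter:
  assumes "\<And>W. W \<in> \<W> \<Longrightarrow> closed_subspace H W" "\<W> \<noteq> {}"
  shows "closed_subspace H (\<Inter>\<W>)"
proof (rule closed_subspaceI)
  obtain W0 where "W0 \<in> \<W>" using assms(2) by auto
  then show "\<Inter>\<W> \<subseteq> carrier H" using closed_subspaceD(1)[OF assms(1), of W0] by auto
  show "x \<in> \<Inter>\<W>" if X: "\<And>n. X n \<in> \<Inter>\<W>" "hconv H X x" for X x
  proof
    fix W assume w: "W \<in> \<W>"
    show "x \<in> W" by (rule closed_subspaceD(6)[OF assms(1)[OF w] _ X(2)]) (use X(1) w in simp)
  qed
qed (simp_all add: closed_subspaceD[OF assms(1)])

lemma closed_span_closed_subspace: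
  assumes "S \<subseteq> carrier H" shows "closed_subspace H (closed_span H S)"
proof -
  have "carrier H \<in> {W. closed_subspace H W \<and> S \<subseteq> W}"
    using closed_subspace_carrier assms by simp
  then show ?thesis unfolding closed_span_def by (intro closed_subspace_Inter) blast+
qed

lemma closed_span_superset: "S \<subseteq> closed_span H S"
  by (auto simp: closed_span_def)

lemma closed_span_minimal: "\<lbrakk>closed_subspace H W; S \<subseteq> W\<rbrakk> \<Longrightarrow> closed_span H S \<subseteq> W"
  by (auto simp: closed_span_def)

lemma closed_subspace_orthogonal:
  assumes "S \<subseteq> carrier H" shows "closed_subspace H {y \<in> carrier H. \<forall>x\<in>S. cip H x y = 0}"
proof (rule closed_subspaceI)
  fix X x assume X: "\<And>n. X n \<in> {y \<in> carrier H. \<forall>x\<in>S. cip H x y = 0}" and c: "hconv H X x"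
  have "cip H s x = 0" if "s \<in> S" for s
  proof -
    have "s \<in> carrier H" using that assms by auto
    from hconv_cip[OF hconv_const[OF this] c] X that have "(\<lambda>n. 0) \<longlonglongrightarrow> cip H s x" by simp
    then show ?thesis by (simp add: LIMSEQ_const_iff)
  qed
  then show "x \<in> {y \<in> carrier H. \<forall>x\<in>S. cip H x y = 0}" using hconvD[OF c] by simp
qed (use assms in \<open>auto simp: cip_simps subset_iff\<close>)

text \<open>W contains midpoints, so a minimising sequence for the distance from x to W is Cauchy by
  the parallelogram law. Its limit p minimises, and a first variation at p shows that x - p is
  orthogonal to W.\<close>

lemma projection_exists:
  assumes W: "closed_subspace H W" and x: "x \<in> carrier H"
  shows "\<exists>p\<in>W. \<forall>y\<in>W. cip H y p = cip H y x"
proof -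
  note cs = closed_subspaceD[OF W]
  let ?D = "(\<lambda>y. (hnorm H (x \<ominus> y))\<^sup>2) ` W"
  define d where "d = Inf ?D"
  have bdd: "bdd_below ?D" by (rule bdd_belowI2[of _ 0]) simp
  have le: "d \<le> (hnorm H (x \<ominus> y))\<^sup>2" if "y \<in> W" for y
    unfolding d_def using that bdd by (intro cInf_lower) auto
  have "\<exists>y\<in>W. (hnorm H (x \<ominus> y))\<^sup>2 < d + inverse (real (Suc n))" for n
    using cInf_lessD[of ?D "d + inverse (real (Suc n))"] cs(3) by (auto simp: d_def)
  then obtain Y where Y: "\<And>n. Y n \<in> W" "\<And>n. (hnorm H (x \<ominus> Y n))\<^sup>2 < d + inverse (real (Suc n))" by metis
  have Yc: "Y n \<in> carrier H" for n by (rule cs(2)[OF Y(1)])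
  have par: "(hnorm H (Y m \<ominus> Y n))\<^sup>2 \<le> 2 * inverse (real (Suc m)) + 2 * inverse (real (Suc n))" for m n
  proof -
    let ?z = "(1/2) \<odot> (Y m \<oplus> Y n)"
    have "?z \<in> W" by (simp add: cs(4,5) Y)
    then have le': "d \<le> (hnorm H (x \<ominus> ?z))\<^sup>2" by (rule le)
    \<comment> \<open>The arithmetic of the parallelogram law, isolated from the inner products: r,
      z and q belong to the midpoint of \<open>Y m\<close> and \<open>Y n\<close>, while p and p'
      are the squared distances of these two vectors from x and e is the squared distance between
      them.\<close>
    have alg: "\<lbrakk>r = (a + b) / 2; z = (A + 2 * c + B) / 4; q = X - 2 * r + z; p = X - 2 * a + A;
        p' = X - 2 * b + B; e = A - 2 * c + B\<rbrakk> \<Longrightarrow> e = 2 * p + 2 * p' - 4 * q"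
      for a b c r z q p p' e X A B :: real by (simp add: field_simps)
    have "Re (cip H x ?z) = (Re (cip H x (Y m)) + Re (cip H x (Y n))) / 2"
      by (subst cip_smult_right, use x Yc in simp, use x Yc in simp, subst cip_add_right[OF x Yc Yc], simp)
    moreover have "(hnorm H ?z)\<^sup>2 = ((hnorm H (Y m))\<^sup>2 + 2 * Re (cip H (Y m) (Y n)) + (hnorm H (Y n))\<^sup>2) / 4"
      by (subst hnorm_sq_smult, simp add: Yc, subst hnorm_sq_add[OF Yc Yc], simp add: power2_eq_square)
    moreover have "(hnorm H (x \<ominus> ?z))\<^sup>2 = (hnorm H x)\<^sup>2 - 2 * Re (cip H x ?z) + (hnorm H ?z)\<^sup>2"
      using x Yc by (intro hnorm_sq_diff) auto
    ultimately have "(hnorm H (Y m \<ominus> Y n))\<^sup>2 = 2 * (hnorm H (x \<ominus> Y m))\<^sup>2 + 2 * (hnorm H (x \<ominus> Y n))\<^sup>2 - 4 * (hnorm H (x \<ominus> ?z))\<^sup>2"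
      using hnorm_sq_diff[OF x Yc[of m]] hnorm_sq_diff[OF x Yc[of n]] hnorm_sq_diff[OF Yc[of m] Yc[of n]]
      by (rule alg)
    then show ?thesis using le' Y(2)[of m] Y(2)[of n] by linarith
  qed
  have "\<exists>p. hconv H Y p"
  proof (rule cauchy_hconv[OF Yc])
    fix e :: real assume e: "e > 0"
    then obtain N where N: "inverse (real (Suc N)) < e\<^sup>2 / 4" using reals_Archimedean[of "e\<^sup>2/4"] by auto
    have "hnorm H (Y m \<ominus> Y n) < e" if "m \<ge> N" "n \<ge> N" for m n
    proof (rule power2_less_imp_less)
      have "inverse (real (Suc m)) \<le> inverse (real (Suc N))" "inverse (real (Suc n)) \<le> inverse (real (Suc N))"
        using that by (auto intro!: le_imp_inverse_le)
      then show "(hnorm H (Y m \<ominus> Y n))\<^sup>2 < e\<^sup>2" using par[of m n] N by linarith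
    qed (use e in simp)
    then show "\<exists>N. \<forall>m\<ge>N. \<forall>n\<ge>N. hnorm H (Y m \<ominus> Y n) < e" by blast
  qed
  then obtain p where p: "hconv H Y p" by blast
  have pW: "p \<in> W" by (rule cs(6)[OF Y(1) p])
  have pc: "p \<in> carrier H" using hconvD[OF p] by simp
  have "(\<lambda>n. (hnorm H (x \<ominus> Y n))\<^sup>2) \<longlonglongrightarrow> (hnorm H (x \<ominus> p))\<^sup>2"
    by (intro tendsto_intros hconv_norm hconv_diff hconv_const x p)
  moreover have "(\<lambda>n. d + inverse (real (Suc n))) \<longlonglongrightarrow> d + 0"
    by (intro tendsto_intros LIMSEQ_inverse_real_of_nat)
  ultimately have pd: "(hnorm H (x \<ominus> p))\<^sup>2 \<le> d"
    by (intro LIMSEQ_le[of "\<lambda>n. (hnorm H (x \<ominus> Y n))\<^sup>2" _ "\<lambda>n. d + inverse (real (Suc n))"]) (use Y in \<open>auto intro: less_imp_le\<close>)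
  have "cip H y p = cip H y x" if y: "y \<in> W" for y
  proof -
    have yc: "y \<in> carrier H" by (rule cs(2)[OF y])
    \<comment> \<open>The competitor p + s conj(z) y is not closer to x than p;
      \<open>quadratic_bound\<close> with constant term 0 then forces z = 0.\<close>
    define z where "z = cip H (x \<ominus> p) y"
    have "(cmod z)\<^sup>2 \<le> 0 * (hnorm H y)\<^sup>2"
    proof (rule quadratic_bound)
      fix s :: real
      let ?c = "of_real s * cnj z"
      have "p \<oplus> ?c \<odot> y \<in> W" by (simp add: cs(4,5) pW y)
      then have "(hnorm H (x \<ominus> p))\<^sup>2 \<le> (hnorm H (x \<ominus> (p \<oplus> ?c \<odot> y)))\<^sup>2" using le pd by force
      also have "x \<ominus> (p \<oplus> ?c \<odot> y) = (x \<ominus> p) \<ominus> ?c \<odot> y"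
        by (rule hilbert_eqI) (use x pc yc in \<open>auto simp: cip_simps\<close>)
      also have "(hnorm H \<dots>)\<^sup>2 = (hnorm H (x \<ominus> p))\<^sup>2 - 2 * Re (cip H (x \<ominus> p) (?c \<odot> y)) + (hnorm H (?c \<odot> y))\<^sup>2"
        by (rule hnorm_sq_diff) (use x pc yc in auto)
      also have "cip H (x \<ominus> p) (?c \<odot> y) = ?c * z"
        using x pc yc unfolding z_def by (intro cip_smult_right) auto
      also have "Re (?c * z) = s * (cmod z)\<^sup>2"
        by (simp add: cmod_power2) (simp add: power2_eq_square algebra_simps)
      also have "(hnorm H (?c \<odot> y))\<^sup>2 = (cmod z)\<^sup>2 * (hnorm H y)\<^sup>2 * s\<^sup>2"
        using yc by (simp add: hnorm_sq_smult norm_mult power_mult_distrib)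
      finally show "0 \<le> 0 - 2 * (cmod z)\<^sup>2 * s + (cmod z)\<^sup>2 * (hnorm H y)\<^sup>2 * s\<^sup>2"
        by (simp add: mult_ac)
    qed simp
    then have "z = 0" by simp
    then have "cip H y (x \<ominus> p) = 0" unfolding z_def using x pc yc by (subst cip_commute) auto
    then show ?thesis using x pc yc by (simp add: cip_diff_right)
  qed
  with pW show ?thesis by blast
qed

text \<open>The difference of x and its projection on the closed span is orthogonal to S, hence
  zero.\<close>

lemma closed_span_eq_carrierI:
  assumes "S \<subseteq> carrier H" "\<And>z. \<lbrakk>z \<in> carrier H; \<forall>x\<in>S. cip H x z = 0\<rbrakk> \<Longrightarrow> z = \<zero>"
  shows "closed_span H S = carrier H"
proof
  have cs: "closed_subspace H (closed_span H S)" by (rule closed_span_closed_subspace[OF assms(1)])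
  then show *: "closed_span H S \<subseteq> carrier H" by (rule closed_subspaceD(1))
  show "carrier H \<subseteq> closed_span H S"
  proof
    fix x assume x: "x \<in> carrier H"
    obtain p where p: "p \<in> closed_span H S" "\<forall>y\<in>closed_span H S. cip H y p = cip H y x"
      using projection_exists[OF cs x] by blast
    have "cip H y (x \<ominus> p) = 0" if "y \<in> S" for y
      using p that closed_span_superset[of S] assms(1) * x by (subst cip_diff_right) auto
    then have "x \<ominus> p = \<zero>" using assms(2) x p(1) * by blast
    then have "x = p" using x p(1) * by (auto simp: diff_eq_zero_iff)
    then show "x \<in> closed_span H S" using p by simp
  qed
qed

text \<open>The vectors orthogonal to z form a closed subspace containing S; it is the whole space
  and contains z itself.\<close>

lemma total_orthogonal:
  assumes "closed_span H S = carrier H" "S \<subseteq> carrier H" "z \<in> carrier H" "\<And>x. x \<in> S \<Longrightarrow> cip H x z = 0"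
  shows "z = \<zero>"
proof -
  have "closed_subspace H {y \<in> carrier H. \<forall>x\<in>{z}. cip H x y = 0}"
    by (rule closed_subspace_orthogonal) (use assms in auto)
  moreover have "S \<subseteq> {y \<in> carrier H. \<forall>x\<in>{z}. cip H x y = 0}"
  proof
    fix s assume "s \<in> S"
    then have "s \<in> carrier H" "cip H s z = 0" using assms by auto
    then show "s \<in> {y \<in> carrier H. \<forall>x\<in>{z}. cip H x y = 0}"
      using cip_commute[of s z] assms(3) by simp
  qed
  ultimately have "carrier H \<subseteq> {y \<in> carrier H. \<forall>x\<in>{z}. cip H x y = 0}"
    unfolding assms(1)[symmetric] by (rule closed_span_minimal)
  then show ?thesis using assms(3) cip_definite by auto
qed

lemma total_eqI:
  assumes "closed_span H S = carrier H" "S \<subseteq> carrier H" "x \<in> carrier H" "y \<in> carrier H"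
    "\<And>s. s \<in> S \<Longrightarrow> cip H s x = cip H s y"
  shows "x = y"
proof -
  have "x \<ominus> y = \<zero>"
    by (rule total_orthogonal[OF assms(1,2)]) (use assms in \<open>auto simp: cip_diff_right subset_iff\<close>)
  then show ?thesis using assms by (simp add: diff_eq_zero_iff)
qed

end

section \<open>Completions\<close>

lemma cauchy_seqs_iff:
  "X \<in> cauchy_seqs V \<longleftrightarrow> (\<forall>n. X n \<in> carrier V) \<and>
     (\<forall>e>0. \<exists>N. \<forall>m\<ge>N. \<forall>n\<ge>N. hnorm V (X m \<ominus>\<^bsub>V\<^esub> X n) < e)"
  by (simp add: cauchy_seqs_def hdist_def image_subset_iff cong: conj_cong)

lemma completion_rel_iff:
  "(X, Y) \<in> completion_rel V \<longleftrightarrow> X \<in> cauchy_seqs V \<and> Y \<in> cauchy_seqs V \<and>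
     (\<lambda>n. hnorm V (X n \<ominus>\<^bsub>V\<^esub> Y n)) \<longlonglongrightarrow> 0"
  by (auto simp: completion_rel_def cauchy_seqs_iff hdist_def)

context pre_hilbert
begin

lemma cauchy_seqsD: "X \<in> cauchy_seqs H \<Longrightarrow> X n \<in> carrier H"
  by (simp add: cauchy_seqs_iff)

lemma cauchy_seqs_const: "x \<in> carrier H \<Longrightarrow> (\<lambda>n. x) \<in> cauchy_seqs H"
  by (simp add: cauchy_seqs_iff)

lemma cauchy_seqs_bounded:
  assumes "X \<in> cauchy_seqs H" shows "\<exists>B>0. \<forall>n. hnorm H (X n) \<le> B"
proof -
  note c = cauchy_seqsD[OF assms]
  from assms obtain N where N: "\<forall>m\<ge>N. \<forall>n\<ge>N. hnorm H (X m \<ominus> X n) < 1"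
    unfolding cauchy_seqs_iff by (meson zero_less_one)
  let ?B = "Max ((\<lambda>n. hnorm H (X n)) ` {..N}) + 1"
  have M: "hnorm H (X n) \<le> Max ((\<lambda>n. hnorm H (X n)) ` {..N})" if "n \<le> N" for n
    using that by (intro Max_ge) auto
  have "hnorm H (X n) \<le> ?B" for n
  proof (cases "n \<le> N")
    case False
    then have "hnorm H (X n \<ominus> X N) < 1" using N by simp
    then show ?thesis using hnorm_triangle2[OF c[of n] c[of N]] M[OF order_refl] by linarith
  next
    case True
    then show ?thesis using M[of n] by linarith
  qed
  moreover have "?B > 0" using M[of 0] hnorm_ge_0[OF c[of 0]] by linarith
  ultimately show ?thesis by blast
qed

lemma completion_rel_refl: "X \<in> cauchy_seqs H \<Longrightarrow> (X, X) \<in> completion_rel H"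
  by (simp add: completion_rel_iff cauchy_seqsD)

lemma completion_class_self: "X \<in> cauchy_seqs H \<Longrightarrow> X \<in> completion_class H X"
  by (simp add: completion_class_def completion_rel_refl)

lemma completion_class_carrier: "X \<in> cauchy_seqs H \<Longrightarrow> completion_class H X \<in> carrier (hcompletion H)"
  by (simp add: completion_class_def hcompletion_def quotientI)

lemma carrier_hcompletion_cases:
  assumes "P \<in> carrier (hcompletion H)"
  obtains X where "X \<in> cauchy_seqs H" "P = completion_class H X"
  using assms by (auto simp: hcompletion_def quotient_def completion_class_def)

text \<open>Both sequences are bounded, which turns the estimate \<open>cip_diff_le\<close> into a
  Cauchy condition for the inner products.\<close>

lemma cauchy_cip_convergent:
  assumes X: "X \<in> cauchy_seqs H" and Y: "Y \<in> cauchy_seqs H"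
  shows "convergent (\<lambda>n. cip H (X n) (Y n))"
proof -
  note cx = cauchy_seqsD[OF X] and cy = cauchy_seqsD[OF Y]
  obtain A where A: "A > 0" "\<forall>n. hnorm H (X n) \<le> A" using cauchy_seqs_bounded[OF X] by blast
  obtain B where B: "B > 0" "\<forall>n. hnorm H (Y n) \<le> B" using cauchy_seqs_bounded[OF Y] by blast
  have "Cauchy (\<lambda>n. cip H (X n) (Y n))"
  proof (rule metric_CauchyI)
    fix e :: real assume e: "e > 0"
    obtain N where N: "\<forall>m\<ge>N. \<forall>n\<ge>N. hnorm H (X m \<ominus> X n) < e / (2 * B)"
      using X e B(1) unfolding cauchy_seqs_iff by (meson divide_pos_pos mult_pos_pos zero_less_numeral)
    obtain M where M: "\<forall>m\<ge>M. \<forall>n\<ge>M. hnorm H (Y m \<ominus> Y n) < e / (2 * A)"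
      using Y e A(1) unfolding cauchy_seqs_iff by (meson divide_pos_pos mult_pos_pos zero_less_numeral)
    have "dist (cip H (X m) (Y m)) (cip H (X n) (Y n)) < e" if "m \<ge> max N M" "n \<ge> max N M" for m n
    proof -
      have "hnorm H (X m \<ominus> X n) * hnorm H (Y m) \<le> hnorm H (X m \<ominus> X n) * B"
        using B cx by (intro mult_left_mono) auto
      also have "\<dots> < e / (2 * B) * B"
        using N that B(1) by (intro mult_strict_right_mono) auto
      finally have 1: "hnorm H (X m \<ominus> X n) * hnorm H (Y m) < e / 2" using B(1) by simp
      have "hnorm H (X n) * hnorm H (Y m \<ominus> Y n) \<le> A * hnorm H (Y m \<ominus> Y n)"
        using A cy by (intro mult_right_mono) auto
      also have "\<dots> < A * (e / (2 * A))"
        using M that A(1) by (intro mult_strict_left_mono) auto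
      finally have 2: "hnorm H (X n) * hnorm H (Y m \<ominus> Y n) < e / 2" using A(1) by simp
      show ?thesis
        using 1 2 cip_diff_le[OF cx[of m] cy[of m] cx[of n] cy[of n]] by (simp add: dist_norm)
    qed
    then show "\<exists>M. \<forall>m\<ge>M. \<forall>n\<ge>M. dist (cip H (X m) (Y m)) (cip H (X n) (Y n)) < e" by blast
  qed
  then show ?thesis by (simp add: Cauchy_convergent_iff)
qed

lemma completion_rel_cip:
  assumes "(X, X') \<in> completion_rel H" "(Y, Y') \<in> completion_rel H"
  shows "(\<lambda>n. cip H (X n) (Y n) - cip H (X' n) (Y' n)) \<longlonglongrightarrow> 0"
proof -
  from assms have c: "X \<in> cauchy_seqs H" "X' \<in> cauchy_seqs H" "Y \<in> cauchy_seqs H" "Y' \<in> cauchy_seqs H"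
    and l: "(\<lambda>n. hnorm H (X n \<ominus> X' n)) \<longlonglongrightarrow> 0" "(\<lambda>n. hnorm H (Y n \<ominus> Y' n)) \<longlonglongrightarrow> 0"
    by (auto simp: completion_rel_iff)
  obtain A where A: "A > 0" "\<forall>n. hnorm H (X' n) \<le> A" using cauchy_seqs_bounded[OF c(2)] by blast
  obtain B where B: "B > 0" "\<forall>n. hnorm H (Y n) \<le> B" using cauchy_seqs_bounded[OF c(3)] by blast
  have "cmod (cip H (X n) (Y n) - cip H (X' n) (Y' n)) \<le> hnorm H (X n \<ominus> X' n) * B + A * hnorm H (Y n \<ominus> Y' n)" for n
  proof -
    have "hnorm H (X n \<ominus> X' n) * hnorm H (Y n) \<le> hnorm H (X n \<ominus> X' n) * B"
      using B c by (intro mult_left_mono) (auto simp: cauchy_seqsD)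
    moreover have "hnorm H (X' n) * hnorm H (Y n \<ominus> Y' n) \<le> A * hnorm H (Y n \<ominus> Y' n)"
      using A c by (intro mult_right_mono) (auto simp: cauchy_seqsD)
    ultimately show ?thesis
      using cip_diff_le[of "X n" "Y n" "X' n" "Y' n"] c by (simp add: cauchy_seqsD)
  qed
  moreover have "(\<lambda>n. hnorm H (X n \<ominus> X' n) * B + A * hnorm H (Y n \<ominus> Y' n)) \<longlonglongrightarrow> 0 * B + A * 0"
    by (intro tendsto_intros l)
  ultimately show ?thesis
    by - (rule Lim_null_comparison[OF always_eventually[OF allI]], simp_all)
qed

text \<open>The description in \<open>hcompletion\<close> admits any representatives; by
  \<open>completion_rel_cip\<close> all of them give the same limit, which may therefore be computed
  on the chosen ones.\<close>

lemma cip_completion_class: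
  assumes X: "X \<in> cauchy_seqs H" and Y: "Y \<in> cauchy_seqs H"
  shows "(\<lambda>n. cip H (X n) (Y n)) \<longlonglongrightarrow> cip (hcompletion H) (completion_class H X) (completion_class H Y)"
proof -
  obtain z where z: "(\<lambda>n. cip H (X n) (Y n)) \<longlonglongrightarrow> z"
    using cauchy_cip_convergent[OF assms] by (auto simp: convergent_def)
  have "cip (hcompletion H) (completion_class H X) (completion_class H Y) = z"
    unfolding hcompletion_def hspace.simps
  proof (rule the_equality)
    show "\<exists>X'\<in>completion_class H X. \<exists>Y'\<in>completion_class H Y. (\<lambda>n. cip H (X' n) (Y' n)) \<longlonglongrightarrow> z"
      using z completion_class_self[OF X] completion_class_self[OF Y] by blast
    fix w assume "\<exists>X'\<in>completion_class H X. \<exists>Y'\<in>completion_class H Y. (\<lambda>n. cip H (X' n) (Y' n)) \<longlonglongrightarrow> w"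
    then obtain X' Y' where "(X, X') \<in> completion_rel H" "(Y, Y') \<in> completion_rel H"
      and w: "(\<lambda>n. cip H (X' n) (Y' n)) \<longlonglongrightarrow> w"
      by (auto simp: completion_class_def)
    from tendsto_add[OF completion_rel_cip[OF this(1,2)] w] have "(\<lambda>n. cip H (X n) (Y n)) \<longlonglongrightarrow> w" by simp
    then show "w = z" using z LIMSEQ_unique by blast
  qed
  with z show ?thesis by simp
qed

lemma cip_completion_const:
  assumes "x \<in> carrier H" "Y \<in> cauchy_seqs H"
  shows "(\<lambda>n. cip H x (Y n)) \<longlonglongrightarrow> cip (hcompletion H) (completion_class H (\<lambda>n. x)) (completion_class H Y)"
  using cip_completion_class[OF cauchy_seqs_const assms(2)] assms(1) by simp

end

text \<open>A Hilbert space \<open>R\<close> that contains an isometric copy of a space with a degenerate form as a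
  dense subset is a model of the completion.\<close>

locale completion_model = V: pre_hilbert V + R: hilbert_space R
  for V :: "'a hspace" and R :: "'b hspace" +
  fixes \<phi> :: "'a \<Rightarrow> 'b"
  assumes linear: "linear_map V R \<phi>"
    and isometric: "\<lbrakk>x \<in> carrier V; y \<in> carrier V\<rbrakk> \<Longrightarrow> cip R (\<phi> x) (\<phi> y) = cip V x y"
    and dense: "closed_span R (\<phi> ` carrier V) = carrier R"
begin

text \<open>The extension of \<open>\<phi>\<close> by continuity: a class is sent to the common
  limit of the images of its representatives.\<close>

definition ext :: "(nat \<Rightarrow> 'a) set \<Rightarrow> 'b" where
  "ext P = (THE r. \<exists>X\<in>P. hconv R (\<lambda>n. \<phi> (X n)) r)"

lemma \<phi>_closed: "x \<in> carrier V \<Longrightarrow> \<phi> x \<in> carrier R"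
  using linear by (auto simp: linear_map_def)

lemma \<phi>_add: "\<lbrakk>x \<in> carrier V; y \<in> carrier V\<rbrakk> \<Longrightarrow> \<phi> (x \<oplus>\<^bsub>V\<^esub> y) = \<phi> x \<oplus>\<^bsub>R\<^esub> \<phi> y"
  using linear by (auto simp: linear_map_def)

lemma \<phi>_smult: "x \<in> carrier V \<Longrightarrow> \<phi> (c \<odot>\<^bsub>V\<^esub> x) = c \<odot>\<^bsub>R\<^esub> \<phi> x"
  using linear by (auto simp: linear_map_def)

lemma \<phi>_diff: "\<lbrakk>x \<in> carrier V; y \<in> carrier V\<rbrakk> \<Longrightarrow> \<phi> (x \<ominus>\<^bsub>V\<^esub> y) = \<phi> x \<ominus>\<^bsub>R\<^esub> \<phi> y"
  by (simp add: V.diff_eq_smult R.diff_eq_smult \<phi>_add \<phi>_smult \<phi>_closed)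

lemma \<phi>_zero: "\<phi> \<zero>\<^bsub>V\<^esub> = \<zero>\<^bsub>R\<^esub>"
  using \<phi>_smult[of "\<zero>\<^bsub>V\<^esub>" 0] V.smult_l_null[of "\<zero>\<^bsub>V\<^esub>"] R.smult_l_null[of "\<phi> \<zero>\<^bsub>V\<^esub>"] by (simp add: \<phi>_closed)

lemma \<phi>_norm: "x \<in> carrier V \<Longrightarrow> hnorm R (\<phi> x) = hnorm V x"
  by (simp add: hnorm_def isometric)

lemma \<phi>_dist: "\<lbrakk>x \<in> carrier V; y \<in> carrier V\<rbrakk> \<Longrightarrow> hnorm R (\<phi> x \<ominus>\<^bsub>R\<^esub> \<phi> y) = hnorm V (x \<ominus>\<^bsub>V\<^esub> y)"
  by (simp flip: \<phi>_diff add: \<phi>_norm)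

lemma cauchy_seqs_hconv:
  assumes "X \<in> cauchy_seqs V" shows "\<exists>r. hconv R (\<lambda>n. \<phi> (X n)) r"
proof (rule R.cauchy_hconv)
  show "\<phi> (X n) \<in> carrier R" for n using assms by (simp add: \<phi>_closed V.cauchy_seqsD)
  fix e :: real assume "e > 0"
  then show "\<exists>N. \<forall>m\<ge>N. \<forall>n\<ge>N. hnorm R (\<phi> (X m) \<ominus>\<^bsub>R\<^esub> \<phi> (X n)) < e"
    using assms by (simp add: cauchy_seqs_iff \<phi>_dist)
qed

text \<open>The isometry pulls the Cauchy property back. Convergence in \<open>R\<close> thus
  certifies membership in \<open>cauchy_seqs\<close>, for instance for termwise sums and
  multiples.\<close>

lemma hconv_cauchy_seqs:
  assumes c: "\<And>n. X n \<in> carrier V" and l: "hconv R (\<lambda>n. \<phi> (X n)) r" shows "X \<in> cauchy_seqs V"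
  unfolding cauchy_seqs_iff
proof (intro conjI allI impI c)
  fix e :: real assume "e > 0"
  then have "e / 2 > 0" by simp
  from LIMSEQ_D[OF R.hconvD(3)[OF l] this] obtain N where N: "\<And>n. n \<ge> N \<Longrightarrow> hnorm R (\<phi> (X n) \<ominus>\<^bsub>R\<^esub> r) < e / 2"
    using R.hconvD[OF l] by auto
  have "hnorm V (X m \<ominus>\<^bsub>V\<^esub> X n) < e" if "m \<ge> N" "n \<ge> N" for m n
  proof -
    have "hnorm V (X m \<ominus>\<^bsub>V\<^esub> X n) = hnorm R (\<phi> (X m) \<ominus>\<^bsub>R\<^esub> \<phi> (X n))" by (simp add: \<phi>_dist c)
    also have "\<dots> \<le> hnorm R (\<phi> (X m) \<ominus>\<^bsub>R\<^esub> r) + hnorm R (r \<ominus>\<^bsub>R\<^esub> \<phi> (X n))"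
      by (rule R.hnorm_triangle) (use R.hconvD[OF l] in auto)
    also have "hnorm R (r \<ominus>\<^bsub>R\<^esub> \<phi> (X n)) = hnorm R (\<phi> (X n) \<ominus>\<^bsub>R\<^esub> r)"
      by (rule R.hnorm_minus_commute) (use R.hconvD[OF l] in auto)
    finally show ?thesis using N[OF that(1)] N[OF that(2)] by simp
  qed
  then show "\<exists>N. \<forall>m\<ge>N. \<forall>n\<ge>N. hnorm V (X m \<ominus>\<^bsub>V\<^esub> X n) < e" by blast
qed

lemma completion_rel_hconv:
  assumes X: "X \<in> cauchy_seqs V" and Y: "Y \<in> cauchy_seqs V"
    and x: "hconv R (\<lambda>n. \<phi> (X n)) x" and y: "hconv R (\<lambda>n. \<phi> (Y n)) y"
  shows "(X, Y) \<in> completion_rel V \<longleftrightarrow> x = y"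
proof -
  note xy = R.hconvD[OF x] R.hconvD[OF y]
  have "(\<lambda>n. hnorm V (X n \<ominus>\<^bsub>V\<^esub> Y n)) \<longlonglongrightarrow> hnorm R (x \<ominus>\<^bsub>R\<^esub> y)"
    using R.hconv_norm[OF R.hconv_diff[OF x y]] by (simp add: \<phi>_dist V.cauchy_seqsD X Y)
  then have "(\<lambda>n. hnorm V (X n \<ominus>\<^bsub>V\<^esub> Y n)) \<longlonglongrightarrow> 0 \<longleftrightarrow> hnorm R (x \<ominus>\<^bsub>R\<^esub> y) = 0"
    by (auto dest: LIMSEQ_unique)
  then show ?thesis using X Y xy R.hnorm_diff_eq_0 by (auto simp: completion_rel_iff)
qed

lemma ext_class:
  assumes X: "X \<in> cauchy_seqs V" shows "hconv R (\<lambda>n. \<phi> (X n)) (ext (completion_class V X))"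
proof -
  obtain r where r: "hconv R (\<lambda>n. \<phi> (X n)) r" using cauchy_seqs_hconv[OF X] by blast
  have "ext (completion_class V X) = r" unfolding ext_def
  proof (rule the_equality)
    show "\<exists>X\<in>completion_class V X. hconv R (\<lambda>n. \<phi> (X n)) r"
      using r V.completion_class_self[OF X] by blast
    fix s assume "\<exists>X\<in>completion_class V X. hconv R (\<lambda>n. \<phi> (X n)) s"
    then obtain Y where Y: "(X, Y) \<in> completion_rel V" "hconv R (\<lambda>n. \<phi> (Y n)) s"
      by (auto simp: completion_class_def)
    then show "s = r" using completion_rel_hconv[OF X _ r Y(2)] by (auto simp: completion_rel_iff)
  qed
  with r show ?thesis by simp
qed

lemma ext_const: "x \<in> carrier V \<Longrightarrow> ext (completion_class V (\<lambda>n. x)) = \<phi> x"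
  using R.hconv_unique[OF ext_class[OF V.cauchy_seqs_const] R.hconv_const] by (simp add: \<phi>_closed)

lemma ext_closed: "P \<in> carrier (hcompletion V) \<Longrightarrow> ext P \<in> carrier R"
  by (elim V.carrier_hcompletion_cases) (auto dest: ext_class R.hconvD(2))

text \<open>A class consists exactly of the Cauchy sequences whose images have the same limit in
  \<open>R\<close>. Equality of classes is thereby tested in \<open>R\<close>, and the operations on
  classes inherit their laws from there.\<close>

lemma class_eq_iff:
  assumes "X \<in> cauchy_seqs V" "Y \<in> cauchy_seqs V"
  shows "completion_class V X = completion_class V Y \<longleftrightarrow> ext (completion_class V X) = ext (completion_class V Y)"
proof
  assume e: "ext (completion_class V X) = ext (completion_class V Y)"
  have "(X, Z) \<in> completion_rel V \<longleftrightarrow> Z \<in> cauchy_seqs V \<and>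
      ext (completion_class V X) = ext (completion_class V Z)" if "X \<in> cauchy_seqs V" for X Z
  proof (cases "Z \<in> cauchy_seqs V")
    case True
    then show ?thesis using completion_rel_hconv[OF that True ext_class[OF that] ext_class[OF True]] by simp
  qed (simp add: completion_rel_iff)
  then have "completion_class V X = {Z. Z \<in> cauchy_seqs V \<and> ext (completion_class V X) = ext (completion_class V Z)}"
    if "X \<in> cauchy_seqs V" for X
    using that by (subst completion_class_def) (simp add: Image_def)
  from this[OF assms(1)] this[OF assms(2)] show "completion_class V X = completion_class V Y"
    unfolding e by (rule trans[OF _ sym])
qed simp

lemma cauchy_add:
  assumes "X \<in> cauchy_seqs V" "Y \<in> cauchy_seqs V"
  shows "(\<lambda>n. X n \<oplus>\<^bsub>V\<^esub> Y n) \<in> cauchy_seqs V"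
    "ext (completion_class V (\<lambda>n. X n \<oplus>\<^bsub>V\<^esub> Y n)) = ext (completion_class V X) \<oplus>\<^bsub>R\<^esub> ext (completion_class V Y)"
proof -
  have l: "hconv R (\<lambda>n. \<phi> (X n \<oplus>\<^bsub>V\<^esub> Y n)) (ext (completion_class V X) \<oplus>\<^bsub>R\<^esub> ext (completion_class V Y))"
    using R.hconv_add[OF ext_class[OF assms(1)] ext_class[OF assms(2)]] assms by (simp add: \<phi>_add V.cauchy_seqsD)
  show c: "(\<lambda>n. X n \<oplus>\<^bsub>V\<^esub> Y n) \<in> cauchy_seqs V"
    by (rule hconv_cauchy_seqs[OF _ l]) (use assms in \<open>simp add: V.cauchy_seqsD\<close>)
  show "ext (completion_class V (\<lambda>n. X n \<oplus>\<^bsub>V\<^esub> Y n)) = ext (completion_class V X) \<oplus>\<^bsub>R\<^esub> ext (completion_class V Y)"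
    by (rule R.hconv_unique[OF ext_class[OF c] l])
qed

lemma cauchy_smult:
  assumes "X \<in> cauchy_seqs V"
  shows "(\<lambda>n. c \<odot>\<^bsub>V\<^esub> X n) \<in> cauchy_seqs V"
    "ext (completion_class V (\<lambda>n. c \<odot>\<^bsub>V\<^esub> X n)) = c \<odot>\<^bsub>R\<^esub> ext (completion_class V X)"
proof -
  have l: "hconv R (\<lambda>n. \<phi> (c \<odot>\<^bsub>V\<^esub> X n)) (c \<odot>\<^bsub>R\<^esub> ext (completion_class V X))"
    using R.hconv_smult[OF ext_class[OF assms]] assms by (simp add: \<phi>_smult V.cauchy_seqsD)
  show c: "(\<lambda>n. c \<odot>\<^bsub>V\<^esub> X n) \<in> cauchy_seqs V"
    by (rule hconv_cauchy_seqs[OF _ l]) (use assms in \<open>simp add: V.cauchy_seqsD\<close>)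
  show "ext (completion_class V (\<lambda>n. c \<odot>\<^bsub>V\<^esub> X n)) = c \<odot>\<^bsub>R\<^esub> ext (completion_class V X)"
    by (rule R.hconv_unique[OF ext_class[OF c] l])
qed

lemma completion_class_memD:
  assumes "X \<in> cauchy_seqs V" "X' \<in> completion_class V X"
  shows "X' \<in> cauchy_seqs V" "ext (completion_class V X') = ext (completion_class V X)"
proof -
  from assms have r: "(X, X') \<in> completion_rel V" by (simp add: completion_class_def)
  then show c: "X' \<in> cauchy_seqs V" by (simp add: completion_rel_iff)
  show "ext (completion_class V X') = ext (completion_class V X)"
    using r completion_rel_hconv[OF assms(1) c ext_class[OF assms(1)] ext_class[OF c]] by simp
qed

text \<open>The definition takes a union over all representatives of both classes; it collapses
  because every pair of representatives yields the same class.\<close>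

lemma add_class:
  assumes "X \<in> cauchy_seqs V" "Y \<in> cauchy_seqs V"
  shows "completion_class V X \<oplus>\<^bsub>hcompletion V\<^esub> completion_class V Y = completion_class V (\<lambda>n. X n \<oplus>\<^bsub>V\<^esub> Y n)"
proof -
  have "completion_class V (\<lambda>n. X' n \<oplus>\<^bsub>V\<^esub> Y' n) = completion_class V (\<lambda>n. X n \<oplus>\<^bsub>V\<^esub> Y n)"
    if "X' \<in> completion_class V X" "Y' \<in> completion_class V Y" for X' Y'
    using completion_class_memD[OF assms(1) that(1)] completion_class_memD[OF assms(2) that(2)] assms
    by (subst class_eq_iff) (simp_all add: cauchy_add)
  then have "(\<Union>X'\<in>completion_class V X. \<Union>Y'\<in>completion_class V Y. completion_class V (\<lambda>n. X' n \<oplus>\<^bsub>V\<^esub> Y' n)) =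
      (\<Union>X'\<in>completion_class V X. \<Union>Y'\<in>completion_class V Y. completion_class V (\<lambda>n. X n \<oplus>\<^bsub>V\<^esub> Y n))"
    by (intro SUP_cong refl)
  also have "\<dots> = completion_class V (\<lambda>n. X n \<oplus>\<^bsub>V\<^esub> Y n)"
    using V.completion_class_self[OF assms(1)] V.completion_class_self[OF assms(2)]
    by (auto simp del: UN_simps)
  finally show ?thesis by (simp add: hcompletion_def)
qed

lemma smult_class:
  assumes "X \<in> cauchy_seqs V"
  shows "c \<odot>\<^bsub>hcompletion V\<^esub> completion_class V X = completion_class V (\<lambda>n. c \<odot>\<^bsub>V\<^esub> X n)"
proof -
  have "completion_class V (\<lambda>n. c \<odot>\<^bsub>V\<^esub> X' n) = completion_class V (\<lambda>n. c \<odot>\<^bsub>V\<^esub> X n)"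
    if "X' \<in> completion_class V X" for X'
    using completion_class_memD[OF assms(1) that(1)] assms
    by (subst class_eq_iff) (simp_all add: cauchy_smult)
  then have "(\<Union>X'\<in>completion_class V X. completion_class V (\<lambda>n. c \<odot>\<^bsub>V\<^esub> X' n)) =
      (\<Union>X'\<in>completion_class V X. completion_class V (\<lambda>n. c \<odot>\<^bsub>V\<^esub> X n))"
    by (intro SUP_cong refl)
  also have "\<dots> = completion_class V (\<lambda>n. c \<odot>\<^bsub>V\<^esub> X n)"
    using V.completion_class_self[OF assms] by auto
  finally show ?thesis by (simp add: hcompletion_def)
qed

lemma ext_add:
  assumes "P \<in> carrier (hcompletion V)" "Q \<in> carrier (hcompletion V)"
  shows "P \<oplus>\<^bsub>hcompletion V\<^esub> Q \<in> carrier (hcompletion V)" "ext (P \<oplus>\<^bsub>hcompletion V\<^esub> Q) = ext P \<oplus>\<^bsub>R\<^esub> ext Q"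
proof -
  from assms obtain X Y where X: "X \<in> cauchy_seqs V" "P = completion_class V X"
    and Y: "Y \<in> cauchy_seqs V" "Q = completion_class V Y"
    by (elim V.carrier_hcompletion_cases)
  note e = add_class[OF X(1) Y(1)] cauchy_add[OF X(1) Y(1)]
  show "P \<oplus>\<^bsub>hcompletion V\<^esub> Q \<in> carrier (hcompletion V)"
    unfolding X(2) Y(2) e(1) by (rule V.completion_class_carrier[OF e(2)])
  show "ext (P \<oplus>\<^bsub>hcompletion V\<^esub> Q) = ext P \<oplus>\<^bsub>R\<^esub> ext Q"
    unfolding X(2) Y(2) e(1) by (rule e(3))
qed

lemma ext_smult:
  assumes "P \<in> carrier (hcompletion V)"
  shows "c \<odot>\<^bsub>hcompletion V\<^esub> P \<in> carrier (hcompletion V)" "ext (c \<odot>\<^bsub>hcompletion V\<^esub> P) = c \<odot>\<^bsub>R\<^esub> ext P"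
proof -
  from assms obtain X where X: "X \<in> cauchy_seqs V" "P = completion_class V X"
    by (elim V.carrier_hcompletion_cases)
  note e = smult_class[OF X(1), of c] cauchy_smult[OF X(1), of c]
  show "c \<odot>\<^bsub>hcompletion V\<^esub> P \<in> carrier (hcompletion V)"
    unfolding X(2) e(1) by (rule V.completion_class_carrier[OF e(2)])
  show "ext (c \<odot>\<^bsub>hcompletion V\<^esub> P) = c \<odot>\<^bsub>R\<^esub> ext P"
    unfolding X(2) e(1) by (rule e(3))
qed

lemma ext_cip:
  assumes "P \<in> carrier (hcompletion V)" "Q \<in> carrier (hcompletion V)"
  shows "cip R (ext P) (ext Q) = cip (hcompletion V) P Q"
proof -
  obtain X where X: "X \<in> cauchy_seqs V" "P = completion_class V X"
    using V.carrier_hcompletion_cases[OF assms(1)] .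
  obtain Y where Y: "Y \<in> cauchy_seqs V" "Q = completion_class V Y"
    using V.carrier_hcompletion_cases[OF assms(2)] .
  have "(\<lambda>n. cip V (X n) (Y n)) \<longlonglongrightarrow> cip R (ext P) (ext Q)"
    using R.hconv_cip[OF ext_class[OF X(1)] ext_class[OF Y(1)]] X Y by (simp add: isometric V.cauchy_seqsD)
  then show ?thesis using V.cip_completion_class[OF X(1) Y(1)] X Y LIMSEQ_unique by auto
qed

text \<open>Closedness under limits is a diagonal choice: each \<open>Z n\<close> is replaced, up to
  an error 1/(n+1), by the image of a single vector of \<open>V\<close>. These images have the same
  limit, so the chosen vectors form a Cauchy sequence that represents it.\<close>

lemma closed_range: "closed_subspace R (ext ` carrier (hcompletion V))"
proof (rule R.closed_subspaceI)
  show "ext ` carrier (hcompletion V) \<subseteq> carrier R" using ext_closed by auto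
  show "\<zero>\<^bsub>R\<^esub> \<in> ext ` carrier (hcompletion V)"
    using ext_const[of "\<zero>\<^bsub>V\<^esub>"] V.completion_class_carrier[OF V.cauchy_seqs_const[of "\<zero>\<^bsub>V\<^esub>"]]
    by (force simp: \<phi>_zero)
next
  fix x y assume "x \<in> ext ` carrier (hcompletion V)" "y \<in> ext ` carrier (hcompletion V)"
  then obtain P Q where "P \<in> carrier (hcompletion V)" "x = ext P" "Q \<in> carrier (hcompletion V)" "y = ext Q"
    by (elim imageE)
  then show "x \<oplus>\<^bsub>R\<^esub> y \<in> ext ` carrier (hcompletion V)"
    using ext_add[of P Q] by (intro image_eqI[of _ _ "P \<oplus>\<^bsub>hcompletion V\<^esub> Q"]) simp_all
next
  fix c x assume "x \<in> ext ` carrier (hcompletion V)"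
  then obtain P where "P \<in> carrier (hcompletion V)" "x = ext P" by (elim imageE)
  then show "c \<odot>\<^bsub>R\<^esub> x \<in> ext ` carrier (hcompletion V)"
    using ext_smult[of P c] by (intro image_eqI[of _ _ "c \<odot>\<^bsub>hcompletion V\<^esub> P"]) simp_all
next
  fix Z z assume Z: "\<And>n. Z n \<in> ext ` carrier (hcompletion V)" and l: "hconv R Z z"
  have "\<exists>x\<in>carrier V. hnorm R (\<phi> x \<ominus>\<^bsub>R\<^esub> Z n) < inverse (real (Suc n))" for n
  proof -
    obtain X where X: "X \<in> cauchy_seqs V" "Z n = ext (completion_class V X)"
      using Z[of n] by (auto elim: V.carrier_hcompletion_cases)
    from LIMSEQ_D[OF R.hconvD(3)[OF ext_class[OF X(1)]], of "inverse (real (Suc n))"]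
    obtain m where "norm (hnorm R (\<phi> (X m) \<ominus>\<^bsub>R\<^esub> ext (completion_class V X)) - 0) < inverse (real (Suc n))"
      by auto
    then show ?thesis using X V.cauchy_seqsD[OF X(1)] by (intro bexI[of _ "X m"]) auto
  qed
  then obtain W where W: "\<And>n. W n \<in> carrier V" "\<And>n. hnorm R (\<phi> (W n) \<ominus>\<^bsub>R\<^esub> Z n) < inverse (real (Suc n))"
    by metis
  have lW: "hconv R (\<lambda>n. \<phi> (W n)) z"
  proof (rule R.hconv_squeeze)
    show "hnorm R (\<phi> (W n) \<ominus>\<^bsub>R\<^esub> z) \<le> inverse (real (Suc n)) + hnorm R (Z n \<ominus>\<^bsub>R\<^esub> z)" for n
      using R.hnorm_triangle[of "\<phi> (W n)" "Z n" z] W[of n] R.hconvD[OF l] by (simp add: \<phi>_closed)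
    show "(\<lambda>n. inverse (real (Suc n)) + hnorm R (Z n \<ominus>\<^bsub>R\<^esub> z)) \<longlonglongrightarrow> 0"
      using tendsto_add[OF LIMSEQ_inverse_real_of_nat R.hconvD(3)[OF l]] by simp
  qed (use W R.hconvD[OF l] in \<open>auto simp: \<phi>_closed\<close>)
  have c: "W \<in> cauchy_seqs V" by (rule hconv_cauchy_seqs[OF W(1) lW])
  then have "z = ext (completion_class V W)" using R.hconv_unique[OF lW ext_class] by simp
  then show "z \<in> ext ` carrier (hcompletion V)" using V.completion_class_carrier[OF c] by blast
qed

text \<open>For surjectivity, the range is a closed subspace and contains the image of
  \<open>V\<close>, which is total in \<open>R\<close>.\<close>

lemma ext_bij: "bij_betw ext (carrier (hcompletion V)) (carrier R)"
  unfolding bij_betw_def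
proof
  show "inj_on ext (carrier (hcompletion V))"
  proof (rule inj_onI)
    fix P Q assume "P \<in> carrier (hcompletion V)" "Q \<in> carrier (hcompletion V)" and e: "ext P = ext Q"
    then obtain X Y where "X \<in> cauchy_seqs V" "P = completion_class V X" "Y \<in> cauchy_seqs V" "Q = completion_class V Y"
      by (elim V.carrier_hcompletion_cases)
    then show "P = Q" using e class_eq_iff[of X Y] by simp
  qed
  have "\<phi> ` carrier V \<subseteq> ext ` carrier (hcompletion V)"
    using ext_const V.completion_class_carrier[OF V.cauchy_seqs_const] by (force simp: image_iff)
  then have "carrier R \<subseteq> ext ` carrier (hcompletion V)"
    unfolding dense[symmetric] by (rule R.closed_span_minimal[OF closed_range])
  then show "ext ` carrier (hcompletion V) = carrier R" using ext_closed by auto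
qed

lemma ext_unitary: "unitary_map (hcompletion V) R ext"
  unfolding unitary_map_def linear_map_def
  using ext_bij ext_closed ext_add ext_smult ext_cip by auto

lemma ext_zero: "\<zero>\<^bsub>hcompletion V\<^esub> \<in> carrier (hcompletion V)" "ext \<zero>\<^bsub>hcompletion V\<^esub> = \<zero>\<^bsub>R\<^esub>"
proof -
  have "\<zero>\<^bsub>hcompletion V\<^esub> = completion_class V (\<lambda>n. \<zero>\<^bsub>V\<^esub>)" by (simp add: hcompletion_def)
  then show "\<zero>\<^bsub>hcompletion V\<^esub> \<in> carrier (hcompletion V)" "ext \<zero>\<^bsub>hcompletion V\<^esub> = \<zero>\<^bsub>R\<^esub>"
    using V.completion_class_carrier[OF V.cauchy_seqs_const] ext_const by (auto simp: \<phi>_zero)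
qed

end

text \<open>Additive inverses come from the scalar -1, since (-1) x + x = 0 x; hence the law for the
  scalar 0 among the hypotheses in place of an inverse.\<close>

lemma module_complex_ringI:
  assumes "\<And>x y. \<lbrakk>x \<in> carrier M; y \<in> carrier M\<rbrakk> \<Longrightarrow> x \<oplus>\<^bsub>M\<^esub> y \<in> carrier M"
    "\<zero>\<^bsub>M\<^esub> \<in> carrier M"
    "\<And>x y z. \<lbrakk>x \<in> carrier M; y \<in> carrier M; z \<in> carrier M\<rbrakk> \<Longrightarrow> (x \<oplus>\<^bsub>M\<^esub> y) \<oplus>\<^bsub>M\<^esub> z = x \<oplus>\<^bsub>M\<^esub> (y \<oplus>\<^bsub>M\<^esub> z)"
    "\<And>x y. \<lbrakk>x \<in> carrier M; y \<in> carrier M\<rbrakk> \<Longrightarrow> x \<oplus>\<^bsub>M\<^esub> y = y \<oplus>\<^bsub>M\<^esub> x"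
    "\<And>x. x \<in> carrier M \<Longrightarrow> \<zero>\<^bsub>M\<^esub> \<oplus>\<^bsub>M\<^esub> x = x"
    "\<And>c x. x \<in> carrier M \<Longrightarrow> c \<odot>\<^bsub>M\<^esub> x \<in> carrier M"
    "\<And>c d x. x \<in> carrier M \<Longrightarrow> (c + d) \<odot>\<^bsub>M\<^esub> x = c \<odot>\<^bsub>M\<^esub> x \<oplus>\<^bsub>M\<^esub> d \<odot>\<^bsub>M\<^esub> x"
    "\<And>c x y. \<lbrakk>x \<in> carrier M; y \<in> carrier M\<rbrakk> \<Longrightarrow> c \<odot>\<^bsub>M\<^esub> (x \<oplus>\<^bsub>M\<^esub> y) = c \<odot>\<^bsub>M\<^esub> x \<oplus>\<^bsub>M\<^esub> c \<odot>\<^bsub>M\<^esub> y"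
    "\<And>c d x. x \<in> carrier M \<Longrightarrow> (c * d) \<odot>\<^bsub>M\<^esub> x = c \<odot>\<^bsub>M\<^esub> (d \<odot>\<^bsub>M\<^esub> x)"
    "\<And>x. x \<in> carrier M \<Longrightarrow> 1 \<odot>\<^bsub>M\<^esub> x = x"
    "\<And>x. x \<in> carrier M \<Longrightarrow> 0 \<odot>\<^bsub>M\<^esub> x = \<zero>\<^bsub>M\<^esub>"
  shows "module complex_ring M"
proof (rule moduleI)
  show "abelian_group M"
  proof (rule abelian_groupI)
    fix x assume x: "x \<in> carrier M"
    have "(-1) \<odot>\<^bsub>M\<^esub> x \<oplus>\<^bsub>M\<^esub> x = \<zero>\<^bsub>M\<^esub>"
      using assms(7)[OF x, of "-1" 1] x by (simp add: assms)
    then show "\<exists>y\<in>carrier M. y \<oplus>\<^bsub>M\<^esub> x = \<zero>\<^bsub>M\<^esub>" using assms(6)[OF x] by blast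
  qed (use assms in auto)
qed (use assms cring_complex_ring in auto)

text \<open>Serves two purposes: \<open>ext\<close> transports the structure of a model to
  \<open>hcompletion\<close>, and evaluation at time 1 transports the structure of a subspace of
  \<open>H 1\<close> to the space of roots.\<close>

lemma (in hilbert_space) hilbert_space_transport:
  assumes bij: "bij_betw T (carrier K) (carrier H)"
    and add: "\<And>x y. \<lbrakk>x \<in> carrier K; y \<in> carrier K\<rbrakk> \<Longrightarrow> x \<oplus>\<^bsub>K\<^esub> y \<in> carrier K"
      "\<And>x y. \<lbrakk>x \<in> carrier K; y \<in> carrier K\<rbrakk> \<Longrightarrow> T (x \<oplus>\<^bsub>K\<^esub> y) = T x \<oplus> T y"
    and smult: "\<And>c x. x \<in> carrier K \<Longrightarrow> c \<odot>\<^bsub>K\<^esub> x \<in> carrier K"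
      "\<And>c x. x \<in> carrier K \<Longrightarrow> T (c \<odot>\<^bsub>K\<^esub> x) = c \<odot> T x"
    and zero: "\<zero>\<^bsub>K\<^esub> \<in> carrier K" "T \<zero>\<^bsub>K\<^esub> = \<zero>"
    and cip: "\<And>x y. \<lbrakk>x \<in> carrier K; y \<in> carrier K\<rbrakk> \<Longrightarrow> cip K x y = cip H (T x) (T y)"
  shows "hilbert_space K"
proof -
  have T: "T x \<in> carrier H" if "x \<in> carrier K" for x using bij that by (auto simp: bij_betw_def)
  have eqI: "x = y" if "T x = T y" "x \<in> carrier K" "y \<in> carrier K" for x y
    using bij that by (auto simp: bij_betw_def inj_on_def)
  have "module complex_ring K"
  proof (rule module_complex_ringI)
    fix c d x assume x: "x \<in> carrier K"
    show "(c + d) \<odot>\<^bsub>K\<^esub> x = c \<odot>\<^bsub>K\<^esub> x \<oplus>\<^bsub>K\<^esub> d \<odot>\<^bsub>K\<^esub> x"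
      by (rule eqI) (use x smult_l_distr[of c d "T x"] in \<open>simp_all add: add smult T\<close>)
    show "(c * d) \<odot>\<^bsub>K\<^esub> x = c \<odot>\<^bsub>K\<^esub> (d \<odot>\<^bsub>K\<^esub> x)"
      by (rule eqI) (use x smult_assoc1[of c d "T x"] in \<open>simp_all add: add smult T\<close>)
    show "1 \<odot>\<^bsub>K\<^esub> x = x" 
      by (rule eqI) (use x smult_one[of "T x"] in \<open>simp_all add: add smult T\<close>)
    show "0 \<odot>\<^bsub>K\<^esub> x = \<zero>\<^bsub>K\<^esub>"
      by (rule eqI) (use x smult_l_null[of "T x"] in \<open>simp_all add: add smult T zero\<close>)
    show "\<zero>\<^bsub>K\<^esub> \<oplus>\<^bsub>K\<^esub> x = x" by (rule eqI) (use x in \<open>simp_all add: add smult T zero\<close>)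
  next
    fix c x y assume x: "x \<in> carrier K" "y \<in> carrier K"
    show "c \<odot>\<^bsub>K\<^esub> (x \<oplus>\<^bsub>K\<^esub> y) = c \<odot>\<^bsub>K\<^esub> x \<oplus>\<^bsub>K\<^esub> c \<odot>\<^bsub>K\<^esub> y"
      by (rule eqI) (use x smult_r_distr[of c "T x" "T y"] in \<open>simp_all add: add smult T\<close>)
    show "x \<oplus>\<^bsub>K\<^esub> y = y \<oplus>\<^bsub>K\<^esub> x"
      by (rule eqI) (use x M.a_comm[of "T x" "T y"] in \<open>simp_all add: add smult T\<close>)
  next
    fix x y z assume x: "x \<in> carrier K" "y \<in> carrier K" "z \<in> carrier K"
    show "(x \<oplus>\<^bsub>K\<^esub> y) \<oplus>\<^bsub>K\<^esub> z = x \<oplus>\<^bsub>K\<^esub> (y \<oplus>\<^bsub>K\<^esub> z)"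
      by (rule eqI) (use x M.a_assoc[of "T x" "T y" "T z"] in \<open>simp_all add: add smult T\<close>)
  qed (use add smult zero in auto)
  note modK = this
  interpret K: pre_hilbert K
  proof (rule pre_hilbert.intro[OF modK pre_hilbert_axioms.intro])
    fix x y assume "x \<in> carrier K" "y \<in> carrier K"
    then show "cip K y x = cnj (cip K x y)"
      using cip[of x y] cip[of y x] cip_commute[OF T T, of x y] by presburger
  qed (simp_all add: cip add smult T cip_add_right cip_smult_right cip_nonneg)
  have dist: "hnorm K (x \<ominus>\<^bsub>K\<^esub> y) = hnorm H (T x \<ominus> T y)" if "x \<in> carrier K" "y \<in> carrier K" for x y
    using that by (simp add: hnorm_def cip K.diff_eq_smult diff_eq_smult add smult T)
  have "Metric_space (carrier K) (hdist K)"
  proof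
    show "0 \<le> hdist K x y" for x y by (auto simp: hdist_def)
    show "hdist K x y = hdist K y x" for x y by (auto simp: hdist_def K.hnorm_minus_commute)
    show "hdist K x y = 0 \<longleftrightarrow> x = y" if "x \<in> carrier K" "y \<in> carrier K" for x y
      using that eqI[of x y] by (auto simp: hdist_def dist hnorm_diff_eq_0 T)
    show "hdist K x z \<le> hdist K x y + hdist K y z" if "x \<in> carrier K" "y \<in> carrier K" "z \<in> carrier K" for x y z
      using that by (simp add: hdist_def K.hnorm_triangle)
  qed
  then interpret MK: Metric_space "carrier K" "hdist K" .
  have "MK.mcomplete" unfolding MK.mcomplete_def
  proof (intro allI impI)
    fix X assume X: "MK.MCauchy X"
    then have c: "X n \<in> carrier K" for n by (auto simp: MK.MCauchy_def)
    have "\<exists>y. hconv H (\<lambda>n. T (X n)) y"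
    proof (rule cauchy_hconv)
      fix e :: real assume "e > 0"
      then obtain N where "\<forall>n n'. N \<le> n \<longrightarrow> N \<le> n' \<longrightarrow> hdist K (X n) (X n') < e"
        using X by (auto simp: MK.MCauchy_def)
      then show "\<exists>N. \<forall>m\<ge>N. \<forall>n\<ge>N. hnorm H (T (X m) \<ominus> T (X n)) < e"
        by (intro exI[of _ N]) (simp add: hdist_def c dist)
    qed (simp add: T c)
    then obtain y where y: "hconv H (\<lambda>n. T (X n)) y" by blast
    then obtain x where x: "x \<in> carrier K" "T x = y"
      using bij hconvD(2)[OF y] unfolding bij_betw_def by (metis imageE)
    have "(\<lambda>n. hdist K (X n) x) \<longlonglongrightarrow> 0"
      using hconvD(3)[OF y] x by (simp add: hdist_def c dist)
    then show "\<exists>x. limitin MK.mtopology X x sequentially"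
      using x c by (auto simp: MK.limitin_metric_dist_null)
  qed
  then show ?thesis
  proof (intro hilbert_space.intro[OF modK] hilbert_space_axioms.intro)
    fix x assume x: "x \<in> carrier K" "cip K x x = 0"
    then have "T x = \<zero>" using cip_definite[OF T] by (simp add: cip)
    then show "x = \<zero>\<^bsub>K\<^esub>" by (intro eqI) (simp_all add: zero x)
  next
    fix x y assume "x \<in> carrier K" "y \<in> carrier K"
    then show "cip K y x = cnj (cip K x y)" by (rule K.cip_commute)
  qed (simp_all add: K.cip_add_right K.cip_smult_right K.cip_nonneg)
qed

lemma (in completion_model) hilbert_space_hcompletion: "hilbert_space (hcompletion V)"
  by (rule R.hilbert_space_transport[OF ext_bij]) (simp_all add: ext_add ext_smult ext_zero ext_cip)

section \<open>Gram matrices and free spaces\<close>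

lemma free_space_simps [simp]:
  "carrier (free_space X k) = {f. finite {x. f x \<noteq> 0} \<and> {x. f x \<noteq> 0} \<subseteq> X}"
  "zero (free_space X k) = (\<lambda>x. 0)" "add (free_space X k) = (\<lambda>f g x. f x + g x)"
  "smult (free_space X k) = (\<lambda>c f x. c * f x)"
  by (simp_all add: free_space_def)

lemma cip_free_space:
  "cip (free_space X k) f g = (\<Sum>x | f x \<noteq> 0. \<Sum>y | g y \<noteq> 0. k x y * cnj (f x) * g y)"
  by (simp add: free_space_def)

lemma cip_free_space_superset:
  assumes "finite A" "{x. f x \<noteq> 0} \<subseteq> A" "{x. g x \<noteq> 0} \<subseteq> A"
  shows "cip (free_space X k) f g = (\<Sum>x\<in>A. \<Sum>y\<in>A. k x y * cnj (f x) * g y)"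
proof -
  have "cip (free_space X k) f g = (\<Sum>x | f x \<noteq> 0. \<Sum>y\<in>A. k x y * cnj (f x) * g y)"
    unfolding cip_free_space
    by (intro sum.cong refl sum.mono_neutral_left) (use assms in auto)
  also have "\<dots> = (\<Sum>x\<in>A. \<Sum>y\<in>A. k x y * cnj (f x) * g y)"
    by (rule sum.mono_neutral_left) (use assms in auto)
  finally show ?thesis .
qed

text \<open>Positivity is demanded only on the subspace \<open>W\<close>. For formal tensors this is
  the whole space, whereas the covariance of units can be negative on a single point mass and is
  nonnegative only on coefficients of total mass zero.\<close>

lemma pre_hilbert_free_subspace:
  assumes W: "W \<subseteq> carrier (free_space X k)" "(\<lambda>x. 0) \<in> W"
      "\<And>f g. \<lbrakk>f \<in> W; g \<in> W\<rbrakk> \<Longrightarrow> (\<lambda>x. f x + g x) \<in> W"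
      "\<And>c f. f \<in> W \<Longrightarrow> (\<lambda>x. c * f x) \<in> W"
    and herm: "\<And>x y. \<lbrakk>x \<in> X; y \<in> X\<rbrakk> \<Longrightarrow> k y x = cnj (k x y)"
    and pos: "\<And>f. f \<in> W \<Longrightarrow> 0 \<le> Re (cip (free_space X k) f f)"
  shows "pre_hilbert ((free_space X k)\<lparr>carrier := W\<rparr>)"
proof (rule pre_hilbert.intro[OF module_complex_ringI pre_hilbert_axioms.intro])
  fix f g h assume "f \<in> carrier ((free_space X k)\<lparr>carrier := W\<rparr>)"
    "g \<in> carrier ((free_space X k)\<lparr>carrier := W\<rparr>)" "h \<in> carrier ((free_space X k)\<lparr>carrier := W\<rparr>)"
  then have fin: "finite {x. f x \<noteq> 0}" "finite {x. g x \<noteq> 0}" "finite {x. h x \<noteq> 0}"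
    using W(1) by auto
  let ?A = "{x. f x \<noteq> 0} \<union> {x. g x \<noteq> 0} \<union> {x. h x \<noteq> 0}"
  have A: "finite ?A" using fin by simp
  have "cip (free_space X k) f (\<lambda>x. g x + h x) = cip (free_space X k) f g + cip (free_space X k) f h"
    by (subst (1 2 3) cip_free_space_superset[OF A]) (auto simp: algebra_simps sum.distrib)
  then show "cip ((free_space X k)\<lparr>carrier := W\<rparr>) f (g \<oplus>\<^bsub>(free_space X k)\<lparr>carrier := W\<rparr>\<^esub> h) =
     cip ((free_space X k)\<lparr>carrier := W\<rparr>) f g + cip ((free_space X k)\<lparr>carrier := W\<rparr>) f h" by simp
next
  fix f g c assume "f \<in> carrier ((free_space X k)\<lparr>carrier := W\<rparr>)" "g \<in> carrier ((free_space X k)\<lparr>carrier := W\<rparr>)"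
  then have fg: "f \<in> W" "g \<in> W" and fin: "finite {x. f x \<noteq> 0}" "finite {x. g x \<noteq> 0}"
    and sub: "{x. f x \<noteq> 0} \<subseteq> X" "{x. g x \<noteq> 0} \<subseteq> X"
    using W(1) by auto
  let ?A = "{x. f x \<noteq> 0} \<union> {x. g x \<noteq> 0}"
  have A: "finite ?A" using fin by simp
  have "cip (free_space X k) f (\<lambda>x. c * g x) = c * cip (free_space X k) f g"
    by (subst (1 2) cip_free_space_superset[OF A]) (auto simp: algebra_simps sum_distrib_left)
  then show "cip ((free_space X k)\<lparr>carrier := W\<rparr>) f (c \<odot>\<^bsub>(free_space X k)\<lparr>carrier := W\<rparr>\<^esub> g) =
     c * cip ((free_space X k)\<lparr>carrier := W\<rparr>) f g" by simp
  have "cip (free_space X k) g f = (\<Sum>x\<in>?A. \<Sum>y\<in>?A. k x y * cnj (g x) * f y)"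
    by (rule cip_free_space_superset[OF A]) auto
  also have "\<dots> = (\<Sum>y\<in>?A. \<Sum>x\<in>?A. k x y * cnj (g x) * f y)" by (rule sum.swap)
  also have "\<dots> = (\<Sum>y\<in>?A. \<Sum>x\<in>?A. cnj (k y x * cnj (f y) * g x))"
    by (intro sum.cong refl) (use herm sub in \<open>auto simp: mult_ac\<close>)
  also have "\<dots> = cnj (cip (free_space X k) f g)"
    by (subst cip_free_space_superset[OF A]) auto
  finally show "cip ((free_space X k)\<lparr>carrier := W\<rparr>) g f = cnj (cip ((free_space X k)\<lparr>carrier := W\<rparr>) f g)"
    by simp
next
  fix f assume "f \<in> carrier ((free_space X k)\<lparr>carrier := W\<rparr>)"
  then show "0 \<le> Re (cip ((free_space X k)\<lparr>carrier := W\<rparr>) f f)" using pos by simp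
qed (simp_all add: W(2-4) algebra_simps)

lemma pre_hilbert_free_space:
  assumes "\<And>x y. \<lbrakk>x \<in> X; y \<in> X\<rbrakk> \<Longrightarrow> k y x = cnj (k x y)"
    and "\<And>f. \<lbrakk>finite {x. f x \<noteq> 0}; {x. f x \<noteq> 0} \<subseteq> X\<rbrakk> \<Longrightarrow> 0 \<le> Re (cip (free_space X k) f f)"
  shows "pre_hilbert (free_space X k)"
proof -
  have add: "finite {x. f x + g x \<noteq> 0} \<and> {x. f x + g x \<noteq> 0} \<subseteq> X"
    if "finite {x. f x \<noteq> 0} \<and> {x. f x \<noteq> 0} \<subseteq> X" "finite {x. g x \<noteq> 0} \<and> {x. g x \<noteq> 0} \<subseteq> X" for f g :: "'a \<Rightarrow> complex"
  proof -
    have "{x. f x + g x \<noteq> 0} \<subseteq> {x. f x \<noteq> 0} \<union> {x. g x \<noteq> 0}" by auto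
    then show ?thesis using that by (meson finite_UnI finite_subset le_supI order_trans)
  qed
  have "pre_hilbert ((free_space X k)\<lparr>carrier := carrier (free_space X k)\<rparr>)"
  proof (rule pre_hilbert_free_subspace)
    fix f g assume "f \<in> carrier (free_space X k)" "g \<in> carrier (free_space X k)"
    then show "(\<lambda>x. f x + g x) \<in> carrier (free_space X k)" using add by simp
  next
    fix c f assume f: "f \<in> carrier (free_space X k)"
    have s: "{x. c * f x \<noteq> 0} \<subseteq> {x. f x \<noteq> 0}" by auto
    have "finite {x. c * f x \<noteq> 0}" by (rule finite_subset[OF s]) (use f in simp)
    then show "(\<lambda>x. c * f x) \<in> carrier (free_space X k)" using f s by auto
  next
    fix f assume "f \<in> carrier (free_space X k)"
    then show "0 \<le> Re (cip (free_space X k) f f)" using assms(2) by simp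
  next
    fix x y assume "x \<in> X" "y \<in> X"
    then show "k y x = cnj (k x y)" by (rule assms(1))
  qed simp_all
  then show ?thesis by (simp add: free_space_def)
qed

context pre_hilbert
begin

lemma finsum_closed': "z \<in> I \<rightarrow> carrier H \<Longrightarrow> finsum H z I \<in> carrier H"
  by (rule M.finsum_closed)

lemma cip_finsum_right:
  assumes "finite I" "z \<in> I \<rightarrow> carrier H" "w \<in> carrier H"
  shows "cip H w (finsum H z I) = (\<Sum>i\<in>I. cip H w (z i))"
  using assms
proof (induction I rule: finite_induct)
  case (insert i I)
  then have z: "z i \<in> carrier H" "z \<in> I \<rightarrow> carrier H" by auto
  have "finsum H z (insert i I) = z i \<oplus> finsum H z I"
    by (rule M.finsum_insert[OF insert(1,2) z(2,1)])
  then show ?case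
    using insert.IH[OF z(2) insert.prems(2)] insert.hyps cip_add_right[OF insert.prems(2) z(1) finsum_closed'[OF z(2)]]
    by simp
qed simp

lemma cip_finsum_finsum:
  assumes "finite I" "z \<in> I \<rightarrow> carrier H"
  shows "cip H (finsum H z I) (finsum H z I) = (\<Sum>i\<in>I. \<Sum>j\<in>I. cip H (z i) (z j))"
proof -
  note c = finsum_closed'[OF assms(2)]
  have z: "z i \<in> carrier H" if "i \<in> I" for i using assms(2) that by auto
  have "cip H (finsum H z I) (finsum H z I) = (\<Sum>i\<in>I. cip H (finsum H z I) (z i))"
    by (rule cip_finsum_right[OF assms c])
  also have "\<dots> = (\<Sum>i\<in>I. cnj (\<Sum>j\<in>I. cip H (z i) (z j)))"
    using cip_commute[OF z c] cip_finsum_right[OF assms z] by (intro sum.cong refl) simp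
  also have "\<dots> = (\<Sum>i\<in>I. \<Sum>j\<in>I. cip H (z j) (z i))"
    unfolding cnj_sum by (intro sum.cong refl cip_commute[symmetric] z)
  also have "\<dots> = (\<Sum>i\<in>I. \<Sum>j\<in>I. cip H (z i) (z j))" by (rule sum.swap)
  finally show ?thesis .
qed

end

text \<open>The Schur product of two Gram matrices is positive: subtract from the second one a
  rank-one Gram matrix that annihilates one of its vectors.\<close>

lemma schur_product_nonneg:
  assumes H: "pre_hilbert H" and K: "hilbert_space K"
    and fin: "finite I" and x: "x \<in> I \<rightarrow> carrier H" and y: "y \<in> I \<rightarrow> carrier K"
  shows "0 \<le> Re (\<Sum>i\<in>I. \<Sum>j\<in>I. cip H (x i) (x j) * cip K (y i) (y j))"
  using y
\<comment> \<open>The induction counts the nonzero vectors among the \<open>y i\<close>. Removing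
  the components along e makes \<open>y l\<close> vanish and keeps zero vectors zero.\<close>
proof (induction "card {i \<in> I. y i \<noteq> \<zero>\<^bsub>K\<^esub>}" arbitrary: y rule: less_induct)
  case less
  interpret H: pre_hilbert H by (rule H)
  interpret K: hilbert_space K by (rule K)
  have yc: "y i \<in> carrier K" and xc: "x i \<in> carrier H" if "i \<in> I" for i using less.prems x that by auto
  show ?case
  proof (cases "{i \<in> I. y i \<noteq> \<zero>\<^bsub>K\<^esub>} = {}")
    case True
    then have "cip K (y i) (y j) = 0" if "i \<in> I" "j \<in> I" for i j
      using that yc[of i] K.cip_zero_right by auto
    then show ?thesis by simp
  next
    case False
    then obtain l where l: "l \<in> I" "y l \<noteq> \<zero>\<^bsub>K\<^esub>" by auto
    then have n: "hnorm K (y l) \<noteq> 0" using K.hnorm_eq_0 yc by simp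
    define e where "e = of_real (1 / hnorm K (y l)) \<odot>\<^bsub>K\<^esub> y l"
    have ec: "e \<in> carrier K" unfolding e_def using l yc by simp
    have "hnorm K e = 1"
      unfolding e_def using K.hnorm_smult[OF yc[OF l(1)]] K.hnorm_ge_0[OF yc[OF l(1)]] n
      by (simp add: norm_divide)
    then have ee: "cip K e e = 1" by (simp add: K.cip_self[OF ec])
    define c where "c i = cip K e (y i)" for i
    define y' where "y' i = y i \<ominus>\<^bsub>K\<^esub> c i \<odot>\<^bsub>K\<^esub> e" for i
    have y'c: "y' \<in> I \<rightarrow> carrier K" using yc ec by (auto simp: y'_def)
    have ye: "cip K (y i) e = cnj (c i)" if "i \<in> I" for i
      unfolding c_def by (rule K.cip_commute[OF ec yc[OF that]])
    have split: "cip K (y i) (y j) = cnj (c i) * c j + cip K (y' i) (y' j)" if "i \<in> I" "j \<in> I" for i j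
      using that ec yc ee ye unfolding y'_def
      by (simp add: K.cip_diff_right K.cip_diff_left K.cip_smult_left K.cip_smult_right flip: c_def)
    have zero: "y' i = \<zero>\<^bsub>K\<^esub>" if "i \<in> I" "y i = \<zero>\<^bsub>K\<^esub>" for i
      using that ec K.smult_l_null[OF ec] by (simp add: y'_def c_def)
    have "cip K (y' l) (y' l) = 0"
      using split[OF l(1) l(1)] ye[OF l(1)] l(1) yc[OF l(1)] n
      by (simp add: c_def e_def K.cip_smult_left K.cip_smult_right K.cip_self[OF yc[OF l(1)]] power2_eq_square)
    then have "y' l = \<zero>\<^bsub>K\<^esub>" using K.cip_definite y'c l(1) by auto
    then have "{i \<in> I. y' i \<noteq> \<zero>\<^bsub>K\<^esub>} \<subset> {i \<in> I. y i \<noteq> \<zero>\<^bsub>K\<^esub>}" using zero l by auto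
    then have "card {i \<in> I. y' i \<noteq> \<zero>\<^bsub>K\<^esub>} < card {i \<in> I. y i \<noteq> \<zero>\<^bsub>K\<^esub>}"
      using fin by (intro psubset_card_mono) auto
    from less.hyps[OF this y'c]
    have 1: "0 \<le> Re (\<Sum>i\<in>I. \<Sum>j\<in>I. cip H (x i) (x j) * cip K (y' i) (y' j))" .
    have z: "(\<lambda>i. c i \<odot>\<^bsub>H\<^esub> x i) \<in> I \<rightarrow> carrier H" using xc by auto
    \<comment> \<open>The rank-one part contributes the squared norm of the sum of the vectors x_i
      multiplied by \<open>c i\<close>.\<close>
    have "(\<Sum>i\<in>I. \<Sum>j\<in>I. cip H (x i) (x j) * (cnj (c i) * c j)) =
        (\<Sum>i\<in>I. \<Sum>j\<in>I. cip H (c i \<odot>\<^bsub>H\<^esub> x i) (c j \<odot>\<^bsub>H\<^esub> x j))"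
      by (intro sum.cong refl) (simp add: H.cip_smult_left H.cip_smult_right xc mult_ac)
    then have 2: "0 \<le> Re (\<Sum>i\<in>I. \<Sum>j\<in>I. cip H (x i) (x j) * (cnj (c i) * c j))"
      using H.cip_finsum_finsum[OF fin z] H.cip_nonneg[OF H.finsum_closed'[OF z]] by simp
    have "(\<Sum>i\<in>I. \<Sum>j\<in>I. cip H (x i) (x j) * cip K (y i) (y j)) =
      (\<Sum>i\<in>I. \<Sum>j\<in>I. cip H (x i) (x j) * (cnj (c i) * c j)) +
      (\<Sum>i\<in>I. \<Sum>j\<in>I. cip H (x i) (x j) * cip K (y' i) (y' j))"
      unfolding sum.distrib[symmetric] by (intro sum.cong refl) (simp add: split distrib_left)
    then show ?thesis using 1 2 by simp
  qed
qed

text \<open>Absorbing the coefficient f(p) into the first component of each pair p turns the form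
  into the sum of the entries of a Schur product of two Gram matrices.\<close>

lemma pre_hilbert_free_tensor:
  assumes "hilbert_space H" "hilbert_space K"
  shows "pre_hilbert (free_tensor H K)"
  unfolding free_tensor_def
proof (rule pre_hilbert_free_space)
  interpret H: hilbert_space H by fact
  interpret K: hilbert_space K by fact
  fix p q assume "p \<in> carrier H \<times> carrier K" "q \<in> carrier H \<times> carrier K"
  then show "(case q of (x, y) \<Rightarrow> \<lambda>(x', y'). cip H x x' * cip K y y') p =
    cnj ((case p of (x, y) \<Rightarrow> \<lambda>(x', y'). cip H x x' * cip K y y') q)"
    using H.cip_commute[of "fst p" "fst q"] K.cip_commute[of "snd p" "snd q"] by auto
next
  interpret H: hilbert_space H by fact
  interpret K: hilbert_space K by fact
  fix f :: "'a \<times> 'b \<Rightarrow> complex"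
  assume fin: "finite {p. f p \<noteq> 0}" and sub: "{p. f p \<noteq> 0} \<subseteq> carrier H \<times> carrier K"
  have "0 \<le> Re (\<Sum>p | f p \<noteq> 0. \<Sum>q | f q \<noteq> 0. cip H (f p \<odot>\<^bsub>H\<^esub> fst p) (f q \<odot>\<^bsub>H\<^esub> fst q) * cip K (snd p) (snd q))"
    by (rule schur_product_nonneg[OF H.pre_hilbert assms(2) fin]) (use sub in auto)
  also have "(\<Sum>p | f p \<noteq> 0. \<Sum>q | f q \<noteq> 0. cip H (f p \<odot>\<^bsub>H\<^esub> fst p) (f q \<odot>\<^bsub>H\<^esub> fst q) * cip K (snd p) (snd q)) =
    cip (free_space (carrier H \<times> carrier K) (\<lambda>(x, y) (x', y'). cip H x x' * cip K y y')) f f"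
    unfolding cip_free_space
  proof (intro sum.cong refl)
    fix p q assume "p \<in> {p. f p \<noteq> 0}" "q \<in> {p. f p \<noteq> 0}"
    then have "p \<in> carrier H \<times> carrier K" "q \<in> carrier H \<times> carrier K" using sub by auto
    then show "cip H (f p \<odot>\<^bsub>H\<^esub> fst p) (f q \<odot>\<^bsub>H\<^esub> fst q) * cip K (snd p) (snd q) =
      (case p of (x, y) \<Rightarrow> \<lambda>(x', y'). cip H x x' * cip K y y') q * cnj (f p) * f q"
      by (auto simp: H.cip_smult_left H.cip_smult_right)
  qed
  finally show "0 \<le> Re (cip (free_space (carrier H \<times> carrier K) (\<lambda>(x, y) (x', y'). cip H x x' * cip K y y')) f f)" .
qed

text \<open>A total family of vectors with prescribed Gram matrix \<open>k\<close>. It makes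
  \<open>R\<close> a model of the completion of \<open>free_space X k\<close>. This is used for
  tensor products, for comparing two families with equal Gram matrices, and for the roots attached
  to units.\<close>

locale free_model = R: hilbert_space R for R :: "'b hspace" +
  fixes X :: "'i set" and k :: "'i \<Rightarrow> 'i \<Rightarrow> complex" and \<psi> :: "'i \<Rightarrow> 'b"
  assumes \<psi>_closed: "x \<in> X \<Longrightarrow> \<psi> x \<in> carrier R"
    and gram: "\<lbrakk>x \<in> X; y \<in> X\<rbrakk> \<Longrightarrow> cip R (\<psi> x) (\<psi> y) = k x y"
    and total: "closed_span R (\<psi> ` X) = carrier R"
begin

lemma lincomb_carrier:
  "f \<in> carrier (free_space X k) \<Longrightarrow> lincomb R \<psi> f \<in> carrier R"
  using \<psi>_closed by (intro R.lincomb_closed) auto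

lemma cip_lincomb:
  assumes "f \<in> carrier (free_space X k)" "g \<in> carrier (free_space X k)"
  shows "cip R (lincomb R \<psi> f) (lincomb R \<psi> g) = cip (free_space X k) f g"
proof -
  have "cip R (lincomb R \<psi> f) (lincomb R \<psi> g) =
     (\<Sum>i | f i \<noteq> 0. \<Sum>j | g j \<noteq> 0. cip R (\<psi> i) (\<psi> j) * cnj (f i) * g j)"
    by (rule R.cip_lincomb_lincomb) (use assms \<psi>_closed in auto)
  also have "\<dots> = cip (free_space X k) f g"
    unfolding cip_free_space by (intro sum.cong refl) (use assms gram in \<open>simp add: subset_iff\<close>)
  finally show ?thesis .
qed

lemma lincomb_point: "x \<in> X \<Longrightarrow> lincomb R \<psi> (\<lambda>p. if p = x then 1 else 0) = \<psi> x"
proof (rule R.hilbert_eqI)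
  assume x: "x \<in> X"
  show "lincomb R \<psi> (\<lambda>p. if p = x then 1 else 0) \<in> carrier R"
    by (rule lincomb_carrier) (use x in auto)
  show "\<psi> x \<in> carrier R" using x \<psi>_closed by simp
  show "cip R z (lincomb R \<psi> (\<lambda>p. if p = x then 1 else 0)) = cip R z (\<psi> x)" if "z \<in> carrier R" for z
    by (subst R.cip_lincomb_right_superset[of "{x}"]) (use x \<psi>_closed that in \<open>auto split: if_splits\<close>)
qed

lemma pre_hilbert_free: "pre_hilbert (free_space X k)"
proof (rule pre_hilbert_free_space)
  fix x y assume "x \<in> X" "y \<in> X"
  then show "k y x = cnj (k x y)" using R.cip_commute[of "\<psi> x" "\<psi> y"] gram \<psi>_closed by metis
next
  fix f :: "'i \<Rightarrow> complex" assume "finite {x. f x \<noteq> 0}" "{x. f x \<noteq> 0} \<subseteq> X"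
  then have f: "f \<in> carrier (free_space X k)" by simp
  show "0 \<le> Re (cip (free_space X k) f f)"
    unfolding cip_lincomb[OF f f, symmetric] by (rule R.cip_nonneg[OF lincomb_carrier[OF f]])
qed

lemma linear_lincomb: "linear_map (free_space X k) R (lincomb R \<psi>)"
  unfolding linear_map_def
proof (intro conjI ballI allI)
  show "lincomb R \<psi> \<in> carrier (free_space X k) \<rightarrow> carrier R" using lincomb_carrier by blast
next
  interpret V: pre_hilbert "free_space X k" by (rule pre_hilbert_free)
  fix f g assume fg: "f \<in> carrier (free_space X k)" "g \<in> carrier (free_space X k)"
  let ?A = "{x. f x \<noteq> 0} \<union> {x. g x \<noteq> 0}"
  note fg' = V.M.a_closed[OF fg]
  show "lincomb R \<psi> (f \<oplus>\<^bsub>free_space X k\<^esub> g) = lincomb R \<psi> f \<oplus>\<^bsub>R\<^esub> lincomb R \<psi> g"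
  proof (rule R.hilbert_eqI)
    show "lincomb R \<psi> (f \<oplus>\<^bsub>free_space X k\<^esub> g) \<in> carrier R" by (rule lincomb_carrier[OF fg'])
    show "lincomb R \<psi> f \<oplus>\<^bsub>R\<^esub> lincomb R \<psi> g \<in> carrier R" using lincomb_carrier fg by blast
    fix z assume z: "z \<in> carrier R"
    have *: "cip R z (lincomb R \<psi> h) = (\<Sum>i\<in>?A. h i * cip R z (\<psi> i))"
      if "h \<in> carrier (free_space X k)" "{x. h x \<noteq> 0} \<subseteq> ?A" for h
      by (rule R.cip_lincomb_right_superset) (use that fg \<psi>_closed z in auto)
    have "{x. (f \<oplus>\<^bsub>free_space X k\<^esub> g) x \<noteq> 0} \<subseteq> ?A" by auto
    then show "cip R z (lincomb R \<psi> (f \<oplus>\<^bsub>free_space X k\<^esub> g)) = cip R z (lincomb R \<psi> f \<oplus>\<^bsub>R\<^esub> lincomb R \<psi> g)"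
      using *[OF fg'] *[OF fg(1)] *[OF fg(2)] lincomb_carrier[OF fg(1)] lincomb_carrier[OF fg(2)] z
      by (simp add: R.cip_add_right distrib_right sum.distrib)
  qed
next
  interpret V: pre_hilbert "free_space X k" by (rule pre_hilbert_free)
  fix c f assume f: "f \<in> carrier (free_space X k)"
  note fg' = V.smult_carrier[OF f, of c]
  show "lincomb R \<psi> (c \<odot>\<^bsub>free_space X k\<^esub> f) = c \<odot>\<^bsub>R\<^esub> lincomb R \<psi> f"
  proof (rule R.hilbert_eqI)
    show "lincomb R \<psi> (c \<odot>\<^bsub>free_space X k\<^esub> f) \<in> carrier R" by (rule lincomb_carrier[OF fg'])
    show "c \<odot>\<^bsub>R\<^esub> lincomb R \<psi> f \<in> carrier R" using lincomb_carrier f by blast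
    fix z assume z: "z \<in> carrier R"
    have *: "cip R z (lincomb R \<psi> h) = (\<Sum>i | f i \<noteq> 0. h i * cip R z (\<psi> i))"
      if "h \<in> carrier (free_space X k)" "{x. h x \<noteq> 0} \<subseteq> {i. f i \<noteq> 0}" for h
      by (rule R.cip_lincomb_right_superset) (use that f \<psi>_closed z in auto)
    have "{x. (c \<odot>\<^bsub>free_space X k\<^esub> f) x \<noteq> 0} \<subseteq> {i. f i \<noteq> 0}" by auto
    then show "cip R z (lincomb R \<psi> (c \<odot>\<^bsub>free_space X k\<^esub> f)) = cip R z (c \<odot>\<^bsub>R\<^esub> lincomb R \<psi> f)"
      using *[OF fg'] *[OF f] lincomb_carrier[OF f] z
      by (simp add: R.cip_smult_right sum_distrib_left mult_ac)
  qed
qed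

lemma dense_lincomb: "closed_span R (lincomb R \<psi> ` carrier (free_space X k)) = carrier R"
proof
  have sub: "lincomb R \<psi> ` carrier (free_space X k) \<subseteq> carrier R" using lincomb_carrier by blast
  note cs = R.closed_span_closed_subspace[OF sub]
  show "closed_span R (lincomb R \<psi> ` carrier (free_space X k)) \<subseteq> carrier R"
    by (rule R.closed_subspaceD(1)[OF cs])
  have "\<psi> ` X \<subseteq> lincomb R \<psi> ` carrier (free_space X k)"
  proof
    fix r assume "r \<in> \<psi> ` X"
    then obtain x where x: "x \<in> X" "r = \<psi> x" by blast
    show "r \<in> lincomb R \<psi> ` carrier (free_space X k)"
      by (rule image_eqI[of _ _ "\<lambda>p. if p = x then 1 else 0"]) (use x lincomb_point in auto)
  qed
  then have "\<psi> ` X \<subseteq> closed_span R (lincomb R \<psi> ` carrier (free_space X k))"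
    using R.closed_span_superset by (rule order_trans)
  from R.closed_span_minimal[OF cs this]
  show "carrier R \<subseteq> closed_span R (lincomb R \<psi> ` carrier (free_space X k))" by (simp add: total)
qed

sublocale completion_model "free_space X k" R "lincomb R \<psi>"
  by (intro completion_model.intro completion_model_axioms.intro pre_hilbert_free R.hilbert_space_axioms
      linear_lincomb dense_lincomb cip_lincomb)

lemma point_class_carrier:
  "x \<in> X \<Longrightarrow> completion_class (free_space X k) (\<lambda>n p. if p = x then 1 else 0) \<in> carrier (hcompletion (free_space X k))"
  by (intro V.completion_class_carrier V.cauchy_seqs_const) auto

lemma ext_point:
  "x \<in> X \<Longrightarrow> ext (completion_class (free_space X k) (\<lambda>n p. if p = x then 1 else 0)) = \<psi> x"
  by (subst ext_const) (auto simp: lincomb_point)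

end

section \<open>Bounded and unitary maps\<close>

lemma unitary_mapD:
  assumes "unitary_map H K T"
  shows "x \<in> carrier H \<Longrightarrow> T x \<in> carrier K"
    "\<lbrakk>x \<in> carrier H; y \<in> carrier H\<rbrakk> \<Longrightarrow> T (x \<oplus>\<^bsub>H\<^esub> y) = T x \<oplus>\<^bsub>K\<^esub> T y"
    "x \<in> carrier H \<Longrightarrow> T (c \<odot>\<^bsub>H\<^esub> x) = c \<odot>\<^bsub>K\<^esub> T x"
    "\<lbrakk>x \<in> carrier H; y \<in> carrier H\<rbrakk> \<Longrightarrow> cip K (T x) (T y) = cip H x y"
    "bij_betw T (carrier H) (carrier K)"
    "x \<in> carrier H \<Longrightarrow> hnorm K (T x) = hnorm H x"
  using assms by (auto simp: unitary_map_def linear_map_def hnorm_def)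

lemma unitary_map_inv_into:
  assumes "unitary_map H K T"
  shows "y \<in> carrier K \<Longrightarrow> inv_into (carrier H) T y \<in> carrier H"
    "y \<in> carrier K \<Longrightarrow> T (inv_into (carrier H) T y) = y"
    "x \<in> carrier H \<Longrightarrow> inv_into (carrier H) T (T x) = x"
  using unitary_mapD(5)[OF assms]
  by (simp_all add: bij_betw_def inv_into_into f_inv_into_f)

lemma unitary_map_inv:
  assumes "hilbert_space H" "unitary_map H K T"
  shows "unitary_map K H (inv_into (carrier H) T)"
proof -
  interpret H: hilbert_space H by fact
  note T = unitary_mapD[OF assms(2)] and i = unitary_map_inv_into[OF assms(2)]
  show ?thesis unfolding unitary_map_def linear_map_def
  proof (intro conjI ballI allI)
    show "bij_betw (inv_into (carrier H) T) (carrier K) (carrier H)" by (rule bij_betw_inv_into[OF T(5)])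
  next
    fix x y assume xy: "x \<in> carrier K" "y \<in> carrier K"
    have "inv_into (carrier H) T (T (inv_into (carrier H) T x \<oplus>\<^bsub>H\<^esub> inv_into (carrier H) T y)) =
        inv_into (carrier H) T x \<oplus>\<^bsub>H\<^esub> inv_into (carrier H) T y"
      using i(3) i(1) xy by simp
    then show "inv_into (carrier H) T (x \<oplus>\<^bsub>K\<^esub> y) = inv_into (carrier H) T x \<oplus>\<^bsub>H\<^esub> inv_into (carrier H) T y"
      using xy by (simp add: T(2) i)
    show "cip H (inv_into (carrier H) T x) (inv_into (carrier H) T y) = cip K x y"
      using xy T(4)[of "inv_into (carrier H) T x" "inv_into (carrier H) T y"] by (simp add: i)
  next
    fix c x assume x: "x \<in> carrier K"
    have "inv_into (carrier H) T (T (c \<odot>\<^bsub>H\<^esub> inv_into (carrier H) T x)) = c \<odot>\<^bsub>H\<^esub> inv_into (carrier H) T x"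
      using i(3) i(1) x by simp
    then show "inv_into (carrier H) T (c \<odot>\<^bsub>K\<^esub> x) = c \<odot>\<^bsub>H\<^esub> inv_into (carrier H) T x"
      using x by (simp add: T(3) i)
  qed (use i in auto)
qed

lemma unitary_map_comp:
  assumes "unitary_map H K T" "unitary_map K L S" shows "unitary_map H L (\<lambda>x. S (T x))"
  using bij_betw_trans[OF unitary_mapD(5)[OF assms(1)] unitary_mapD(5)[OF assms(2)]]
  by (simp add: unitary_map_def linear_map_def comp_def unitary_mapD(1-4)[OF assms(1)]
      unitary_mapD(1-4)[OF assms(2)])

lemma unitary_map_bounded: "unitary_map H K T \<Longrightarrow> bounded_map H K T"
  using unitary_mapD(6)[of H K T] unfolding bounded_map_def unitary_map_def
  by (metis mult_1 order_refl)

lemma bounded_map_comp: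
  assumes "hilbert_space K" "bounded_map H K T" "bounded_map K L S" shows "bounded_map H L (\<lambda>x. S (T x))"
proof -
  interpret K: hilbert_space K by fact
  obtain C D where C: "\<forall>x\<in>carrier H. hnorm K (T x) \<le> C * hnorm H x"
    and D: "\<forall>x\<in>carrier K. hnorm L (S x) \<le> D * hnorm K x"
    using assms by (auto simp: bounded_map_def)
  have "hnorm L (S (T x)) \<le> (\<bar>D\<bar> * C) * hnorm H x" if x: "x \<in> carrier H" for x
  proof -
    have Tx: "T x \<in> carrier K" using assms(2) x by (auto simp: bounded_map_def linear_map_def)
    have "hnorm L (S (T x)) \<le> D * hnorm K (T x)" using D Tx by blast
    also have "\<dots> \<le> \<bar>D\<bar> * hnorm K (T x)" using Tx by (intro mult_right_mono) auto
    also have "\<dots> \<le> \<bar>D\<bar> * (C * hnorm H x)" using C x by (intro mult_left_mono) auto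
    finally show ?thesis by (simp add: mult_ac)
  qed
  moreover have "linear_map H L (\<lambda>x. S (T x))"
    using assms(2,3) by (auto simp: bounded_map_def linear_map_def Pi_iff)
  ultimately show ?thesis unfolding bounded_map_def by blast
qed

lemma bounded_map_cong:
  assumes "bounded_map H K T" "hilbert_space H" "\<And>x. x \<in> carrier H \<Longrightarrow> T x = S x"
  shows "bounded_map H K S"
proof -
  interpret H: hilbert_space H by fact
  show ?thesis using assms(1) unfolding bounded_map_def linear_map_def
    by (auto simp: assms(3)[symmetric] Pi_iff)
qed

lemma bounded_map_hconv:
  assumes "hilbert_space H" "hilbert_space K" "bounded_map H K T" "hconv H X x"
  shows "hconv K (\<lambda>n. T (X n)) (T x)"
proof -
  interpret H: hilbert_space H by fact
  interpret K: hilbert_space K by fact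
  from assms(3) obtain C where C: "\<forall>x\<in>carrier H. hnorm K (T x) \<le> C * hnorm H x" by (auto simp: bounded_map_def)
  have T: "T x \<in> carrier K" "T (c \<odot>\<^bsub>H\<^esub> x) = c \<odot>\<^bsub>K\<^esub> T x" if "x \<in> carrier H" for x c
    using assms(3) that by (auto simp: bounded_map_def linear_map_def)
  have Ta: "T (x \<oplus>\<^bsub>H\<^esub> y) = T x \<oplus>\<^bsub>K\<^esub> T y" if "x \<in> carrier H" "y \<in> carrier H" for x y
    using assms(3) that by (auto simp: bounded_map_def linear_map_def)
  note c = H.hconvD[OF assms(4)]
  have "hnorm K (T (X n) \<ominus>\<^bsub>K\<^esub> T x) \<le> C * hnorm H (X n \<ominus>\<^bsub>H\<^esub> x)" for n
  proof -
    have "T (X n) \<ominus>\<^bsub>K\<^esub> T x = T (X n \<ominus>\<^bsub>H\<^esub> x)"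
      using c by (simp add: H.diff_eq_smult K.diff_eq_smult T Ta)
    then show ?thesis using C c by simp
  qed
  moreover have "(\<lambda>n. C * hnorm H (X n \<ominus>\<^bsub>H\<^esub> x)) \<longlonglongrightarrow> 0"
    using tendsto_mult_left[OF c(3), of C] by simp
  ultimately show ?thesis using T c by (intro K.hconv_squeeze) auto
qed

text \<open>The vectors on which the two maps agree form a closed subspace. This supplies uniqueness
  in the descriptions of \<open>tensor_map\<close> and \<open>tensor_assoc\<close>.\<close>

lemma bounded_map_eq_on_total:
  assumes "hilbert_space H" "hilbert_space K" "bounded_map H K T" "bounded_map H K S"
    and "closed_span H A = carrier H" "A \<subseteq> carrier H" "\<And>a. a \<in> A \<Longrightarrow> T a = S a" "x \<in> carrier H"
  shows "T x = S x"
proof -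
  interpret H: hilbert_space H by fact
  interpret K: hilbert_space K by fact
  have lin: "T x \<in> carrier K" "T (c \<odot>\<^bsub>H\<^esub> x) = c \<odot>\<^bsub>K\<^esub> T x" "S x \<in> carrier K" "S (c \<odot>\<^bsub>H\<^esub> x) = c \<odot>\<^bsub>K\<^esub> S x"
    if "x \<in> carrier H" for x c
    using assms(3,4) that by (auto simp: bounded_map_def linear_map_def)
  have add: "T (x \<oplus>\<^bsub>H\<^esub> y) = T x \<oplus>\<^bsub>K\<^esub> T y" "S (x \<oplus>\<^bsub>H\<^esub> y) = S x \<oplus>\<^bsub>K\<^esub> S y"
    if "x \<in> carrier H" "y \<in> carrier H" for x y
    using assms(3,4) that by (auto simp: bounded_map_def linear_map_def)
  have "closed_subspace H {x \<in> carrier H. T x = S x}"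
  proof (rule H.closed_subspaceI)
    have "T \<zero>\<^bsub>H\<^esub> = \<zero>\<^bsub>K\<^esub>" "S \<zero>\<^bsub>H\<^esub> = \<zero>\<^bsub>K\<^esub>"
      using lin(1,3)[of "\<zero>\<^bsub>H\<^esub>"] lin(2,4)[of "\<zero>\<^bsub>H\<^esub>" 0] H.smult_l_null[of "\<zero>\<^bsub>H\<^esub>"] K.smult_l_null[of "T \<zero>\<^bsub>H\<^esub>"] K.smult_l_null[of "S \<zero>\<^bsub>H\<^esub>"]
      by simp_all
    then show "\<zero>\<^bsub>H\<^esub> \<in> {x \<in> carrier H. T x = S x}" by simp
  next
    fix X x assume X: "\<And>n. X n \<in> {x \<in> carrier H. T x = S x}" and l: "hconv H X x"
    have "hconv K (\<lambda>n. T (X n)) (T x)" "hconv K (\<lambda>n. T (X n)) (S x)"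
      using bounded_map_hconv[OF assms(1-3) l] bounded_map_hconv[OF assms(1,2,4) l] X by simp_all
    then show "x \<in> {x \<in> carrier H. T x = S x}" using K.hconv_unique H.hconvD(2)[OF l] by blast
  qed (auto simp: lin add)
  moreover have "A \<subseteq> {x \<in> carrier H. T x = S x}" using assms(6,7) by blast
  ultimately have "closed_span H A \<subseteq> {x \<in> carrier H. T x = S x}" by (rule H.closed_span_minimal)
  then show ?thesis using assms(5,8) by auto
qed

text \<open>Settles the adjoint inside \<open>sys_prod\<close>: the product of two vectors is the
  preimage of their elementary tensor under the structure map.\<close>

lemma hadjoint_unitary:
  assumes "hilbert_space H" "unitary_map H K T" "y \<in> carrier K"
  shows "hadjoint H K T y = inv_into (carrier H) T y"
  unfolding hadjoint_def
proof (rule the_equality)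
  interpret H: hilbert_space H by fact
  note T = unitary_mapD[OF assms(2)] and i = unitary_map_inv_into[OF assms(2)]
  have *: "cip H z (inv_into (carrier H) T y) = cip K (T z) y" if "z \<in> carrier H" for z
    using T(4)[OF that i(1)[OF assms(3)]] i(2)[OF assms(3)] by simp
  then show "inv_into (carrier H) T y \<in> carrier H \<and> (\<forall>z\<in>carrier H. cip H z (inv_into (carrier H) T y) = cip K (T z) y)"
    using i(1)[OF assms(3)] by blast
  show "w = inv_into (carrier H) T y" if "w \<in> carrier H \<and> (\<forall>z\<in>carrier H. cip H z w = cip K (T z) y)" for w
    by (rule H.hilbert_eqI) (use that * i(1)[OF assms(3)] in auto)
qed

lemma unitary_image_closed_span:
  assumes "hilbert_space H" "hilbert_space K" "unitary_map H K T" "S \<subseteq> carrier H"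
  shows "T ` closed_span H S = closed_span K (T ` S)"
proof -
  \<comment> \<open>Stated for arbitrary spaces, so that it also applies to the inverse of
    \<open>T\<close> with the two spaces exchanged; this gives the reverse inclusion.\<close>
  have *: "T ` closed_span H S \<subseteq> closed_span K (T ` S)"
    if hyps: "hilbert_space H" "hilbert_space K" "unitary_map H K T" "S \<subseteq> carrier H"
    for H :: "'x hspace" and K :: "'y hspace" and T S
  proof -
    interpret H: hilbert_space H by fact
    interpret K: hilbert_space K by fact
    note T = unitary_mapD[OF hyps(3)]
    have TS: "T ` S \<subseteq> carrier K" using T(1) hyps(4) by auto
    note cs = K.closed_subspaceD[OF K.closed_span_closed_subspace[OF TS]]
    have T0: "T \<zero>\<^bsub>H\<^esub> = \<zero>\<^bsub>K\<^esub>"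
      using T(1)[of "\<zero>\<^bsub>H\<^esub>"] T(3)[of "\<zero>\<^bsub>H\<^esub>" 0] H.smult_l_null[of "\<zero>\<^bsub>H\<^esub>"] K.smult_l_null[of "T \<zero>\<^bsub>H\<^esub>"] by simp
    have "closed_subspace H {x \<in> carrier H. T x \<in> closed_span K (T ` S)}"
    proof (rule H.closed_subspaceI)
      fix X x assume X: "\<And>n. X n \<in> {x \<in> carrier H. T x \<in> closed_span K (T ` S)}" and l: "hconv H X x"
      have "hconv K (\<lambda>n. T (X n)) (T x)"
        by (rule bounded_map_hconv[OF hyps(1,2) unitary_map_bounded[OF hyps(3)] l])
      then have "T x \<in> closed_span K (T ` S)" by (rule cs(6)[rotated]) (use X in blast)
      then show "x \<in> {x \<in> carrier H. T x \<in> closed_span K (T ` S)}" using H.hconvD(2)[OF l] by simp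
    qed (auto simp: T(1-3) T0 cs(3,4,5))
    moreover have "S \<subseteq> {x \<in> carrier H. T x \<in> closed_span K (T ` S)}"
      using K.closed_span_superset[of "T ` S"] hyps(4) by blast
    ultimately show ?thesis using H.closed_span_minimal by blast
  qed
  interpret H: hilbert_space H by fact
  interpret K: hilbert_space K by fact
  note T = unitary_mapD[OF assms(3)] and i = unitary_map_inv_into[OF assms(3)]
  have TS: "T ` S \<subseteq> carrier K" using T(1) assms(4) by auto
  have inv: "inv_into (carrier H) T ` T ` S = S"
  proof -
    have "inv_into (carrier H) T ` T ` S = (\<lambda>x. x) ` S"
      unfolding image_image by (rule image_cong[OF refl]) (rule i(3), use assms(4) in blast)
    then show ?thesis by simp
  qed
  have "closed_span K (T ` S) \<subseteq> T ` closed_span H S"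
  proof
    fix y assume y: "y \<in> closed_span K (T ` S)"
    then have yK: "y \<in> carrier K" using K.closed_subspaceD(2)[OF K.closed_span_closed_subspace[OF TS]] by simp
    have "inv_into (carrier H) T y \<in> closed_span H S"
      using *[OF assms(2,1) unitary_map_inv[OF assms(1,3)] TS] y inv by auto
    then show "y \<in> T ` closed_span H S" using i(2)[OF yK] by (metis image_eqI)
  qed
  with *[OF assms] show ?thesis by blast
qed

section \<open>Tensor products\<close>

text \<open>An abstract tensor product: a map whose inner products multiply and whose range is
  total. Bilinearity is a consequence of these inner products. The identification \<open>val\<close>
  with \<open>htensor H K\<close> replaces calculations with classes of sequences of formal
  sums.\<close>

locale tensor_model = H: hilbert_space H + K: hilbert_space K + R: hilbert_space R
  for H :: "'a hspace" and K :: "'b hspace" and R :: "'c hspace" +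
  fixes m :: "'a \<Rightarrow> 'b \<Rightarrow> 'c"
  assumes m_closed: "\<lbrakk>x \<in> carrier H; y \<in> carrier K\<rbrakk> \<Longrightarrow> m x y \<in> carrier R"
    and m_isometric: "\<lbrakk>x \<in> carrier H; y \<in> carrier K; x' \<in> carrier H; y' \<in> carrier K\<rbrakk> \<Longrightarrow>
       cip R (m x y) (m x' y') = cip H x x' * cip K y y'"
    and m_total: "closed_span R {m x y | x y. x \<in> carrier H \<and> y \<in> carrier K} = carrier R"
begin

sublocale F: free_model R "carrier H \<times> carrier K" "\<lambda>(x, y) (x', y'). cip H x x' * cip K y y'" "\<lambda>(x, y). m x y"
proof
  have "(\<lambda>(x, y). m x y) ` (carrier H \<times> carrier K) = {m x y | x y. x \<in> carrier H \<and> y \<in> carrier K}" by auto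
  then show "closed_span R ((\<lambda>(x, y). m x y) ` (carrier H \<times> carrier K)) = carrier R"
    using m_total by simp
qed (auto simp: m_closed m_isometric)

definition val :: "('a, 'b) tensor \<Rightarrow> 'c" where "val = F.ext"

lemma hilbert_htensor: "hilbert_space (htensor H K)"
  using F.hilbert_space_hcompletion by (simp add: htensor_def free_tensor_def)

lemma val_unitary: "unitary_map (htensor H K) R val"
  using F.ext_unitary by (simp add: htensor_def free_tensor_def val_def)

lemma elem_tensor_carrier: "\<lbrakk>x \<in> carrier H; y \<in> carrier K\<rbrakk> \<Longrightarrow> elem_tensor H K x y \<in> carrier (htensor H K)"
  using F.point_class_carrier[of "(x, y)"] by (simp add: htensor_def free_tensor_def elem_tensor_def)

lemma val_elem_tensor: "\<lbrakk>x \<in> carrier H; y \<in> carrier K\<rbrakk> \<Longrightarrow> val (elem_tensor H K x y) = m x y"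
  using F.ext_point[of "(x, y)"] by (simp add: htensor_def free_tensor_def elem_tensor_def val_def)

text \<open>Totality of the products in \<open>R\<close> is pulled back along the unitary
  \<open>val\<close>.\<close>

lemma elem_tensor_total:
  "closed_span (htensor H K) {elem_tensor H K x y | x y. x \<in> carrier H \<and> y \<in> carrier K} = carrier (htensor H K)"
proof -
  interpret T: hilbert_space "htensor H K" by (rule hilbert_htensor)
  let ?E = "{elem_tensor H K x y | x y. x \<in> carrier H \<and> y \<in> carrier K}"
  have E: "?E \<subseteq> carrier (htensor H K)" using elem_tensor_carrier by auto
  have "val ` ?E = {m x y | x y. x \<in> carrier H \<and> y \<in> carrier K}"
  proof (intro equalityI subsetI)
    fix b assume "b \<in> {m x y | x y. x \<in> carrier H \<and> y \<in> carrier K}"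
    then obtain x y where "x \<in> carrier H" "y \<in> carrier K" "b = m x y" by blast
    then show "b \<in> val ` ?E" by (intro image_eqI[of _ _ "elem_tensor H K x y"]) (auto simp: val_elem_tensor)
  next
    fix b assume "b \<in> val ` ?E"
    then obtain x y where "x \<in> carrier H" "y \<in> carrier K" "b = val (elem_tensor H K x y)" by blast
    then show "b \<in> {m x y | x y. x \<in> carrier H \<and> y \<in> carrier K}" using val_elem_tensor by blast
  qed
  then have v: "val ` closed_span (htensor H K) ?E = carrier R"
    using unitary_image_closed_span[OF hilbert_htensor R.hilbert_space_axioms val_unitary E] m_total by simp
  have sub: "closed_span (htensor H K) ?E \<subseteq> carrier (htensor H K)"
    by (rule T.closed_subspaceD(1)[OF T.closed_span_closed_subspace[OF E]])
  have "carrier (htensor H K) \<subseteq> closed_span (htensor H K) ?E"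
  proof
    fix z assume z: "z \<in> carrier (htensor H K)"
    then have "val z \<in> val ` closed_span (htensor H K) ?E" using v unitary_mapD(1)[OF val_unitary] by simp
    then obtain w where w: "w \<in> closed_span (htensor H K) ?E" "val z = val w" by blast
    then have "z = w" using unitary_map_inv_into(3)[OF val_unitary, of z]
        unitary_map_inv_into(3)[OF val_unitary, of w] z sub by auto
    then show "z \<in> closed_span (htensor H K) ?E" using w by simp
  qed
  with sub show ?thesis by blast
qed

end

lemma val_inj:
  assumes "tensor_model H K R m" "z \<in> carrier (htensor H K)" "w \<in> carrier (htensor H K)"
    "tensor_model.val R m z = tensor_model.val R m w"
  shows "z = w"
  using unitary_map_inv_into(3)[OF tensor_model.val_unitary[OF assms(1)]] assms(2-4) by metis

text \<open>A bounded operator \<open>J\<close> between models that acts on products like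
  \<open>T\<close> and \<open>S\<close> is the tensor product of \<open>T\<close> and
  \<open>S\<close> seen through the identifications. Conjugating \<open>J\<close> by them gives a
  map with the required properties, and totality of the elementary tensors makes it the only
  one.\<close>

lemma tensor_map_val:
  assumes M: "tensor_model H K R m" and M': "tensor_model H' K' R' m'" and J: "bounded_map R R' J"
    and T: "T \<in> carrier H \<rightarrow> carrier H'" and S: "S \<in> carrier K \<rightarrow> carrier K'"
    and eq: "\<And>x y. \<lbrakk>x \<in> carrier H; y \<in> carrier K\<rbrakk> \<Longrightarrow> J (m x y) = m' (T x) (S y)"
    and z: "z \<in> carrier (htensor H K)"
  shows "tensor_map H K H' K' T S z \<in> carrier (htensor H' K')"
    "tensor_model.val R' m' (tensor_map H K H' K' T S z) = J (tensor_model.val R m z)"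
proof -
  interpret M: tensor_model H K R m by fact
  interpret M': tensor_model H' K' R' m' by fact
  \<comment> \<open>The restriction to the carrier meets the extensionality that makes the
    description of \<open>tensor_map\<close> unique.\<close>
  define Q where "Q = restrict (\<lambda>z. inv_into (carrier (htensor H' K')) M'.val (J (M.val z))) (carrier (htensor H K))"
  note inv = unitary_map_inv[OF M'.hilbert_htensor M'.val_unitary]
  have Jc: "J x \<in> carrier R'" if "x \<in> carrier R" for x
    using J that by (auto simp: bounded_map_def linear_map_def)
  have bQ: "bounded_map (htensor H K) (htensor H' K') Q"
  proof (rule bounded_map_cong[OF bounded_map_comp[OF _ bounded_map_comp[OF _ _ J]] M.hilbert_htensor])
    show "bounded_map (htensor H K) R M.val" by (rule unitary_map_bounded[OF M.val_unitary])
    show "bounded_map R' (htensor H' K') (inv_into (carrier (htensor H' K')) M'.val)"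
      by (rule unitary_map_bounded[OF inv])
  qed (use M.R.hilbert_space_axioms M'.R.hilbert_space_axioms Q_def in auto)
  have Qe: "Q (elem_tensor H K x y) = elem_tensor H' K' (T x) (S y)" if "x \<in> carrier H" "y \<in> carrier K" for x y
  proof -
    have TS: "T x \<in> carrier H'" "S y \<in> carrier K'" using T S that by auto
    have "J (M.val (elem_tensor H K x y)) = M'.val (elem_tensor H' K' (T x) (S y))"
      using that TS by (simp add: M.val_elem_tensor M'.val_elem_tensor eq)
    then show ?thesis
      using unitary_map_inv_into(3)[OF M'.val_unitary M'.elem_tensor_carrier[OF TS]] M.elem_tensor_carrier[OF that]
      by (simp add: Q_def)
  qed
  have "tensor_map H K H' K' T S = Q" unfolding tensor_map_def
  proof (rule the_equality)
    show "Q \<in> extensional (carrier (htensor H K)) \<and> bounded_map (htensor H K) (htensor H' K') Q \<and>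
      (\<forall>x\<in>carrier H. \<forall>y\<in>carrier K. Q (elem_tensor H K x y) = elem_tensor H' K' (T x) (S y))"
      using bQ Qe by (simp add: Q_def)
  next
    fix Q' assume Q': "Q' \<in> extensional (carrier (htensor H K)) \<and> bounded_map (htensor H K) (htensor H' K') Q' \<and>
      (\<forall>x\<in>carrier H. \<forall>y\<in>carrier K. Q' (elem_tensor H K x y) = elem_tensor H' K' (T x) (S y))"
    have "Q' z = Q z" if "z \<in> carrier (htensor H K)" for z
      by (rule bounded_map_eq_on_total[OF M.hilbert_htensor M'.hilbert_htensor _ bQ M.elem_tensor_total _ _ that])
         (use Q' Qe M.elem_tensor_carrier in auto)
    then show "Q' = Q" using Q' by (auto simp: Q_def extensional_def fun_eq_iff)
  qed
  moreover have "M.val z \<in> carrier R" using unitary_mapD(1)[OF M.val_unitary z] .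
  ultimately show "tensor_map H K H' K' T S z \<in> carrier (htensor H' K')"
    "M'.val (tensor_map H K H' K' T S z) = J (M.val z)"
    using z Jc unitary_map_inv_into(1,2)[OF M'.val_unitary] by (simp_all add: Q_def)
qed

text \<open>The analogue of \<open>tensor_map_val\<close> for the associator, with a bounded
  \<open>J\<close> that carries products bracketed to the left to products bracketed to the right.
  Totality is asked for triple products because the associator is prescribed only on these.\<close>

lemma tensor_assoc_val:
  assumes HK: "tensor_model H K P p" and KL: "tensor_model K L Q q"
    and M: "tensor_model (htensor H K) L R m" and M': "tensor_model H (htensor K L) R' m'"
    and J: "bounded_map R R' J"
    and eq: "\<And>x y z. \<lbrakk>x \<in> carrier H; y \<in> carrier K; z \<in> carrier L\<rbrakk> \<Longrightarrow>
        J (m (elem_tensor H K x y) z) = m' x (elem_tensor K L y z)"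
    and total: "closed_span R {m (elem_tensor H K x y) z | x y z. x \<in> carrier H \<and> y \<in> carrier K \<and> z \<in> carrier L} = carrier R"
    and w: "w \<in> carrier (htensor (htensor H K) L)"
  shows "tensor_assoc H K L w \<in> carrier (htensor H (htensor K L))"
    "tensor_model.val R' m' (tensor_assoc H K L w) = J (tensor_model.val R m w)"
proof -
  interpret HK: tensor_model H K P p by fact
  interpret KL: tensor_model K L Q q by fact
  interpret M: tensor_model "htensor H K" L R m by fact
  interpret M': tensor_model H "htensor K L" R' m' by fact
  let ?S = "htensor (htensor H K) L" and ?S' = "htensor H (htensor K L)"
  let ?e = "\<lambda>x y z. elem_tensor (htensor H K) L (elem_tensor H K x y) z"
  let ?e' = "\<lambda>x y z. elem_tensor H (htensor K L) x (elem_tensor K L y z)"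
  let ?A = "{?e x y z | x y z. x \<in> carrier H \<and> y \<in> carrier K \<and> z \<in> carrier L}"
  define G where "G = restrict (\<lambda>z. inv_into (carrier ?S') M'.val (J (M.val z))) (carrier ?S)"
  note inv = unitary_map_inv[OF M'.hilbert_htensor M'.val_unitary]
  have Jc: "J x \<in> carrier R'" if "x \<in> carrier R" for x
    using J that by (auto simp: bounded_map_def linear_map_def)
  have bG: "bounded_map ?S ?S' G"
  proof (rule bounded_map_cong[OF bounded_map_comp[OF _ bounded_map_comp[OF _ _ J]] M.hilbert_htensor])
    show "bounded_map ?S R M.val" by (rule unitary_map_bounded[OF M.val_unitary])
    show "bounded_map R' ?S' (inv_into (carrier ?S') M'.val)"
      by (rule unitary_map_bounded[OF inv])
  qed (use M.R.hilbert_space_axioms M'.R.hilbert_space_axioms G_def in auto)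
  have ec: "?e x y z \<in> carrier ?S" "M.val (?e x y z) = m (elem_tensor H K x y) z"
    if "x \<in> carrier H" "y \<in> carrier K" "z \<in> carrier L" for x y z
    using that M.elem_tensor_carrier M.val_elem_tensor HK.elem_tensor_carrier by auto
  have Ge: "G (?e x y z) = ?e' x y z" if "x \<in> carrier H" "y \<in> carrier K" "z \<in> carrier L" for x y z
  proof -
    have c: "?e' x y z \<in> carrier ?S'" using that M'.elem_tensor_carrier KL.elem_tensor_carrier by simp
    have "J (M.val (?e x y z)) = M'.val (?e' x y z)"
      using that by (simp add: ec eq M'.val_elem_tensor KL.elem_tensor_carrier)
    then show ?thesis
      using unitary_map_inv_into(3)[OF M'.val_unitary c] ec(1)[OF that] by (simp add: G_def)
  qed
  have A: "?A \<subseteq> carrier ?S" using ec by auto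
  have vA: "M.val ` ?A = {m (elem_tensor H K x y) z | x y z. x \<in> carrier H \<and> y \<in> carrier K \<and> z \<in> carrier L}"
    (is "_ = ?B")
  proof (intro equalityI subsetI)
    fix b assume "b \<in> ?B"
    then obtain x y z where "x \<in> carrier H" "y \<in> carrier K" "z \<in> carrier L" "b = m (elem_tensor H K x y) z" by blast
    then show "b \<in> M.val ` ?A" by (intro image_eqI[of _ _ "?e x y z"]) (auto simp: ec)
  next
    fix b assume "b \<in> M.val ` ?A"
    then obtain x y z where "x \<in> carrier H" "y \<in> carrier K" "z \<in> carrier L" "b = M.val (?e x y z)" by blast
    then show "b \<in> ?B" using ec(2) by blast
  qed
  interpret S: hilbert_space ?S by (rule M.hilbert_htensor)
  have tot: "closed_span ?S ?A = carrier ?S"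
  proof -
    have v: "M.val ` closed_span ?S ?A = carrier R"
      using unitary_image_closed_span[OF M.hilbert_htensor M.R.hilbert_space_axioms M.val_unitary A] total vA by simp
    have sub: "closed_span ?S ?A \<subseteq> carrier ?S"
      by (rule S.closed_subspaceD(1)[OF S.closed_span_closed_subspace[OF A]])
    have "z \<in> closed_span ?S ?A" if z: "z \<in> carrier ?S" for z
    proof -
      from z have "M.val z \<in> M.val ` closed_span ?S ?A" using v unitary_mapD(1)[OF M.val_unitary] by simp
      then obtain w where w: "w \<in> closed_span ?S ?A" "M.val z = M.val w" by blast
      then show ?thesis using val_inj[OF M z, of w] sub by blast
    qed
    with sub show ?thesis by blast
  qed
  have "tensor_assoc H K L = G" unfolding tensor_assoc_def
  proof (rule the_equality)
    show "G \<in> extensional (carrier ?S) \<and> bounded_map ?S ?S' G \<and>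
      (\<forall>x\<in>carrier H. \<forall>y\<in>carrier K. \<forall>z\<in>carrier L. G (?e x y z) = ?e' x y z)"
      using bG Ge by (simp add: G_def)
  next
    fix G' assume G': "G' \<in> extensional (carrier ?S) \<and> bounded_map ?S ?S' G' \<and>
      (\<forall>x\<in>carrier H. \<forall>y\<in>carrier K. \<forall>z\<in>carrier L. G' (?e x y z) = ?e' x y z)"
    have "G' z = G z" if "z \<in> carrier ?S" for z
    proof (rule bounded_map_eq_on_total[OF M.hilbert_htensor M'.hilbert_htensor _ bG tot A _ that])
      show "G' a = G a" if "a \<in> ?A" for a using that G' Ge by auto
    qed (use G' in blast)
    then show "G' = G" using G' by (auto simp: G_def extensional_def fun_eq_iff)
  qed
  moreover have "M.val w \<in> carrier R" using unitary_mapD(1)[OF M.val_unitary w] .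
  ultimately show "tensor_assoc H K L w \<in> carrier ?S'"
    "M'.val (tensor_assoc H K L w) = J (M.val w)"
    using w Jc unitary_map_inv_into(1,2)[OF M'.val_unitary] by (simp_all add: G_def)
qed

text \<open>Computed from the definitions without a model: the fact that the fibres of a product
  system are models of tensor products is derived from it.\<close>

lemma cip_elem_tensor:
  assumes "hilbert_space H" "hilbert_space K" "x \<in> carrier H" "y \<in> carrier K" "x' \<in> carrier H" "y' \<in> carrier K"
  shows "elem_tensor H K x y \<in> carrier (htensor H K)"
    "cip (htensor H K) (elem_tensor H K x y) (elem_tensor H K x' y') = cip H x x' * cip K y y'"
proof -
  interpret V: pre_hilbert "free_tensor H K" by (rule pre_hilbert_free_tensor[OF assms(1,2)])
  have c: "(\<lambda>p. if p = (x, y) then 1 else 0) \<in> carrier (free_tensor H K)" if "x \<in> carrier H" "y \<in> carrier K" for x y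
    using that by (auto simp: free_tensor_def)
  show "elem_tensor H K x y \<in> carrier (htensor H K)"
    unfolding htensor_def elem_tensor_def
    by (rule V.completion_class_carrier[OF V.cauchy_seqs_const[OF c]]) (use assms in auto)
  have "cip (free_tensor H K) (\<lambda>p. if p = (x, y) then 1 else 0) (\<lambda>p. if p = (x', y') then 1 else 0) =
    cip H x x' * cip K y y'"
    by (simp add: free_tensor_def cip_free_space)
  then show "cip (htensor H K) (elem_tensor H K x y) (elem_tensor H K x' y') = cip H x x' * cip K y y'"
    using LIMSEQ_unique[OF V.cip_completion_const[OF c V.cauchy_seqs_const[OF c]] tendsto_const] assms
    unfolding htensor_def elem_tensor_def by simp
qed

text \<open>Density of the elementary tensors, again without a model. If \<open>X\<close> represents
  \<open>P\<close> and N is large, the inner product of \<open>X n\<close> with itself is close to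
  that of \<open>X N\<close> with \<open>X n\<close>; the latter tends to 0 because
  \<open>X N\<close> is a finite combination of point masses.\<close>

lemma htensor_elem_orthogonal:
  assumes "hilbert_space H" "hilbert_space K" "P \<in> carrier (htensor H K)"
    and orth: "\<And>x y. \<lbrakk>x \<in> carrier H; y \<in> carrier K\<rbrakk> \<Longrightarrow> cip (htensor H K) (elem_tensor H K x y) P = 0"
  shows "cip (htensor H K) P P = 0"
proof -
  interpret V: pre_hilbert "free_tensor H K" by (rule pre_hilbert_free_tensor[OF assms(1,2)])
  obtain X where X: "X \<in> cauchy_seqs (free_tensor H K)" "P = completion_class (free_tensor H K) X"
    using assms(3) unfolding htensor_def by (elim V.carrier_hcompletion_cases)
  note Xc = V.cauchy_seqsD[OF X(1)]
  let ?d = "\<lambda>q p. if p = q then 1 else (0::complex)"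
  have dc: "?d q \<in> carrier (free_tensor H K)" if "q \<in> carrier H \<times> carrier K" for q
    using that by (auto simp: free_tensor_def)
  have d: "(\<lambda>n. cip (free_tensor H K) (?d q) (X n)) \<longlonglongrightarrow> 0" if q: "q \<in> carrier H \<times> carrier K" for q
    using V.cip_completion_const[OF dc[OF q] X(1)] orth[of "fst q" "snd q"] q X(2)
    by (auto simp: htensor_def elem_tensor_def)
  have fX: "(\<lambda>n. cip (free_tensor H K) f (X n)) \<longlonglongrightarrow> 0" if f: "f \<in> carrier (free_tensor H K)" for f
  proof -
    from f have ff: "finite {p. f p \<noteq> 0}" "{p. f p \<noteq> 0} \<subseteq> carrier H \<times> carrier K" by (auto simp: free_tensor_def)
    have "cip (free_tensor H K) f (X n) = (\<Sum>q | f q \<noteq> 0. cnj (f q) * cip (free_tensor H K) (?d q) (X n))" for n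
      unfolding free_tensor_def cip_free_space by (simp add: sum_distrib_left mult_ac)
    moreover have "(\<lambda>n. \<Sum>q | f q \<noteq> 0. cnj (f q) * cip (free_tensor H K) (?d q) (X n)) \<longlonglongrightarrow> (\<Sum>q | f q \<noteq> 0. cnj (f q) * 0)"
      by (intro tendsto_sum tendsto_mult tendsto_const d) (use ff in auto)
    ultimately show ?thesis by simp
  qed
  obtain B where B: "B > 0" "\<forall>n. hnorm (free_tensor H K) (X n) \<le> B" using V.cauchy_seqs_bounded[OF X(1)] by blast
  have "(\<lambda>n. cip (free_tensor H K) (X n) (X n)) \<longlonglongrightarrow> 0"
  proof (rule LIMSEQ_I)
    fix e :: real assume e: "e > 0"
    obtain N where N: "\<forall>m\<ge>N. \<forall>n\<ge>N. hnorm (free_tensor H K) (X m \<ominus>\<^bsub>free_tensor H K\<^esub> X n) < e / (2 * B)"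
      using X(1) e B(1) unfolding cauchy_seqs_iff by (meson divide_pos_pos mult_pos_pos zero_less_numeral)
    obtain M where M: "\<forall>n\<ge>M. cmod (cip (free_tensor H K) (X N) (X n)) < e / 2"
      using LIMSEQ_D[OF fX[OF Xc[of N]], of "e / 2"] e by auto
    have "norm (cip (free_tensor H K) (X n) (X n) - 0) < e" if "n \<ge> max M N" for n
    proof -
      let ?D = "X n \<ominus>\<^bsub>free_tensor H K\<^esub> X N"
      have "cip (free_tensor H K) (X n) (X n) = cip (free_tensor H K) ?D (X n) + cip (free_tensor H K) (X N) (X n)"
        using Xc by (simp add: V.cip_diff_left)
      moreover have "cmod (cip (free_tensor H K) ?D (X n)) \<le> hnorm (free_tensor H K) ?D * hnorm (free_tensor H K) (X n)"
        by (rule V.cauchy_schwarz) (use Xc in auto)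
      moreover have "\<dots> \<le> hnorm (free_tensor H K) ?D * B"
        using B Xc by (intro mult_left_mono) auto
      moreover have "\<dots> < e / (2 * B) * B"
        using N that B(1) by (intro mult_strict_right_mono) auto
      moreover have "e / (2 * B) * B = e / 2" using B(1) by simp
      ultimately show ?thesis
        using M that norm_triangle_ineq[of "cip (free_tensor H K) ?D (X n)" "cip (free_tensor H K) (X N) (X n)"]
        by (smt (verit) diff_zero field_sum_of_halves max.bounded_iff)
    qed
    then show "\<exists>no. \<forall>n\<ge>no. norm (cip (free_tensor H K) (X n) (X n) - 0) < e" by blast
  qed
  then show ?thesis
    using V.cip_completion_class[OF X(1) X(1)] X(2) LIMSEQ_unique by (auto simp: htensor_def)
qed

section \<open>The multiplication of a product system\<close>

context product_system
begin

abbreviation "H t \<equiv> fibre E t"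
abbreviation "prd \<equiv> sys_prod E"

lemma prd_struct:
  assumes "s > 0" "t > 0" "x \<in> carrier (H s)" "y \<in> carrier (H t)"
  shows prd_closed: "prd s t x y \<in> carrier (H (s + t))"
    and struct_prd: "struct_map E s t (prd s t x y) = elem_tensor (H s) (H t) x y"
proof -
  note U = unitary_struct_map[OF assms(1,2)]
  note e = cip_elem_tensor(1)[OF hilbert_fibre[OF assms(1)] hilbert_fibre[OF assms(2)] assms(3,4) assms(3,4)]
  have h: "hilbert_space (H (s + t))" using hilbert_fibre assms by simp
  show "prd s t x y \<in> carrier (H (s + t))" "struct_map E s t (prd s t x y) = elem_tensor (H s) (H t) x y"
    unfolding sys_prod_def hadjoint_unitary[OF h U e]
    by (rule unitary_map_inv_into(1,2)[OF U e])+
qed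

lemma cip_prd:
  assumes "s > 0" "t > 0" "x \<in> carrier (H s)" "y \<in> carrier (H t)" "x' \<in> carrier (H s)" "y' \<in> carrier (H t)"
  shows "cip (H (s + t)) (prd s t x y) (prd s t x' y') = cip (H s) x x' * cip (H t) y y'"
  using unitary_mapD(4)[OF unitary_struct_map[OF assms(1,2)] prd_closed prd_closed, of x y x' y'] assms
    cip_elem_tensor(2)[OF hilbert_fibre[OF assms(1)] hilbert_fibre[OF assms(2)] assms(3-6)]
  by (simp add: struct_prd)

text \<open>The structure map sends products to elementary tensors, so a vector orthogonal to all
  products has an image orthogonal to all elementary tensors.\<close>

lemma prd_total:
  assumes s: "s > 0" and t: "t > 0"
  shows "closed_span (H (s + t)) {prd s t x y | x y. x \<in> carrier (H s) \<and> y \<in> carrier (H t)} = carrier (H (s + t))"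
proof -
  interpret hilbert_space "H (s + t)" using hilbert_fibre s t by simp
  note U = unitary_mapD[OF unitary_struct_map[OF s t]]
  show ?thesis
  proof (rule closed_span_eq_carrierI)
    show "{prd s t x y | x y. x \<in> carrier (H s) \<and> y \<in> carrier (H t)} \<subseteq> carrier (H (s + t))"
      using prd_closed s t by auto
    fix z assume z: "z \<in> carrier (H (s + t))"
      and o: "\<forall>x\<in>{prd s t x y | x y. x \<in> carrier (H s) \<and> y \<in> carrier (H t)}. cip (H (s + t)) x z = 0"
    have "cip (htensor (H s) (H t)) (struct_map E s t z) (struct_map E s t z) = 0"
    proof (rule htensor_elem_orthogonal[OF hilbert_fibre[OF s] hilbert_fibre[OF t] U(1)[OF z]])
      fix x y assume xy: "x \<in> carrier (H s)" "y \<in> carrier (H t)"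
      have "cip (htensor (H s) (H t)) (elem_tensor (H s) (H t) x y) (struct_map E s t z) = cip (H (s + t)) (prd s t x y) z"
        using U(4)[OF prd_closed[OF s t xy] z] struct_prd[OF s t xy] by simp
      then show "cip (htensor (H s) (H t)) (elem_tensor (H s) (H t) x y) (struct_map E s t z) = 0"
        using o xy by auto
    qed
    then have "cip (H (s + t)) z z = 0" using U(4)[OF z z] by simp
    then show "z = \<zero>\<^bsub>H (s + t)\<^esub>" using cip_definite z by blast
  qed
qed

text \<open>The fibre over s + t serves as the tensor product of the fibres over s and t, which
  allows later arguments to work with \<open>prd\<close> in place of the structure map.\<close>

lemma tensor_model_prd: "\<lbrakk>s > 0; t > 0\<rbrakk> \<Longrightarrow> tensor_model (H s) (H t) (H (s + t)) (prd s t)"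
  by (intro tensor_model.intro tensor_model_axioms.intro hilbert_fibre prd_closed cip_prd prd_total) auto

abbreviation "uval s t \<equiv> tensor_model.val (H (s + t)) (prd s t)"

text \<open>Both the structure map and \<open>uval\<close> preserve inner products, and
  \<open>uval\<close> takes the elementary tensor of x and y back to their product; hence z and its
  image have the same inner products with the total set of products.\<close>

lemma uval_struct:
  assumes s: "s > 0" and t: "t > 0" and z: "z \<in> carrier (H (s + t))"
  shows "uval s t (struct_map E s t z) = z"
proof -
  interpret M: tensor_model "H s" "H t" "H (s + t)" "prd s t" by (rule tensor_model_prd[OF s t])
  note U = unitary_mapD[OF unitary_struct_map[OF s t]]
  show ?thesis
  proof (rule M.R.total_eqI[OF prd_total[OF s t]])
    show "uval s t (struct_map E s t z) \<in> carrier (H (s + t))"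
      using unitary_mapD(1)[OF M.val_unitary U(1)[OF z]] .
    fix w assume "w \<in> {prd s t x y | x y. x \<in> carrier (H s) \<and> y \<in> carrier (H t)}"
    then obtain x y where xy: "x \<in> carrier (H s)" "y \<in> carrier (H t)" "w = prd s t x y" by blast
    have "cip (H (s + t)) w (uval s t (struct_map E s t z)) =
        cip (H (s + t)) (uval s t (elem_tensor (H s) (H t) x y)) (uval s t (struct_map E s t z))"
      using xy by (simp add: M.val_elem_tensor)
    also have "\<dots> = cip (htensor (H s) (H t)) (elem_tensor (H s) (H t) x y) (struct_map E s t z)"
      by (rule unitary_mapD(4)[OF M.val_unitary M.elem_tensor_carrier U(1)[OF z]]) (use xy in auto)
    also have "\<dots> = cip (H (s + t)) w z"
      using U(4)[OF prd_closed[OF s t xy(1,2)] z] struct_prd[OF s t xy(1,2)] xy(3) by simp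
    finally show "cip (H (s + t)) w (uval s t (struct_map E s t z)) = cip (H (s + t)) w z" .
  qed (use z prd_closed s t in auto)
qed

lemmas cip_simps = pre_hilbert.cip_simps[OF hilbert_space.pre_hilbert[OF hilbert_fibre]]
lemmas fibre_smult_closed = pre_hilbert.smult_carrier[OF hilbert_space.pre_hilbert[OF hilbert_fibre]]

lemma fibre_add_closed: "\<lbrakk>t > 0; x \<in> carrier (H t); y \<in> carrier (H t)\<rbrakk> \<Longrightarrow> x \<oplus>\<^bsub>H t\<^esub> y \<in> carrier (H t)"
proof -
  assume t: "t > 0" and xy: "x \<in> carrier (H t)" "y \<in> carrier (H t)"
  interpret hilbert_space "H t" by (rule hilbert_fibre[OF t])
  show ?thesis using xy by simp
qed

lemma fibre_diff_closed: "\<lbrakk>t > 0; x \<in> carrier (H t); y \<in> carrier (H t)\<rbrakk> \<Longrightarrow> x \<ominus>\<^bsub>H t\<^esub> y \<in> carrier (H t)"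
  by (rule pre_hilbert.diff_carrier[OF hilbert_space.pre_hilbert[OF hilbert_fibre]])

lemmas fibre_closed = fibre_smult_closed fibre_add_closed fibre_diff_closed

text \<open>Products are total, so inner products with them determine a vector. Bilinearity of
  \<open>prd\<close> then follows from \<open>cip_prd\<close> by arithmetic.\<close>

lemma prd_eqI:
  assumes "s > 0" "t > 0" "z \<in> carrier (H (s + t))" "w \<in> carrier (H (s + t))"
    "\<And>x y. \<lbrakk>x \<in> carrier (H s); y \<in> carrier (H t)\<rbrakk> \<Longrightarrow> cip (H (s + t)) (prd s t x y) z = cip (H (s + t)) (prd s t x y) w"
  shows "z = w"
proof -
  interpret hilbert_space "H (s + t)" using hilbert_fibre assms by simp
  show ?thesis
    by (rule total_eqI[OF prd_total[OF assms(1,2)] _ assms(3,4)]) (use prd_closed[OF assms(1,2)] assms(5) in auto)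
qed

context
  fixes s t :: real
  assumes s: "s > 0" and t: "t > 0"
begin

lemma prd_add_left:
  assumes "x \<in> carrier (H s)" "x' \<in> carrier (H s)" "y \<in> carrier (H t)"
  shows "prd s t (x \<oplus>\<^bsub>H s\<^esub> x') y = prd s t x y \<oplus>\<^bsub>H (s + t)\<^esub> prd s t x' y"
  by (rule prd_eqI[OF s t])
     (use assms s t in \<open>simp_all add: prd_closed cip_prd fibre_closed cip_simps algebra_simps\<close>)

lemma prd_add_right:
  assumes "x \<in> carrier (H s)" "y \<in> carrier (H t)" "y' \<in> carrier (H t)"
  shows "prd s t x (y \<oplus>\<^bsub>H t\<^esub> y') = prd s t x y \<oplus>\<^bsub>H (s + t)\<^esub> prd s t x y'"
  by (rule prd_eqI[OF s t])
     (use assms s t in \<open>simp_all add: prd_closed cip_prd fibre_closed cip_simps algebra_simps\<close>)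

lemma prd_diff_left:
  assumes "x \<in> carrier (H s)" "x' \<in> carrier (H s)" "y \<in> carrier (H t)"
  shows "prd s t (x \<ominus>\<^bsub>H s\<^esub> x') y = prd s t x y \<ominus>\<^bsub>H (s + t)\<^esub> prd s t x' y"
  by (rule prd_eqI[OF s t])
     (use assms s t in \<open>simp_all add: prd_closed cip_prd fibre_closed cip_simps algebra_simps\<close>)

lemma prd_diff_right:
  assumes "x \<in> carrier (H s)" "y \<in> carrier (H t)" "y' \<in> carrier (H t)"
  shows "prd s t x (y \<ominus>\<^bsub>H t\<^esub> y') = prd s t x y \<ominus>\<^bsub>H (s + t)\<^esub> prd s t x y'"
  by (rule prd_eqI[OF s t])
     (use assms s t in \<open>simp_all add: prd_closed cip_prd fibre_closed cip_simps algebra_simps\<close>)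

lemma prd_smult_left:
  assumes "x \<in> carrier (H s)" "y \<in> carrier (H t)"
  shows "prd s t (c \<odot>\<^bsub>H s\<^esub> x) y = c \<odot>\<^bsub>H (s + t)\<^esub> prd s t x y"
  by (rule prd_eqI[OF s t])
     (use assms s t in \<open>simp_all add: prd_closed cip_prd fibre_closed cip_simps algebra_simps\<close>)

lemma prd_smult_right:
  assumes "x \<in> carrier (H s)" "y \<in> carrier (H t)"
  shows "prd s t x (c \<odot>\<^bsub>H t\<^esub> y) = c \<odot>\<^bsub>H (s + t)\<^esub> prd s t x y"
  by (rule prd_eqI[OF s t])
     (use assms s t in \<open>simp_all add: prd_closed cip_prd fibre_closed cip_simps algebra_simps\<close>)

lemma hnorm_prd:
  assumes "x \<in> carrier (H s)" "y \<in> carrier (H t)"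
  shows "hnorm (H (s + t)) (prd s t x y) = hnorm (H s) x * hnorm (H t) y"
proof -
  interpret S: hilbert_space "H s" by (rule hilbert_fibre[OF s])
  interpret T: hilbert_space "H t" by (rule hilbert_fibre[OF t])
  show ?thesis
    unfolding hnorm_def cip_prd[OF s t assms assms] by (simp add: assms real_sqrt_mult)
qed

lemma hconv_prd:
  assumes "hconv (H s) X x" "hconv (H t) Y y"
  shows "hconv (H (s + t)) (\<lambda>n. prd s t (X n) (Y n)) (prd s t x y)"
proof -
  interpret S: hilbert_space "H s" by (rule hilbert_fibre[OF s])
  interpret T: hilbert_space "H t" by (rule hilbert_fibre[OF t])
  interpret ST: hilbert_space "H (s + t)" by (rule hilbert_fibre[OF add_pos_pos[OF s t]])
  note X = S.hconvD[OF assms(1)] and Y = T.hconvD[OF assms(2)]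
  note c = prd_closed[OF s t]
  show ?thesis
  proof (rule ST.hconv_squeeze)
    fix n
    have "hnorm (H (s + t)) (prd s t (X n) (Y n) \<ominus>\<^bsub>H (s + t)\<^esub> prd s t x y)
      \<le> hnorm (H (s + t)) (prd s t (X n) (Y n) \<ominus>\<^bsub>H (s + t)\<^esub> prd s t x (Y n)) +
        hnorm (H (s + t)) (prd s t x (Y n) \<ominus>\<^bsub>H (s + t)\<^esub> prd s t x y)"
      by (rule ST.hnorm_triangle) (use X Y c in auto)
    also have "\<dots> = hnorm (H s) (X n \<ominus>\<^bsub>H s\<^esub> x) * hnorm (H t) (Y n) + hnorm (H s) x * hnorm (H t) (Y n \<ominus>\<^bsub>H t\<^esub> y)"
      using X Y by (simp flip: prd_diff_left prd_diff_right add: hnorm_prd)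
    finally show "hnorm (H (s + t)) (prd s t (X n) (Y n) \<ominus>\<^bsub>H (s + t)\<^esub> prd s t x y)
      \<le> hnorm (H s) (X n \<ominus>\<^bsub>H s\<^esub> x) * hnorm (H t) (Y n) + hnorm (H s) x * hnorm (H t) (Y n \<ominus>\<^bsub>H t\<^esub> y)" .
  next
    have "(\<lambda>n. hnorm (H s) (X n \<ominus>\<^bsub>H s\<^esub> x) * hnorm (H t) (Y n) + hnorm (H s) x * hnorm (H t) (Y n \<ominus>\<^bsub>H t\<^esub> y))
      \<longlonglongrightarrow> 0 * hnorm (H t) y + hnorm (H s) x * 0"
      by (intro tendsto_intros X Y T.hconv_norm assms)
    then show "(\<lambda>n. hnorm (H s) (X n \<ominus>\<^bsub>H s\<^esub> x) * hnorm (H t) (Y n) + hnorm (H s) x * hnorm (H t) (Y n \<ominus>\<^bsub>H t\<^esub> y))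
      \<longlonglongrightarrow> 0" by simp
  qed (use X Y c in auto)
qed

lemma prd_zero_left: assumes "y \<in> carrier (H t)" shows "prd s t \<zero>\<^bsub>H s\<^esub> y = \<zero>\<^bsub>H (s + t)\<^esub>"
proof -
  interpret S: hilbert_space "H s" by (rule hilbert_fibre[OF s])
  interpret ST: hilbert_space "H (s + t)" by (rule hilbert_fibre[OF add_pos_pos[OF s t]])
  show ?thesis
    using hnorm_prd[of "\<zero>\<^bsub>H s\<^esub>" y] assms ST.hnorm_eq_0[OF prd_closed[OF s t, of "\<zero>\<^bsub>H s\<^esub>" y]] by simp
qed

lemma prd_zero_right: assumes "x \<in> carrier (H s)" shows "prd s t x \<zero>\<^bsub>H t\<^esub> = \<zero>\<^bsub>H (s + t)\<^esub>"
proof -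
  interpret T: hilbert_space "H t" by (rule hilbert_fibre[OF t])
  interpret ST: hilbert_space "H (s + t)" by (rule hilbert_fibre[OF add_pos_pos[OF s t]])
  show ?thesis
    using hnorm_prd[of x "\<zero>\<^bsub>H t\<^esub>"] assms ST.hnorm_eq_0[OF prd_closed[OF s t, of x "\<zero>\<^bsub>H t\<^esub>"]] by simp
qed

text \<open>For fixed y, the vectors x whose product with y lies in \<open>W\<close> form a closed
  subspace. Membership therefore passes from generators to their closed span, one factor at a
  time.\<close>

lemma prd_span_left:
  assumes W: "closed_subspace (H (s + t)) W" and A: "A \<subseteq> carrier (H s)" and x: "x \<in> closed_span (H s) A"
    and y: "y \<in> carrier (H t)" and AW: "\<And>a. a \<in> A \<Longrightarrow> prd s t a y \<in> W"
  shows "prd s t x y \<in> W"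
proof -
  interpret S: hilbert_space "H s" by (rule hilbert_fibre[OF s])
  interpret T: hilbert_space "H t" by (rule hilbert_fibre[OF t])
  interpret ST: hilbert_space "H (s + t)" by (rule hilbert_fibre[OF add_pos_pos[OF s t]])
  note w = ST.closed_subspaceD[OF W]
  have "closed_subspace (H s) {x \<in> carrier (H s). prd s t x y \<in> W}"
  proof (rule S.closed_subspaceI)
    fix X x assume X: "\<And>n. X n \<in> {x \<in> carrier (H s). prd s t x y \<in> W}" and l: "hconv (H s) X x"
    have "prd s t x y \<in> W"
      by (rule w(6)[OF _ hconv_prd[OF l T.hconv_const[OF y]]]) (use X in blast)
    then show "x \<in> {x \<in> carrier (H s). prd s t x y \<in> W}" using S.hconvD(2)[OF l] by simp
  qed (use y w(3-5) in \<open>auto simp: prd_add_left prd_smult_left prd_zero_left\<close>)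
  from S.closed_span_minimal[OF this, of A] show ?thesis using x A AW by blast
qed

lemma prd_span_right:
  assumes W: "closed_subspace (H (s + t)) W" and A: "A \<subseteq> carrier (H t)" and y: "y \<in> closed_span (H t) A"
    and x: "x \<in> carrier (H s)" and AW: "\<And>a. a \<in> A \<Longrightarrow> prd s t x a \<in> W"
  shows "prd s t x y \<in> W"
proof -
  interpret S: hilbert_space "H s" by (rule hilbert_fibre[OF s])
  interpret T: hilbert_space "H t" by (rule hilbert_fibre[OF t])
  interpret ST: hilbert_space "H (s + t)" by (rule hilbert_fibre[OF add_pos_pos[OF s t]])
  note w = ST.closed_subspaceD[OF W]
  have "closed_subspace (H t) {y \<in> carrier (H t). prd s t x y \<in> W}"
  proof (rule T.closed_subspaceI)
    fix Y y assume Y: "\<And>n. Y n \<in> {y \<in> carrier (H t). prd s t x y \<in> W}" and l: "hconv (H t) Y y"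
    have "prd s t x y \<in> W"
      by (rule w(6)[OF _ hconv_prd[OF S.hconv_const[OF x] l]]) (use Y in blast)
    then show "y \<in> {y \<in> carrier (H t). prd s t x y \<in> W}" using T.hconvD(2)[OF l] by simp
  qed (use x w(3-5) in \<open>auto simp: prd_add_right prd_smult_right prd_zero_right\<close>)
  from T.closed_span_minimal[OF this, of A] show ?thesis using y A AW by blast
qed

end

end

text \<open>Replaces the second factor of a model by a unitarily equivalent space. With
  \<open>htensor (H s) (H t)\<close> in place of \<open>H (s + t)\<close> this produces a model of
  an iterated tensor product as it occurs in coassociativity.\<close>

lemma tensor_model_right:
  assumes "tensor_model A B R m" "hilbert_space B'" "unitary_map B' B V"
  shows "tensor_model A B' R (\<lambda>x w. m x (V w))"
proof -
  interpret tensor_model A B R m by fact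
  note V = unitary_mapD[OF assms(3)] and i = unitary_map_inv_into[OF assms(3)]
  have "{m x (V w) | x w. x \<in> carrier A \<and> w \<in> carrier B'} = {m x y | x y. x \<in> carrier A \<and> y \<in> carrier B}"
    (is "?L = ?R")
  proof
    show "?L \<subseteq> ?R" using V(1) by blast
    show "?R \<subseteq> ?L"
    proof
      fix b assume "b \<in> ?R"
      then obtain x y where xy: "x \<in> carrier A" "y \<in> carrier B" "b = m x y" by blast
      then have "b = m x (V (inv_into (carrier B') V y))" "inv_into (carrier B') V y \<in> carrier B'" using i by auto
      then show "b \<in> ?L" using xy by blast
    qed
  qed
  then show ?thesis
    by (intro tensor_model.intro tensor_model_axioms.intro assms(2) H.hilbert_space_axioms R.hilbert_space_axioms)
       (simp_all add: m_closed m_isometric V m_total)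
qed

lemma tensor_model_left:
  assumes "tensor_model A B R m" "hilbert_space A'" "unitary_map A' A V"
  shows "tensor_model A' B R (\<lambda>w y. m (V w) y)"
proof -
  interpret tensor_model A B R m by fact
  note V = unitary_mapD[OF assms(3)] and i = unitary_map_inv_into[OF assms(3)]
  have "{m (V w) y | w y. w \<in> carrier A' \<and> y \<in> carrier B} = {m x y | x y. x \<in> carrier A \<and> y \<in> carrier B}"
    (is "?L = ?R")
  proof
    show "?L \<subseteq> ?R" using V(1) by blast
    show "?R \<subseteq> ?L"
    proof
      fix b assume "b \<in> ?R"
      then obtain x y where xy: "x \<in> carrier A" "y \<in> carrier B" "b = m x y" by blast
      then have "b = m (V (inv_into (carrier A') V x)) y" "inv_into (carrier A') V x \<in> carrier A'" using i by auto
      then show "b \<in> ?L" using xy by blast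
    qed
  qed
  then show ?thesis
    by (intro tensor_model.intro tensor_model_axioms.intro assms(2) K.hilbert_space_axioms R.hilbert_space_axioms)
       (simp_all add: m_closed m_isometric V m_total)
qed

text \<open>Both spaces are models of the same completion; one identification is composed with the
  inverse of the other.\<close>

lemma gram_unitary:
  assumes "free_model R X k \<psi>" "free_model S X k \<omega>"
  shows "\<exists>T. unitary_map R S T \<and> (\<forall>x\<in>X. T (\<psi> x) = \<omega> x)"
proof -
  interpret R: free_model R X k \<psi> by fact
  interpret S: free_model S X k \<omega> by fact
  let ?C = "hcompletion (free_space X k)"
  let ?T = "\<lambda>r. S.ext (inv_into (carrier ?C) R.ext r)"
  have "unitary_map R S ?T"
    by (rule unitary_map_comp[OF unitary_map_inv[OF R.hilbert_space_hcompletion R.ext_unitary] S.ext_unitary])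
  moreover have "?T (\<psi> x) = \<omega> x" if "x \<in> X" for x
    using unitary_map_inv_into(3)[OF R.ext_unitary R.point_class_carrier[OF that]] R.ext_point[OF that] S.ext_point[OF that]
    by simp
  ultimately show ?thesis by blast
qed

section \<open>Associativity of the multiplication\<close>

context product_system
begin

lemma image_triple:
  "(\<lambda>(x, y, z). f x y z) ` (A \<times> B \<times> C) = {f x y z | x y z. x \<in> A \<and> y \<in> B \<and> z \<in> C}"
  by (fastforce simp: image_def)

text \<open>The closed span of the triple products contains, by \<open>prd_span_left\<close> or
  \<open>prd_span_right\<close>, the products of arbitrary pairs, and these are total.\<close>

lemma prd_total_nested:
  assumes r: "r > 0" and s: "s > 0" and t: "t > 0"
  shows "closed_span (H (r + s + t)) {prd (r + s) t (prd r s x y) z | x y z. x \<in> carrier (H r) \<and> y \<in> carrier (H s) \<and> z \<in> carrier (H t)}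
      = carrier (H (r + s + t))" (is "closed_span _ ?A = _")
    and "closed_span (H (r + s + t)) {prd r (s + t) x (prd s t y z) | x y z. x \<in> carrier (H r) \<and> y \<in> carrier (H s) \<and> z \<in> carrier (H t)}
      = carrier (H (r + s + t))" (is "closed_span _ ?B = _")
proof -
  have rs: "r + s > 0" and st: "s + t > 0" and rst: "r + s + t > 0" and eq: "r + (s + t) = r + s + t"
    using r s t by auto
  interpret hilbert_space "H (r + s + t)" by (rule hilbert_fibre[OF rst])
  have A: "?A \<subseteq> carrier (H (r + s + t))" using prd_closed r s t rs by auto
  have B: "?B \<subseteq> carrier (H (r + s + t))" using prd_closed[OF r st] prd_closed[OF s t] by (auto simp: eq)
  note csA = closed_span_closed_subspace[OF A] and csB = closed_span_closed_subspace[OF B]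
  have "prd (r + s) t w z \<in> closed_span (H (r + s + t)) ?A" if "w \<in> carrier (H (r + s))" "z \<in> carrier (H t)" for w z
  proof (rule prd_span_left[OF rs t csA _ _ that(2)])
    show "{prd r s x y | x y. x \<in> carrier (H r) \<and> y \<in> carrier (H s)} \<subseteq> carrier (H (r + s))"
      using prd_closed[OF r s] by auto
    show "w \<in> closed_span (H (r + s)) {prd r s x y | x y. x \<in> carrier (H r) \<and> y \<in> carrier (H s)}"
      using prd_total[OF r s] that by simp
    fix a assume "a \<in> {prd r s x y | x y. x \<in> carrier (H r) \<and> y \<in> carrier (H s)}"
    then show "prd (r + s) t a z \<in> closed_span (H (r + s + t)) ?A"
      using closed_span_superset[of ?A] that(2) by blast
  qed
  then have "{prd (r + s) t w z | w z. w \<in> carrier (H (r + s)) \<and> z \<in> carrier (H t)} \<subseteq> closed_span (H (r + s + t)) ?A"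
    by blast
  from closed_span_minimal[OF csA this] prd_total[OF rs t] closed_subspaceD(1)[OF csA]
  show "closed_span (H (r + s + t)) ?A = carrier (H (r + s + t))" by simp
  have "prd r (s + t) x w \<in> closed_span (H (r + s + t)) ?B" if "x \<in> carrier (H r)" "w \<in> carrier (H (s + t))" for x w
  proof (rule prd_span_right[OF r st csB[folded eq] _ _ that(1), unfolded eq])
    show "{prd s t y z | y z. y \<in> carrier (H s) \<and> z \<in> carrier (H t)} \<subseteq> carrier (H (s + t))"
      using prd_closed[OF s t] by auto
    show "w \<in> closed_span (H (s + t)) {prd s t y z | y z. y \<in> carrier (H s) \<and> z \<in> carrier (H t)}"
      using prd_total[OF s t] that by simp
    fix a assume "a \<in> {prd s t y z | y z. y \<in> carrier (H s) \<and> z \<in> carrier (H t)}"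
    then show "prd r (s + t) x a \<in> closed_span (H (r + s + t)) ?B"
      using closed_span_superset[of ?B] that(1) by blast
  qed
  then have "{prd r (s + t) x w | x w. x \<in> carrier (H r) \<and> w \<in> carrier (H (s + t))} \<subseteq> closed_span (H (r + s + t)) ?B"
    by blast
  from closed_span_minimal[OF csB this] prd_total[OF r st] closed_subspaceD(1)[OF csB]
  show "closed_span (H (r + s + t)) ?B = carrier (H (r + s + t))" by (simp add: eq)
qed

text \<open>The space over \<open>r + s + t\<close> is a model of both threefold tensor products; coassociativity
  says that the two identifications agree.\<close>

lemma prd_assoc:
  assumes r: "r > 0" and s: "s > 0" and t: "t > 0"
    and x: "x \<in> carrier (H r)" and y: "y \<in> carrier (H s)" and z: "z \<in> carrier (H t)"
  shows "prd (r + s) t (prd r s x y) z = prd r (s + t) x (prd s t y z)"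
proof -
  have rs: "r + s > 0" and st: "s + t > 0" and rst: "r + s + t > 0" and eq: "r + (s + t) = r + s + t"
    using r s t by auto
  let ?R = "H (r + s + t)"
  let ?X = "carrier (H r) \<times> carrier (H s) \<times> carrier (H t)"
  let ?k = "\<lambda>(x, y, z) (x', y', z'). cip (H r) x x' * cip (H s) y y' * cip (H t) z z'"
  have hR: "hilbert_space ?R" by (rule hilbert_fibre[OF rst])
  have 1: "free_model ?R ?X ?k (\<lambda>(x, y, z). prd (r + s) t (prd r s x y) z)"
  proof (intro free_model.intro free_model_axioms.intro hR)
    have "(\<lambda>(x, y, z). prd (r + s) t (prd r s x y) z) ` ?X =
      {prd (r + s) t (prd r s x y) z | x y z. x \<in> carrier (H r) \<and> y \<in> carrier (H s) \<and> z \<in> carrier (H t)}" by (rule image_triple)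
    then show "closed_span ?R ((\<lambda>(x, y, z). prd (r + s) t (prd r s x y) z) ` ?X) = carrier ?R"
      using prd_total_nested(1)[OF r s t] by simp
  qed (use r s t rs in \<open>auto simp: prd_closed cip_prd\<close>)
  have 2: "free_model ?R ?X ?k (\<lambda>(x, y, z). prd r (s + t) x (prd s t y z))"
  proof (intro free_model.intro free_model_axioms.intro hR)
    have "(\<lambda>(x, y, z). prd r (s + t) x (prd s t y z)) ` ?X =
      {prd r (s + t) x (prd s t y z) | x y z. x \<in> carrier (H r) \<and> y \<in> carrier (H s) \<and> z \<in> carrier (H t)}" by (rule image_triple)
    then show "closed_span ?R ((\<lambda>(x, y, z). prd r (s + t) x (prd s t y z)) ` ?X) = carrier ?R"
      using prd_total_nested(2)[OF r s t] by simp
  qed (use prd_closed[OF r st] cip_prd[OF r st] prd_closed[OF s t] cip_prd[OF s t] in \<open>auto simp: eq mult_ac\<close>)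
  \<comment> \<open>The two bracketings have the same Gram matrix, hence are related by a unitary J.
    Associativity amounts to J fixing the products bracketed to the left.\<close>
  obtain J where J: "unitary_map ?R ?R J"
    and J': "\<And>x y z. \<lbrakk>x \<in> carrier (H r); y \<in> carrier (H s); z \<in> carrier (H t)\<rbrakk> \<Longrightarrow>
      J (prd (r + s) t (prd r s x y) z) = prd r (s + t) x (prd s t y z)"
    using gram_unitary[OF 1 2] by auto
  note M1 = tensor_model_prd[OF r st, unfolded eq] and M3 = tensor_model_prd[OF rs t]
  interpret RS: tensor_model "H r" "H s" "H (r + s)" "prd r s" by (rule tensor_model_prd[OF r s])
  interpret ST: tensor_model "H s" "H t" "H (s + t)" "prd s t" by (rule tensor_model_prd[OF s t])
  have M2: "tensor_model (H r) (htensor (H s) (H t)) ?R (\<lambda>x w. prd r (s + t) x (uval s t w))"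
    by (rule tensor_model_right[OF M1 ST.hilbert_htensor ST.val_unitary])
  have M4: "tensor_model (htensor (H r) (H s)) (H t) ?R (\<lambda>w z. prd (r + s) t (uval r s w) z)"
    by (rule tensor_model_left[OF M3 RS.hilbert_htensor RS.val_unitary])
  let ?v2 = "tensor_model.val ?R (\<lambda>x w. prd r (s + t) x (uval s t w))"
  let ?v4 = "tensor_model.val ?R (\<lambda>w z. prd (r + s) t (uval r s w) z)"
  have id: "bounded_map ?R ?R (\<lambda>x. x)"
    unfolding bounded_map_def linear_map_def by (auto intro: exI[of _ 1])
  note Bst = unitary_mapD[OF unitary_struct_map[OF s t]] and Brs = unitary_mapD[OF unitary_struct_map[OF r s]]
    and Br = unitary_mapD[OF unitary_struct_map[OF r st], unfolded eq] and Bt = unitary_mapD[OF unitary_struct_map[OF rs t]]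
  define \<zeta> where "\<zeta> = prd (r + s) t (prd r s x y) z"
  have \<zeta>: "\<zeta> \<in> carrier ?R" unfolding \<zeta>_def by (intro prd_closed rs t r s x y z)
  let ?L = "tensor_map (H r) (H (s + t)) (H r) (htensor (H s) (H t)) (\<lambda>x. x) (struct_map E s t) (struct_map E r (s + t) \<zeta>)"
  let ?M = "tensor_map (H (r + s)) (H t) (htensor (H r) (H s)) (H t) (struct_map E r s) (\<lambda>x. x) (struct_map E (r + s) t \<zeta>)"
  have "?v2 ?L = tensor_model.val ?R (prd r (s + t)) (struct_map E r (s + t) \<zeta>)"
    by (rule tensor_map_val(2)[OF M1 M2 id]) (use Bst(1) Br(1)[OF \<zeta>] uval_struct[OF s t] in auto)
  also have "\<dots> = \<zeta>" using uval_struct[OF r st] \<zeta> by (simp add: eq)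
  finally have L: "?v2 ?L = \<zeta>" .
  have M: "?M \<in> carrier (htensor (htensor (H r) (H s)) (H t))"
    by (rule tensor_map_val(1)[OF M3 M4 id]) (use Brs(1) Bt(1)[OF \<zeta>] uval_struct[OF r s] in auto)
  have "?v4 ?M = uval (r + s) t (struct_map E (r + s) t \<zeta>)"
    by (rule tensor_map_val(2)[OF M3 M4 id]) (use Brs(1) Bt(1)[OF \<zeta>] uval_struct[OF r s] in auto)
  also have "\<dots> = \<zeta>" using uval_struct[OF rs t] \<zeta> by simp
  finally have M': "?v4 ?M = \<zeta>" .
  have "?v2 (tensor_assoc (H r) (H s) (H t) ?M) = J (?v4 ?M)"
  proof (rule tensor_assoc_val(2)[OF RS.tensor_model_axioms ST.tensor_model_axioms M4 M2 unitary_map_bounded[OF J] _ _ M])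
    show "J (prd (r + s) t (uval r s (elem_tensor (H r) (H s) x y)) z) = prd r (s + t) x (uval s t (elem_tensor (H s) (H t) y z))"
      if "x \<in> carrier (H r)" "y \<in> carrier (H s)" "z \<in> carrier (H t)" for x y z
      using that by (simp add: RS.val_elem_tensor ST.val_elem_tensor J')
    have "{prd (r + s) t (uval r s (elem_tensor (H r) (H s) x y)) z | x y z. x \<in> carrier (H r) \<and> y \<in> carrier (H s) \<and> z \<in> carrier (H t)}
      = {prd (r + s) t (prd r s x y) z | x y z. x \<in> carrier (H r) \<and> y \<in> carrier (H s) \<and> z \<in> carrier (H t)}"
      by (intro Collect_cong ex_cong1) (auto simp: RS.val_elem_tensor)
    then show "closed_span ?R {prd (r + s) t (uval r s (elem_tensor (H r) (H s) x y)) z | x y z. x \<in> carrier (H r) \<and> y \<in> carrier (H s) \<and> z \<in> carrier (H t)}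
      = carrier ?R" using prd_total_nested(1)[OF r s t] by simp
  qed
  \<comment> \<open>Read in the model \<open>?v2\<close>, the left side of coassociativity at
    \<open>\<zeta>\<close> is \<open>\<zeta>\<close> and the right side is
    \<open>J \<zeta>\<close>.\<close>
  then have "\<zeta> = J \<zeta>" using L M' coassoc[OF r s t \<zeta>] by simp
  then show ?thesis using J'[OF x y z] by (simp add: \<zeta>_def)
qed

end

section \<open>Partitions and the logarithm of a unit\<close>

text \<open>Partitions of an interval, given by their cell lengths. The empty list is excluded
  because there is no fibre over 0.\<close>

definition pos_list :: "real list \<Rightarrow> bool" where
  "pos_list hs \<longleftrightarrow> hs \<noteq> [] \<and> (\<forall>h\<in>set hs. 0 < h)"

definition uniform_partition :: "real \<Rightarrow> nat \<Rightarrow> real list" where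
  "uniform_partition t n = replicate (Suc n) (t / real (Suc n))"

lemma pos_list_simps [simp]:
  "\<not> pos_list []" "pos_list [h] \<longleftrightarrow> 0 < h" "pos_list (h # k # ks) \<longleftrightarrow> 0 < h \<and> pos_list (k # ks)"
  by (auto simp: pos_list_def)

lemma pos_list_Cons: "hs \<noteq> [] \<Longrightarrow> pos_list (h # hs) \<longleftrightarrow> 0 < h \<and> pos_list hs"
  by (cases hs) auto

lemma pos_list_append: "\<lbrakk>pos_list hs; pos_list ks\<rbrakk> \<Longrightarrow> pos_list (hs @ ks)"
  by (auto simp: pos_list_def)

lemma sum_list_pos: "pos_list hs \<Longrightarrow> 0 < sum_list hs"
proof (induction hs)
  case (Cons h hs)
  then show ?case by (cases hs) auto
qed simp

lemma uniform_partition: assumes "t > 0"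
  shows "pos_list (uniform_partition t n)" "sum_list (uniform_partition t n) = t"
  using assms by (simp_all add: uniform_partition_def pos_list_def sum_list_replicate del: replicate_Suc of_nat_Suc)

lemma pos_list_induct [consumes 1, case_names single Cons]:
  assumes "pos_list hs" "\<And>h. 0 < h \<Longrightarrow> P [h]"
    "\<And>h hs. \<lbrakk>0 < h; pos_list hs; 0 < sum_list hs; P hs\<rbrakk> \<Longrightarrow> P (h # hs)"
  shows "P hs"
  using assms(1)
proof (induction hs)
  case (Cons h hs)
  show ?case
  proof (cases "hs = []")
    case False
    then have "0 < h" "pos_list hs" using Cons.prems by (auto simp: pos_list_Cons)
    then show ?thesis using assms(3) Cons.IH sum_list_pos by blast
  qed (use Cons.prems assms(2) in simp)
qed simp

text \<open>Approximants indexed by partitions that are close to each other as soon as both partitions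
  are fine have a limit along every sequence of partitions whose error tends to zero.\<close>

lemma (in product_system) partition_limit:
  assumes X: "\<And>hs. pos_list hs \<Longrightarrow> X hs \<in> carrier (fibre E (sum_list hs))"
    and diff: "\<And>hs ks. \<lbrakk>pos_list hs; pos_list ks; sum_list hs = sum_list ks\<rbrakk> \<Longrightarrow>
        hnorm (fibre E (sum_list hs)) (X hs \<ominus>\<^bsub>fibre E (sum_list hs)\<^esub> X ks) \<le> \<epsilon> hs + \<epsilon> ks"
    and unif: "\<And>t. t > 0 \<Longrightarrow> (\<lambda>n. \<epsilon> (uniform_partition t n)) \<longlonglongrightarrow> 0"
  obtains L where "\<And>t P. \<lbrakk>t > 0; \<And>n. pos_list (P n); \<And>n. sum_list (P n) = t; (\<lambda>n. \<epsilon> (P n)) \<longlonglongrightarrow> 0\<rbrakk>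
      \<Longrightarrow> hconv (fibre E t) (\<lambda>n. X (P n)) (L t)"
proof -
  have ex: "\<exists>x. hconv (H t) (\<lambda>n. X (uniform_partition t n)) x" if t: "t > 0" for t
  proof -
    interpret hilbert_space "H t" by (rule hilbert_fibre[OF t])
    note U = uniform_partition[OF t]
    show ?thesis
    proof (rule cauchy_hconv)
      show "X (uniform_partition t n) \<in> carrier (H t)" for n using X[OF U(1)] U(2) by simp
      fix e :: real assume "e > 0"
      then obtain N where N: "\<And>n. n \<ge> N \<Longrightarrow> norm (\<epsilon> (uniform_partition t n) - 0) < e / 2"
        using LIMSEQ_D[OF unif[OF t], of "e / 2"] by auto
      have "hnorm (H t) (X (uniform_partition t m) \<ominus>\<^bsub>H t\<^esub> X (uniform_partition t n)) < e" if "m \<ge> N" "n \<ge> N" for m n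
        using diff[OF U(1) U(1), of m n] U(2) N[OF that(1)] N[OF that(2)] by (simp add: abs_less_iff)
      then show "\<exists>N. \<forall>m\<ge>N. \<forall>n\<ge>N. hnorm (H t) (X (uniform_partition t m) \<ominus>\<^bsub>H t\<^esub> X (uniform_partition t n)) < e" by blast
    qed
  qed
  define L where "L t = (SOME x. hconv (H t) (\<lambda>n. X (uniform_partition t n)) x)" for t
  have L: "hconv (H t) (\<lambda>n. X (uniform_partition t n)) (L t)" if "t > 0" for t
    unfolding L_def by (rule someI_ex[OF ex[OF that]])
  have "hconv (H t) (\<lambda>n. X (P n)) (L t)"
    if t: "t > 0" and P: "\<And>n. pos_list (P n)" "\<And>n. sum_list (P n) = t" "(\<lambda>n. \<epsilon> (P n)) \<longlonglongrightarrow> 0" for t P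
  proof -
    interpret hilbert_space "H t" by (rule hilbert_fibre[OF t])
    note U = uniform_partition[OF t]
    note l = hconvD[OF L[OF t]]
    have Xc: "X (P n) \<in> carrier (H t)" for n using X[OF P(1)] P(2) by simp
    show ?thesis
    proof (rule hconv_squeeze[OF Xc l(2)])
      fix n
      \<comment> \<open>An arbitrary sequence of partitions with vanishing error is compared term by
        term with the uniform one, along which \<open>L\<close> was chosen.\<close>
      have "hnorm (H t) (X (P n) \<ominus>\<^bsub>H t\<^esub> L t)
        \<le> hnorm (H t) (X (P n) \<ominus>\<^bsub>H t\<^esub> X (uniform_partition t n)) + hnorm (H t) (X (uniform_partition t n) \<ominus>\<^bsub>H t\<^esub> L t)"
        by (rule hnorm_triangle[OF Xc l(1,2)])
      then show "hnorm (H t) (X (P n) \<ominus>\<^bsub>H t\<^esub> L t)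
        \<le> \<epsilon> (P n) + \<epsilon> (uniform_partition t n) + hnorm (H t) (X (uniform_partition t n) \<ominus>\<^bsub>H t\<^esub> L t)"
        using diff[OF P(1) U(1), of n n] P(2) U(2) by simp
      show "(\<lambda>n. \<epsilon> (P n) + \<epsilon> (uniform_partition t n) + hnorm (H t) (X (uniform_partition t n) \<ominus>\<^bsub>H t\<^esub> L t)) \<longlonglongrightarrow> 0"
        using tendsto_add[OF tendsto_add[OF P(3) unif[OF t]] l(3)] by simp
    qed
  qed
  then show ?thesis by (rule that)
qed

text \<open>The difference quotient of exp(z w) at w = 0, taken along w = 1/(n+1). It evaluates
  inner products of logarithmic sums over uniform partitions and recovers an exponent from its
  exponential.\<close>

lemma exp_difference_quotient:
  fixes z :: complex
  shows "(\<lambda>n. of_nat (Suc n) * (exp (z / of_nat (Suc n)) - 1)) \<longlonglongrightarrow> z"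
proof -
  have d: "((\<lambda>w. exp (z * w)) has_field_derivative z) (at 0)"
    by (auto intro!: derivative_eq_intros)
  have l: "filterlim (\<lambda>n. 1 / of_nat (Suc n) :: complex) (at 0) sequentially"
    unfolding filterlim_at using LIMSEQ_Suc[OF lim_1_over_n[where 'a = complex]]
    by (auto intro!: always_eventually simp del: of_nat_Suc)
  have "((\<lambda>w. (exp (z * w) - 1) / w) \<longlongrightarrow> z) (at 0)"
    using d by (simp add: has_field_derivative_iff)
  from filterlim_compose[OF this l] show ?thesis by (simp add: field_simps)
qed

text \<open>Measurability is deferred to \<open>spatial_system\<close>. What it yields about inner
  products, namely that they are exponentials in t, enters the constructions here as explicit
  hypotheses.\<close>

locale normalised_system = product_system E for E :: "('a, 'm) product_system_data_scheme" +
  fixes u :: "real \<Rightarrow> 'a"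
  assumes u_closed [simp]: "t > 0 \<Longrightarrow> u t \<in> carrier (fibre E t)"
    and u_mult: "\<lbrakk>s > 0; t > 0\<rbrakk> \<Longrightarrow> u (s + t) = sys_prod E s t (u s) (u t)"
    and u_norm: "t > 0 \<Longrightarrow> cip (fibre E t) (u t) (u t) = 1"
begin

text \<open>Up to measurability, the units that have inner product 1 with u; \<open>additive\<close>
  describes the roots in the same sense.\<close>

definition unital :: "(real \<Rightarrow> 'a) \<Rightarrow> bool" where
  "unital v \<longleftrightarrow> (\<forall>t>0. v t \<in> carrier (H t) \<and> cip (H t) (u t) (v t) = 1) \<and>
     (\<forall>s>0. \<forall>t>0. v (s + t) = prd s t (v s) (v t))"

definition additive :: "(real \<Rightarrow> 'a) \<Rightarrow> bool" where
  "additive a \<longleftrightarrow> (\<forall>t>0. a t \<in> carrier (H t) \<and> cip (H t) (u t) (a t) = 0) \<and>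
     (\<forall>s>0. \<forall>t>0. a (s + t) = prd s t (a s) (u t) \<oplus>\<^bsub>H (s + t)\<^esub> prd s t (u s) (a t))"

lemma unitalD:
  assumes "unital v"
  shows "t > 0 \<Longrightarrow> v t \<in> carrier (H t)" "t > 0 \<Longrightarrow> cip (H t) (u t) (v t) = 1"
    "\<lbrakk>s > 0; t > 0\<rbrakk> \<Longrightarrow> v (s + t) = prd s t (v s) (v t)"
  using assms by (auto simp: unital_def)

lemma additiveD:
  assumes "additive a"
  shows "t > 0 \<Longrightarrow> a t \<in> carrier (H t)" "t > 0 \<Longrightarrow> cip (H t) (u t) (a t) = 0"
    "\<lbrakk>s > 0; t > 0\<rbrakk> \<Longrightarrow> a (s + t) = prd s t (a s) (u t) \<oplus>\<^bsub>H (s + t)\<^esub> prd s t (u s) (a t)"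
  using assms by (auto simp: additive_def)

lemma cip_commute: "\<lbrakk>t > 0; x \<in> carrier (H t); y \<in> carrier (H t)\<rbrakk> \<Longrightarrow> cip (H t) y x = cnj (cip (H t) x y)"
  by (rule pre_hilbert.cip_commute[OF hilbert_space.pre_hilbert[OF hilbert_fibre]])

lemma unital_cip_u: "\<lbrakk>unital v; t > 0\<rbrakk> \<Longrightarrow> cip (H t) (v t) (u t) = 1"
  using cip_commute[of t "u t" "v t"] unitalD[of v t] by simp

lemma additive_cip_u: "\<lbrakk>additive a; t > 0\<rbrakk> \<Longrightarrow> cip (H t) (a t) (u t) = 0"
  using cip_commute[of t "u t" "a t"] additiveD[of a t] by simp

lemma unital_u: "unital u"
  by (simp add: unital_def u_norm u_mult)

abbreviation "incr v h \<equiv> v h \<ominus>\<^bsub>H h\<^esub> u h"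

fun log_sum :: "(real \<Rightarrow> 'a) \<Rightarrow> real list \<Rightarrow> 'a" where
  "log_sum v [] = undefined"
| "log_sum v [h] = incr v h"
| "log_sum v (h # k # ks) = prd h (sum_list (k # ks)) (incr v h) (u (sum_list (k # ks)))
     \<oplus>\<^bsub>H (h + sum_list (k # ks))\<^esub> prd h (sum_list (k # ks)) (u h) (log_sum v (k # ks))"

lemma log_sum_Cons:
  "hs \<noteq> [] \<Longrightarrow> log_sum v (h # hs) = prd h (sum_list hs) (incr v h) (u (sum_list hs))
     \<oplus>\<^bsub>H (h + sum_list hs)\<^esub> prd h (sum_list hs) (u h) (log_sum v hs)"
  by (cases hs) auto

lemma pos_list_nonempty: "pos_list hs \<Longrightarrow> hs \<noteq> []" by auto

lemma incr_closed: "\<lbrakk>unital v; t > 0\<rbrakk> \<Longrightarrow> incr v t \<in> carrier (H t)"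
  by (simp add: fibre_closed unitalD)

lemma cip_u_incr: "\<lbrakk>unital v; t > 0\<rbrakk> \<Longrightarrow> cip (H t) (u t) (incr v t) = 0"
  by (simp add: cip_simps unitalD u_norm)

lemma cip_incr_u: "\<lbrakk>unital v; t > 0\<rbrakk> \<Longrightarrow> cip (H t) (incr v t) (u t) = 0"
  by (simp add: cip_simps unitalD u_norm unital_cip_u)

lemma cip_incr_incr: "\<lbrakk>unital v; unital w; t > 0\<rbrakk> \<Longrightarrow> cip (H t) (incr v t) (incr w t) = cip (H t) (v t) (w t) - 1"
  by (simp add: fibre_closed cip_simps unitalD u_norm unital_cip_u)

lemma log_sum_closed: assumes v: "unital v" and "pos_list hs"
  shows "log_sum v hs \<in> carrier (H (sum_list hs))"
  using assms(2)
proof (induction rule: pos_list_induct)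
  case (Cons h hs)
  then show ?case
    by (simp add: log_sum_Cons pos_list_nonempty fibre_add_closed prd_closed incr_closed[OF v])
qed (simp add: incr_closed[OF v])

lemma cip_u_log_sum: assumes v: "unital v" and "pos_list hs"
  shows "cip (H (sum_list hs)) (u (sum_list hs)) (log_sum v hs) = 0"
  using assms(2)
proof (induction rule: pos_list_induct)
  case (Cons h hs)
  then show ?case
    by (simp add: log_sum_Cons pos_list_nonempty prd_closed incr_closed[OF v] cip_simps u_mult cip_prd
        log_sum_closed[OF v] cip_u_incr[OF v])
qed (simp add: cip_u_incr[OF v])

text \<open>Increments are orthogonal to u, so the terms of different cells are orthogonal and only
  the diagonal remains.\<close>

lemma cip_log_sum_log_sum: assumes v: "unital v" and w: "unital w" and "pos_list hs"
  shows "cip (H (sum_list hs)) (log_sum v hs) (log_sum w hs) = (\<Sum>h\<leftarrow>hs. cip (H h) (v h) (w h) - 1)"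
  using assms(3)
proof (induction rule: pos_list_induct)
  case (Cons h hs)
  then show ?case
    by (simp add: log_sum_Cons pos_list_nonempty prd_closed fibre_add_closed incr_closed[OF v] incr_closed[OF w] cip_simps cip_prd
        log_sum_closed[OF v] log_sum_closed[OF w] cip_u_incr[OF w] cip_incr_u[OF v] u_norm cip_incr_incr[OF v w])
qed (simp add: cip_incr_incr[OF v w])

text \<open>Both sides are additive when a cell is split off: v has inner product 1 with u on the
  remaining cells, and b is orthogonal to u, so that an increment may be replaced by v. The equality
  is therefore exact for each partition and survives in the limit.\<close>

lemma cip_additive_log_sum: assumes b: "additive b" and v: "unital v" and "pos_list hs"
  shows "cip (H (sum_list hs)) (b (sum_list hs)) (log_sum v hs) = cip (H (sum_list hs)) (b (sum_list hs)) (v (sum_list hs))"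
  using assms(3)
proof (induction rule: pos_list_induct)
  case (single h)
  then show ?case
    by (simp add: cip_simps unitalD[OF v] additiveD(1)[OF b] additive_cip_u[OF b])
next
  case (Cons h hs)
  then show ?case
    by (simp add: log_sum_Cons pos_list_nonempty prd_closed fibre_add_closed incr_closed[OF v] cip_simps cip_prd
        log_sum_closed[OF v] cip_u_incr[OF v] u_norm additiveD[OF b] unitalD[OF v] additive_cip_u[OF b])
qed

text \<open>The source of the additivity of the limit: a regrouping by associativity, in which u is
  multiplicative.\<close>

lemma log_sum_append: assumes v: "unital v" and "pos_list hs" and ks: "pos_list ks"
  shows "log_sum v (hs @ ks) = prd (sum_list hs) (sum_list ks) (log_sum v hs) (u (sum_list ks))
     \<oplus>\<^bsub>H (sum_list hs + sum_list ks)\<^esub> prd (sum_list hs) (sum_list ks) (u (sum_list hs)) (log_sum v ks)"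
  using assms(2)
proof (induction rule: pos_list_induct)
  case (single h)
  then show ?case using ks by (simp add: log_sum_Cons pos_list_nonempty)
next
  case (Cons h hs)
  let ?s = "sum_list hs" and ?t = "sum_list ks"
  have t: "?t > 0" using sum_list_pos[OF ks] .
  note c = incr_closed[OF v] log_sum_closed[OF v \<open>pos_list hs\<close>] log_sum_closed[OF v ks] prd_closed fibre_add_closed
  interpret T: hilbert_space "H (h + (?s + ?t))" by (rule hilbert_fibre) (use Cons t in simp)
  have "log_sum v ((h # hs) @ ks) = prd h (?s + ?t) (incr v h) (u (?s + ?t)) \<oplus>\<^bsub>H (h + (?s + ?t))\<^esub>
     prd h (?s + ?t) (u h) (prd ?s ?t (log_sum v hs) (u ?t) \<oplus>\<^bsub>H (?s + ?t)\<^esub> prd ?s ?t (u ?s) (log_sum v ks))"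
    using Cons ks by (simp add: log_sum_Cons pos_list_nonempty)
  also have "\<dots> = prd h (?s + ?t) (incr v h) (prd ?s ?t (u ?s) (u ?t)) \<oplus>\<^bsub>H (h + (?s + ?t))\<^esub>
     (prd h (?s + ?t) (u h) (prd ?s ?t (log_sum v hs) (u ?t)) \<oplus>\<^bsub>H (h + (?s + ?t))\<^esub> prd h (?s + ?t) (u h) (prd ?s ?t (u ?s) (log_sum v ks)))"
    using Cons t c by (simp add: prd_add_right u_mult)
  also have "\<dots> = (prd (h + ?s) ?t (prd h ?s (incr v h) (u ?s)) (u ?t) \<oplus>\<^bsub>H (h + (?s + ?t))\<^esub>
     prd (h + ?s) ?t (prd h ?s (u h) (log_sum v hs)) (u ?t)) \<oplus>\<^bsub>H (h + (?s + ?t))\<^esub> prd (h + ?s) ?t (prd h ?s (u h) (u ?s)) (log_sum v ks)"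
    using Cons t c prd_closed[of h "?s + ?t"] by (simp add: prd_assoc T.M.a_assoc)
  also have "\<dots> = prd (h + ?s) ?t (log_sum v (h # hs)) (u ?t) \<oplus>\<^bsub>H (h + (?s + ?t))\<^esub> prd (h + ?s) ?t (u (h + ?s)) (log_sum v ks)"
    using Cons t c by (simp add: log_sum_Cons pos_list_nonempty prd_add_left u_mult add.assoc)
  finally show ?case by (simp add: add.assoc)
qed

text \<open>Telescoping in the first cell: v_h v_k - u_h u_k = (v_h - u_h) v_k + u_h (v_k - u_k).
  The tail q that follows the first increment is no longer u, but all that is used later is its
  inner product 1 with the tail u of another logarithmic sum.\<close>

lemma log_sum_split:
  assumes v: "unital v" and h: "h > 0" and k: "k > 0" and ks: "ks = [] \<or> pos_list ks"
  shows "\<exists>q\<in>carrier (H (k + sum_list ks)). cip (H (k + sum_list ks)) (u (k + sum_list ks)) q = 1 \<and>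
     cip (H (k + sum_list ks)) q (u (k + sum_list ks)) = 1 \<and>
     log_sum v ((h + k) # ks) = prd h (k + sum_list ks) (incr v h) q \<oplus>\<^bsub>H (h + (k + sum_list ks))\<^esub>
        prd h (k + sum_list ks) (u h) (log_sum v (k # ks))"
proof -
  note c = incr_closed[OF v] prd_closed fibre_add_closed unitalD(1)[OF v]
  have hk: "incr v (h + k) = prd h k (incr v h) (v k) \<oplus>\<^bsub>H (h + k)\<^esub> prd h k (u h) (incr v k)"
  proof (rule prd_eqI[OF h k])
    fix x y assume "x \<in> carrier (H h)" "y \<in> carrier (H k)"
    then show "cip (H (h + k)) (prd h k x y) (incr v (h + k)) =
      cip (H (h + k)) (prd h k x y) (prd h k (incr v h) (v k) \<oplus>\<^bsub>H (h + k)\<^esub> prd h k (u h) (incr v k))"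
      using h k c by (simp add: unitalD(3)[OF v] u_mult cip_simps cip_prd fibre_closed algebra_simps)
  qed (use h k c in \<open>auto simp: fibre_closed\<close>)
  show ?thesis
  proof (cases "ks = []")
    case True
    then show ?thesis using hk h k unitalD[OF v] unital_cip_u[OF v] by (intro bexI[of _ "v k"]) auto
  next
    case False
    then have ks: "pos_list ks" using ks by simp
    let ?s = "sum_list ks"
    have s: "?s > 0" by (rule sum_list_pos[OF ks])
    note c = c log_sum_closed[OF v ks]
    interpret T: hilbert_space "H (h + (k + ?s))" by (rule hilbert_fibre) (use h k s in simp)
    have hks: "h + k + ?s = h + (k + ?s)" by simp
    let ?q = "prd k ?s (v k) (u ?s)"
    have "log_sum v ((h + k) # ks) =
       prd (h + k) ?s (prd h k (incr v h) (v k) \<oplus>\<^bsub>H (h + k)\<^esub> prd h k (u h) (incr v k)) (u ?s) \<oplus>\<^bsub>H (h + (k + ?s))\<^esub>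
       prd (h + k) ?s (prd h k (u h) (u k)) (log_sum v ks)"
      unfolding log_sum_Cons[OF False] hks hk unfolding u_mult[OF h k] ..
    also have "\<dots> = (prd h (k + ?s) (incr v h) ?q \<oplus>\<^bsub>H (h + (k + ?s))\<^esub> prd h (k + ?s) (u h) (prd k ?s (incr v k) (u ?s)))
       \<oplus>\<^bsub>H (h + (k + ?s))\<^esub> prd h (k + ?s) (u h) (prd k ?s (u k) (log_sum v ks))"
      using h k s c prd_add_left[of "h + k" ?s] by (simp add: prd_assoc hks)
    also have "\<dots> = prd h (k + ?s) (incr v h) ?q \<oplus>\<^bsub>H (h + (k + ?s))\<^esub> prd h (k + ?s) (u h)
       (prd k ?s (incr v k) (u ?s) \<oplus>\<^bsub>H (k + ?s)\<^esub> prd k ?s (u k) (log_sum v ks))"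
      using h k s c by (simp add: prd_add_right T.M.a_assoc)
    also have "\<dots> = prd h (k + ?s) (incr v h) ?q \<oplus>\<^bsub>H (h + (k + ?s))\<^esub> prd h (k + ?s) (u h) (log_sum v (k # ks))"
      using False by (simp add: log_sum_Cons)
    finally show ?thesis
      using h k s c by (intro bexI[of _ ?q]) (simp_all add: u_mult cip_prd unitalD(2)[OF v] unital_cip_u[OF v] u_norm)
  qed
qed

text \<open>The shorter of the two first cells is cut off from both partitions. A common cell h
  contributes exp(c h) - 1 >= c h, the mixed terms vanish because increments are orthogonal to u,
  and the rest is covered by induction on the total number of cells.\<close>

lemma log_sum_lower_bound:
  assumes v: "unital v" and nrm: "\<And>t. t > 0 \<Longrightarrow> cip (H t) (v t) (v t) = of_real (exp (c * t))"
    and "pos_list hs" "pos_list ks" "sum_list hs = sum_list ks"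
  shows "c * sum_list hs \<le> Re (cip (H (sum_list hs)) (log_sum v hs) (log_sum v ks))"
  using assms(3-)
proof (induction "length hs + length ks" arbitrary: hs ks rule: less_induct)
  case less
  have ex: "c * h \<le> exp (c * h) - 1" for h using exp_ge_add_one_self[of "c * h"] by linarith
  have ii: "cip (H h) (incr v h) (incr v h) = of_real (exp (c * h) - 1)" if "h > 0" for h
    using that by (simp add: cip_incr_incr[OF v v] nrm)
  \<comment> \<open>Both orders of the inner product are treated at once, because the roles of the
    two partitions are exchanged when the second one has the shorter first cell.\<close>
  have step: "c * (h + sum_list hs) \<le> Re (cip (H (h + sum_list hs)) (log_sum v (h # hs)) (log_sum v ks)) \<and>
      c * (h + sum_list hs) \<le> Re (cip (H (h + sum_list hs)) (log_sum v ks) (log_sum v (h # hs)))"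
    if h: "h > 0" and hs: "pos_list hs" and ks': "pos_list ks'" and eq: "sum_list hs = sum_list ks'"
      and q: "q \<in> carrier (H (sum_list hs))" "cip (H (sum_list hs)) (u (sum_list hs)) q = 1" "cip (H (sum_list hs)) q (u (sum_list hs)) = 1"
      and ks: "log_sum v ks = prd h (sum_list hs) (incr v h) q \<oplus>\<^bsub>H (h + sum_list hs)\<^esub> prd h (sum_list hs) (u h) (log_sum v ks')"
      and IH: "c * sum_list hs \<le> Re (cip (H (sum_list hs)) (log_sum v hs) (log_sum v ks'))"
        "c * sum_list hs \<le> Re (cip (H (sum_list hs)) (log_sum v ks') (log_sum v hs))"
    for h hs ks ks' q
  proof -
    let ?s = "sum_list hs"
    have s: "?s > 0" by (rule sum_list_pos[OF hs])
    note cl = incr_closed[OF v h] u_closed[OF s] u_closed[OF h] log_sum_closed[OF v hs] log_sum_closed[OF v ks', folded eq] q(1)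
    note cl' = prd_closed[OF h s] fibre_add_closed
    have 1: "cip (H (h + ?s)) (log_sum v (h # hs)) (log_sum v ks) =
        of_real (exp (c * h) - 1) + cip (H ?s) (log_sum v hs) (log_sum v ks')"
      unfolding ks log_sum_Cons[OF pos_list_nonempty[OF hs]]
      using cl h s by (simp add: cl' cip_simps cip_prd ii q cip_u_incr[OF v] cip_incr_u[OF v] u_norm)
    have 2: "cip (H (h + ?s)) (log_sum v ks) (log_sum v (h # hs)) =
        of_real (exp (c * h) - 1) + cip (H ?s) (log_sum v ks') (log_sum v hs)"
      unfolding ks log_sum_Cons[OF pos_list_nonempty[OF hs]]
      using cl h s by (simp add: cl' cip_simps cip_prd ii q cip_u_incr[OF v] cip_incr_u[OF v] u_norm)
    show ?thesis
      unfolding 1 2 plus_complex.simps Re_complex_of_real distrib_left using IH ex[of h] by linarith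
  qed
  obtain h hs' where hs: "hs = h # hs'" "h > 0" "hs' = [] \<or> pos_list hs'"
    using less.prems(1) by (cases hs) (auto simp: pos_list_def)
  obtain k ks' where ks: "ks = k # ks'" "k > 0" "ks' = [] \<or> pos_list ks'"
    using less.prems(2) by (cases ks) (auto simp: pos_list_def)
  have sp: "sum_list hs' \<ge> 0" "sum_list ks' \<ge> 0" "hs' \<noteq> [] \<Longrightarrow> sum_list hs' > 0" "ks' \<noteq> [] \<Longrightarrow> sum_list ks' > 0"
    using hs(3) ks(3) sum_list_pos[of hs'] sum_list_pos[of ks'] by auto
  consider "h = k" "hs' = []" "ks' = []" | "h = k" "pos_list hs'" "pos_list ks'" | "h < k" "pos_list hs'" | "k < h" "pos_list ks'"
    using hs ks less.prems(3) sp by (cases "hs' = []"; cases "ks' = []"; force)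
  then show ?case
  proof cases
    case 1
    then show ?thesis using hs ks ii[of h] ex[of h] by simp
  next
    case 2
    then have eq: "sum_list hs' = sum_list ks'" using less.prems(3) hs ks by simp
    have s: "sum_list hs' > 0" using sum_list_pos[OF 2(2)] .
    have IH: "c * sum_list hs' \<le> Re (cip (H (sum_list hs')) (log_sum v hs') (log_sum v ks'))"
      "c * sum_list hs' \<le> Re (cip (H (sum_list hs')) (log_sum v ks') (log_sum v hs'))"
      using less.hyps[of hs' ks'] less.hyps[of ks' hs'] hs ks 2 eq by simp_all
    have "log_sum v ks = prd h (sum_list hs') (incr v h) (u (sum_list hs')) \<oplus>\<^bsub>H (h + sum_list hs')\<^esub> prd h (sum_list hs') (u h) (log_sum v ks')"
      unfolding ks(1) log_sum_Cons[OF pos_list_nonempty[OF 2(3)]] eq 2(1) by simp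
    from step[OF hs(2) 2(2,3) eq _ _ _ this IH] s show ?thesis by (simp add: u_norm hs)
  next
    case 3
    have s: "sum_list hs' > 0" using sum_list_pos[OF 3(2)] .
    \<comment> \<open>The remainder k - h takes the place of the longer cell k, so that one list
      keeps its length while the other loses a cell.\<close>
    have p: "pos_list ((k - h) # ks')" using 3 ks(3) by (cases "ks' = []") (auto simp: pos_list_Cons)
    have eq: "sum_list hs' = sum_list ((k - h) # ks')" "k - h + sum_list ks' = sum_list hs'" using less.prems(3) hs ks by simp_all
    have IH: "c * sum_list hs' \<le> Re (cip (H (sum_list hs')) (log_sum v hs') (log_sum v ((k - h) # ks')))"
      "c * sum_list hs' \<le> Re (cip (H (sum_list hs')) (log_sum v ((k - h) # ks')) (log_sum v hs'))"
    proof -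
      have "length hs' + length ((k - h) # ks') < length hs + length ks"
        "length ((k - h) # ks') + length hs' < length hs + length ks" by (simp_all add: hs ks)
      then show "c * sum_list hs' \<le> Re (cip (H (sum_list hs')) (log_sum v hs') (log_sum v ((k - h) # ks')))"
        "c * sum_list hs' \<le> Re (cip (H (sum_list hs')) (log_sum v ((k - h) # ks')) (log_sum v hs'))"
        using less.hyps[OF _ 3(2) p eq(1)] less.hyps[OF _ p 3(2) eq(1)[symmetric], folded eq(1)] by blast+
    qed
    obtain q where q: "q \<in> carrier (H (sum_list hs'))" "cip (H (sum_list hs')) (u (sum_list hs')) q = 1" "cip (H (sum_list hs')) q (u (sum_list hs')) = 1"
      "log_sum v ks = prd h (sum_list hs') (incr v h) q \<oplus>\<^bsub>H (h + sum_list hs')\<^esub> prd h (sum_list hs') (u h) (log_sum v ((k - h) # ks'))"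
    proof -
      have "h + (k - h) = k" "k - h > 0" using 3 by auto
      then show ?thesis using log_sum_split[OF v hs(2) _ ks(3), of "k - h"] that unfolding eq(2) ks by metis
    qed
    from step[OF hs(2) 3(2) p eq(1) q IH] show ?thesis by (simp add: hs)
  next
    case 4
    have s: "sum_list ks' > 0" using sum_list_pos[OF 4(2)] .
    have p: "pos_list ((h - k) # hs')" using 4 hs(3) by (cases "hs' = []") (auto simp: pos_list_Cons)
    have eq: "sum_list ks' = sum_list ((h - k) # hs')" "h - k + sum_list hs' = sum_list ks'" "k + sum_list ks' = h + sum_list hs'"
      using less.prems(3) hs ks by simp_all
    have IH: "c * sum_list ks' \<le> Re (cip (H (sum_list ks')) (log_sum v ks') (log_sum v ((h - k) # hs')))"
      "c * sum_list ks' \<le> Re (cip (H (sum_list ks')) (log_sum v ((h - k) # hs')) (log_sum v ks'))"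
    proof -
      have "length ks' + length ((h - k) # hs') < length hs + length ks"
        "length ((h - k) # hs') + length ks' < length hs + length ks" by (simp_all add: hs ks)
      then show "c * sum_list ks' \<le> Re (cip (H (sum_list ks')) (log_sum v ks') (log_sum v ((h - k) # hs')))"
        "c * sum_list ks' \<le> Re (cip (H (sum_list ks')) (log_sum v ((h - k) # hs')) (log_sum v ks'))"
        using less.hyps[OF _ 4(2) p eq(1)] less.hyps[OF _ p 4(2) eq(1)[symmetric], folded eq(1)] by blast+
    qed
    obtain q where q: "q \<in> carrier (H (sum_list ks'))" "cip (H (sum_list ks')) (u (sum_list ks')) q = 1" "cip (H (sum_list ks')) q (u (sum_list ks')) = 1"
      "log_sum v hs = prd k (sum_list ks') (incr v k) q \<oplus>\<^bsub>H (k + sum_list ks')\<^esub> prd k (sum_list ks') (u k) (log_sum v ((h - k) # hs'))"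
    proof -
      have "k + (h - k) = h" "h - k > 0" using 4 by auto
      then show ?thesis using log_sum_split[OF v ks(2) _ hs(3), of "h - k"] that unfolding eq(2) hs by metis
    qed
    from step[OF ks(2) 4(2) p eq(1) q IH] show ?thesis by (simp add: hs ks eq(3))
  qed
qed

text \<open>The squared norm of a logarithmic sum is the sum of the exp(c h) - 1; the sum under the
  root is its excess over the limit c t.\<close>

definition log_err :: "real \<Rightarrow> real list \<Rightarrow> real" where
  "log_err c hs = sqrt (\<Sum>h\<leftarrow>hs. exp (c * h) - 1 - c * h)"

lemma log_err_nonneg: "0 \<le> (\<Sum>h\<leftarrow>hs. exp (c * h) - 1 - c * h)" for c :: real
proof (induction hs)
  case (Cons h hs)
  then show ?case using exp_ge_add_one_self[of "c * h"] unfolding list.map sum_list.Cons by linarith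
qed simp

lemma log_err_uniform: assumes "t > 0" shows "(\<lambda>n. log_err c (uniform_partition t n)) \<longlonglongrightarrow> 0"
proof -
  have "(\<lambda>n. Re (of_nat (Suc n) * (exp (of_real (c * t) / of_nat (Suc n)) - 1))) \<longlonglongrightarrow> Re (of_real (c * t))"
    by (rule tendsto_Re[OF exp_difference_quotient])
  moreover have "Re (of_nat (Suc n) * (exp (complex_of_real (c * t) / of_nat (Suc n)) - 1)) = real (Suc n) * (exp (c * t / real (Suc n)) - 1)" for n
  proof -
    have "of_nat (Suc n) * (exp (complex_of_real (c * t) / of_nat (Suc n)) - 1) = of_real (real (Suc n) * (exp (c * t / real (Suc n)) - 1))"
      by (simp flip: exp_of_real)
    then show ?thesis by (simp del: of_real_mult)
  qed
  ultimately have "(\<lambda>n. real (Suc n) * (exp (c * t / real (Suc n)) - 1)) \<longlonglongrightarrow> c * t"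
    by (simp only: Re_complex_of_real)
  then have "(\<lambda>n. real (Suc n) * (exp (c * t / real (Suc n)) - 1) - c * t) \<longlonglongrightarrow> 0" by (rule LIM_zero)
  moreover have "(\<Sum>h\<leftarrow>uniform_partition t n. exp (c * h) - 1 - c * h) = real (Suc n) * (exp (c * t / real (Suc n)) - 1) - c * t" for n
    by (simp add: uniform_partition_def sum_list_replicate del: of_nat_Suc replicate_Suc) (simp add: field_simps)
  ultimately have "(\<lambda>n. \<Sum>h\<leftarrow>uniform_partition t n. exp (c * h) - 1 - c * h) \<longlonglongrightarrow> 0" by presburger
  from tendsto_real_sqrt[OF this] show ?thesis unfolding log_err_def by simp
qed

text \<open>In the expansion of the squared distance the inner product has real part at least c t by
  \<open>log_sum_lower_bound\<close>. What remains is bounded by the two excesses of the squared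
  norms over c t.\<close>

lemma log_sum_dist:
  assumes v: "unital v" and nrm: "\<And>t. t > 0 \<Longrightarrow> cip (H t) (v t) (v t) = of_real (exp (c * t))"
    and hs: "pos_list hs" and ks: "pos_list ks" and eq: "sum_list hs = sum_list ks"
  shows "hnorm (H (sum_list hs)) (log_sum v hs \<ominus>\<^bsub>H (sum_list hs)\<^esub> log_sum v ks) \<le> log_err c hs + log_err c ks"
proof -
  have t: "sum_list hs > 0" by (rule sum_list_pos[OF hs])
  interpret hilbert_space "H (sum_list hs)" by (rule hilbert_fibre[OF t])
  note c = log_sum_closed[OF v hs] log_sum_closed[OF v ks, folded eq]
  have n: "Re (cip (H (sum_list l)) (log_sum v l) (log_sum v l)) = (\<Sum>h\<leftarrow>l. exp (c * h) - 1)" if l: "pos_list l" for l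
  proof -
    have "(\<Sum>h\<leftarrow>l. cip (H h) (v h) (v h) - 1) = (\<Sum>h\<leftarrow>l. of_real (exp (c * h) - 1))"
      using l by (intro arg_cong[of _ _ sum_list] map_cong refl) (auto simp: pos_list_def nrm)
    also have "\<dots> = of_real (\<Sum>h\<leftarrow>l. exp (c * h) - 1)" by (induction l) auto
    finally show ?thesis using cip_log_sum_log_sum[OF v v l] by simp
  qed
  have e: "(\<Sum>h\<leftarrow>l. exp (c * h) - 1 - c * h) = (\<Sum>h\<leftarrow>l. exp (c * h) - 1) - c * sum_list l" for l
    by (induction l) (auto simp: algebra_simps)
  have lb: "c * sum_list hs \<le> Re (cip (H (sum_list hs)) (log_sum v hs) (log_sum v ks))"
    by (rule log_sum_lower_bound[OF v _ hs ks eq]) (rule nrm)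
  have "(hnorm (H (sum_list hs)) (log_sum v hs \<ominus>\<^bsub>H (sum_list hs)\<^esub> log_sum v ks))\<^sup>2 \<le>
     (\<Sum>h\<leftarrow>hs. exp (c * h) - 1 - c * h) + (\<Sum>h\<leftarrow>ks. exp (c * h) - 1 - c * h)"
    unfolding hnorm_sq_diff[OF c] e hnorm_sq[OF c(1)] hnorm_sq[OF c(2)]
    unfolding eq[symmetric] using lb n[OF hs] n[OF ks, folded eq] by linarith
  then have "hnorm (H (sum_list hs)) (log_sum v hs \<ominus>\<^bsub>H (sum_list hs)\<^esub> log_sum v ks) \<le>
     sqrt ((\<Sum>h\<leftarrow>hs. exp (c * h) - 1 - c * h) + (\<Sum>h\<leftarrow>ks. exp (c * h) - 1 - c * h))"
    by (rule real_le_rsqrt)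
  also have "\<dots> \<le> log_err c hs + log_err c ks"
    unfolding log_err_def by (rule sqrt_add_le_add_sqrt[OF log_err_nonneg log_err_nonneg])
  finally show ?thesis .
qed

definition log_unit :: "(real \<Rightarrow> 'a) \<Rightarrow> real \<Rightarrow> 'a" where
  "log_unit v = (\<lambda>t\<in>{0<..}. THE x. hconv (H t) (\<lambda>n. log_sum v (uniform_partition t n)) x)"

lemma log_unit:
  assumes v: "unital v" and nrm: "\<And>t. t > 0 \<Longrightarrow> cip (H t) (v t) (v t) = of_real (exp (c * t))"
  shows log_unit_hconv: "t > 0 \<Longrightarrow> hconv (H t) (\<lambda>n. log_sum v (uniform_partition t n)) (log_unit v t)"
    and log_unit_additive: "additive (log_unit v)"
proof -
  obtain L where L: "\<And>t P. \<lbrakk>t > 0; \<And>n. pos_list (P n); \<And>n. sum_list (P n) = t; (\<lambda>n. log_err c (P n)) \<longlonglongrightarrow> 0\<rbrakk>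
      \<Longrightarrow> hconv (H t) (\<lambda>n. log_sum v (P n)) (L t)"
    using partition_limit[OF log_sum_closed[OF v] log_sum_dist[OF v nrm] log_err_uniform] by blast
  have LU: "hconv (H t) (\<lambda>n. log_sum v (uniform_partition t n)) (L t)" if "t > 0" for t
    by (rule L[OF that uniform_partition[OF that] log_err_uniform[OF that]])
  have eq: "log_unit v t = L t" if t: "t > 0" for t
  proof -
    have "(THE x. hconv (H t) (\<lambda>n. log_sum v (uniform_partition t n)) x) = L t"
      by (rule the_equality[of "hconv (H t) (\<lambda>n. log_sum v (uniform_partition t n))", OF LU[OF t]
            hilbert_space.hconv_unique[OF hilbert_fibre[OF t] _ LU[OF t]]])
    then show ?thesis unfolding log_unit_def using t by simp
  qed
  show l: "hconv (H t) (\<lambda>n. log_sum v (uniform_partition t n)) (log_unit v t)" if "t > 0" for t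
    using LU[OF that] eq[OF that] by simp
  show "additive (log_unit v)" unfolding additive_def
  proof (intro conjI allI impI)
    fix t :: real assume t: "t > 0"
    interpret hilbert_space "H t" by (rule hilbert_fibre[OF t])
    show "log_unit v t \<in> carrier (H t)" by (rule hconvD(2)[OF l[OF t]])
    have "(\<lambda>n. cip (H t) (u t) (log_sum v (uniform_partition t n))) \<longlonglongrightarrow> cip (H t) (u t) (log_unit v t)"
      by (rule hconv_cip[OF hconv_const l[OF t]]) (use t in simp)
    moreover have "cip (H t) (u t) (log_sum v (uniform_partition t n)) = 0" for n
      using cip_u_log_sum[OF v uniform_partition(1)[OF t]] uniform_partition(2)[OF t] by simp
    ultimately show "cip (H t) (u t) (log_unit v t) = 0" by (simp add: LIMSEQ_const_iff)
  next
    fix s t :: real assume s: "s > 0" and t: "t > 0"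
    interpret hilbert_space "H (s + t)" by (rule hilbert_fibre) (use s t in simp)
    interpret S: hilbert_space "H s" by (rule hilbert_fibre) (use s t in simp)
    interpret T: hilbert_space "H t" by (rule hilbert_fibre) (use s t in simp)
    \<comment> \<open>The limit does not depend on the sequence of partitions, so over s + t it may
      be taken along concatenations, to which \<open>log_sum_append\<close> applies.\<close>
    let ?P = "\<lambda>n. uniform_partition s n @ uniform_partition t n"
    have "(\<lambda>n. log_err c (?P n)) \<longlonglongrightarrow> 0"
    proof (rule tendsto_sandwich[OF always_eventually always_eventually tendsto_const], safe)
      show "0 \<le> log_err c (?P n)" for n unfolding log_err_def using log_err_nonneg by (rule real_sqrt_ge_zero)
      show "log_err c (?P n) \<le> log_err c (uniform_partition s n) + log_err c (uniform_partition t n)" for n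
        unfolding log_err_def map_append sum_list_append by (rule sqrt_add_le_add_sqrt[OF log_err_nonneg log_err_nonneg])
      show "(\<lambda>n. log_err c (uniform_partition s n) + log_err c (uniform_partition t n)) \<longlonglongrightarrow> 0"
        using tendsto_add[OF log_err_uniform[OF s] log_err_uniform[OF t]] by simp
    qed
    then have 1: "hconv (H (s + t)) (\<lambda>n. log_sum v (?P n)) (log_unit v (s + t))"
      using s t uniform_partition pos_list_append by (subst eq) (auto intro!: L)
    have "hconv (H (s + t)) (\<lambda>n. prd s t (log_sum v (uniform_partition s n)) (u t) \<oplus>\<^bsub>H (s + t)\<^esub> prd s t (u s) (log_sum v (uniform_partition t n)))
        (prd s t (log_unit v s) (u t) \<oplus>\<^bsub>H (s + t)\<^esub> prd s t (u s) (log_unit v t))"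
      by (intro hconv_add hconv_prd s t l S.hconv_const T.hconv_const u_closed)
    then have 2: "hconv (H (s + t)) (\<lambda>n. log_sum v (?P n)) (prd s t (log_unit v s) (u t) \<oplus>\<^bsub>H (s + t)\<^esub> prd s t (u s) (log_unit v t))"
      using log_sum_append[OF v uniform_partition(1)[OF s] uniform_partition(1)[OF t]] uniform_partition(2)[OF s] uniform_partition(2)[OF t]
      by simp
    show "log_unit v (s + t) = prd s t (log_unit v s) (u t) \<oplus>\<^bsub>H (s + t)\<^esub> prd s t (u s) (log_unit v t)"
      by (rule hconv_unique[OF 1 2])
  qed
qed

text \<open>Over n + 1 equal cells the inner product of the approximants is the difference quotient
  (n + 1) (exp(t \<gamma> / (n + 1)) - 1).\<close>

lemma cip_log_unit:
  assumes v: "unital v" and nv: "\<And>t. t > 0 \<Longrightarrow> cip (H t) (v t) (v t) = of_real (exp (c * t))"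
    and w: "unital w" and nw: "\<And>t. t > 0 \<Longrightarrow> cip (H t) (w t) (w t) = of_real (exp (d * t))"
    and vw: "\<And>t. t > 0 \<Longrightarrow> cip (H t) (v t) (w t) = exp (of_real t * \<gamma>)" and t: "t > 0"
  shows "cip (H t) (log_unit v t) (log_unit w t) = of_real t * \<gamma>"
proof -
  interpret hilbert_space "H t" by (rule hilbert_fibre[OF t])
  have "(\<lambda>n. cip (H t) (log_sum v (uniform_partition t n)) (log_sum w (uniform_partition t n))) \<longlonglongrightarrow> cip (H t) (log_unit v t) (log_unit w t)"
    by (rule hconv_cip[OF log_unit_hconv[OF v nv t] log_unit_hconv[OF w nw t]])
  moreover have "cip (H t) (log_sum v (uniform_partition t n)) (log_sum w (uniform_partition t n)) =
      of_nat (Suc n) * (exp (of_real t * \<gamma> / of_nat (Suc n)) - 1)" for n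
    using cip_log_sum_log_sum[OF v w uniform_partition(1)[OF t], of n] t vw[of "t / real (Suc n)"]
    unfolding uniform_partition(2)[OF t]
    by (simp add: uniform_partition_def sum_list_replicate del: of_nat_Suc replicate_Suc)
  ultimately show ?thesis
    using exp_difference_quotient[of "of_real t * \<gamma>"] LIMSEQ_unique by simp
qed

lemma cip_additive_log_unit:
  assumes b: "additive b" and v: "unital v" and nv: "\<And>t. t > 0 \<Longrightarrow> cip (H t) (v t) (v t) = of_real (exp (c * t))"
    and t: "t > 0"
  shows "cip (H t) (b t) (log_unit v t) = cip (H t) (b t) (v t)"
proof -
  interpret hilbert_space "H t" by (rule hilbert_fibre[OF t])
  have "(\<lambda>n. cip (H t) (b t) (log_sum v (uniform_partition t n))) \<longlonglongrightarrow> cip (H t) (b t) (log_unit v t)"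
    by (rule hconv_cip[OF hconv_const log_unit_hconv[OF v nv t]]) (use additiveD[OF b] t in simp)
  moreover have "cip (H t) (b t) (log_sum v (uniform_partition t n)) = cip (H t) (b t) (v t)" for n
    using cip_additive_log_sum[OF b v uniform_partition(1)[OF t], of n] unfolding uniform_partition(2)[OF t] .
  ultimately show ?thesis by (simp add: LIMSEQ_const_iff)
qed

end

text \<open>The finer list is a concatenation of blocks, one for each coarse cell and with that cell
  as its sum. Presented block by block so that inner products of \<open>exp_prod\<close> can be
  computed by rule induction.\<close>

inductive refines :: "real list \<Rightarrow> real list \<Rightarrow> bool" where
  single: "\<lbrakk>pos_list ks; h = sum_list ks\<rbrakk> \<Longrightarrow> refines [h] ks"
| append: "\<lbrakk>pos_list ks; h = sum_list ks; refines hs ls\<rbrakk> \<Longrightarrow> refines (h # hs) (ks @ ls)"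

lemma pos_list_ConsI: "\<lbrakk>0 < h; hs = [] \<or> pos_list hs\<rbrakk> \<Longrightarrow> pos_list (h # hs)"
  by (auto simp: pos_list_def)

lemma refinesD:
  assumes "refines hs ks"
  shows "pos_list hs" "pos_list ks" "sum_list hs = sum_list ks"
  using assms
  by (induction rule: refines.induct) (auto simp: sum_list_pos pos_list_append intro!: pos_list_ConsI)

text \<open>Undoes the cut made in \<open>common_refinement\<close>: the piece h is glued back to
  the first coarse cell, while it stays a cell of its own in the refinement.\<close>

lemma refines_grow: "\<lbrakk>refines (k # ks) ls; 0 < h\<rbrakk> \<Longrightarrow> refines ((h + k) # ks) (h # ls)"
proof (erule refines.cases, goal_cases)
  case (1 js l)
  then have "pos_list (h # js)" by (auto intro!: pos_list_ConsI)
  then show ?case using 1 by (auto intro!: refines.single)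
next
  case (2 js l hs ms)
  then have "pos_list (h # js)" by (auto intro!: pos_list_ConsI)
  then have "refines ((h + l) # hs) ((h # js) @ ms)" using 2 by (intro refines.append) auto
  then show ?case using 2 by simp
qed

lemma refines_Cons: "\<lbrakk>refines hs ks; 0 < h\<rbrakk> \<Longrightarrow> refines (h # hs) (h # ks)"
  using refines.append[of "[h]" h hs ks] by simp

text \<open>The shorter of the two first cells becomes the first cell of the refinement and is
  removed from both partitions, which lowers the total number of cells.\<close>

lemma common_refinement:
  assumes "pos_list hs" "pos_list ks" "sum_list hs = sum_list ks"
  shows "\<exists>ls. refines hs ls \<and> refines ks ls"
  using assms
proof (induction "length hs + length ks" arbitrary: hs ks rule: less_induct)
  case less
  obtain h hs' where hs: "hs = h # hs'" "h > 0" "hs' = [] \<or> pos_list hs'"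
    using less.prems(1) by (cases hs) (auto simp: pos_list_def)
  obtain k ks' where ks: "ks = k # ks'" "k > 0" "ks' = [] \<or> pos_list ks'"
    using less.prems(2) by (cases ks) (auto simp: pos_list_def)
  have sp: "sum_list hs' \<ge> 0" "sum_list ks' \<ge> 0" "hs' \<noteq> [] \<Longrightarrow> sum_list hs' > 0" "ks' \<noteq> [] \<Longrightarrow> sum_list ks' > 0"
    using hs(3) ks(3) sum_list_pos[of hs'] sum_list_pos[of ks'] by auto
  consider "h = k" "hs' = []" "ks' = []" | "h = k" "pos_list hs'" "pos_list ks'" | "h < k" "pos_list hs'" | "k < h" "pos_list ks'"
    using hs ks less.prems(3) sp by (cases "hs' = []"; cases "ks' = []"; force)
  then show ?case
  proof cases
    case 1
    then show ?thesis using hs ks by (auto intro!: exI[of _ "[h]"] refines.single)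
  next
    case 2
    then have "sum_list hs' = sum_list ks'" using less.prems(3) hs ks by simp
    then obtain ls where "refines hs' ls" "refines ks' ls"
      using less.hyps[of hs' ks'] 2 hs ks by auto
    then show ?thesis using hs ks 2 by (auto intro!: exI[of _ "h # ls"] refines_Cons)
  next
    case 3
    have p: "pos_list ((k - h) # ks')" using 3 ks(3) by (cases "ks' = []") (auto simp: pos_list_Cons)
    have eq: "sum_list hs' = sum_list ((k - h) # ks')" using less.prems(3) hs ks by simp
    have "length hs' + length ((k - h) # ks') < length hs + length ks" by (simp add: hs ks)
    from less.hyps[OF this 3(2) p eq] obtain ls where "refines hs' ls" "refines ((k - h) # ks') ls" by blast
    then have "refines hs (h # ls)" "refines ks (h # ls)"
      using refines_Cons[of hs' ls h] refines_grow[of "k - h" ks' ls h] hs ks by simp_all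
    then show ?thesis by blast
  next
    case 4
    have p: "pos_list ((h - k) # hs')" using 4 hs(3) by (cases "hs' = []") (auto simp: pos_list_Cons)
    have eq: "sum_list ((h - k) # hs') = sum_list ks'" using less.prems(3) hs ks by simp
    have "length ((h - k) # hs') + length ks' < length hs + length ks" by (simp add: hs ks)
    from less.hyps[OF this p 4(2) eq] obtain ls where "refines ((h - k) # hs') ls" "refines ks' ls" by blast
    then have "refines hs (k # ls)" "refines ks (k # ls)"
      using refines_Cons[of ks' ls k] refines_grow[of "h - k" hs' ls k] hs ks by simp_all
    then show ?thesis by blast
  qed
qed

context normalised_system
begin

section \<open>The exponential of a root\<close>

abbreviation "u_plus a h \<equiv> u h \<oplus>\<^bsub>H h\<^esub> a h"

fun exp_prod :: "(real \<Rightarrow> 'a) \<Rightarrow> real list \<Rightarrow> 'a" where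
  "exp_prod a [] = undefined"
| "exp_prod a [h] = u_plus a h"
| "exp_prod a (h # k # ks) = prd h (sum_list (k # ks)) (u_plus a h) (exp_prod a (k # ks))"

lemma exp_prod_Cons:
  "hs \<noteq> [] \<Longrightarrow> exp_prod a (h # hs) = prd h (sum_list hs) (u_plus a h) (exp_prod a hs)"
  by (cases hs) auto

lemma u_plus_closed: "\<lbrakk>additive a; t > 0\<rbrakk> \<Longrightarrow> u_plus a t \<in> carrier (H t)"
  by (simp add: fibre_closed additiveD)

lemma exp_prod_closed: assumes a: "additive a" and "pos_list hs"
  shows "exp_prod a hs \<in> carrier (H (sum_list hs))"
  using assms(2)
proof (induction rule: pos_list_induct)
  case (Cons h hs)
  then show ?case by (simp add: exp_prod_Cons pos_list_nonempty prd_closed u_plus_closed[OF a])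
qed (simp add: u_plus_closed[OF a])

lemma exp_prod_append: assumes a: "additive a" and "pos_list hs" and ks: "pos_list ks"
  shows "exp_prod a (hs @ ks) = prd (sum_list hs) (sum_list ks) (exp_prod a hs) (exp_prod a ks)"
  using assms(2)
proof (induction rule: pos_list_induct)
  case (single h)
  then show ?case using ks by (simp add: exp_prod_Cons pos_list_nonempty)
next
  case (Cons h hs)
  then show ?case using sum_list_pos[OF ks]
    by (simp add: exp_prod_Cons pos_list_nonempty prd_assoc u_plus_closed[OF a] exp_prod_closed[OF a] ks)
qed

lemma cip_u_u_plus: "\<lbrakk>additive a; t > 0\<rbrakk> \<Longrightarrow> cip (H t) (u t) (u_plus a t) = 1"
  by (simp add: cip_simps additiveD u_norm)

lemma cip_u_exp_prod: assumes a: "additive a" and "pos_list hs"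
  shows "cip (H (sum_list hs)) (u (sum_list hs)) (exp_prod a hs) = 1"
  using assms(2)
proof (induction rule: pos_list_induct)
  case (Cons h hs)
  then show ?case
    by (simp add: exp_prod_Cons pos_list_nonempty u_mult cip_prd u_plus_closed[OF a] exp_prod_closed[OF a] cip_u_u_plus[OF a])
qed (simp add: cip_u_u_plus[OF a])

text \<open>That the squared norm of an additive section is a multiple \<alpha> t of time is a
  hypothesis in this context; \<open>additive_norm'\<close> later supplies it, with \<alpha> the
  squared norm at time 1.\<close>

context
  fixes a and \<alpha> :: real
  assumes a: "additive a" and a_norm: "\<And>t. t > 0 \<Longrightarrow> cip (H t) (a t) (a t) = of_real (\<alpha> * t)" and \<alpha>: "0 \<le> \<alpha>"
begin

lemma cip_a_u_plus: "t > 0 \<Longrightarrow> cip (H t) (a t) (u_plus a t) = of_real (\<alpha> * t)"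
  by (simp add: cip_simps additiveD[OF a] additive_cip_u[OF a] a_norm)

text \<open>Since u has inner product 1 with every factor and with every partial product, splitting
  off a cell h adds exactly \<alpha> h.\<close>

lemma cip_a_exp_prod: assumes "pos_list hs"
  shows "cip (H (sum_list hs)) (a (sum_list hs)) (exp_prod a hs) = of_real (\<alpha> * sum_list hs)"
  using assms
proof (induction rule: pos_list_induct)
  case (Cons h hs)
  have "cip (H (h + sum_list hs)) (a (h + sum_list hs)) (exp_prod a (h # hs)) =
     cip (H h) (a h) (u_plus a h) * cip (H (sum_list hs)) (u (sum_list hs)) (exp_prod a hs) +
     cip (H h) (u h) (u_plus a h) * cip (H (sum_list hs)) (a (sum_list hs)) (exp_prod a hs)"
    using Cons by (simp add: exp_prod_Cons pos_list_nonempty additiveD[OF a] cip_simps cip_prd prd_closed u_plus_closed[OF a] exp_prod_closed[OF a])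
  then show ?case
    using Cons by (simp add: cip_a_u_plus cip_u_u_plus[OF a] cip_u_exp_prod[OF a] algebra_simps)
qed (simp add: cip_a_u_plus)

lemma cip_u_plus_exp_prod: assumes "pos_list hs"
  shows "cip (H (sum_list hs)) (u_plus a (sum_list hs)) (exp_prod a hs) = of_real (1 + \<alpha> * sum_list hs)"
  using sum_list_pos[OF assms] cip_a_exp_prod[OF assms] cip_u_exp_prod[OF a assms]
  by (simp add: cip_simps additiveD[OF a] exp_prod_closed[OF a assms])

text \<open>A single coarse cell h paired with its block gives 1 + \<alpha> h by
  \<open>cip_u_plus_exp_prod\<close>, whatever the block is, and inner products multiply over the
  cells. The value is the squared norm of the coarser vector.\<close>

lemma cip_exp_prod_refines: assumes "refines hs ks"
  shows "cip (H (sum_list hs)) (exp_prod a hs) (exp_prod a ks) = of_real (\<Prod>h\<leftarrow>hs. 1 + \<alpha> * h)"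
  using assms
proof (induction rule: refines.induct)
  case (single ks h)
  then show ?case using cip_u_plus_exp_prod[of ks] by simp
next
  case (append ks h hs ls)
  note r = refinesD[OF append(3)]
  have p: "sum_list ks > 0" "sum_list ls > 0" using sum_list_pos append(1) r by auto
  show ?case
    using append r p cip_u_plus_exp_prod[OF append(1)]
    by (simp add: exp_prod_Cons pos_list_nonempty exp_prod_append[OF a] cip_prd u_plus_closed[OF a] exp_prod_closed[OF a])
       (simp add: cip_prd u_plus_closed[OF a] exp_prod_closed[OF a, of hs, unfolded r(3)] exp_prod_closed[OF a])
qed

lemma refines_self: "pos_list hs \<Longrightarrow> refines hs hs"
proof (induction rule: pos_list_induct)
  case (single h)
  then show ?case by (intro refines.single) auto
qed (rule refines_Cons)

lemma cip_exp_prod_self: "pos_list hs \<Longrightarrow> cip (H (sum_list hs)) (exp_prod a hs) (exp_prod a hs) = of_real (\<Prod>h\<leftarrow>hs. 1 + \<alpha> * h)"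
  by (rule cip_exp_prod_refines[OF refines_self])

lemma prod_le_exp: "pos_list hs \<Longrightarrow> (\<Prod>h\<leftarrow>hs. 1 + \<alpha> * h) \<le> exp (\<alpha> * sum_list hs)"
proof (induction rule: pos_list_induct)
  case (single h)
  then show ?case by simp
next
  case (Cons h hs)
  have "(1 + \<alpha> * h) * (\<Prod>h\<leftarrow>hs. 1 + \<alpha> * h) \<le> exp (\<alpha> * h) * exp (\<alpha> * sum_list hs)"
  proof (rule mult_mono[OF exp_ge_add_one_self Cons(4) exp_ge_zero])
    show "0 \<le> (\<Prod>h\<leftarrow>hs. 1 + \<alpha> * h)"
      using Cons(2) \<alpha> by (intro prod_list_nonneg) (auto simp: pos_list_def intro!: add_nonneg_nonneg mult_nonneg_nonneg intro: less_imp_le)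
  qed
  then show ?case by (simp add: exp_add distrib_left)
qed

text \<open>Under the root stands the amount by which the squared norm of the approximant falls
  short of its limit exp(\<alpha> t).\<close>

definition exp_err :: "real list \<Rightarrow> real" where
  "exp_err hs = sqrt (exp (\<alpha> * sum_list hs) - (\<Prod>h\<leftarrow>hs. 1 + \<alpha> * h))"

text \<open>The inner product equals the squared norm of the coarser vector. The squared distance is
  thus the difference of the squared norms, and the finer one is at most exp(\<alpha> t).\<close>

lemma exp_prod_dist_refines:
  assumes r: "refines hs ks"
  shows "hnorm (H (sum_list hs)) (exp_prod a hs \<ominus>\<^bsub>H (sum_list hs)\<^esub> exp_prod a ks) \<le> exp_err hs"
proof -
  note p = refinesD[OF r]
  have t: "sum_list hs > 0" by (rule sum_list_pos[OF p(1)])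
  interpret hilbert_space "H (sum_list hs)" by (rule hilbert_fibre[OF t])
  note c = exp_prod_closed[OF a p(1)] exp_prod_closed[OF a p(2), folded p(3)]
  have "(hnorm (H (sum_list hs)) (exp_prod a hs \<ominus>\<^bsub>H (sum_list hs)\<^esub> exp_prod a ks))\<^sup>2 =
     (\<Prod>h\<leftarrow>ks. 1 + \<alpha> * h) - (\<Prod>h\<leftarrow>hs. 1 + \<alpha> * h)"
    unfolding hnorm_sq_diff[OF c] hnorm_sq[OF c(1)] hnorm_sq[OF c(2)]
    using cip_exp_prod_refines[OF r] cip_exp_prod_self[OF p(1)] cip_exp_prod_self[OF p(2), folded p(3)] by simp
  also have "\<dots> \<le> exp (\<alpha> * sum_list hs) - (\<Prod>h\<leftarrow>hs. 1 + \<alpha> * h)"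
    using prod_le_exp[OF p(2), folded p(3)] by simp
  finally show ?thesis unfolding exp_err_def by (rule real_le_rsqrt)
qed

lemma exp_prod_dist:
  assumes hs: "pos_list hs" and ks: "pos_list ks" and eq: "sum_list hs = sum_list ks"
  shows "hnorm (H (sum_list hs)) (exp_prod a hs \<ominus>\<^bsub>H (sum_list hs)\<^esub> exp_prod a ks) \<le> exp_err hs + exp_err ks"
proof -
  have t: "sum_list hs > 0" by (rule sum_list_pos[OF hs])
  interpret hilbert_space "H (sum_list hs)" by (rule hilbert_fibre[OF t])
  obtain ls where r: "refines hs ls" "refines ks ls" using common_refinement[OF assms] by blast
  note eql = refinesD(3)[OF r(1)]
  note c = exp_prod_closed[OF a hs] exp_prod_closed[OF a ks, folded eq] exp_prod_closed[OF a refinesD(2)[OF r(1)], folded eql]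
  have "hnorm (H (sum_list hs)) (exp_prod a hs \<ominus>\<^bsub>H (sum_list hs)\<^esub> exp_prod a ks) \<le>
    hnorm (H (sum_list hs)) (exp_prod a hs \<ominus>\<^bsub>H (sum_list hs)\<^esub> exp_prod a ls) +
    hnorm (H (sum_list hs)) (exp_prod a ls \<ominus>\<^bsub>H (sum_list hs)\<^esub> exp_prod a ks)"
    by (rule hnorm_triangle[OF c(1) c(3) c(2)])
  also have "hnorm (H (sum_list hs)) (exp_prod a ls \<ominus>\<^bsub>H (sum_list hs)\<^esub> exp_prod a ks) =
    hnorm (H (sum_list hs)) (exp_prod a ks \<ominus>\<^bsub>H (sum_list hs)\<^esub> exp_prod a ls)"
    by (rule hnorm_minus_commute[OF c(3,2)])
  finally show ?thesis
    using exp_prod_dist_refines[OF r(1)] exp_prod_dist_refines[OF r(2), folded eq] by linarith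
qed

lemma exp_err_tendsto:
  assumes "\<And>n. sum_list (P n) = t" "(\<lambda>n. \<Prod>h\<leftarrow>P n. 1 + \<alpha> * h) \<longlonglongrightarrow> exp (\<alpha> * t)"
  shows "(\<lambda>n. exp_err (P n)) \<longlonglongrightarrow> 0"
proof -
  have "(\<lambda>n. exp (\<alpha> * t) - (\<Prod>h\<leftarrow>P n. 1 + \<alpha> * h)) \<longlonglongrightarrow> exp (\<alpha> * t) - exp (\<alpha> * t)"
    by (intro tendsto_intros assms)
  then have "(\<lambda>n. sqrt (exp (\<alpha> * t) - (\<Prod>h\<leftarrow>P n. 1 + \<alpha> * h))) \<longlonglongrightarrow> sqrt 0"
    by (intro tendsto_real_sqrt) simp
  then show ?thesis by (simp add: exp_err_def assms(1))
qed

lemma prod_uniform: "(\<lambda>n. \<Prod>h\<leftarrow>uniform_partition t n. 1 + \<alpha> * h) \<longlonglongrightarrow> exp (\<alpha> * t)"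
  using LIMSEQ_Suc[OF tendsto_exp_limit_sequentially[of "\<alpha> * t"]]
  by (simp add: uniform_partition_def prod_list_replicate del: replicate_Suc of_nat_Suc)

definition exp_root :: "real \<Rightarrow> 'a" where
  "exp_root = (\<lambda>t\<in>{0<..}. THE x. hconv (H t) (\<lambda>n. exp_prod a (uniform_partition t n)) x)"

lemma exp_root:
  shows exp_root_hconv: "t > 0 \<Longrightarrow> hconv (H t) (\<lambda>n. exp_prod a (uniform_partition t n)) (exp_root t)"
    and exp_root_unital: "unital exp_root"
proof -
  have unif: "(\<lambda>n. exp_err (uniform_partition t n)) \<longlonglongrightarrow> 0" if "t > 0" for t
    by (rule exp_err_tendsto[OF uniform_partition(2)[OF that] prod_uniform])
  obtain L where L: "\<And>t P. \<lbrakk>t > 0; \<And>n. pos_list (P n); \<And>n. sum_list (P n) = t; (\<lambda>n. exp_err (P n)) \<longlonglongrightarrow> 0\<rbrakk>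
      \<Longrightarrow> hconv (H t) (\<lambda>n. exp_prod a (P n)) (L t)"
    using partition_limit[OF exp_prod_closed[OF a] exp_prod_dist unif] by blast
  have LU: "hconv (H t) (\<lambda>n. exp_prod a (uniform_partition t n)) (L t)" if "t > 0" for t
    by (rule L[OF that uniform_partition[OF that] unif[OF that]])
  have eq: "exp_root t = L t" if t: "t > 0" for t
  proof -
    have "(THE x. hconv (H t) (\<lambda>n. exp_prod a (uniform_partition t n)) x) = L t"
      by (rule the_equality[of "hconv (H t) (\<lambda>n. exp_prod a (uniform_partition t n))", OF LU[OF t]
            hilbert_space.hconv_unique[OF hilbert_fibre[OF t] _ LU[OF t]]])
    then show ?thesis unfolding exp_root_def using t by simp
  qed
  show l: "hconv (H t) (\<lambda>n. exp_prod a (uniform_partition t n)) (exp_root t)" if "t > 0" for t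
    using LU[OF that] eq[OF that] by simp
  show "unital exp_root" unfolding unital_def
  proof (intro conjI allI impI)
    fix t :: real assume t: "t > 0"
    interpret hilbert_space "H t" by (rule hilbert_fibre[OF t])
    show "exp_root t \<in> carrier (H t)" by (rule hconvD(2)[OF l[OF t]])
    have "(\<lambda>n. cip (H t) (u t) (exp_prod a (uniform_partition t n))) \<longlonglongrightarrow> cip (H t) (u t) (exp_root t)"
      by (rule hconv_cip[OF hconv_const l[OF t]]) (use t in simp)
    moreover have "cip (H t) (u t) (exp_prod a (uniform_partition t n)) = 1" for n
      using cip_u_exp_prod[OF a uniform_partition(1)[OF t]] uniform_partition(2)[OF t] by simp
    ultimately show "cip (H t) (u t) (exp_root t) = 1" by (simp add: LIMSEQ_const_iff)
  next
    fix s t :: real assume s: "s > 0" and t: "t > 0"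
    interpret hilbert_space "H (s + t)" by (rule hilbert_fibre) (use s t in simp)
    let ?P = "\<lambda>n. uniform_partition s n @ uniform_partition t n"
    have "(\<lambda>n. exp_err (?P n)) \<longlonglongrightarrow> 0"
    proof (rule exp_err_tendsto)
      show "sum_list (?P n) = s + t" for n using uniform_partition s t by simp
      show "(\<lambda>n. \<Prod>h\<leftarrow>?P n. 1 + \<alpha> * h) \<longlonglongrightarrow> exp (\<alpha> * (s + t))"
        using tendsto_mult[OF prod_uniform[of s] prod_uniform[of t]] by (simp add: exp_add distrib_left)
    qed
    then have 1: "hconv (H (s + t)) (\<lambda>n. exp_prod a (?P n)) (exp_root (s + t))"
      using s t uniform_partition pos_list_append by (subst eq) (auto intro!: L)
    have "hconv (H (s + t)) (\<lambda>n. prd s t (exp_prod a (uniform_partition s n)) (exp_prod a (uniform_partition t n)))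
        (prd s t (exp_root s) (exp_root t))"
      by (intro hconv_prd s t l)
    then have 2: "hconv (H (s + t)) (\<lambda>n. exp_prod a (?P n)) (prd s t (exp_root s) (exp_root t))"
      using exp_prod_append[OF a uniform_partition(1)[OF s] uniform_partition(1)[OF t]] uniform_partition(2)[OF s] uniform_partition(2)[OF t]
      by simp
    show "exp_root (s + t) = prd s t (exp_root s) (exp_root t)"
      by (rule hconv_unique[OF 1 2])
  qed
qed

lemma cip_exp_root_self:
  assumes t: "t > 0" shows "cip (H t) (exp_root t) (exp_root t) = of_real (exp (\<alpha> * t))"
proof -
  interpret hilbert_space "H t" by (rule hilbert_fibre[OF t])
  have "(\<lambda>n. cip (H t) (exp_prod a (uniform_partition t n)) (exp_prod a (uniform_partition t n))) \<longlonglongrightarrow> cip (H t) (exp_root t) (exp_root t)"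
    by (rule hconv_cip[OF exp_root_hconv[OF t] exp_root_hconv[OF t]])
  moreover have "cip (H t) (exp_prod a (uniform_partition t n)) (exp_prod a (uniform_partition t n)) = of_real (\<Prod>h\<leftarrow>uniform_partition t n. 1 + \<alpha> * h)" for n
    using cip_exp_prod_self[OF uniform_partition(1)[OF t]] uniform_partition(2)[OF t] by simp
  ultimately show ?thesis
    using tendsto_of_real[OF prod_uniform[of t], where 'a = complex] LIMSEQ_unique by simp
qed

lemma cip_a_exp_root:
  assumes t: "t > 0" shows "cip (H t) (a t) (exp_root t) = of_real (\<alpha> * t)"
proof -
  interpret hilbert_space "H t" by (rule hilbert_fibre[OF t])
  have "(\<lambda>n. cip (H t) (a t) (exp_prod a (uniform_partition t n))) \<longlonglongrightarrow> cip (H t) (a t) (exp_root t)"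
    by (rule hconv_cip[OF hconv_const exp_root_hconv[OF t]]) (use t additiveD[OF a] in simp)
  moreover have "cip (H t) (a t) (exp_prod a (uniform_partition t n)) = of_real (\<alpha> * t)" for n
    using cip_a_exp_prod[OF uniform_partition(1)[OF t]] uniform_partition(2)[OF t] by simp
  ultimately show ?thesis by (simp add: LIMSEQ_const_iff)
qed

text \<open>The vectors \<open>log_unit exp_root t\<close> and \<open>a t\<close> both have squared norm \<open>\<alpha> t\<close>, and their inner
  product is \<open>\<alpha> t\<close>, so that they coincide.\<close>

lemma log_exp_root:
  assumes t: "t > 0" shows "log_unit exp_root t = a t"
proof -
  interpret hilbert_space "H t" by (rule hilbert_fibre[OF t])
  note n = cip_exp_root_self
  have add: "additive (log_unit exp_root)" by (rule log_unit_additive[OF exp_root_unital n])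
  have vw: "cip (H t) (exp_root t) (exp_root t) = exp (of_real t * of_real \<alpha>)" if "t > 0" for t
    using n[OF that] by (simp add: mult.commute flip: exp_of_real)
  have 1: "cip (H t) (log_unit exp_root t) (log_unit exp_root t) = of_real (\<alpha> * t)"
    using cip_log_unit[OF exp_root_unital n exp_root_unital n vw t] by (simp add: mult.commute)
  have 2: "cip (H t) (a t) (log_unit exp_root t) = of_real (\<alpha> * t)"
    using cip_additive_log_unit[OF a exp_root_unital n t] cip_a_exp_root[OF t] by simp
  note c = additiveD(1)[OF add t] additiveD(1)[OF a t]
  have 3: "cip (H t) (log_unit exp_root t) (a t) = of_real (\<alpha> * t)"
    using cip_commute[OF c(2) c(1)] 2 by simp
  have "(hnorm (H t) (log_unit exp_root t \<ominus>\<^bsub>H t\<^esub> a t))\<^sup>2 = 0"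
    unfolding hnorm_sq_diff[OF c] hnorm_sq[OF c(1)] hnorm_sq[OF c(2)] 1 3 a_norm[OF t] by simp
  then show ?thesis using hnorm_diff_eq_0[OF c] by simp
qed

end

text \<open>Passing to logarithms, \<gamma> is found from the inner product of the logarithm of
  \<open>exp_root (log_unit v)\<close> with \<open>log_unit v\<close>. The former is again
  \<open>log_unit v\<close> by \<open>log_exp_root\<close>, whence \<gamma> = c; the inner product
  of the two sections then equals both squared norms, and their distance is zero.\<close>

lemma exp_log_unit:
  assumes v: "unital v" and nv: "\<And>t. t > 0 \<Longrightarrow> cip (H t) (v t) (v t) = of_real (exp (c * t))" and c: "0 \<le> c"
    and ev: "\<And>t. t > 0 \<Longrightarrow> cip (H t) (exp_root (log_unit v) t) (v t) = exp (of_real t * \<gamma>)"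
    and t: "t > 0"
  shows "exp_root (log_unit v) t = v t"
proof -
  interpret hilbert_space "H t" by (rule hilbert_fibre[OF t])
  have vv: "cip (H t) (v t) (v t) = exp (of_real t * of_real c)" if "t > 0" for t
    using nv[OF that] by (simp add: mult.commute flip: exp_of_real)
  have ll: "cip (H t) (log_unit v t) (log_unit v t) = of_real (c * t)" if "t > 0" for t
    using cip_log_unit[OF v nv v nv vv that] by (simp add: mult.commute)
  have a: "additive (log_unit v)" by (rule log_unit_additive[OF v nv])
  have e: "unital (exp_root (log_unit v))" by (rule exp_root_unital[OF a ll c])
  have ne: "cip (H t) (exp_root (log_unit v) t) (exp_root (log_unit v) t) = of_real (exp (c * t))" if "t > 0" for t
    by (rule cip_exp_root_self[OF a ll c that])
  have "cip (H t) (log_unit (exp_root (log_unit v)) t) (log_unit v t) = of_real t * \<gamma>"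
    by (rule cip_log_unit[OF e ne v nv ev t])
  then have "of_real t * \<gamma> = of_real (c * t)"
    using log_exp_root[OF a ll c t] ll[OF t] by metis
  then have 1: "cip (H t) (exp_root (log_unit v) t) (v t) = of_real (exp (c * t))"
    using ev[OF t] by (simp only: exp_of_real)
  note cl = unitalD(1)[OF e t] unitalD(1)[OF v t]
  have "(hnorm (H t) (exp_root (log_unit v) t \<ominus>\<^bsub>H t\<^esub> v t))\<^sup>2 = 0"
    unfolding hnorm_sq_diff[OF cl] hnorm_sq[OF cl(1)] hnorm_sq[OF cl(2)] 1 nv[OF t] ne[OF t] by simp
  then show ?thesis using hnorm_diff_eq_0[OF cl] by simp
qed

end

section \<open>Measurable multiplicative functions\<close>

text \<open>A single t leaves an ambiguity of multiples of 2 \<pi> \<i> / t; the exponent is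
  recovered as a limit for t tending to 0.\<close>

lemma exp_of_real_eq_imp:
  fixes z w :: complex
  assumes "\<And>t::real. t > 0 \<Longrightarrow> exp (of_real t * z) = exp (of_real t * w)"
  shows "z = w"
proof -
  have "(\<lambda>n. of_nat (Suc n) * (exp (z / of_nat (Suc n)) - 1)) = (\<lambda>n. of_nat (Suc n) * (exp (w / of_nat (Suc n)) - 1))"
  proof
    fix n
    have "exp (z / of_nat (Suc n)) = exp (w / of_nat (Suc n))"
      using assms[of "1 / real (Suc n)"] by (simp del: of_nat_Suc)
    then show "of_nat (Suc n) * (exp (z / of_nat (Suc n)) - 1) = of_nat (Suc n) * (exp (w / of_nat (Suc n)) - 1)" by simp
  qed
  then show ?thesis
    using exp_difference_quotient[of z] exp_difference_quotient[of w] LIMSEQ_unique by simp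
qed

text \<open>By Henstock's lemma a unimodular integrable function has a nonzero integral over some interval.\<close>

lemma unimodular_interval_integral:
  fixes g :: "real \<Rightarrow> complex"
  assumes g: "g integrable_on {1..2}" and u: "\<And>t. t > 0 \<Longrightarrow> cmod (g t) = 1"
  shows "\<exists>p q. 1 \<le> p \<and> p \<le> q \<and> integral {p..q} g \<noteq> 0"
proof (rule ccontr)
  assume "\<not> ?thesis"
  then have zero: "integral {p..q} g = 0" if "1 \<le> p" "p \<le> q" for p q using that by blast
  have g': "g integrable_on cbox 1 2" using g by simp
  \<comment> \<open>The bound 1 is the length of {1..2}: with vanishing integrals and unimodular
    values each term of the Henstock sum is the length of its interval, so that the sum equals
    1.\<close>
  obtain \<gamma> where \<gamma>: "gauge \<gamma>"
    and h: "\<And>p. \<lbrakk>p tagged_partial_division_of cbox 1 2; \<gamma> fine p\<rbrakk> \<Longrightarrow>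
      (\<Sum>(x, k)\<in>p. norm (measure lborel k *\<^sub>R g x - integral k g)) < 1"
    using Henstock_lemma[OF g', of 1] by auto
  obtain p where p: "p tagged_division_of cbox 1 2" "\<gamma> fine p"
    using fine_division_exists[OF \<gamma>] by blast
  have "norm (measure lborel k *\<^sub>R g x - integral k g) = measure lborel k" if "(x, k) \<in> p" for x k
  proof -
    note xk = that
    obtain a b where k: "k = {a..b}" using tagged_division_ofD(4)[OF p(1) xk] by (auto simp: box_real)
    have x: "x \<in> k" "k \<subseteq> {1..2}" using tagged_division_ofD(2,3)[OF p(1) xk] by auto
    then have "1 \<le> a" "a \<le> b" using k by auto
    then show ?thesis using zero[of a b] u[of x] x k by simp
  qed
  then have "(\<Sum>(x, k)\<in>p. norm (measure lborel k *\<^sub>R g x - integral k g)) = (\<Sum>(x, k)\<in>p. measure lborel k)"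
    by (intro sum.cong) auto
  also have "\<dots> = measure lborel (cbox (1::real) 2)" by (rule additive_content_tagged_division[OF p(1)])
  finally show False using h[OF _ p(2)] p(1) by (simp add: tagged_division_of_def)
qed

text \<open>Multiplication by a nonzero integral C over {p..q} turns f(t) into the integral over the
  interval translated by t. Regularity improves by itself: that integral is continuous in t, hence f
  is, hence the integral is differentiable, and f' = \<kappa> f.\<close>

lemma unimodular_multiplicative:
  fixes g :: "real \<Rightarrow> complex"
  assumes meas: "g \<in> borel_measurable (restrict_space borel {0<..})"
    and u: "\<And>t. t > 0 \<Longrightarrow> cmod (g t) = 1"
    and mult: "\<And>s t. \<lbrakk>s > 0; t > 0\<rbrakk> \<Longrightarrow> g (s + t) = g s * g t"
  shows "\<exists>\<kappa>. \<forall>t>0. g t = exp (of_real t * \<kappa>)"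
proof -
  \<comment> \<open>The extension by 0 is Borel on the whole line and bounded, hence integrable over
    every compact interval.\<close>
  define f where "f t = (if t > 0 then g t else 0)" for t
  have fg: "f t = g t" if "t > 0" for t using that by (simp add: f_def)
  have "(\<lambda>t. indicator {0<..} t *\<^sub>R g t) \<in> borel_measurable borel"
    using meas by (simp add: borel_measurable_restrict_space_iff)
  also have "(\<lambda>t. indicator {0<..} t *\<^sub>R g t) = f" by (auto simp: f_def fun_eq_iff)
  finally have fm: "f \<in> borel_measurable borel" .
  have int: "f integrable_on {a..b}" for a b
  proof (rule measurable_bounded_by_integrable_imp_integrable)
    show "f \<in> borel_measurable (lebesgue_on {a..b})"
      using fm by (intro measurable_restrict_space1 measurable_completion) simp
    show "(\<lambda>x. 1::real) integrable_on {a..b}" by (rule integrable_const_ivl)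
    show "norm (f x) \<le> 1" for x using u by (simp add: f_def)
  qed auto
  obtain p q where pq: "1 \<le> p" "p \<le> q" "integral {p..q} f \<noteq> 0"
    using unimodular_interval_integral[OF int] u fg by metis
  define C where "C = integral {p..q} f"
  define G where "G x = integral {0..x} f" for x
  have diff: "integral {a..b} f = G b - G a" if "0 \<le> a" "a \<le> b" for a b
    unfolding G_def using Henstock_Kurzweil_Integration.integral_combine[OF that int[of 0 b]]
    by (simp add: eq_diff_eq add.commute)
  have shift: "f t * C = G (q + t) - G (p + t)" if t: "t > 0" for t
  proof -
    have "f t * C = integral {p..q} (\<lambda>x. f t * f x)" unfolding C_def by simp
    also have "\<dots> = integral {p..q} (f \<circ> (+) t)"
      by (rule integral_cong) (use t pq mult in \<open>simp add: f_def\<close>)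
    also have "\<dots> = integral {p + t..q + t} f" by (rule integral_shift_Icc_real)
    also have "\<dots> = G (q + t) - G (p + t)" by (rule diff) (use t pq in auto)
    finally show ?thesis .
  qed
  have Gc: "continuous_on {0..b} G" for b
    unfolding G_def by (rule indefinite_integral_continuous_1[OF int])
  have Gc': "continuous_on {0<..} G"
  proof (rule continuous_at_imp_continuous_on, safe)
    fix x :: real assume "x > 0"
    then have "x \<in> interior {0..x + 1}" by simp
    then show "isCont G x" using Gc[of "x + 1"] continuous_on_interior by blast
  qed
  have "continuous_on {0<..} (\<lambda>t. (G (q + t) - G (p + t)) / C)"
    using pq by (intro continuous_intros continuous_on_compose2[OF Gc']) (auto simp: C_def)
  then have fc: "continuous_on {0<..} f"
    by (rule continuous_on_eq) (use shift pq in \<open>auto simp: C_def field_simps\<close>)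
  have Gd: "(G has_vector_derivative f x) (at x)" if x: "x > 0" for x
  proof -
    have "((\<lambda>y. integral {x/2..y} f) has_vector_derivative f x) (at x within {x/2..x+1})"
      by (rule integral_has_vector_derivative) (use x in \<open>auto intro: continuous_on_subset[OF fc]\<close>)
    then have "((\<lambda>y. integral {x/2..y} f) has_vector_derivative f x) (at x)"
      using x by (simp add: at_within_Icc_at)
    then have "((\<lambda>y. integral {x/2..y} f + G (x/2)) has_vector_derivative f x) (at x)"
      by (auto intro!: derivative_eq_intros)
    then show ?thesis
      by (rule has_vector_derivative_transform_within_open[of _ _ _ "{x/2<..}"]) (use x diff[of "x/2"] in auto)
  qed
  \<comment> \<open>This constant comes from differentiating f(t) C = G(q + t) - G(p + t) and using
    f(q + t) = f(q) f(t), and likewise for p.\<close>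
  define \<kappa> where "\<kappa> = (f q - f p) / C"
  have fd: "(f has_vector_derivative \<kappa> * f t) (at t)" if t: "t > 0" for t
  proof -
    have d: "((+) c has_vector_derivative 1) (at t)" for c :: real
      unfolding has_real_derivative_iff_has_vector_derivative[symmetric]
      by (auto intro!: derivative_eq_intros)
    have "((\<lambda>s. G (q + s)) has_vector_derivative f (q + t)) (at t)"
      using Gd[of "q + t"] pq t vector_diff_chain_at[OF d[of q], of G "f (q + t)"]
      by (auto simp: o_def)
    moreover have "((\<lambda>s. G (p + s)) has_vector_derivative f (p + t)) (at t)"
      using Gd[of "p + t"] pq t vector_diff_chain_at[OF d[of p], of G "f (p + t)"]
      by (auto simp: o_def)
    ultimately have "((\<lambda>s. (G (q + s) - G (p + s)) / C) has_vector_derivative (f (q + t) - f (p + t)) / C) (at t)"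
      by (intro has_vector_derivative_divide has_vector_derivative_diff)
    moreover have "(f (q + t) - f (p + t)) / C = \<kappa> * f t"
      using t pq mult by (simp add: f_def \<kappa>_def field_simps)
    ultimately have "((\<lambda>s. (G (q + s) - G (p + s)) / C) has_vector_derivative \<kappa> * f t) (at t)" by simp
    then show ?thesis
      by (rule has_vector_derivative_transform_within_open[of _ _ _ "{0<..}"])
         (use t shift pq in \<open>auto simp: C_def field_simps\<close>)
  qed
  define h where "h t = f t * exp (- (of_real t * \<kappa>))" for t
  have hd: "(h has_vector_derivative 0) (at t)" if "t > 0" for t
  proof -
    have "((\<lambda>t. exp (- (of_real t * \<kappa>))) has_vector_derivative (- \<kappa> * exp (- (of_real t * \<kappa>)))) (at t)"
      by (rule has_vector_derivative_real_field[of "\<lambda>z. exp (- (z * \<kappa>))"]) (auto intro!: derivative_eq_intros)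
    from has_vector_derivative_mult[OF fd[OF that] this] show ?thesis
      unfolding h_def by (simp add: mult_ac)
  qed
  obtain K where K: "\<And>t. t \<in> {0<..} \<Longrightarrow> h t = K"
    by (rule has_vector_derivative_zero_constant[of "{0<..}" h])
       (auto intro: has_vector_derivative_at_within[OF hd])
  \<comment> \<open>Multiplicativity makes the constant value K idempotent; being nonzero, it is
    1.\<close>
  have "h 1 * h 1 = h 2"
    using mult[of 1 1] fg[of 1] fg[of 2] unfolding h_def by (simp add: exp_double flip: exp_add)
  then have "K * K = K" using K[of 1] K[of 2] by simp
  moreover have "h 1 \<noteq> 0" using u[of 1] fg[of 1] by (auto simp: h_def)
  ultimately have "K = 1" using K[of 1] by simp
  then have "g t = exp (of_real t * \<kappa>)" if "t > 0" for t
    using K[of t] fg[OF that] that by (simp add: h_def exp_minus field_simps)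
  then show ?thesis by blast
qed

text \<open>Halving n times gives k(t) = 2^n k(t/2^n). A nonzero integer at t/2^n would make the
  modulus of k(t) at least 2^n, for every n.\<close>

lemma additive_zero_if_multiples:
  fixes k :: "real \<Rightarrow> real"
  assumes add: "\<And>s t. \<lbrakk>s > 0; t > 0\<rbrakk> \<Longrightarrow> k (s + t) = k s + k t" and int: "\<And>t. t > 0 \<Longrightarrow> k t \<in> \<int>" and t: "t > 0"
  shows "k t = 0"
proof (rule ccontr)
  assume nz: "k t \<noteq> 0"
  have half: "k t = 2 ^ n * k (t / 2 ^ n)" for n
  proof (induction n)
    case (Suc n)
    then show ?case using add[of "t / 2 ^ Suc n" "t / 2 ^ Suc n"] t by (simp add: field_simps)
  qed simp
  obtain n where n: "\<bar>k t\<bar> < 2 ^ n" using real_arch_pow[of 2 "\<bar>k t\<bar>"] by auto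
  have "k (t / 2 ^ n) \<in> \<int>" using int t by simp
  moreover have "k (t / 2 ^ n) \<noteq> 0" using half[of n] nz by auto
  ultimately have "1 \<le> \<bar>k (t / 2 ^ n)\<bar>" using Ints_nonzero_abs_ge1 by blast
  then have "2 ^ n * 1 \<le> 2 ^ n * \<bar>k (t / 2 ^ n)\<bar>" by (intro mult_left_mono) auto
  then show False using n half[of n] by (simp add: abs_mult)
qed

text \<open>The modulus is treated by applying the unimodular case to \<open>exp (\<i> ln \<bar>f\<bar>)\<close>.\<close>

lemma measurable_multiplicative:
  fixes f :: "real \<Rightarrow> complex"
  assumes meas: "f \<in> borel_measurable (restrict_space borel {0<..})"
    and nz: "\<And>t. t > 0 \<Longrightarrow> f t \<noteq> 0"
    and mult: "\<And>s t. \<lbrakk>s > 0; t > 0\<rbrakk> \<Longrightarrow> f (s + t) = f s * f t"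
  shows "\<exists>\<kappa>. \<forall>t>0. f t = exp (of_real t * \<kappa>)"
proof -
  define l where "l t = ln (cmod (f t))" for t
  have lm: "l \<in> borel_measurable (restrict_space borel {0<..})" unfolding l_def using meas by measurable
  have ladd: "l (s + t) = l s + l t" if "s > 0" "t > 0" for s t
    using that nz by (simp add: l_def mult norm_mult ln_mult)
  have "\<exists>\<kappa>. \<forall>t>0. exp (\<i> * of_real (l t)) = exp (of_real t * \<kappa>)"
  proof (rule unimodular_multiplicative)
    show "(\<lambda>t. exp (\<i> * of_real (l t))) \<in> borel_measurable (restrict_space borel {0<..})"
      using lm by measurable
  qed (auto simp: ladd exp_add distrib_left)
  then obtain \<kappa> where \<kappa>: "\<And>t. t > 0 \<Longrightarrow> exp (\<i> * of_real (l t)) = exp (of_real t * \<kappa>)" by blast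
  have "cmod (exp (of_real 1 * \<kappa>)) = 1" using \<kappa>[of 1] by (metis norm_exp_i_times zero_less_one)
  then have re: "Re \<kappa> = 0" by simp
  \<comment> \<open>The integer by which l(t) and t Im \<kappa> differ, in units of 2 \<pi>. It is
    additive in t and therefore zero.\<close>
  define k where "k t = (l t - t * Im \<kappa>) / (2 * pi)" for t
  have "k t = 0" if "t > 0" for t
  proof (rule additive_zero_if_multiples[OF _ _ that])
    show "k (s + t) = k s + k t" if "s > 0" "t > 0" for s t
      using that by (simp add: k_def ladd field_simps)
    fix t :: real assume t: "t > 0"
    obtain n :: int where "\<i> * of_real (l t) = of_real t * \<kappa> + (of_int (2 * n) * pi) * \<i>"
      using \<kappa>[OF t] unfolding exp_eq by blast
    then have "l t = t * Im \<kappa> + 2 * of_int n * pi" by (simp add: complex_eq_iff)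
    then have "k t = of_int n" by (simp add: k_def)
    then show "k t \<in> \<int>" by simp
  qed
  then have lt: "cmod (f t) = exp (t * Im \<kappa>)" if "t > 0" for t
    using that nz[OF that] by (simp add: k_def l_def) (metis exp_ln zero_less_norm_iff)
  have "\<exists>\<kappa>. \<forall>t>0. f t / of_real (cmod (f t)) = exp (of_real t * \<kappa>)"
  proof (rule unimodular_multiplicative)
    show "(\<lambda>t. f t / of_real (cmod (f t))) \<in> borel_measurable (restrict_space borel {0<..})"
      using meas by measurable
  qed (use nz mult in \<open>auto simp: norm_divide norm_mult\<close>)
  then obtain \<mu> where \<mu>: "\<And>t. t > 0 \<Longrightarrow> f t / of_real (cmod (f t)) = exp (of_real t * \<mu>)" by blast
  have "f t = exp (of_real t * (\<mu> + of_real (Im \<kappa>)))" if t: "t > 0" for t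
  proof -
    have "f t = exp (of_real t * \<mu>) * of_real (cmod (f t))" using \<mu>[OF t] nz[OF t] by (simp add: field_simps)
    also have "\<dots> = exp (of_real t * (\<mu> + of_real (Im \<kappa>)))"
      unfolding lt[OF t] by (simp add: distrib_left exp_add flip: exp_of_real)
    finally show ?thesis .
  qed
  then show ?thesis by blast
qed

text \<open>Combinations with Gaussian rational coefficients, encoded as lists so that they are
  indexed by a countable type; the supremum in \<open>measurable_hnorm_sq\<close> runs over
  it.\<close>

fun rat_comb :: "'a hspace \<Rightarrow> ('i \<Rightarrow> 'a) \<Rightarrow> ('i \<times> rat \<times> rat) list \<Rightarrow> 'a" where
  "rat_comb H f [] = \<zero>\<^bsub>H\<^esub>"
| "rat_comb H f ((i, a, b) # l) = Complex (of_rat a) (of_rat b) \<odot>\<^bsub>H\<^esub> f i \<oplus>\<^bsub>H\<^esub> rat_comb H f l"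

section \<open>Measurable fields of vectors\<close>

lemma complex_rat_approx:
  fixes c :: complex assumes "e > 0" shows "\<exists>a b. cmod (c - Complex (of_rat a) (of_rat b)) < e"
proof -
  obtain a where a: "Re c < of_rat a" "of_rat a < Re c + e / 2"
    using of_rat_dense[of "Re c" "Re c + e/2"] assms by auto
  obtain b where b: "Im c < of_rat b" "of_rat b < Im c + e / 2"
    using of_rat_dense[of "Im c" "Im c + e/2"] assms by auto
  have "cmod (c - Complex (of_rat a) (of_rat b)) \<le> \<bar>Re c - of_rat a\<bar> + \<bar>Im c - of_rat b\<bar>"
    using cmod_le[of "c - Complex (of_rat a) (of_rat b)"] by simp
  also have "\<dots> < e" using a b by linarith
  finally show ?thesis by blast
qed

context hilbert_space
begin

lemma rat_comb_closed: "(\<And>i. f i \<in> carrier H) \<Longrightarrow> rat_comb H f l \<in> carrier H"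
proof (induction l)
  case (Cons p l)
  then show ?case by (cases p) auto
qed simp

lemma rat_comb_append: "(\<And>i. f i \<in> carrier H) \<Longrightarrow> rat_comb H f (l @ l') = rat_comb H f l \<oplus> rat_comb H f l'"
proof (induction l)
  case (Cons p l)
  then show ?case by (cases p) (simp add: rat_comb_closed M.a_assoc)
qed (simp add: rat_comb_closed)

lemma rat_comb_smult:
  assumes "\<And>i. f i \<in> carrier H"
  shows "Complex (of_rat c) (of_rat d) \<odot> rat_comb H f l = rat_comb H f (map (\<lambda>(i, a, b). (i, c * a - d * b, c * b + d * a)) l)"
proof (induction l)
  case (Cons p l)
  obtain i a b where p: "p = (i, a, b)" by (cases p)
  have "Complex (of_rat c) (of_rat d) * Complex (of_rat a) (of_rat b) = Complex (of_rat (c * a - d * b)) (of_rat (c * b + d * a))"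
    by (simp add: complex_eq_iff of_rat_mult of_rat_add of_rat_diff)
  then show ?case
    using Cons p smult_assoc1[of "Complex (of_rat c) (of_rat d)" "Complex (of_rat a) (of_rat b)" "f i"]
      smult_r_distr[of "Complex (of_rat c) (of_rat d)" "Complex (of_rat a) (of_rat b) \<odot> f i" "rat_comb H f l"]
      assms rat_comb_closed[of f l] by simp
qed (use smult_r_null in simp)

text \<open>The vectors that rational combinations approximate form a closed subspace containing the
  total family.\<close>

lemma rat_comb_dense:
  assumes f: "\<And>i. f i \<in> carrier H" and tot: "closed_span H (range f) = carrier H" and y: "y \<in> carrier H" and e: "e > 0"
  shows "\<exists>l. hnorm H (y \<ominus> rat_comb H f l) < e"
proof -
  let ?D = "{y \<in> carrier H. \<forall>e>0. \<exists>l. hnorm H (y \<ominus> rat_comb H f l) < e}"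
  have rc: "rat_comb H f l \<in> carrier H" for l by (rule rat_comb_closed[OF f])
  have "closed_subspace H ?D"
  proof (rule closed_subspaceI)
    show "\<zero> \<in> ?D" by (auto intro!: exI[of _ "[]"])
  next
    fix x y assume x: "x \<in> ?D" and y: "y \<in> ?D"
    have "\<exists>l. hnorm H (x \<oplus> y \<ominus> rat_comb H f l) < e" if "e > 0" for e :: real
    proof -
      obtain l l' where l: "hnorm H (x \<ominus> rat_comb H f l) < e / 2" "hnorm H (y \<ominus> rat_comb H f l') < e / 2"
        using x y \<open>e > 0\<close> by (auto dest!: spec[of _ "e / 2"])
      have "x \<oplus> y \<ominus> rat_comb H f (l @ l') = (x \<ominus> rat_comb H f l) \<oplus> (y \<ominus> rat_comb H f l')"
        using x y rc by (simp add: rat_comb_append[OF f] diff_add_add)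
      then have "hnorm H (x \<oplus> y \<ominus> rat_comb H f (l @ l')) < e"
        using hnorm_add_le[of "x \<ominus> rat_comb H f l" "y \<ominus> rat_comb H f l'"] l x y rc by simp
      then show ?thesis by blast
    qed
    then show "x \<oplus> y \<in> ?D" using x y by simp
  next
    fix c x assume x: "x \<in> ?D"
    then have xc: "x \<in> carrier H" by simp
    have "\<exists>l. hnorm H (c \<odot> x \<ominus> rat_comb H f l) < e" if e: "e > 0" for e :: real
    proof -
      \<comment> \<open>The tolerance for x is fixed first; the one for the scalar depends on the
        norm of the combination \<open>?z\<close> found for it. The summands 1 guard against
        division by 0.\<close>
      have "e / (2 * (cmod c + 1)) > 0" using e by (simp add: add_nonneg_pos)
      then obtain l where l: "hnorm H (x \<ominus> rat_comb H f l) < e / (2 * (cmod c + 1))" using x by blast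
      let ?z = "rat_comb H f l"
      have "e / (2 * (hnorm H ?z + 1)) > 0" using e rc by (simp add: add_nonneg_pos)
      then obtain a b where ab: "cmod (c - Complex (of_rat a) (of_rat b)) < e / (2 * (hnorm H ?z + 1))"
        using complex_rat_approx by blast
      let ?r = "Complex (of_rat a) (of_rat b)"
      have "hnorm H (c \<odot> x \<ominus> ?r \<odot> ?z) \<le> hnorm H (c \<odot> x \<ominus> c \<odot> ?z) + hnorm H (c \<odot> ?z \<ominus> ?r \<odot> ?z)"
        by (rule hnorm_triangle) (use xc rc in auto)
      also have "hnorm H (c \<odot> x \<ominus> c \<odot> ?z) = cmod c * hnorm H (x \<ominus> ?z)"
        using xc rc by (simp add: hnorm_smult flip: smult_diff)
      also have "c \<odot> ?z \<ominus> ?r \<odot> ?z = (c - ?r) \<odot> ?z"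
        by (rule hilbert_eqI) (use rc in \<open>auto simp: cip_diff_right cip_smult_right algebra_simps\<close>)
      also have "hnorm H \<dots> = cmod (c - ?r) * hnorm H ?z" using rc by (simp add: hnorm_smult)
      finally have 1: "hnorm H (c \<odot> x \<ominus> ?r \<odot> ?z) \<le> cmod c * hnorm H (x \<ominus> ?z) + cmod (c - ?r) * hnorm H ?z" .
      have "cmod c * hnorm H (x \<ominus> ?z) \<le> (cmod c + 1) * hnorm H (x \<ominus> ?z)"
        using xc rc by (intro mult_right_mono) auto
      also have "\<dots> < (cmod c + 1) * (e / (2 * (cmod c + 1)))"
        using l by (intro mult_strict_left_mono) (auto simp: add_nonneg_pos)
      also have "\<dots> = e / 2" using norm_ge_zero[of c] by (simp add: field_simps add_nonneg_eq_0_iff)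
      finally have 2: "cmod c * hnorm H (x \<ominus> ?z) < e / 2" .
      have "cmod (c - ?r) * hnorm H ?z \<le> cmod (c - ?r) * (hnorm H ?z + 1)"
        by (intro mult_left_mono) auto
      also have "\<dots> < e / (2 * (hnorm H ?z + 1)) * (hnorm H ?z + 1)"
        using ab hnorm_ge_0[OF rc[of l]] by (intro mult_strict_right_mono) linarith+
      also have "\<dots> = e / 2" using hnorm_ge_0[OF rc[of l]] by (simp add: field_simps add_nonneg_eq_0_iff)
      finally have 3: "cmod (c - ?r) * hnorm H ?z < e / 2" .
      have "hnorm H (c \<odot> x \<ominus> rat_comb H f (map (\<lambda>(i, c, d). (i, a * c - b * d, a * d + b * c)) l)) < e"
        using 1 2 3 rat_comb_smult[where f = f and c = a and d = b and l = l, OF f] by simp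
      then show ?thesis by blast
    qed
    then show "c \<odot> x \<in> ?D" using xc by simp
  next
    fix X x assume X: "\<And>n. X n \<in> ?D" and l: "hconv H X x"
    note hc = hconvD[OF l]
    have "\<exists>l. hnorm H (x \<ominus> rat_comb H f l) < e" if e: "e > 0" for e :: real
    proof -
      obtain n where "norm (hnorm H (X n \<ominus> x) - 0) < e / 2"
        using LIMSEQ_D[OF hc(3), of "e / 2"] e by auto
      then have n: "hnorm H (X n \<ominus> x) < e / 2" by simp
      obtain l where l: "hnorm H (X n \<ominus> rat_comb H f l) < e / 2" using X[of n] e by (auto dest!: spec[of _ "e / 2"])
      have "hnorm H (x \<ominus> rat_comb H f l) \<le> hnorm H (x \<ominus> X n) + hnorm H (X n \<ominus> rat_comb H f l)"
        by (rule hnorm_triangle) (use hc rc in auto)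
      then show ?thesis using n l hnorm_minus_commute[of x "X n"] hc by (intro exI[of _ l]) simp
    qed
    then show "x \<in> ?D" using hc(2) by simp
  qed auto
  moreover have "range f \<subseteq> ?D"
  proof safe
    fix i and e :: real assume "e > 0"
    have "rat_comb H f [(i, 1, 0)] = f i"
      using smult_one[of "f i"] f by (simp add: complex_eq_iff flip: one_complex.code)
    then have "hnorm H (f i \<ominus> rat_comb H f [(i, 1, 0)]) < e" using f \<open>e > 0\<close> by simp
    then show "\<exists>l. hnorm H (f i \<ominus> rat_comb H f l) < e" by blast
  qed (rule f)
  ultimately have "closed_span H (range f) \<subseteq> ?D" by (rule closed_span_minimal)
  then show ?thesis using y e unfolding tot by blast
qed

end

lemma measurable_rat_comb:
  assumes H: "\<And>\<omega>. \<omega> \<in> space M \<Longrightarrow> hilbert_space (H \<omega>)"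
    and f: "\<And>i \<omega>. \<omega> \<in> space M \<Longrightarrow> f i \<omega> \<in> carrier (H \<omega>)"
    and y: "\<And>\<omega>. \<omega> \<in> space M \<Longrightarrow> y \<omega> \<in> carrier (H \<omega>)"
    and my: "\<And>i. (\<lambda>\<omega>. cip (H \<omega>) (f i \<omega>) (y \<omega>)) \<in> borel_measurable M"
  shows "(\<lambda>\<omega>. cip (H \<omega>) (rat_comb (H \<omega>) (\<lambda>i. f i \<omega>) l) (y \<omega>)) \<in> borel_measurable M"
proof (induction l)
  case Nil
  have "(\<lambda>\<omega>. 0 :: complex) \<in> borel_measurable M" by simp
  then show ?case
  proof (rule measurable_cong[THEN iffD1, rotated])
    fix \<omega> assume w: "\<omega> \<in> space M"
    interpret hilbert_space "H \<omega>" by (rule H[OF w])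
    show "0 = cip (H \<omega>) (rat_comb (H \<omega>) (\<lambda>i. f i \<omega>) []) (y \<omega>)" using y[OF w] by simp
  qed
next
  case (Cons p l)
  obtain i a b where p: "p = (i, a, b)" by (cases p)
  have "(\<lambda>\<omega>. cnj (Complex (of_rat a) (of_rat b)) * cip (H \<omega>) (f i \<omega>) (y \<omega>) + cip (H \<omega>) (rat_comb (H \<omega>) (\<lambda>i. f i \<omega>) l) (y \<omega>)) \<in> borel_measurable M"
    using my[of i] Cons by measurable
  then show ?case
  proof (rule measurable_cong[THEN iffD1, rotated])
    fix \<omega> assume w: "\<omega> \<in> space M"
    interpret hilbert_space "H \<omega>" by (rule H[OF w])
    show "cnj (Complex (of_rat a) (of_rat b)) * cip (H \<omega>) (f i \<omega>) (y \<omega>) + cip (H \<omega>) (rat_comb (H \<omega>) (\<lambda>i. f i \<omega>) l) (y \<omega>) =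
       cip (H \<omega>) (rat_comb (H \<omega>) (\<lambda>i. f i \<omega>) (p # l)) (y \<omega>)"
      using y[OF w] f[OF w] rat_comb_closed[of "\<lambda>i. f i \<omega>" l] by (simp add: p cip_add_left cip_smult_left)
  qed
qed

text \<open>The squared norm is a countable supremum of measurable functions, since
  \<open>\<parallel>y\<parallel>\<^sup>2 - \<parallel>y - z\<parallel>\<^sup>2 = 2 Re \<langle>z, y\<rangle> - \<parallel>z\<parallel>\<^sup>2\<close>.\<close>

lemma measurable_hnorm_sq:
  fixes f :: "'i::countable \<Rightarrow> 'w \<Rightarrow> 'a"
  assumes H: "\<And>\<omega>. \<omega> \<in> space M \<Longrightarrow> hilbert_space (H \<omega>)"
    and f: "\<And>i \<omega>. \<omega> \<in> space M \<Longrightarrow> f i \<omega> \<in> carrier (H \<omega>)"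
    and tot: "\<And>\<omega>. \<omega> \<in> space M \<Longrightarrow> closed_span (H \<omega>) (range (\<lambda>i. f i \<omega>)) = carrier (H \<omega>)"
    and gram: "\<And>i j. (\<lambda>\<omega>. cip (H \<omega>) (f i \<omega>) (f j \<omega>)) \<in> borel_measurable M"
    and y: "\<And>\<omega>. \<omega> \<in> space M \<Longrightarrow> y \<omega> \<in> carrier (H \<omega>)"
    and my: "\<And>i. (\<lambda>\<omega>. cip (H \<omega>) (f i \<omega>) (y \<omega>)) \<in> borel_measurable M"
  shows "(\<lambda>\<omega>. Re (cip (H \<omega>) (y \<omega>) (y \<omega>))) \<in> borel_measurable M"
proof -
  let ?z = "\<lambda>l \<omega>. rat_comb (H \<omega>) (\<lambda>i. f i \<omega>) l"
  have zc: "?z l \<omega> \<in> carrier (H \<omega>)" if "\<omega> \<in> space M" for l \<omega>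
    by (rule hilbert_space.rat_comb_closed[OF H[OF that] f[OF that]])
  have zf: "(\<lambda>\<omega>. cip (H \<omega>) (f j \<omega>) (?z l \<omega>)) \<in> borel_measurable M" for j l
  proof -
    have "(\<lambda>\<omega>. cip (H \<omega>) (?z l \<omega>) (f j \<omega>)) \<in> borel_measurable M"
      by (rule measurable_rat_comb[of M H f "f j"]) (simp_all add: H f gram)
    then have "(\<lambda>\<omega>. cnj (cip (H \<omega>) (?z l \<omega>) (f j \<omega>))) \<in> borel_measurable M"
      by (rule borel_measurable_continuous_on[rotated]) (intro continuous_intros)
    then show ?thesis
    proof (rule measurable_cong[THEN iffD1, rotated])
      fix \<omega> assume w: "\<omega> \<in> space M"
      interpret hilbert_space "H \<omega>" by (rule H[OF w])
      show "cnj (cip (H \<omega>) (?z l \<omega>) (f j \<omega>)) = cip (H \<omega>) (f j \<omega>) (?z l \<omega>)"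
        by (rule cip_commute[OF zc[OF w] f[OF w], symmetric])
    qed
  qed
  have zz: "(\<lambda>\<omega>. cip (H \<omega>) (?z l \<omega>) (?z l \<omega>)) \<in> borel_measurable M" for l
    by (rule measurable_rat_comb[of M H f, OF H f zc zf])
  have zy: "(\<lambda>\<omega>. cip (H \<omega>) (?z l \<omega>) (y \<omega>)) \<in> borel_measurable M" for l
    by (rule measurable_rat_comb[of M H f, OF H f y my])
  define q where "q l \<omega> = 2 * Re (cip (H \<omega>) (?z l \<omega>) (y \<omega>)) - Re (cip (H \<omega>) (?z l \<omega>) (?z l \<omega>))" for l \<omega>
  have qm: "q l \<in> borel_measurable M" for l
    unfolding q_def using zz[of l] zy[of l] by measurable
  have iff: "Re (cip (H \<omega>) (y \<omega>) (y \<omega>)) > a \<longleftrightarrow> (\<exists>l. q l \<omega> > a)" if w: "\<omega> \<in> space M" for \<omega> a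
  proof -
    interpret hilbert_space "H \<omega>" by (rule H[OF w])
    note c = zc[OF w] y[OF w]
    have eq: "q l \<omega> = Re (cip (H \<omega>) (y \<omega>) (y \<omega>)) - (hnorm (H \<omega>) (y \<omega> \<ominus>\<^bsub>H \<omega>\<^esub> ?z l \<omega>))\<^sup>2" for l
      using hnorm_sq_diff[OF c(2) c(1)[of l]] hnorm_sq[OF c(2)] hnorm_sq[OF c(1)[of l]] Re_cip_commute[OF c(2) c(1)[of l]]
      by (simp add: q_def)
    show ?thesis
    proof
      assume a: "a < Re (cip (H \<omega>) (y \<omega>) (y \<omega>))"
      define e where "e = Re (cip (H \<omega>) (y \<omega>) (y \<omega>)) - a"
      have "sqrt e > 0" using a by (simp add: e_def)
      then obtain l where l: "hnorm (H \<omega>) (y \<omega> \<ominus>\<^bsub>H \<omega>\<^esub> ?z l \<omega>) < sqrt e"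
        using rat_comb_dense[OF f[OF w] tot[OF w] c(2)] by blast
      then have "(hnorm (H \<omega>) (y \<omega> \<ominus>\<^bsub>H \<omega>\<^esub> ?z l \<omega>))\<^sup>2 < (sqrt e)\<^sup>2"
        by (intro power_strict_mono) (use c in auto)
      then show "\<exists>l. q l \<omega> > a" using a eq[of l] by (intro exI[of _ l]) (simp add: e_def)
    next
      assume "\<exists>l. q l \<omega> > a"
      then obtain l where "q l \<omega> > a" by blast
      then show "a < Re (cip (H \<omega>) (y \<omega>) (y \<omega>))"
        using eq[of l] zero_le_power2[of "hnorm (H \<omega>) (y \<omega> \<ominus>\<^bsub>H \<omega>\<^esub> ?z l \<omega>)"] by linarith
    qed
  qed
  show ?thesis
  proof (rule borel_measurable_iff_greater[THEN iffD2], rule allI)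
    fix a
    have "{\<omega> \<in> space M. a < Re (cip (H \<omega>) (y \<omega>) (y \<omega>))} = (\<Union>l. {\<omega> \<in> space M. a < q l \<omega>})"
      using iff by auto
    also have "\<dots> \<in> sets M" using qm by (intro sets.countable_UN' ) auto
    finally show "{\<omega> \<in> space M. a < Re (cip (H \<omega>) (y \<omega>) (y \<omega>))} \<in> sets M" .
  qed
qed

text \<open>Polarisation: the inner product is recovered from the squared norms of c x + y for c =
  1, -1, \<i>, -\<i>. The form is conjugate linear in x, so the scalars \<i> and -\<i> give the
  imaginary part with a positive sign.\<close>

lemma measurable_cip:
  fixes f :: "'i::countable \<Rightarrow> 'w \<Rightarrow> 'a"
  assumes H: "\<And>\<omega>. \<omega> \<in> space M \<Longrightarrow> hilbert_space (H \<omega>)"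
    and f: "\<And>i \<omega>. \<omega> \<in> space M \<Longrightarrow> f i \<omega> \<in> carrier (H \<omega>)"
    and tot: "\<And>\<omega>. \<omega> \<in> space M \<Longrightarrow> closed_span (H \<omega>) (range (\<lambda>i. f i \<omega>)) = carrier (H \<omega>)"
    and gram: "\<And>i j. (\<lambda>\<omega>. cip (H \<omega>) (f i \<omega>) (f j \<omega>)) \<in> borel_measurable M"
    and x: "\<And>\<omega>. \<omega> \<in> space M \<Longrightarrow> x \<omega> \<in> carrier (H \<omega>)"
    and mx: "\<And>i. (\<lambda>\<omega>. cip (H \<omega>) (f i \<omega>) (x \<omega>)) \<in> borel_measurable M"
    and y: "\<And>\<omega>. \<omega> \<in> space M \<Longrightarrow> y \<omega> \<in> carrier (H \<omega>)"
    and my: "\<And>i. (\<lambda>\<omega>. cip (H \<omega>) (f i \<omega>) (y \<omega>)) \<in> borel_measurable M"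
  shows "(\<lambda>\<omega>. cip (H \<omega>) (x \<omega>) (y \<omega>)) \<in> borel_measurable M"
proof -
  define s where "s c \<omega> = c \<odot>\<^bsub>H \<omega>\<^esub> x \<omega> \<oplus>\<^bsub>H \<omega>\<^esub> y \<omega>" for c \<omega>
  have sc: "s c \<omega> \<in> carrier (H \<omega>)" if w: "\<omega> \<in> space M" for c \<omega>
  proof -
    interpret hilbert_space "H \<omega>" by (rule H[OF w])
    show ?thesis using x[OF w] y[OF w] by (simp add: s_def)
  qed
  have "(\<lambda>\<omega>. cip (H \<omega>) (f i \<omega>) (s c \<omega>)) \<in> borel_measurable M" for c i
  proof -
    have "(\<lambda>\<omega>. c * cip (H \<omega>) (f i \<omega>) (x \<omega>) + cip (H \<omega>) (f i \<omega>) (y \<omega>)) \<in> borel_measurable M"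
      using mx[of i] my[of i] by measurable
    then show ?thesis
    proof (rule measurable_cong[THEN iffD1, rotated])
      fix \<omega> assume w: "\<omega> \<in> space M"
      interpret hilbert_space "H \<omega>" by (rule H[OF w])
      show "c * cip (H \<omega>) (f i \<omega>) (x \<omega>) + cip (H \<omega>) (f i \<omega>) (y \<omega>) = cip (H \<omega>) (f i \<omega>) (s c \<omega>)"
        using x[OF w] y[OF w] f[OF w] by (simp add: s_def cip_add_right cip_smult_right)
    qed
  qed
  note n = measurable_hnorm_sq[of M H f, OF H f tot gram sc this]
  have "(\<lambda>\<omega>. Complex ((Re (cip (H \<omega>) (s 1 \<omega>) (s 1 \<omega>)) - Re (cip (H \<omega>) (s (-1) \<omega>) (s (-1) \<omega>))) / 4)
      ((Re (cip (H \<omega>) (s \<i> \<omega>) (s \<i> \<omega>)) - Re (cip (H \<omega>) (s (-\<i>) \<omega>) (s (-\<i>) \<omega>))) / 4)) \<in> borel_measurable M"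
    unfolding Complex_eq using n[of 1] n[of "-1"] n[of "\<i>"] n[of "-\<i>"] by measurable
  then show ?thesis
  proof (rule measurable_cong[THEN iffD1, rotated])
    fix \<omega> assume w: "\<omega> \<in> space M"
    interpret hilbert_space "H \<omega>" by (rule H[OF w])
    note c = x[OF w] y[OF w]
    have "Re (cip (H \<omega>) (s c \<omega>) (s c \<omega>)) = (cmod c)\<^sup>2 * (hnorm (H \<omega>) (x \<omega>))\<^sup>2 + 2 * Re (cnj c * cip (H \<omega>) (x \<omega>) (y \<omega>)) + (hnorm (H \<omega>) (y \<omega>))\<^sup>2" for c
    proof -
      have "Re (cip (H \<omega>) (s c \<omega>) (s c \<omega>)) = (hnorm (H \<omega>) (s c \<omega>))\<^sup>2" using hnorm_sq[OF sc[OF w]] by simp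
      also have "\<dots> = (hnorm (H \<omega>) (c \<odot>\<^bsub>H \<omega>\<^esub> x \<omega>))\<^sup>2 + 2 * Re (cip (H \<omega>) (c \<odot>\<^bsub>H \<omega>\<^esub> x \<omega>) (y \<omega>)) + (hnorm (H \<omega>) (y \<omega>))\<^sup>2"
        unfolding s_def by (rule hnorm_sq_add) (use c in auto)
      finally show ?thesis using c by (simp only: hnorm_sq_smult cip_smult_left)
    qed
    then show "Complex ((Re (cip (H \<omega>) (s 1 \<omega>) (s 1 \<omega>)) - Re (cip (H \<omega>) (s (-1) \<omega>) (s (-1) \<omega>))) / 4)
      ((Re (cip (H \<omega>) (s \<i> \<omega>) (s \<i> \<omega>)) - Re (cip (H \<omega>) (s (-\<i>) \<omega>) (s (-\<i>) \<omega>))) / 4) = cip (H \<omega>) (x \<omega>) (y \<omega>)"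
      by (simp add: complex_eq_iff)
  qed
qed

text \<open>Completeness passes to \<open>W\<close> because limits stay in it. Used for the fibres
  of a subsystem and for the values of roots at time 1.\<close>

lemma (in hilbert_space) hilbert_space_closed_subspace:
  assumes W: "closed_subspace H W" shows "hilbert_space (H\<lparr>carrier := W\<rparr>)"
proof -
  let ?K = "H\<lparr>carrier := W\<rparr>"
  note w = closed_subspaceD[OF W]
  have mod: "module complex_ring ?K"
  proof (rule module_complex_ringI)
    show "(c + d) \<odot>\<^bsub>?K\<^esub> x = c \<odot>\<^bsub>?K\<^esub> x \<oplus>\<^bsub>?K\<^esub> d \<odot>\<^bsub>?K\<^esub> x" if "x \<in> carrier ?K" for c d x
      using smult_l_distr[of c d x] that w(2) by simp
    show "c \<odot>\<^bsub>?K\<^esub> (x \<oplus>\<^bsub>?K\<^esub> y) = c \<odot>\<^bsub>?K\<^esub> x \<oplus>\<^bsub>?K\<^esub> c \<odot>\<^bsub>?K\<^esub> y" if "x \<in> carrier ?K" "y \<in> carrier ?K" for c x y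
      using smult_r_distr[of c x y] that w(2) by simp
    show "(c * d) \<odot>\<^bsub>?K\<^esub> x = c \<odot>\<^bsub>?K\<^esub> (d \<odot>\<^bsub>?K\<^esub> x)" if "x \<in> carrier ?K" for c d x
      using smult_assoc1[of c d x] that w(2) by simp
    show "1 \<odot>\<^bsub>?K\<^esub> x = x" if "x \<in> carrier ?K" for x using smult_one[of x] that w(2) by simp
    show "0 \<odot>\<^bsub>?K\<^esub> x = \<zero>\<^bsub>?K\<^esub>" if "x \<in> carrier ?K" for x using smult_l_null[of x] that w(2) by simp
    show "(x \<oplus>\<^bsub>?K\<^esub> y) \<oplus>\<^bsub>?K\<^esub> z = x \<oplus>\<^bsub>?K\<^esub> (y \<oplus>\<^bsub>?K\<^esub> z)" if "x \<in> carrier ?K" "y \<in> carrier ?K" "z \<in> carrier ?K" for x y z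
      using M.a_assoc[of x y z] that w(2) by simp
    show "x \<oplus>\<^bsub>?K\<^esub> y = y \<oplus>\<^bsub>?K\<^esub> x" if "x \<in> carrier ?K" "y \<in> carrier ?K" for x y
      using M.a_comm[of x y] that w(2) by simp
  qed (use w in auto)
  interpret K: pre_hilbert ?K
  proof (rule pre_hilbert.intro[OF mod pre_hilbert_axioms.intro])
    show "cip ?K y x = cnj (cip ?K x y)" if "x \<in> carrier ?K" "y \<in> carrier ?K" for x y
      using cip_commute[of x y] that w(2) by simp
  qed (use w(2) in \<open>auto simp: cip_add_right cip_smult_right cip_nonneg\<close>)
  have dist: "hdist ?K x y = hdist H x y" if "x \<in> W" "y \<in> W" for x y
    using that w(2) by (simp add: hdist_def hnorm_def K.diff_eq_smult diff_eq_smult)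
  have MS: "Metric_space W (hdist ?K)"
  proof
    show "0 \<le> hdist ?K x y" for x y
      using K.hnorm_ge_0[OF K.diff_carrier, of x y] by (simp add: hdist_def)
    show "hdist ?K x y = hdist ?K y x" for x y by (auto simp: hdist_def K.hnorm_minus_commute)
    show "hdist ?K x y = 0 \<longleftrightarrow> x = y" if "x \<in> W" "y \<in> W" for x y
      using that w(2) dist[OF that] by (simp add: hdist_eq hnorm_diff_eq_0)
    show "hdist ?K x z \<le> hdist ?K x y + hdist ?K y z" if "x \<in> W" "y \<in> W" "z \<in> W" for x y z
      using that by (simp add: hdist_def K.hnorm_triangle)
  qed
  interpret MK: Metric_space W "hdist ?K" by (rule MS)
  have "MK.mcomplete" unfolding MK.mcomplete_def
  proof (intro allI impI)
    fix X assume X: "MK.MCauchy X"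
    then have c: "X n \<in> W" for n by (auto simp: MK.MCauchy_def)
    have "\<exists>y. hconv H X y"
    proof (rule cauchy_hconv)
      fix e :: real assume "e > 0"
      then obtain N where N: "\<forall>n n'. N \<le> n \<longrightarrow> N \<le> n' \<longrightarrow> hdist ?K (X n) (X n') < e"
        using X by (auto simp: MK.MCauchy_def)
      then show "\<exists>N. \<forall>m\<ge>N. \<forall>n\<ge>N. hnorm H (X m \<ominus> X n) < e"
        using dist[OF c c] hdist_eq[OF w(2) w(2), OF c c] by (intro exI[of _ N]) simp
    qed (use c w(2) in auto)
    then obtain y where y: "hconv H X y" by blast
    have yW: "y \<in> W" by (rule w(6)[OF c y])
    have "(\<lambda>n. hdist ?K (X n) y) \<longlonglongrightarrow> 0"
      using hconvD(3)[OF y] dist[OF c yW] hdist_eq[OF w(2) w(2), OF c yW] by simp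
    then show "\<exists>x. limitin MK.mtopology X x sequentially"
      using yW c by (auto simp: MK.limitin_metric_dist_null)
  qed
  then show ?thesis
  proof (intro hilbert_space.intro[OF mod] hilbert_space_axioms.intro)
    fix x y assume "x \<in> carrier ?K" "y \<in> carrier ?K"
    then show "cip ?K y x = cnj (cip ?K x y)" by (rule K.cip_commute)
  next
    fix x assume "x \<in> carrier ?K" "cip ?K x x = 0"
    then show "x = \<zero>\<^bsub>?K\<^esub>" using cip_definite[of x] w(2) by simp
  qed (use w(2) in \<open>auto simp: cip_add_right cip_smult_right cip_nonneg\<close>)
qed

text \<open>A zero at t forces zeros at all t/2^n, since f(t) is the square of f(t/2), and from
  there at every larger argument.\<close>

lemma multiplicative_zero:
  fixes f :: "real \<Rightarrow> complex"
  assumes mult: "\<And>s t. \<lbrakk>s > 0; t > 0\<rbrakk> \<Longrightarrow> f (s + t) = f s * f t" and t: "t > 0" "f t = 0" and s: "s > 0"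
  shows "f s = 0"
proof -
  have half: "f (t / 2 ^ n) = 0" for n
  proof (induction n)
    case (Suc n)
    then show ?case using mult[of "t / 2 ^ Suc n" "t / 2 ^ Suc n"] t by (simp add: field_simps)
  qed (use t in simp)
  obtain n where "t / s < 2 ^ n" using real_arch_pow[of 2 "t / s"] by auto
  then have "t / 2 ^ n < s" using s by (simp add: field_simps)
  then show ?thesis using mult[of "t / 2 ^ n" "s - t / 2 ^ n"] half t by simp
qed

text \<open>Nonnegative values make f monotone. Comparing (n + 1) t with its integer part bounds n +
  1 times the defect f(t) - t f(1) by f(1), for every n.\<close>

lemma nonneg_additive_linear:
  fixes f :: "real \<Rightarrow> real"
  assumes add: "\<And>s t. \<lbrakk>s > 0; t > 0\<rbrakk> \<Longrightarrow> f (s + t) = f s + f t" and nn: "\<And>t. t > 0 \<Longrightarrow> 0 \<le> f t" and t: "t > 0"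
  shows "f t = t * f 1"
proof -
  have mul: "f (real (Suc n) * s) = real (Suc n) * f s" if "s > 0" for n s
  proof (induction n)
    case (Suc n)
    have "f (real (Suc (Suc n)) * s) = f (real (Suc n) * s + s)" by (simp add: algebra_simps)
    also have "\<dots> = f (real (Suc n) * s) + f s" by (rule add) (use that in auto)
    finally show ?case using Suc by (simp add: algebra_simps)
  qed simp
  have mono: "f s \<le> f r" if "0 < s" "s \<le> r" for s r
    using that add[of s "r - s"] nn[of "r - s"] by (cases "s = r") auto
  have bd: "real (Suc n) * \<bar>f t - t * f 1\<bar> \<le> f 1" for n
  proof -
    let ?x = "real (Suc n) * t"
    define m where "m = nat \<lfloor>?x\<rfloor>"
    have x: "?x > 0" using t by simp
    then have m: "real m \<le> ?x" "?x \<le> real (Suc m)"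
      using real_of_int_floor_add_one_ge[of ?x] by (simp_all add: m_def of_nat_nat add.commute)
    have up: "f ?x \<le> real (Suc m) * f 1" using mono[OF x m(2)] mul[of 1 m] by simp
    have lo: "real m * f 1 \<le> f ?x"
    proof (cases m)
      case (Suc k)
      then show ?thesis using mono[of "real m" ?x] m(1) mul[of 1 k] by simp
    qed (use nn[OF x] in simp)
    have "real m * f 1 \<le> ?x * f 1" "?x * f 1 \<le> real (Suc m) * f 1"
      using m nn[of 1] by (auto intro!: mult_right_mono)
    then have "\<bar>f ?x - ?x * f 1\<bar> \<le> f 1" using up lo by (simp add: algebra_simps abs_le_iff)
    moreover have "f ?x - ?x * f 1 = real (Suc n) * (f t - t * f 1)" unfolding mul[OF t] by (simp add: algebra_simps)
    ultimately show ?thesis by (simp only: abs_mult abs_of_nat)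
  qed
  show ?thesis
  proof (rule ccontr)
    assume "f t \<noteq> t * f 1"
    then have "\<bar>f t - t * f 1\<bar> > 0" by simp
    then obtain n where n: "f 1 / \<bar>f t - t * f 1\<bar> < real n" using reals_Archimedean2 by blast
    then have "f 1 < real n * \<bar>f t - t * f 1\<bar>" using \<open>\<bar>f t - t * f 1\<bar> > 0\<close> by (simp add: field_simps)
    also have "\<dots> \<le> real (Suc n) * \<bar>f t - t * f 1\<bar>" by (intro mult_right_mono) auto
    finally show False using bd[of n] by simp
  qed
qed

abbreviation "pos_reals \<equiv> restrict_space borel {0::real<..}"

lemma space_pos_reals [simp]: "space pos_reals = {0<..}"
  by (simp add: space_restrict_space)

lemma measurable_scale:
  assumes "h \<in> borel_measurable pos_reals" "\<alpha> > 0"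
  shows "(\<lambda>t. h (\<alpha> * t)) \<in> borel_measurable pos_reals"
proof (rule measurable_compose[OF _ assms(1)])
  show "(\<lambda>t. \<alpha> * t) \<in> pos_reals \<rightarrow>\<^sub>M pos_reals"
    by (rule measurable_restrict_space2) (use assms(2) in \<open>auto intro!: measurable_restrict_space1\<close>)
qed

section \<open>Measurable fields along rays of time\<close>

context arveson_system
begin

abbreviation "e \<equiv> base_section E"

lemma e_closed: "t > 0 \<Longrightarrow> e n t \<in> carrier (H t)"
  using base_section[of n] by (auto simp: sections_def PiE_def Pi_def)

text \<open>The vector x t lies in the fibre over \<alpha> t. Approximants over uniform partitions
  are built from fibres over fractions of t, so the recursion passes through such fields; \<alpha> =
  1 is the case of sections.\<close>

definition measurable_field :: "real \<Rightarrow> (real \<Rightarrow> 'a) \<Rightarrow> bool" where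
  "measurable_field \<alpha> x \<longleftrightarrow> (\<forall>t>0. x t \<in> carrier (H (\<alpha> * t))) \<and>
     (\<forall>n. (\<lambda>t. cip (H (\<alpha> * t)) (e n (\<alpha> * t)) (x t)) \<in> borel_measurable pos_reals)"

lemma measurable_fieldD:
  assumes "measurable_field \<alpha> x"
  shows "t > 0 \<Longrightarrow> x t \<in> carrier (H (\<alpha> * t))"
    "(\<lambda>t. cip (H (\<alpha> * t)) (e n (\<alpha> * t)) (x t)) \<in> borel_measurable pos_reals"
  using assms by (auto simp: measurable_field_def)

lemma measurable_field_cong:
  assumes "measurable_field \<alpha> x" "\<And>t. t > 0 \<Longrightarrow> x t = y t" shows "measurable_field \<alpha> y"
  unfolding measurable_field_def
proof (intro conjI allI impI)
  show "y t \<in> carrier (H (\<alpha> * t))" if "t > 0" for t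
    using measurable_fieldD(1)[OF assms(1) that] assms(2)[OF that] by simp
  show "(\<lambda>t. cip (H (\<alpha> * t)) (e n (\<alpha> * t)) (y t)) \<in> borel_measurable pos_reals" for n
    by (rule measurable_cong[THEN iffD1, OF _ measurable_fieldD(2)[OF assms(1)]]) (use assms(2) in simp)
qed

lemma measurable_field_cip:
  assumes \<alpha>: "\<alpha> > 0" and x: "measurable_field \<alpha> x" and y: "measurable_field \<alpha> y"
  shows "(\<lambda>t. cip (H (\<alpha> * t)) (x t) (y t)) \<in> borel_measurable pos_reals"
proof (rule measurable_cip[where f = "\<lambda>n t. e n (\<alpha> * t)"])
  fix t assume "t \<in> space pos_reals"
  then have t: "t > 0" "\<alpha> * t > 0" using \<alpha> by auto
  show "hilbert_space (H (\<alpha> * t))" by (rule hilbert_fibre[OF t(2)])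
  show "e i (\<alpha> * t) \<in> carrier (H (\<alpha> * t))" for i by (rule e_closed[OF t(2)])
  show "closed_span (H (\<alpha> * t)) (range (\<lambda>i. e i (\<alpha> * t))) = carrier (H (\<alpha> * t))"
    by (rule base_section_total[OF t(2)])
  show "x t \<in> carrier (H (\<alpha> * t))" "y t \<in> carrier (H (\<alpha> * t))"
    using measurable_fieldD(1)[OF x t(1)] measurable_fieldD(1)[OF y t(1)] by auto
next
  show "(\<lambda>t. cip (H (\<alpha> * t)) (e i (\<alpha> * t)) (e j (\<alpha> * t))) \<in> borel_measurable pos_reals" for i j
    by (rule measurable_scale[OF base_section_measurable \<alpha>])
qed (use measurable_fieldD(2)[OF x] measurable_fieldD(2)[OF y] in auto)

lemma measurable_field_base: "\<alpha> > 0 \<Longrightarrow> measurable_field \<alpha> (\<lambda>t. e n (\<alpha> * t))"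
  unfolding measurable_field_def using measurable_scale[OF base_section_measurable] by (auto intro: e_closed)

lemma measurable_field_section:
  assumes "x \<in> measurable_sections E" "\<alpha> > 0" shows "measurable_field \<alpha> (\<lambda>t. x (\<alpha> * t))"
  unfolding measurable_field_def
proof (intro conjI allI impI)
  fix t :: real assume "t > 0"
  then show "x (\<alpha> * t) \<in> carrier (H (\<alpha> * t))"
    using assms by (auto simp: measurable_sections_def sections_def PiE_def Pi_def)
next
  fix n show "(\<lambda>t. cip (H (\<alpha> * t)) (e n (\<alpha> * t)) (x (\<alpha> * t))) \<in> borel_measurable pos_reals"
    by (rule measurable_scale) (use assms in \<open>auto simp: measurable_sections_def\<close>)
qed

lemma measurable_section_iff:
  "x \<in> measurable_sections E \<longleftrightarrow> x \<in> extensional {0<..} \<and> measurable_field 1 x"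
  by (auto simp: measurable_sections_def measurable_field_def sections_def PiE_def Pi_def)

text \<open>A second countable total family in the fibre over s + t, adapted to products: its inner
  products with a product factorise.\<close>

lemma base_prod_total:
  assumes s: "s > 0" and t: "t > 0"
  shows "closed_span (H (s + t)) (range (\<lambda>(m, n). prd s t (e m s) (e n t))) = carrier (H (s + t))"
proof -
  interpret hilbert_space "H (s + t)" by (rule hilbert_fibre) (use s t in simp)
  let ?A = "range (\<lambda>(m, n). prd s t (e m s) (e n t))"
  have A: "?A \<subseteq> carrier (H (s + t))" using prd_closed[OF s t] e_closed s t by auto
  note cs = closed_span_closed_subspace[OF A]
  have 1: "prd s t (e m s) y \<in> closed_span (H (s + t)) ?A" if y: "y \<in> carrier (H t)" for m y
  proof (rule prd_span_right[OF s t cs _ _ e_closed[OF s]])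
    show "range (\<lambda>n. e n t) \<subseteq> carrier (H t)" using e_closed[OF t] by auto
    show "y \<in> closed_span (H t) (range (\<lambda>n. e n t))" using base_section_total[OF t] y by simp
    show "prd s t (e m s) a \<in> closed_span (H (s + t)) ?A" if "a \<in> range (\<lambda>n. e n t)" for a
      using closed_span_superset[of ?A] that by auto
  qed
  have 2: "prd s t x y \<in> closed_span (H (s + t)) ?A" if x: "x \<in> carrier (H s)" and y: "y \<in> carrier (H t)" for x y
  proof (rule prd_span_left[OF s t cs _ _ y])
    show "range (\<lambda>n. e n s) \<subseteq> carrier (H s)" using e_closed[OF s] by auto
    show "x \<in> closed_span (H s) (range (\<lambda>n. e n s))" using base_section_total[OF s] x by simp
    show "prd s t a y \<in> closed_span (H (s + t)) ?A" if "a \<in> range (\<lambda>n. e n s)" for a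
      using 1[OF y] that by auto
  qed
  then have "{prd s t x y | x y. x \<in> carrier (H s) \<and> y \<in> carrier (H t)} \<subseteq> closed_span (H (s + t)) ?A" by blast
  from closed_span_minimal[OF cs this] closed_subspaceD(1)[OF cs] show ?thesis
    unfolding prd_total[OF s t] by simp
qed

text \<open>The products of base sections serve as the total family in
  \<open>measurable_cip\<close>. Their inner products with the given product factorise, and those
  with a base section over the sum of the times are measurable by the axiom; it follows that the
  given product is measurable against base sections.\<close>

lemma measurable_field_prd:
  assumes \<alpha>: "\<alpha> > 0" and \<beta>: "\<beta> > 0" and x: "measurable_field \<alpha> x" and y: "measurable_field \<beta> y"
  shows "measurable_field (\<alpha> + \<beta>) (\<lambda>t. prd (\<alpha> * t) (\<beta> * t) (x t) (y t))"
  unfolding measurable_field_def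
proof (intro conjI allI impI)
  fix t :: real assume t: "t > 0"
  then show "prd (\<alpha> * t) (\<beta> * t) (x t) (y t) \<in> carrier (H ((\<alpha> + \<beta>) * t))"
    using \<alpha> \<beta> prd_closed[of "\<alpha> * t" "\<beta> * t"] measurable_fieldD(1)[OF x t] measurable_fieldD(1)[OF y t]
    by (simp add: distrib_right)
next
  fix l
  let ?f = "\<lambda>(m, n) t. prd (\<alpha> * t) (\<beta> * t) (e m (\<alpha> * t)) (e n (\<beta> * t))"
  have prod: "(\<lambda>t. cip (H (\<alpha> * t + \<beta> * t)) (?f i t) (prd (\<alpha> * t) (\<beta> * t) (x t) (y t))) \<in> borel_measurable pos_reals"
    if x: "measurable_field \<alpha> x" and y: "measurable_field \<beta> y" for i x y
  proof -
    obtain m n where i: "i = (m, n)" by (cases i)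
    have "(\<lambda>t. cip (H (\<alpha> * t)) (e m (\<alpha> * t)) (x t) * cip (H (\<beta> * t)) (e n (\<beta> * t)) (y t)) \<in> borel_measurable pos_reals"
      by (intro borel_measurable_times measurable_fieldD(2)[OF x] measurable_fieldD(2)[OF y])
    then show ?thesis
    proof (rule measurable_cong[THEN iffD1, rotated])
      fix t assume "t \<in> space pos_reals"
      then have t: "t > 0" by simp
      show "cip (H (\<alpha> * t)) (e m (\<alpha> * t)) (x t) * cip (H (\<beta> * t)) (e n (\<beta> * t)) (y t) =
          cip (H (\<alpha> * t + \<beta> * t)) (?f i t) (prd (\<alpha> * t) (\<beta> * t) (x t) (y t))"
        using t \<alpha> \<beta> measurable_fieldD(1)[OF x t] measurable_fieldD(1)[OF y t] e_closed
        by (simp add: i cip_prd)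
    qed
  qed
  have base: "(\<lambda>t. cip (H (\<alpha> * t + \<beta> * t)) (?f i t) (e l (\<alpha> * t + \<beta> * t))) \<in> borel_measurable pos_reals" for i
  proof -
    obtain m n where i: "i = (m, n)" by (cases i)
    \<comment> \<open>The axiom is a joint measurability in the quadrant; it is composed with the
      ray through (\<alpha>, \<beta>).\<close>
    have "(\<lambda>t. (\<alpha> * t, \<beta> * t)) \<in> pos_reals \<rightarrow>\<^sub>M restrict_space borel ({0<..} \<times> {0<..})"
      by (rule measurable_restrict_space2) (use \<alpha> \<beta> in \<open>auto intro!: measurable_restrict_space1 borel_measurable_Pair\<close>)
    from measurable_compose[OF this base_section_prod_measurable[of l m n]]
    have "(\<lambda>t. cip (H (\<alpha> * t + \<beta> * t)) (e l (\<alpha> * t + \<beta> * t)) (prd (\<alpha> * t) (\<beta> * t) (e m (\<alpha> * t)) (e n (\<beta> * t)))) \<in> borel_measurable pos_reals"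
      by simp
    then have "(\<lambda>t. cnj (cip (H (\<alpha> * t + \<beta> * t)) (e l (\<alpha> * t + \<beta> * t)) (prd (\<alpha> * t) (\<beta> * t) (e m (\<alpha> * t)) (e n (\<beta> * t))))) \<in> borel_measurable pos_reals"
      by (rule borel_measurable_continuous_on[rotated]) (intro continuous_intros)
    then show ?thesis
    proof (rule measurable_cong[THEN iffD1, rotated])
      fix t assume "t \<in> space pos_reals"
      then have t: "\<alpha> * t > 0" "\<beta> * t > 0" using \<alpha> \<beta> by auto
      interpret hilbert_space "H (\<alpha> * t + \<beta> * t)" by (rule hilbert_fibre) (use t in simp)
      show "cnj (cip (H (\<alpha> * t + \<beta> * t)) (e l (\<alpha> * t + \<beta> * t)) (prd (\<alpha> * t) (\<beta> * t) (e m (\<alpha> * t)) (e n (\<beta> * t)))) =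
          cip (H (\<alpha> * t + \<beta> * t)) (?f i t) (e l (\<alpha> * t + \<beta> * t))"
        unfolding i prod.case
        by (rule cip_commute[symmetric]) (use t e_closed prd_closed in auto)
    qed
  qed
  have "(\<lambda>t. cip (H (\<alpha> * t + \<beta> * t)) (e l (\<alpha> * t + \<beta> * t)) (prd (\<alpha> * t) (\<beta> * t) (x t) (y t))) \<in> borel_measurable pos_reals"
  proof (rule measurable_cip[where f = ?f])
    fix t assume "t \<in> space pos_reals"
    then have t: "t > 0" "\<alpha> * t > 0" "\<beta> * t > 0" using \<alpha> \<beta> by auto
    show "hilbert_space (H (\<alpha> * t + \<beta> * t))" by (rule hilbert_fibre) (use t in simp)
    show "?f i t \<in> carrier (H (\<alpha> * t + \<beta> * t))" for i
      using prd_closed[OF t(2,3)] e_closed t by (auto split: prod.split)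
    show "closed_span (H (\<alpha> * t + \<beta> * t)) (range (\<lambda>i. ?f i t)) = carrier (H (\<alpha> * t + \<beta> * t))"
      using base_prod_total[OF t(2,3)] by (simp add: case_prod_beta)
    show "e l (\<alpha> * t + \<beta> * t) \<in> carrier (H (\<alpha> * t + \<beta> * t))" using e_closed t by simp
    show "prd (\<alpha> * t) (\<beta> * t) (x t) (y t) \<in> carrier (H (\<alpha> * t + \<beta> * t))"
      using prd_closed[OF t(2,3)] measurable_fieldD(1)[OF x t(1)] measurable_fieldD(1)[OF y t(1)] by simp
  next
    show "(\<lambda>t. cip (H (\<alpha> * t + \<beta> * t)) (?f i t) (?f j t)) \<in> borel_measurable pos_reals" for i j
    proof -
      obtain m n where j: "j = (m, n)" by (cases j)
      show ?thesis unfolding j prod.case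
        using prod[OF measurable_field_base[OF \<alpha>] measurable_field_base[OF \<beta>], of i m n] by simp
    qed
  qed (use base prod[OF x y] in auto)
  then show "(\<lambda>t. cip (H ((\<alpha> + \<beta>) * t)) (e l ((\<alpha> + \<beta>) * t)) (prd (\<alpha> * t) (\<beta> * t) (x t) (y t))) \<in> borel_measurable pos_reals"
    by (simp add: distrib_right)
qed

lemma measurable_field_add:
  assumes \<alpha>: "\<alpha> > 0" and x: "measurable_field \<alpha> x" and y: "measurable_field \<alpha> y"
  shows "measurable_field \<alpha> (\<lambda>t. x t \<oplus>\<^bsub>H (\<alpha> * t)\<^esub> y t)"
  unfolding measurable_field_def
proof (intro conjI allI impI)
  fix t :: real assume t: "t > 0"
  then show "x t \<oplus>\<^bsub>H (\<alpha> * t)\<^esub> y t \<in> carrier (H (\<alpha> * t))"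
    using \<alpha> measurable_fieldD(1)[OF x t] measurable_fieldD(1)[OF y t] by (simp add: fibre_add_closed)
next
  fix n
  have "(\<lambda>t. cip (H (\<alpha> * t)) (e n (\<alpha> * t)) (x t) + cip (H (\<alpha> * t)) (e n (\<alpha> * t)) (y t)) \<in> borel_measurable pos_reals"
    by (intro borel_measurable_add measurable_fieldD(2)[OF x] measurable_fieldD(2)[OF y])
  then show "(\<lambda>t. cip (H (\<alpha> * t)) (e n (\<alpha> * t)) (x t \<oplus>\<^bsub>H (\<alpha> * t)\<^esub> y t)) \<in> borel_measurable pos_reals"
    by (rule measurable_cong[THEN iffD1, rotated])
       (use \<alpha> measurable_fieldD(1)[OF x] measurable_fieldD(1)[OF y] e_closed in \<open>simp add: cip_simps\<close>)
qed

lemma measurable_field_smult: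
  assumes \<alpha>: "\<alpha> > 0" and x: "measurable_field \<alpha> x" and c: "c \<in> borel_measurable pos_reals"
  shows "measurable_field \<alpha> (\<lambda>t. c t \<odot>\<^bsub>H (\<alpha> * t)\<^esub> x t)"
  unfolding measurable_field_def
proof (intro conjI allI impI)
  fix t :: real assume t: "t > 0"
  then show "c t \<odot>\<^bsub>H (\<alpha> * t)\<^esub> x t \<in> carrier (H (\<alpha> * t))"
    using \<alpha> measurable_fieldD(1)[OF x t] by (simp add: fibre_smult_closed)
next
  fix n
  have "(\<lambda>t. c t * cip (H (\<alpha> * t)) (e n (\<alpha> * t)) (x t)) \<in> borel_measurable pos_reals"
    by (intro borel_measurable_times measurable_fieldD(2)[OF x] c)
  then show "(\<lambda>t. cip (H (\<alpha> * t)) (e n (\<alpha> * t)) (c t \<odot>\<^bsub>H (\<alpha> * t)\<^esub> x t)) \<in> borel_measurable pos_reals"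
    by (rule measurable_cong[THEN iffD1, rotated])
       (use \<alpha> measurable_fieldD(1)[OF x] e_closed in \<open>simp add: cip_simps\<close>)
qed

lemma measurable_field_diff:
  assumes \<alpha>: "\<alpha> > 0" and x: "measurable_field \<alpha> x" and y: "measurable_field \<alpha> y"
  shows "measurable_field \<alpha> (\<lambda>t. x t \<ominus>\<^bsub>H (\<alpha> * t)\<^esub> y t)"
proof (rule measurable_field_cong[OF measurable_field_add[OF \<alpha> x measurable_field_smult[OF \<alpha> y, of "\<lambda>_. -1"]]])
  fix t :: real assume t: "t > 0"
  interpret hilbert_space "H (\<alpha> * t)" by (rule hilbert_fibre) (use \<alpha> t in simp)
  show "x t \<oplus>\<^bsub>H (\<alpha> * t)\<^esub> (-1) \<odot>\<^bsub>H (\<alpha> * t)\<^esub> y t = x t \<ominus>\<^bsub>H (\<alpha> * t)\<^esub> y t"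
    using measurable_fieldD(1)[OF x t] measurable_fieldD(1)[OF y t] by (simp add: diff_eq_smult)
qed simp

text \<open>Carries measurability from the approximants to logarithms and exponentials.\<close>

lemma measurable_field_lim:
  assumes \<alpha>: "\<alpha> > 0" and X: "\<And>n. measurable_field \<alpha> (X n)"
    and l: "\<And>t. t > 0 \<Longrightarrow> hconv (H (\<alpha> * t)) (\<lambda>n. X n t) (x t)"
  shows "measurable_field \<alpha> x"
  unfolding measurable_field_def
proof (intro conjI allI impI)
  fix t :: real assume t: "t > 0"
  interpret hilbert_space "H (\<alpha> * t)" by (rule hilbert_fibre) (use \<alpha> t in simp)
  show "x t \<in> carrier (H (\<alpha> * t))" by (rule hconvD(2)[OF l[OF t]])
next
  fix k
  show "(\<lambda>t. cip (H (\<alpha> * t)) (e k (\<alpha> * t)) (x t)) \<in> borel_measurable pos_reals"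
  proof (rule borel_measurable_LIMSEQ_metric)
    show "(\<lambda>t. cip (H (\<alpha> * t)) (e k (\<alpha> * t)) (X n t)) \<in> borel_measurable pos_reals" for n
      by (rule measurable_fieldD(2)[OF X])
    fix t assume "t \<in> space pos_reals"
    then have t: "t > 0" "\<alpha> * t > 0" using \<alpha> by auto
    interpret hilbert_space "H (\<alpha> * t)" by (rule hilbert_fibre[OF t(2)])
    show "(\<lambda>n. cip (H (\<alpha> * t)) (e k (\<alpha> * t)) (X n t)) \<longlonglongrightarrow> cip (H (\<alpha> * t)) (e k (\<alpha> * t)) (x t)"
      by (rule hconv_cip[OF hconv_const l[OF t(1)]]) (use e_closed t in simp)
  qed
qed

lemma measurable_section_restrict: "measurable_field 1 x \<Longrightarrow> (\<lambda>t\<in>{0<..}. x t) \<in> measurable_sections E"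
  unfolding measurable_section_iff by (auto intro: measurable_field_cong)

section \<open>Units\<close>

lemma measurable_sectionD: "\<lbrakk>x \<in> measurable_sections E; t > 0\<rbrakk> \<Longrightarrow> x t \<in> carrier (H t)"
  by (auto simp: measurable_sections_def sections_def PiE_def Pi_def)

lemma measurable_sections_cip:
  "\<lbrakk>x \<in> measurable_sections E; y \<in> measurable_sections E\<rbrakk> \<Longrightarrow> (\<lambda>t. cip (H t) (x t) (y t)) \<in> borel_measurable pos_reals"
  using measurable_field_cip[of 1 x y] by (simp add: measurable_section_iff)

lemma unitsD:
  assumes "v \<in> units E"
  shows "v \<in> measurable_sections E" "t > 0 \<Longrightarrow> v t \<in> carrier (H t)"
    "\<lbrakk>s > 0; t > 0\<rbrakk> \<Longrightarrow> v (s + t) = prd s t (v s) (v t)"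
  using assms measurable_sectionD by (auto simp: units_def)

lemma cip_units_mult:
  assumes "v \<in> units E" "w \<in> units E" "s > 0" "t > 0"
  shows "cip (H (s + t)) (v (s + t)) (w (s + t)) = cip (H s) (v s) (w s) * cip (H t) (v t) (w t)"
  using assms by (simp add: unitsD cip_prd)

lemma units_nonzero:
  assumes v: "v \<in> units E" and t: "t > 0" shows "cip (H t) (v t) (v t) \<noteq> 0"
proof
  assume "cip (H t) (v t) (v t) = 0"
  then have z: "cip (H s) (v s) (v s) = 0" if "s > 0" for s
    using multiplicative_zero[of "\<lambda>t. cip (H t) (v t) (v t)", OF cip_units_mult[OF v v] t _ that] by blast
  obtain s where s: "s > 0" "v s \<noteq> \<zero>\<^bsub>H s\<^esub>" using v by (auto simp: units_def)
  interpret hilbert_space "H s" by (rule hilbert_fibre[OF s(1)])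
  show False using cip_definite[OF unitsD(2)[OF v s(1)] z[OF s(1)]] s(2) by simp
qed

text \<open>If all \<open>\<langle>v t, w t\<rangle>\<close> vanished, the vectors \<open>v s \<cdot> w (1 - s)\<close> for \<open>0 < s < 1\<close> would form
  an uncountable orthogonal family.\<close>

lemma units_not_orthogonal:
  assumes v: "v \<in> units E" and w: "w \<in> units E" and t: "t > 0"
  shows "cip (H t) (v t) (w t) \<noteq> 0"
proof
  assume "cip (H t) (v t) (w t) = 0"
  then have z: "cip (H s) (v s) (w s) = 0" if "s > 0" for s
    using multiplicative_zero[of "\<lambda>t. cip (H t) (v t) (w t)", OF cip_units_mult[OF v w] t _ that] by blast
  interpret hilbert_space "H 1" by (rule hilbert_fibre) simp
  define y where "y s = prd s (1 - s) (v s) (w (1 - s))" for s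
  have yc: "y s \<in> carrier (H 1)" if "0 < s" "s < 1" for s
    using prd_closed[of s "1 - s"] that unitsD(2)[OF v] unitsD(2)[OF w] by (simp add: y_def)
  have orth: "cip (H 1) (y s) (y (s + r)) = 0" if s: "0 < s" and r: "0 < r" and sr: "s + r < 1" for s r
  proof -
    let ?q = "1 - (s + r)"
    have q: "?q > 0" using sr by simp
    note c = unitsD(2)[OF v s] unitsD(2)[OF v r] unitsD(2)[OF w r] unitsD(2)[OF w q] prd_closed
    have e: "1 - s = r + ?q" "s + (r + ?q) = 1" by simp_all
    \<comment> \<open>Over the cells s, r and 1 - (s + r), the vectors \<open>y s\<close> and
      \<open>y (s + r)\<close> carry w and v respectively on the middle cell, so the factor there
      vanishes.\<close>
    have 1: "y s = prd s (r + ?q) (v s) (prd r ?q (w r) (w ?q))"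
      unfolding y_def e(1) unitsD(3)[OF w r q] ..
    have 2: "y (s + r) = prd s (r + ?q) (v s) (prd r ?q (v r) (w ?q))"
      unfolding y_def unitsD(3)[OF v s r] by (rule prd_assoc[OF s r q]) (use c in auto)
    have "cip (H (s + (r + ?q))) (y s) (y (s + r)) = cip (H s) (v s) (v s) * (cip (H r) (w r) (v r) * cip (H ?q) (w ?q) (w ?q))"
      unfolding 1 2 using s r q c by (simp only: cip_prd add_pos_pos)
    moreover have "cip (H r) (w r) (v r) = 0"
      using pre_hilbert.cip_commute[OF hilbert_space.pre_hilbert[OF hilbert_fibre[OF r]] c(2,3)] z[OF r] by simp
    ultimately show ?thesis unfolding e(2) by simp
  qed
  have orth': "cip (H 1) (y s) (y r) = 0" if "0 < s" "s < 1" "0 < r" "r < 1" "s \<noteq> r" for s r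
  proof (cases "s < r")
    case True
    then show ?thesis using orth[of s "r - s"] that by simp
  next
    case False
    then have "cip (H 1) (y r) (y s) = 0" using orth[of r "s - r"] that by simp
    then show ?thesis using cip_commute[OF yc[of r] yc[of s]] that by simp
  qed
  have ny: "hnorm (H 1) (y s) > 0" if "0 < s" "s < 1" for s
  proof -
    have "cip (H (s + (1 - s))) (y s) (y s) \<noteq> 0"
      unfolding y_def using that units_nonzero[OF v] units_nonzero[OF w] unitsD(2)[OF v] unitsD(2)[OF w]
      by (subst cip_prd) auto
    then have "hnorm (H 1) (y s) \<noteq> 0" using cip_self[OF yc[OF that]] by auto
    then show ?thesis using hnorm_ge_0[OF yc[OF that]] by simp
  qed
  define x where "x s = of_real (1 / hnorm (H 1) (y s)) \<odot>\<^bsub>H 1\<^esub> y s" for s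
  have xc: "x s \<in> carrier (H 1)" "hnorm (H 1) (x s) = 1" if "0 < s" "s < 1" for s
    using yc[OF that] ny[OF that] by (auto simp: x_def hnorm_smult norm_divide)
  \<comment> \<open>Orthonormal vectors have distance sqrt 2 > 1. The balls of radius 1/2 around
    them are disjoint, and each takes its own point of a countable dense set.\<close>
  have far: "1 < hnorm (H 1) (x s \<ominus>\<^bsub>H 1\<^esub> x r)" if "0 < s" "s < 1" "0 < r" "r < 1" "s \<noteq> r" for s r
  proof -
    have "cip (H 1) (x s) (x r) = 0"
      using orth'[OF that] yc[OF that(1,2)] yc[OF that(3,4)] by (simp add: x_def cip_smult_left cip_smult_right)
    then have "(hnorm (H 1) (x s \<ominus>\<^bsub>H 1\<^esub> x r))\<^sup>2 = 2"
      using hnorm_sq_diff[OF xc(1)[OF that(1,2)] xc(1)[OF that(3,4)]] xc(2)[OF that(1,2)] xc(2)[OF that(3,4)] by simp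
    then show ?thesis using power_le_one_iff[of "hnorm (H 1) (x s \<ominus>\<^bsub>H 1\<^esub> x r)" 2] xc that
      by (metis diff_carrier hnorm_ge_0 not_le one_less_numeral_iff power_le_one_iff semiring_norm(76) zero_neq_numeral)
  qed
  interpret MS: Metric_space "carrier (H 1)" "hdist (H 1)" by (rule Metric_space)
  obtain C where C: "countable C" "C \<subseteq> carrier (H 1)" "htopology (H 1) closure_of C = carrier (H 1)"
    using separable_fibre[of 1] by (auto simp: separable_space_def)
  have "\<exists>c\<in>C. hnorm (H 1) (x s \<ominus>\<^bsub>H 1\<^esub> c) < 1 / 2" if "0 < s" "s < 1" for s
  proof -
    have "x s \<in> htopology (H 1) closure_of C" using C(3) xc(1)[OF that] by simp
    then obtain c where "c \<in> C" "c \<in> MS.mball (x s) (1 / 2)"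
      unfolding MS.metric_closure_of by (auto dest!: spec[of _ "1/2"])
    then show ?thesis using xc(1)[OF that] by (auto simp: MS.in_mball hdist_eq)
  qed
  then obtain f where f: "\<And>s. \<lbrakk>0 < s; s < 1\<rbrakk> \<Longrightarrow> f s \<in> C \<and> hnorm (H 1) (x s \<ominus>\<^bsub>H 1\<^esub> f s) < 1 / 2" by metis
  have "inj_on f {0<..<1}"
  proof (rule inj_onI, rule ccontr)
    fix s r assume s: "s \<in> {0<..<1}" and r: "r \<in> {0<..<1}" and eq: "f s = f r" and ne: "s \<noteq> r"
    have fs: "f s \<in> carrier (H 1)" using f[of s] C(2) s by auto
    have "hnorm (H 1) (x s \<ominus>\<^bsub>H 1\<^esub> x r) \<le> hnorm (H 1) (x s \<ominus>\<^bsub>H 1\<^esub> f s) + hnorm (H 1) (f s \<ominus>\<^bsub>H 1\<^esub> x r)"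
      by (rule hnorm_triangle) (use xc s r fs in auto)
    also have "hnorm (H 1) (f s \<ominus>\<^bsub>H 1\<^esub> x r) = hnorm (H 1) (x r \<ominus>\<^bsub>H 1\<^esub> f r)"
      using hnorm_minus_commute[OF fs, of "x r"] xc(1)[of r] r eq by simp
    finally show False using f[of s] f[of r] far[of s r] s r ne by auto
  qed
  moreover have "f ` {0<..<1} \<subseteq> C" using f by auto
  ultimately have "countable {0<..<1::real}" using C(1) by (meson countable_image_inj_on countable_subset)
  then show False using uncountable_open_interval[of 0 1] by simp
qed

text \<open>Inner products of units are measurable, multiplicative and nowhere zero, hence
  exponentials; uniqueness of the exponent settles the description in
  \<open>covariance\<close>.\<close>

lemma cip_units:
  assumes v: "v \<in> units E" and w: "w \<in> units E" and t: "t > 0"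
  shows "cip (H t) (v t) (w t) = exp (of_real t * covariance E v w)"
proof -
  have "\<exists>g. \<forall>t>0. cip (H t) (v t) (w t) = exp (of_real t * g)"
    by (rule measurable_multiplicative[OF measurable_sections_cip[OF unitsD(1)[OF v] unitsD(1)[OF w]]
          units_not_orthogonal[OF v w] cip_units_mult[OF v w]])
  then obtain g where g: "\<forall>t>0. cip (H t) (v t) (w t) = exp (of_real t * g)" by blast
  have "covariance E v w = g" unfolding covariance_def
    by (rule the_equality[of "\<lambda>g. \<forall>t>0. cip (H t) (v t) (w t) = exp (of_real t * g)", OF g])
       (rule exp_of_real_eq_imp, use g in simp)
  then show ?thesis using g t by simp
qed

lemma covariance_eqI:
  assumes "v \<in> units E" "w \<in> units E" "\<And>t. t > 0 \<Longrightarrow> cip (H t) (v t) (w t) = exp (of_real t * g)"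
  shows "covariance E v w = g"
  by (rule exp_of_real_eq_imp) (use cip_units[OF assms(1,2)] assms(3) in simp)

end

section \<open>Units and additive sections of a spatial system\<close>

locale spatial_system = arveson_system E for E :: "('a, 'm) arveson_data_scheme" +
  fixes u :: "real \<Rightarrow> 'a"
  assumes normalised: "normalised_unit E u"
begin

lemma u_unit: "u \<in> units E" using normalised by (simp add: normalised_unit_def)

sublocale normalised_system E u
proof
  fix t :: real assume t: "t > 0"
  interpret hilbert_space "H t" by (rule hilbert_fibre[OF t])
  show "u t \<in> carrier (H t)" by (rule unitsD(2)[OF u_unit t])
  then show "cip (H t) (u t) (u t) = 1" using normalised t by (simp add: cip_self normalised_unit_def)
qed (rule unitsD(3)[OF u_unit])

lemma roots_iff: "a \<in> roots E u \<longleftrightarrow> a \<in> measurable_sections E \<and> additive a"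
  unfolding roots_def additive_def using measurable_sectionD by auto

lemma units_iff: "unital v \<Longrightarrow> v \<in> units E \<longleftrightarrow> v \<in> measurable_sections E"
proof -
  assume v: "unital v"
  have "v 1 \<noteq> \<zero>\<^bsub>H 1\<^esub>"
  proof
    interpret hilbert_space "H 1" by (rule hilbert_fibre) simp
    assume "v 1 = \<zero>\<^bsub>H 1\<^esub>"
    then show False using unitalD(2)[OF v, of 1] by simp
  qed
  then show ?thesis using unitalD[OF v] by (auto simp: units_def intro!: exI[of _ 1])
qed

text \<open>The exponent is real because squared norms are, and nonnegative because Cauchy-Schwarz
  against the unit vector \<open>u 1\<close> makes the norm of \<open>v 1\<close> at least
  1.\<close>

lemma unital_norm:
  assumes v: "v \<in> units E" "unital v"
  obtains c where "0 \<le> c" "\<And>t. t > 0 \<Longrightarrow> cip (H t) (v t) (v t) = of_real (exp (c * t))"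
proof -
  let ?g = "covariance E v v"
  have "?g = cnj ?g"
  proof (rule exp_of_real_eq_imp)
    fix t :: real assume t: "t > 0"
    have "cip (H t) (v t) (v t) = cnj (cip (H t) (v t) (v t))"
      by (rule cip_commute[OF t unitsD(2)[OF v(1) t] unitsD(2)[OF v(1) t]])
    then show "exp (of_real t * ?g) = exp (of_real t * cnj ?g)"
      unfolding cip_units[OF v(1) v(1) t] by (simp add: exp_cnj)
  qed
  then have g: "?g = of_real (Re ?g)" by (simp add: complex_eq_iff)
  have n: "cip (H t) (v t) (v t) = of_real (exp (Re ?g * t))" if t: "t > 0" for t
    unfolding cip_units[OF v(1) v(1) t] by (subst g) (simp add: mult.commute flip: exp_of_real)
  have "0 \<le> Re ?g"
  proof -
    interpret hilbert_space "H 1" by (rule hilbert_fibre) simp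
    have c: "u 1 \<in> carrier (H 1)" "v 1 \<in> carrier (H 1)" using unitsD(2)[OF v(1)] by auto
    have "hnorm (H 1) (u 1) = 1" by (simp add: hnorm_def u_norm)
    then have "1 \<le> hnorm (H 1) (v 1)" using cauchy_schwarz[OF c] unitalD(2)[OF v(2)] by simp
    then have "1 \<le> (hnorm (H 1) (v 1))\<^sup>2" by simp
    then have "1 \<le> exp (Re ?g)" using hnorm_sq[OF c(2)] n[of 1] by simp
    then show ?thesis by simp
  qed
  then show ?thesis using n by (rule that)
qed

lemma additive_lincomb:
  assumes a: "additive a" and b: "additive b"
  shows "additive (\<lambda>t. a t \<oplus>\<^bsub>H t\<^esub> c \<odot>\<^bsub>H t\<^esub> b t)"
  unfolding additive_def
proof (intro conjI allI impI)
  fix t :: real assume t: "t > 0"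
  show "a t \<oplus>\<^bsub>H t\<^esub> c \<odot>\<^bsub>H t\<^esub> b t \<in> carrier (H t)" "cip (H t) (u t) (a t \<oplus>\<^bsub>H t\<^esub> c \<odot>\<^bsub>H t\<^esub> b t) = 0"
    using t additiveD[OF a] additiveD[OF b] by (auto simp: fibre_closed cip_simps)
next
  fix s t :: real assume s: "s > 0" and t: "t > 0"
  note cl = additiveD(1)[OF a] additiveD(1)[OF b] fibre_closed
  show "a (s + t) \<oplus>\<^bsub>H (s + t)\<^esub> c \<odot>\<^bsub>H (s + t)\<^esub> b (s + t) =
     prd s t (a s \<oplus>\<^bsub>H s\<^esub> c \<odot>\<^bsub>H s\<^esub> b s) (u t) \<oplus>\<^bsub>H (s + t)\<^esub> prd s t (u s) (a t \<oplus>\<^bsub>H t\<^esub> c \<odot>\<^bsub>H t\<^esub> b t)"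
  proof (rule prd_eqI[OF s t])
    show "a (s + t) \<oplus>\<^bsub>H (s + t)\<^esub> c \<odot>\<^bsub>H (s + t)\<^esub> b (s + t) \<in> carrier (H (s + t))"
      using s t cl by simp
    show "prd s t (a s \<oplus>\<^bsub>H s\<^esub> c \<odot>\<^bsub>H s\<^esub> b s) (u t) \<oplus>\<^bsub>H (s + t)\<^esub> prd s t (u s) (a t \<oplus>\<^bsub>H t\<^esub> c \<odot>\<^bsub>H t\<^esub> b t) \<in> carrier (H (s + t))"
      using s t cl by (simp add: prd_closed)
    fix x y assume "x \<in> carrier (H s)" "y \<in> carrier (H t)"
    then show "cip (H (s + t)) (prd s t x y) (a (s + t) \<oplus>\<^bsub>H (s + t)\<^esub> c \<odot>\<^bsub>H (s + t)\<^esub> b (s + t)) = cip (H (s + t)) (prd s t x y)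
       (prd s t (a s \<oplus>\<^bsub>H s\<^esub> c \<odot>\<^bsub>H s\<^esub> b s) (u t) \<oplus>\<^bsub>H (s + t)\<^esub> prd s t (u s) (a t \<oplus>\<^bsub>H t\<^esub> c \<odot>\<^bsub>H t\<^esub> b t))"
      using s t cl by (simp add: additiveD(3)[OF a] additiveD(3)[OF b] cip_simps cip_prd prd_closed algebra_simps)
  qed
qed

text \<open>Each mixed term contains an inner product of u with a or b and vanishes; the remaining
  ones contain the factor 1 from u.\<close>

lemma cip_additive_add:
  assumes a: "additive a" and b: "additive b" and s: "s > 0" and t: "t > 0"
  shows "cip (H (s + t)) (a (s + t)) (b (s + t)) = cip (H s) (a s) (b s) + cip (H t) (a t) (b t)"
  using s t by (simp add: additiveD[OF a] additiveD[OF b] fibre_closed prd_closed cip_simps cip_prd u_norm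
      additive_cip_u[OF a] additive_cip_u[OF b])

lemma additive_norm:
  assumes a: "additive a" and t: "t > 0"
  shows "Re (cip (H t) (a t) (a t)) = t * Re (cip (H 1) (a 1) (a 1))"
proof (rule nonneg_additive_linear[OF _ _ t])
  show "Re (cip (H (s + t)) (a (s + t)) (a (s + t))) = Re (cip (H s) (a s) (a s)) + Re (cip (H t) (a t) (a t))"
    if "s > 0" "t > 0" for s t using cip_additive_add[OF a a that] by simp
  show "0 \<le> Re (cip (H t) (a t) (a t))" if "t > 0" for t
    by (rule pre_hilbert.cip_nonneg[OF hilbert_space.pre_hilbert[OF hilbert_fibre[OF that]] additiveD(1)[OF a that]])
qed

text \<open>Polarisation of \<open>additive_norm\<close>, applied to a + c b; the scalars 1 and
  -\<i> give the real and the imaginary part.\<close>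

lemma cip_additive:
  assumes a: "additive a" and b: "additive b" and t: "t > 0"
  shows "cip (H t) (a t) (b t) = of_real t * cip (H 1) (a 1) (b 1)"
proof -
  have ex: "Re (cip (H t) (a t \<oplus>\<^bsub>H t\<^esub> c \<odot>\<^bsub>H t\<^esub> b t) (a t \<oplus>\<^bsub>H t\<^esub> c \<odot>\<^bsub>H t\<^esub> b t)) =
     Re (cip (H t) (a t) (a t)) + 2 * Re (c * cip (H t) (a t) (b t)) + (cmod c)\<^sup>2 * Re (cip (H t) (b t) (b t))"
    if t: "t > 0" for t c
  proof -
    interpret hilbert_space "H t" by (rule hilbert_fibre[OF t])
    note cl = additiveD(1)[OF a t] additiveD(1)[OF b t]
    have "(hnorm (H t) (a t \<oplus>\<^bsub>H t\<^esub> c \<odot>\<^bsub>H t\<^esub> b t))\<^sup>2 =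
       (hnorm (H t) (a t))\<^sup>2 + 2 * Re (cip (H t) (a t) (c \<odot>\<^bsub>H t\<^esub> b t)) + (hnorm (H t) (c \<odot>\<^bsub>H t\<^esub> b t))\<^sup>2"
      by (rule hnorm_sq_add) (use cl in auto)
    then show ?thesis using cl by (simp add: hnorm_sq_smult cip_smult_right) (simp add: hnorm_sq cip_smult_right)
  qed
  have "Re (c * cip (H t) (a t) (b t)) = t * Re (c * cip (H 1) (a 1) (b 1))" for c
    using additive_norm[OF additive_lincomb[OF a b, of c] t] additive_norm[OF a t] additive_norm[OF b t]
      ex[OF t, of c] ex[of 1 c] by (simp add: algebra_simps)
  from this[of 1] this[of "- \<i>"] show ?thesis by (simp add: complex_eq_iff)
qed

lemma additive_norm':
  assumes a: "additive a" and t: "t > 0"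
  shows "cip (H t) (a t) (a t) = of_real ((hnorm (H 1) (a 1))\<^sup>2 * t)"
proof -
  interpret hilbert_space "H 1" by (rule hilbert_fibre) simp
  show ?thesis using cip_additive[OF a a t] cip_self[OF additiveD(1)[OF a]] by (simp add: mult.commute)
qed

lemma exp_root_facts:
  assumes a: "additive a"
  shows "t > 0 \<Longrightarrow> hconv (H t) (\<lambda>n. exp_prod a (uniform_partition t n)) (exp_root a t)"
    "unital (exp_root a)" "t > 0 \<Longrightarrow> log_unit (exp_root a) t = a t" "exp_root a \<in> extensional {0<..}"
proof -
  have n: "cip (H t) (a t) (a t) = of_real ((hnorm (H 1) (a 1))\<^sup>2 * t)" if "t > 0" for t
    by (rule additive_norm'[OF a that])
  show "t > 0 \<Longrightarrow> hconv (H t) (\<lambda>n. exp_prod a (uniform_partition t n)) (exp_root a t)"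
    by (rule exp_root_hconv[OF a n zero_le_power2])
  show "unital (exp_root a)" by (rule exp_root_unital[OF a n zero_le_power2])
  show "t > 0 \<Longrightarrow> log_unit (exp_root a) t = a t" by (rule log_exp_root[OF a n zero_le_power2])
  show "exp_root a \<in> extensional {0<..}"
    by (subst exp_root_def[OF a n zero_le_power2]) simp_all
qed

section \<open>Measurability of logarithms and exponentials\<close>

text \<open>The induction multiplies a field over \<alpha> t with one over (n + 1) \<alpha> t and
  thus needs a free \<alpha>; uniform partitions of t are the case \<alpha> = 1/(n + 1).\<close>

lemma measurable_log_sum:
  assumes v: "v \<in> units E" "unital v" and \<alpha>: "\<alpha> > 0"
  shows "measurable_field (real (Suc n) * \<alpha>) (\<lambda>t. log_sum v (replicate (Suc n) (\<alpha> * t)))"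
proof (induction n)
  case 0
  show ?case
    using measurable_field_diff[OF \<alpha> measurable_field_section[OF unitsD(1)[OF v(1)] \<alpha>] measurable_field_section[OF unitsD(1)[OF u_unit] \<alpha>]]
    by simp
next
  case (Suc n)
  let ?\<beta> = "real (Suc n) * \<alpha>"
  have \<beta>: "?\<beta> > 0" using \<alpha> by simp
  have \<alpha>\<beta>: "\<alpha> + ?\<beta> > 0" by (rule add_pos_pos[OF \<alpha> \<beta>])
  have eq: "\<alpha> + ?\<beta> = real (Suc (Suc n)) * \<alpha>" by (simp add: algebra_simps)
  note V = measurable_field_section[OF unitsD(1)[OF v(1)]] and U = measurable_field_section[OF unitsD(1)[OF u_unit]]
  have "measurable_field (\<alpha> + ?\<beta>) (\<lambda>t. prd (\<alpha> * t) (?\<beta> * t) (v (\<alpha> * t) \<ominus>\<^bsub>H (\<alpha> * t)\<^esub> u (\<alpha> * t)) (u (?\<beta> * t)) \<oplus>\<^bsub>H ((\<alpha> + ?\<beta>) * t)\<^esub>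
      prd (\<alpha> * t) (?\<beta> * t) (u (\<alpha> * t)) (log_sum v (replicate (Suc n) (\<alpha> * t))))"
    by (intro measurable_field_add measurable_field_prd measurable_field_diff V U Suc \<alpha> \<beta> \<alpha>\<beta>)
  then show ?case unfolding eq
  proof (rule measurable_field_cong)
    fix t :: real assume "t > 0"
    have e: "sum_list (replicate (Suc n) (\<alpha> * t)) = ?\<beta> * t" by (simp add: sum_list_replicate algebra_simps)
    have e': "\<alpha> * t + ?\<beta> * t = real (Suc (Suc n)) * \<alpha> * t" by (simp add: algebra_simps)
    show "prd (\<alpha> * t) (?\<beta> * t) (v (\<alpha> * t) \<ominus>\<^bsub>H (\<alpha> * t)\<^esub> u (\<alpha> * t)) (u (?\<beta> * t)) \<oplus>\<^bsub>H (real (Suc (Suc n)) * \<alpha> * t)\<^esub>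
      prd (\<alpha> * t) (?\<beta> * t) (u (\<alpha> * t)) (log_sum v (replicate (Suc n) (\<alpha> * t))) =
      log_sum v (replicate (Suc (Suc n)) (\<alpha> * t))"
      using log_sum_Cons[of "replicate (Suc n) (\<alpha> * t)" v "\<alpha> * t"] unfolding e e' by simp
  qed
qed

lemma measurable_exp_prod:
  assumes a: "a \<in> roots E u" and \<alpha>: "\<alpha> > 0"
  shows "measurable_field (real (Suc n) * \<alpha>) (\<lambda>t. exp_prod a (replicate (Suc n) (\<alpha> * t)))"
proof (induction n)
  case 0
  have "a \<in> measurable_sections E" using a by (simp add: roots_iff)
  then show ?case
    using measurable_field_add[OF \<alpha> measurable_field_section[OF unitsD(1)[OF u_unit] \<alpha>] measurable_field_section[OF _ \<alpha>]]
    by simp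
next
  case (Suc n)
  let ?\<beta> = "real (Suc n) * \<alpha>"
  have \<beta>: "?\<beta> > 0" using \<alpha> by simp
  have \<alpha>\<beta>: "\<alpha> + ?\<beta> > 0" by (rule add_pos_pos[OF \<alpha> \<beta>])
  have eq: "\<alpha> + ?\<beta> = real (Suc (Suc n)) * \<alpha>" by (simp add: algebra_simps)
  have am: "a \<in> measurable_sections E" using a by (simp add: roots_iff)
  note V = measurable_field_section[OF am] and U = measurable_field_section[OF unitsD(1)[OF u_unit]]
  have "measurable_field (\<alpha> + ?\<beta>) (\<lambda>t. prd (\<alpha> * t) (?\<beta> * t) (u (\<alpha> * t) \<oplus>\<^bsub>H (\<alpha> * t)\<^esub> a (\<alpha> * t)) (exp_prod a (replicate (Suc n) (\<alpha> * t))))"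
    by (intro measurable_field_add measurable_field_prd V U Suc \<alpha> \<beta>)
  then show ?case unfolding eq
  proof (rule measurable_field_cong)
    fix t :: real assume "t > 0"
    have e: "sum_list (replicate (Suc n) (\<alpha> * t)) = ?\<beta> * t" by (simp add: sum_list_replicate algebra_simps)
    show "prd (\<alpha> * t) (?\<beta> * t) (u (\<alpha> * t) \<oplus>\<^bsub>H (\<alpha> * t)\<^esub> a (\<alpha> * t)) (exp_prod a (replicate (Suc n) (\<alpha> * t))) =
      exp_prod a (replicate (Suc (Suc n)) (\<alpha> * t))"
      using exp_prod_Cons[of "replicate (Suc n) (\<alpha> * t)" a "\<alpha> * t"] unfolding e by simp
  qed
qed

lemma log_unit_root:
  assumes v: "v \<in> units E" "unital v" shows "log_unit v \<in> roots E u"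
proof -
  obtain c where c: "0 \<le> c" "\<And>t. t > 0 \<Longrightarrow> cip (H t) (v t) (v t) = of_real (exp (c * t))"
    using unital_norm[OF v] by blast
  have "measurable_field 1 (log_unit v)"
  proof (rule measurable_field_lim[of 1 "\<lambda>n t. log_sum v (uniform_partition t n)"])
    show "measurable_field 1 (\<lambda>t. log_sum v (uniform_partition t n))" for n
      using measurable_log_sum[OF v, of "1 / real (Suc n)" n] by (simp add: uniform_partition_def del: of_nat_Suc replicate_Suc)
    show "hconv (H (1 * t)) (\<lambda>n. log_sum v (uniform_partition t n)) (log_unit v t)" if "t > 0" for t
      using log_unit_hconv[OF v(2) c(2) that] by simp
  qed simp
  moreover have "additive (log_unit v)" by (rule log_unit_additive[OF v(2) c(2)])
  ultimately show ?thesis by (simp add: roots_iff measurable_section_iff log_unit_def)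
qed

lemma exp_root_unit:
  assumes a: "a \<in> roots E u" shows "exp_root a \<in> units E" "unital (exp_root a)"
proof -
  have add: "additive a" using a by (simp add: roots_iff)
  show e: "unital (exp_root a)" by (rule exp_root_facts(2)[OF add])
  have "measurable_field 1 (exp_root a)"
  proof (rule measurable_field_lim[of 1 "\<lambda>n t. exp_prod a (uniform_partition t n)"])
    show "measurable_field 1 (\<lambda>t. exp_prod a (uniform_partition t n))" for n
      using measurable_exp_prod[OF a, of "1 / real (Suc n)" n] by (simp add: uniform_partition_def del: of_nat_Suc replicate_Suc)
    show "hconv (H (1 * t)) (\<lambda>n. exp_prod a (uniform_partition t n)) (exp_root a t)" if "t > 0" for t
      using exp_root_facts(1)[OF add that] by simp
  qed simp
  then show "exp_root a \<in> units E" using units_iff[OF e] exp_root_facts(4)[OF add] by (simp add: measurable_section_iff)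
qed

definition rescale :: "(real \<Rightarrow> 'a) \<Rightarrow> real \<Rightarrow> 'a" where
  "rescale v = (\<lambda>t\<in>{0<..}. exp (- (of_real t * covariance E u v)) \<odot>\<^bsub>H t\<^esub> v t)"

lemma rescale_unital: assumes v: "v \<in> units E" shows "unital (rescale v)"
  unfolding unital_def
proof (intro conjI allI impI)
  fix t :: real assume t: "t > 0"
  show "rescale v t \<in> carrier (H t)" using t unitsD(2)[OF v t] by (simp add: rescale_def fibre_closed)
  show "cip (H t) (u t) (rescale v t) = 1"
    using t unitsD(2)[OF v t] cip_units[OF u_unit v t] by (simp add: rescale_def cip_simps flip: exp_add)
next
  fix s t :: real assume s: "s > 0" and t: "t > 0"
  interpret hilbert_space "H (s + t)" by (rule hilbert_fibre) (use s t in simp)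
  note c = unitsD(2)[OF v s] unitsD(2)[OF v t]
  let ?g = "covariance E u v"
  have "prd s t (rescale v s) (rescale v t) = exp (- (of_real t * ?g)) \<odot>\<^bsub>H (s + t)\<^esub> (exp (- (of_real s * ?g)) \<odot>\<^bsub>H (s + t)\<^esub> prd s t (v s) (v t))"
    using s t c by (simp add: rescale_def prd_smult_left prd_smult_right fibre_smult_closed prd_closed)
  also have "\<dots> = (exp (- (of_real t * ?g)) * exp (- (of_real s * ?g))) \<odot>\<^bsub>H (s + t)\<^esub> prd s t (v s) (v t)"
    using smult_assoc1[of "exp (- (of_real t * ?g))" "exp (- (of_real s * ?g))" "prd s t (v s) (v t)"] prd_closed[OF s t c] by simp
  also have "exp (- (of_real t * ?g)) * exp (- (of_real s * ?g)) = exp (- (of_real (s + t) * ?g))"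
    by (simp add: algebra_simps flip: exp_add)
  finally show "rescale v (s + t) = prd s t (rescale v s) (rescale v t)"
    using s t unitsD(3)[OF v s t] by (simp add: rescale_def)
qed

lemma rescale_unit: assumes v: "v \<in> units E" shows "rescale v \<in> units E"
proof -
  have "(\<lambda>t. exp (- (complex_of_real t * covariance E u v))) \<in> borel_measurable pos_reals"
    by (intro measurable_restrict_space1 borel_measurable_continuous_onI continuous_intros)
  from measurable_field_smult[OF zero_less_one _ this, of v] have "measurable_field 1 (\<lambda>t. exp (- (of_real t * covariance E u v)) \<odot>\<^bsub>H t\<^esub> v t)"
    using unitsD(1)[OF v] by (simp add: measurable_section_iff)
  then show ?thesis using measurable_section_restrict units_iff[OF rescale_unital[OF v]] by (simp add: rescale_def)
qed

lemma unit_eq_rescale: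
  assumes v: "v \<in> units E" and t: "t > 0"
  shows "v t = exp (of_real t * covariance E u v) \<odot>\<^bsub>H t\<^esub> rescale v t"
proof -
  interpret hilbert_space "H t" by (rule hilbert_fibre[OF t])
  show ?thesis
    using t smult_assoc1[of "exp (of_real t * covariance E u v)" "exp (- (of_real t * covariance E u v))" "v t"]
      smult_one[of "v t"] unitsD(2)[OF v t] by (simp add: rescale_def flip: exp_add)
qed

text \<open>The exponent that \<open>exp_log_unit\<close> asks for exists because
  \<open>exp_root (log_unit v)\<close> is a unit, so that its inner product with v is an
  exponential.\<close>

lemma exp_log_unit': assumes v: "v \<in> units E" "unital v" and t: "t > 0"
  shows "exp_root (log_unit v) t = v t"
proof -
  obtain c where c: "0 \<le> c" "\<And>t. t > 0 \<Longrightarrow> cip (H t) (v t) (v t) = of_real (exp (c * t))"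
    using unital_norm[OF v] by blast
  show ?thesis
    by (rule exp_log_unit[OF v(2) c(2) c(1) cip_units[OF exp_root_unit(1)[OF log_unit_root[OF v]] v(1)] t])
qed

lemma log_exp_root': assumes a: "a \<in> roots E u" shows "log_unit (exp_root a) = a"
proof
  have add: "additive a" and ext: "a \<in> extensional {0<..}" using a by (auto simp: roots_iff measurable_section_iff)
  fix t show "log_unit (exp_root a) t = a t"
  proof (cases "t > 0")
    case True
    then show ?thesis by (rule exp_root_facts(3)[OF add])
  next
    case False
    then show ?thesis using ext by (simp add: log_unit_def extensional_def)
  qed
qed

lemma cip_log_units:
  assumes v: "v \<in> units E" "unital v" and w: "w \<in> units E" "unital w"
  shows "cip (H 1) (log_unit v 1) (log_unit w 1) = covariance E v w"
proof -
  obtain c where c: "\<And>t. t > 0 \<Longrightarrow> cip (H t) (v t) (v t) = of_real (exp (c * t))"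
    using unital_norm[OF v] by blast
  obtain d where d: "\<And>t. t > 0 \<Longrightarrow> cip (H t) (w t) (w t) = of_real (exp (d * t))"
    using unital_norm[OF w] by blast
  show ?thesis using cip_log_unit[OF v(2) c w(2) d cip_units[OF v(1) w(1)], of 1] by simp
qed

lemma covariance_rescale:
  assumes v: "v \<in> units E" and w: "w \<in> units E"
  shows "covariance E v w = cnj (covariance E u v) + covariance E u w + cip (H 1) (log_unit (rescale v) 1) (log_unit (rescale w) 1)"
  unfolding cip_log_units[OF rescale_unit[OF v] rescale_unital[OF v] rescale_unit[OF w] rescale_unital[OF w]]
proof (rule covariance_eqI[OF v w])
  fix t :: real assume t: "t > 0"
  have "cip (H t) (v t) (w t) = cnj (exp (of_real t * covariance E u v)) * (exp (of_real t * covariance E u w) * cip (H t) (rescale v t) (rescale w t))"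
    using t unitsD(2)[OF rescale_unit[OF v]] unitsD(2)[OF rescale_unit[OF w]]
    by (subst unit_eq_rescale[OF v t], subst unit_eq_rescale[OF w t]) (simp add: cip_simps fibre_smult_closed)
  also have "\<dots> = exp (of_real t * (cnj (covariance E u v) + covariance E u w + covariance E (rescale v) (rescale w)))"
    unfolding cip_units[OF rescale_unit[OF v] rescale_unit[OF w] t]
    by (simp add: exp_cnj algebra_simps flip: exp_add)
  finally show "cip (H t) (v t) (w t) = exp (of_real t * (cnj (covariance E u v) + covariance E u w + covariance E (rescale v) (rescale w)))" .
qed

lemma rescale_normal: assumes v: "v \<in> units E" "unital v" shows "rescale v = v"
proof -
  have "covariance E u v = 0" by (rule covariance_eqI[OF u_unit v(1)]) (use unitalD(2)[OF v(2)] in simp)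
  then have "rescale v t = v t" for t
  proof (cases "t > 0")
    case True
    interpret hilbert_space "H t" by (rule hilbert_fibre[OF True])
    show ?thesis using True \<open>covariance E u v = 0\<close> smult_one[of "v t"] unitsD(2)[OF v(1) True] by (simp add: rescale_def)
  next
    case False
    then show ?thesis using unitsD(1)[OF v(1)] by (simp add: rescale_def measurable_section_iff extensional_def)
  qed
  then show ?thesis by blast
qed

section \<open>The space of roots\<close>

lemma root_space_simps [simp]:
  "carrier (root_space E u) = roots E u" "zero (root_space E u) = (\<lambda>t\<in>{0<..}. \<zero>\<^bsub>H t\<^esub>)"
  "add (root_space E u) = (\<lambda>a b. \<lambda>t\<in>{0<..}. a t \<oplus>\<^bsub>H t\<^esub> b t)"
  "smult (root_space E u) = (\<lambda>c a. \<lambda>t\<in>{0<..}. c \<odot>\<^bsub>H t\<^esub> a t)"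
  "cip (root_space E u) = (\<lambda>a b. cip (H 1) (a 1) (b 1))"
  by (simp_all add: root_space_def)

lemma additive_cong:
  assumes "additive a" "\<And>t. t > 0 \<Longrightarrow> a t = b t" shows "additive b"
  using assms unfolding additive_def by (metis add_pos_pos)

lemma rootI: assumes "measurable_field 1 a" "additive a" shows "(\<lambda>t\<in>{0<..}. a t) \<in> roots E u"
  unfolding roots_iff using measurable_section_restrict[OF assms(1)] additive_cong[OF assms(2)] by auto

lemma rootD:
  assumes "a \<in> roots E u"
  shows "measurable_field 1 a" "additive a" "a \<in> extensional {0<..}" "t > 0 \<Longrightarrow> a t \<in> carrier (H t)"
  using assms additiveD(1)[of a] by (auto simp: roots_iff measurable_section_iff)

lemma additive_zero: "additive (\<lambda>t. \<zero>\<^bsub>H t\<^esub>)"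
proof -
  have z: "\<zero>\<^bsub>H t\<^esub> \<in> carrier (H t)" "cip (H t) (u t) \<zero>\<^bsub>H t\<^esub> = 0" "\<zero>\<^bsub>H t\<^esub> \<oplus>\<^bsub>H t\<^esub> \<zero>\<^bsub>H t\<^esub> = \<zero>\<^bsub>H t\<^esub>" if "t > 0" for t
  proof -
    interpret hilbert_space "H t" by (rule hilbert_fibre[OF that])
    show "\<zero>\<^bsub>H t\<^esub> \<in> carrier (H t)" "cip (H t) (u t) \<zero>\<^bsub>H t\<^esub> = 0" "\<zero>\<^bsub>H t\<^esub> \<oplus>\<^bsub>H t\<^esub> \<zero>\<^bsub>H t\<^esub> = \<zero>\<^bsub>H t\<^esub>" using that by auto
  qed
  show ?thesis unfolding additive_def using z by (auto simp: prd_zero_left prd_zero_right)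
qed

lemma zero_root: "(\<lambda>t\<in>{0<..}. \<zero>\<^bsub>H t\<^esub>) \<in> roots E u"
proof (rule rootI[OF _ additive_zero])
  have z: "\<zero>\<^bsub>H t\<^esub> \<in> carrier (H t)" "cip (H t) (e n t) \<zero>\<^bsub>H t\<^esub> = 0" if "t > 0" for t n
  proof -
    interpret hilbert_space "H t" by (rule hilbert_fibre[OF that])
    show "\<zero>\<^bsub>H t\<^esub> \<in> carrier (H t)" "cip (H t) (e n t) \<zero>\<^bsub>H t\<^esub> = 0" using that e_closed by auto
  qed
  have "(\<lambda>t. cip (H t) (e n t) \<zero>\<^bsub>H t\<^esub>) \<in> borel_measurable pos_reals" for n
    by (rule measurable_cong[THEN iffD1, of pos_reals "\<lambda>_. 0"]) (use z in auto)
  then show "measurable_field 1 (\<lambda>t. \<zero>\<^bsub>H t\<^esub>)" using z by (simp add: measurable_field_def)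
qed

lemma lincomb_root:
  assumes a: "a \<in> roots E u" and b: "b \<in> roots E u"
  shows "(\<lambda>t\<in>{0<..}. a t \<oplus>\<^bsub>H t\<^esub> c \<odot>\<^bsub>H t\<^esub> b t) \<in> roots E u"
proof (rule rootI[OF _ additive_lincomb[OF rootD(2)[OF a] rootD(2)[OF b]]])
  show "measurable_field 1 (\<lambda>t. a t \<oplus>\<^bsub>H t\<^esub> c \<odot>\<^bsub>H t\<^esub> b t)"
    using measurable_field_add[OF zero_less_one rootD(1)[OF a] measurable_field_smult[OF zero_less_one rootD(1)[OF b], of "\<lambda>_. c"]]
    by simp
qed

lemma add_root: assumes a: "a \<in> roots E u" and b: "b \<in> roots E u"
  shows "(\<lambda>t\<in>{0<..}. a t \<oplus>\<^bsub>H t\<^esub> b t) \<in> roots E u"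
proof -
  have "1 \<odot>\<^bsub>H t\<^esub> b t = b t" if "t > 0" for t
  proof -
    interpret hilbert_space "H t" by (rule hilbert_fibre[OF that])
    show ?thesis using smult_one[of "b t"] rootD(4)[OF b that] by simp
  qed
  then have "(\<lambda>t\<in>{0<..}. a t \<oplus>\<^bsub>H t\<^esub> 1 \<odot>\<^bsub>H t\<^esub> b t) = (\<lambda>t\<in>{0<..}. a t \<oplus>\<^bsub>H t\<^esub> b t)"
    by (intro restrict_ext) simp
  then show ?thesis using lincomb_root[OF a b, of 1] by simp
qed

lemma smult_root: assumes a: "a \<in> roots E u"
  shows "(\<lambda>t\<in>{0<..}. c \<odot>\<^bsub>H t\<^esub> a t) \<in> roots E u"
proof -
  have "\<zero>\<^bsub>H t\<^esub> \<oplus>\<^bsub>H t\<^esub> c \<odot>\<^bsub>H t\<^esub> a t = c \<odot>\<^bsub>H t\<^esub> a t" if "t > 0" for t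
  proof -
    interpret hilbert_space "H t" by (rule hilbert_fibre[OF that])
    show ?thesis using rootD(4)[OF a that] by simp
  qed
  then have "(\<lambda>t\<in>{0<..}. (\<lambda>t\<in>{0<..}. \<zero>\<^bsub>H t\<^esub>) t \<oplus>\<^bsub>H t\<^esub> c \<odot>\<^bsub>H t\<^esub> a t) = (\<lambda>t\<in>{0<..}. c \<odot>\<^bsub>H t\<^esub> a t)"
    by (intro restrict_ext) simp
  then show ?thesis using lincomb_root[OF zero_root a, of c] by simp
qed

text \<open>The difference of two roots is additive, so its squared norm is linear in t. Evaluation
  at time 1 therefore controls all fibres.\<close>

lemma root_dist:
  assumes a: "a \<in> roots E u" and b: "b \<in> roots E u" and t: "t > 0"
  shows "(hnorm (H t) (a t \<ominus>\<^bsub>H t\<^esub> b t))\<^sup>2 = t * (hnorm (H 1) (a 1 \<ominus>\<^bsub>H 1\<^esub> b 1))\<^sup>2"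
proof -
  have *: "(hnorm (H t) (a t \<ominus>\<^bsub>H t\<^esub> b t))\<^sup>2 = Re (cip (H t) (a t \<oplus>\<^bsub>H t\<^esub> (-1) \<odot>\<^bsub>H t\<^esub> b t) (a t \<oplus>\<^bsub>H t\<^esub> (-1) \<odot>\<^bsub>H t\<^esub> b t))"
    if t: "t > 0" for t
  proof -
    interpret hilbert_space "H t" by (rule hilbert_fibre[OF t])
    show ?thesis using rootD(4)[OF a t] rootD(4)[OF b t] hnorm_sq[of "a t \<ominus>\<^bsub>H t\<^esub> b t"] by (simp add: diff_eq_smult)
  qed
  show ?thesis unfolding *[OF t] *[OF zero_less_one]
    by (rule additive_norm[OF additive_lincomb[OF rootD(2)[OF a] rootD(2)[OF b]] t])
qed

text \<open>Completeness of the space of roots: convergence of the values at time 1 forces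
  convergence in every fibre by \<open>root_dist\<close>, and the pointwise limit is again a
  root.\<close>

lemma closed_subspace_roots: "closed_subspace (H 1) ((\<lambda>a. a 1) ` roots E u)"
proof -
  interpret H1: hilbert_space "H 1" by (rule hilbert_fibre) simp
  show ?thesis
  proof (rule H1.closed_subspaceI)
    show "(\<lambda>a. a 1) ` roots E u \<subseteq> carrier (H 1)" using rootD(4) by auto
    show "\<zero>\<^bsub>H 1\<^esub> \<in> (\<lambda>a. a 1) ` roots E u" by (rule image_eqI[OF _ zero_root]) simp
    show "x \<oplus>\<^bsub>H 1\<^esub> y \<in> (\<lambda>a. a 1) ` roots E u" if x: "x \<in> (\<lambda>a. a 1) ` roots E u" and y: "y \<in> (\<lambda>a. a 1) ` roots E u" for x y
    proof -
      obtain a b where ab: "a \<in> roots E u" "x = a 1" "b \<in> roots E u" "y = b 1" using x y by blast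
      show ?thesis by (rule image_eqI[OF _ add_root[OF ab(1,3)]]) (simp add: ab)
    qed
    show "c \<odot>\<^bsub>H 1\<^esub> x \<in> (\<lambda>a. a 1) ` roots E u" if x: "x \<in> (\<lambda>a. a 1) ` roots E u" for c x
    proof -
      obtain a where ab: "a \<in> roots E u" "x = a 1" using x by blast
      show ?thesis by (rule image_eqI[OF _ smult_root[OF ab(1)]]) (simp add: ab)
    qed
  next
    fix X x assume X: "\<And>n. X n \<in> (\<lambda>a. a 1) ` roots E u" and l: "hconv (H 1) X x"
    then have "\<forall>n. \<exists>a\<in>roots E u. X n = a 1" by blast
    then obtain A where A: "\<And>n. A n \<in> roots E u" "\<And>n. X n = A n 1" by metis
    note hc = H1.hconvD[OF l]
    have "\<exists>y. hconv (H t) (\<lambda>n. A n t) y" if t: "t > 0" for t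
    proof -
      interpret hilbert_space "H t" by (rule hilbert_fibre[OF t])
      show ?thesis
      proof (rule cauchy_hconv)
        show "A n t \<in> carrier (H t)" for n by (rule rootD(4)[OF A(1) t])
        fix d :: real assume "d > 0"
        \<comment> \<open>The factor sqrt t compensates the scaling in \<open>root_dist\<close>, the
          factor 2 the detour through x in the triangle inequality.\<close>
        then have d: "d / (2 * sqrt t) > 0" using t by simp
        obtain N where N: "\<And>n. n \<ge> N \<Longrightarrow> norm (hnorm (H 1) (X n \<ominus>\<^bsub>H 1\<^esub> x) - 0) < d / (2 * sqrt t)"
          using LIMSEQ_D[OF hc(3) d] by blast
        have "hnorm (H t) (A m t \<ominus>\<^bsub>H t\<^esub> A n t) < d" if mn: "m \<ge> N" "n \<ge> N" for m n
        proof -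
          have "hnorm (H 1) (X m \<ominus>\<^bsub>H 1\<^esub> X n) \<le> hnorm (H 1) (X m \<ominus>\<^bsub>H 1\<^esub> x) + hnorm (H 1) (x \<ominus>\<^bsub>H 1\<^esub> X n)"
            by (rule H1.hnorm_triangle[OF hc(1) hc(2) hc(1)])
          also have "hnorm (H 1) (x \<ominus>\<^bsub>H 1\<^esub> X n) = hnorm (H 1) (X n \<ominus>\<^bsub>H 1\<^esub> x)" by (rule H1.hnorm_minus_commute[OF hc(2,1)])
          finally have "hnorm (H 1) (X m \<ominus>\<^bsub>H 1\<^esub> X n) < d / sqrt t" using N[OF mn(1)] N[OF mn(2)] by simp
          then have "(hnorm (H 1) (X m \<ominus>\<^bsub>H 1\<^esub> X n))\<^sup>2 < (d / sqrt t)\<^sup>2"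
            by (rule power_strict_mono) (use hc(1) in auto)
          then have "(hnorm (H t) (A m t \<ominus>\<^bsub>H t\<^esub> A n t))\<^sup>2 < d\<^sup>2"
            unfolding root_dist[OF A(1) A(1) t] using t by (simp add: A(2) power_divide field_simps)
          then show ?thesis by (rule power2_less_imp_less) (use \<open>d > 0\<close> in simp)
        qed
        then show "\<exists>N. \<forall>m\<ge>N. \<forall>n\<ge>N. hnorm (H t) (A m t \<ominus>\<^bsub>H t\<^esub> A n t) < d" by blast
      qed
    qed
    then obtain b where b: "\<And>t. t > 0 \<Longrightarrow> hconv (H t) (\<lambda>n. A n t) (b t)" by metis
    have "additive b" unfolding additive_def
    proof (intro conjI allI impI)
      fix t :: real assume t: "t > 0"
      interpret hilbert_space "H t" by (rule hilbert_fibre[OF t])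
      show "b t \<in> carrier (H t)" by (rule hconvD(2)[OF b[OF t]])
      have "(\<lambda>n. cip (H t) (u t) (A n t)) \<longlonglongrightarrow> cip (H t) (u t) (b t)"
        by (rule hconv_cip[OF hconv_const b[OF t]]) (use t in simp)
      then show "cip (H t) (u t) (b t) = 0"
        using additiveD(2)[OF rootD(2)[OF A(1)] t] by (simp add: LIMSEQ_const_iff)
    next
      fix s t :: real assume s: "s > 0" and t: "t > 0"
      interpret hilbert_space "H (s + t)" by (rule hilbert_fibre) (use s t in simp)
      interpret S: hilbert_space "H s" by (rule hilbert_fibre[OF s])
      interpret T: hilbert_space "H t" by (rule hilbert_fibre[OF t])
      have "hconv (H (s + t)) (\<lambda>n. prd s t (A n s) (u t) \<oplus>\<^bsub>H (s + t)\<^esub> prd s t (u s) (A n t))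
          (prd s t (b s) (u t) \<oplus>\<^bsub>H (s + t)\<^esub> prd s t (u s) (b t))"
        by (intro hconv_add hconv_prd s t b S.hconv_const T.hconv_const u_closed)
      then have "hconv (H (s + t)) (\<lambda>n. A n (s + t)) (prd s t (b s) (u t) \<oplus>\<^bsub>H (s + t)\<^esub> prd s t (u s) (b t))"
        by (simp add: additiveD(3)[OF rootD(2)[OF A(1)] s t])
      then show "b (s + t) = prd s t (b s) (u t) \<oplus>\<^bsub>H (s + t)\<^esub> prd s t (u s) (b t)"
        by (rule hconv_unique[OF b, rotated]) (use s t in simp)
    qed
    moreover have "measurable_field 1 b"
      by (rule measurable_field_lim[of 1 A]) (use rootD(1)[OF A(1)] b in auto)
    ultimately have "(\<lambda>t\<in>{0<..}. b t) \<in> roots E u" by (intro rootI)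
    moreover have "x = b 1"
    proof (rule H1.hconv_unique[OF l])
      have "X = (\<lambda>n. A n 1)" using A(2) by blast
      then show "hconv (H 1) X (b 1)" using b[of 1] by simp
    qed
    ultimately show "x \<in> (\<lambda>a. a 1) ` roots E u" by (intro image_eqI[of _ _ "\<lambda>t\<in>{0<..}. b t"]) auto
  qed
qed

lemma root_eqI:
  assumes a: "a \<in> roots E u" and b: "b \<in> roots E u" and eq: "a 1 = b 1" shows "a = b"
proof
  fix t show "a t = b t"
  proof (cases "t > 0")
    case True
    interpret hilbert_space "H t" by (rule hilbert_fibre[OF True])
    interpret H1: hilbert_space "H 1" by (rule hilbert_fibre) simp
    have "hnorm (H 1) (a 1 \<ominus>\<^bsub>H 1\<^esub> b 1) = 0" using eq rootD(4)[OF b, of 1] by simp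
    then have "hnorm (H t) (a t \<ominus>\<^bsub>H t\<^esub> b t) = 0" using root_dist[OF a b True] by simp
    then show ?thesis using hnorm_diff_eq_0 rootD(4)[OF a True] rootD(4)[OF b True] by simp
  next
    case False
    then show ?thesis using rootD(3)[OF a] rootD(3)[OF b] by (simp add: extensional_def)
  qed
qed

text \<open>Evaluation at time 1 identifies the roots with a closed subspace of
  \<open>H 1\<close>.\<close>

lemma hilbert_root_space: "hilbert_space (root_space E u)"
proof -
  interpret H1: hilbert_space "H 1" by (rule hilbert_fibre) simp
  interpret W: hilbert_space "(H 1)\<lparr>carrier := (\<lambda>a. a 1) ` roots E u\<rparr>"
    by (rule H1.hilbert_space_closed_subspace[OF closed_subspace_roots])
  show ?thesis
  proof (rule W.hilbert_space_transport[of "\<lambda>a. a 1"])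
    show "bij_betw (\<lambda>a. a 1) (carrier (root_space E u)) (carrier ((H 1)\<lparr>carrier := (\<lambda>a. a 1) ` roots E u\<rparr>))"
      by (auto simp: bij_betw_def inj_on_def intro: root_eqI)
  qed (use add_root smult_root zero_root in auto)
qed

end

section \<open>Product subsystems in terms of the multiplication\<close>

context product_system
begin

text \<open>The condition on images under the structure map becomes a statement about closed spans
  of products inside the fibres; the structure map is injective and can be cancelled.\<close>

lemma subsystemD:
  assumes F: "product_subsystem E F"
  shows "t > 0 \<Longrightarrow> closed_subspace (H t) (F t)"
    "\<lbrakk>t > 0; x \<in> F t\<rbrakk> \<Longrightarrow> x \<in> carrier (H t)"
    "\<lbrakk>s > 0; t > 0\<rbrakk> \<Longrightarrow> F (s + t) = closed_span (H (s + t)) {prd s t x y | x y. x \<in> F s \<and> y \<in> F t}"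
    "\<lbrakk>s > 0; t > 0; x \<in> F s; y \<in> F t\<rbrakk> \<Longrightarrow> prd s t x y \<in> F (s + t)"
proof -
  show cs: "closed_subspace (H t) (F t)" if "t > 0" for t using F that by (simp add: product_subsystem_def)
  show c: "x \<in> carrier (H t)" if "t > 0" "x \<in> F t" for x t
    by (rule hilbert_space.closed_subspaceD(2)[OF hilbert_fibre[OF that(1)] cs[OF that(1)] that(2)])
  show *: "F (s + t) = closed_span (H (s + t)) {prd s t x y | x y. x \<in> F s \<and> y \<in> F t}"
    if s: "s > 0" and t: "t > 0" for s t
  proof -
    let ?A = "{prd s t x y | x y. x \<in> F s \<and> y \<in> F t}"
    have A: "?A \<subseteq> carrier (H (s + t))" using prd_closed[OF s t] c s t by blast
    interpret hilbert_space "H (s + t)" by (rule hilbert_fibre) (use s t in simp)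
    note U = unitary_struct_map[OF s t]
    interpret M: tensor_model "H s" "H t" "H (s + t)" "prd s t" by (rule tensor_model_prd[OF s t])
    have "struct_map E s t ` ?A = {elem_tensor (H s) (H t) x y | x y. x \<in> F s \<and> y \<in> F t}"
    proof (intro equalityI subsetI)
      fix z assume "z \<in> struct_map E s t ` ?A"
      then obtain x y where xy: "x \<in> F s" "y \<in> F t" "z = struct_map E s t (prd s t x y)" by blast
      then have "z = elem_tensor (H s) (H t) x y" using struct_prd[OF s t c[OF s] c[OF t]] by simp
      then show "z \<in> {elem_tensor (H s) (H t) x y | x y. x \<in> F s \<and> y \<in> F t}" using xy by blast
    next
      fix z assume "z \<in> {elem_tensor (H s) (H t) x y | x y. x \<in> F s \<and> y \<in> F t}"
      then obtain x y where xy: "x \<in> F s" "y \<in> F t" "z = elem_tensor (H s) (H t) x y" by blast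
      then have "z = struct_map E s t (prd s t x y)" using struct_prd[OF s t c[OF s] c[OF t]] by simp
      then show "z \<in> struct_map E s t ` ?A" using xy by blast
    qed
    then have "struct_map E s t ` closed_span (H (s + t)) ?A = tensor_subspace (H s) (H t) (F s) (F t)"
      using unitary_image_closed_span[OF hilbert_space_axioms M.hilbert_htensor U A] by (simp add: tensor_subspace_def)
    also have "\<dots> = struct_map E s t ` F (s + t)" using F s t by (simp add: product_subsystem_def)
    finally have eq: "struct_map E s t ` closed_span (H (s + t)) ?A = struct_map E s t ` F (s + t)" .
    have inj: "inj_on (struct_map E s t) (carrier (H (s + t)))"
      using unitary_mapD(5)[OF U] by (simp add: bij_betw_def)
    have "closed_span (H (s + t)) ?A \<subseteq> carrier (H (s + t))" "F (s + t) \<subseteq> carrier (H (s + t))"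
      using closed_subspaceD(1)[OF closed_span_closed_subspace[OF A]] c[of "s + t"] s t by auto
    from inj_on_image_eq_iff[OF inj this] eq show ?thesis by simp
  qed
  show "prd s t x y \<in> F (s + t)" if "s > 0" "t > 0" "x \<in> F s" "y \<in> F t" for s t x y
  proof -
    interpret hilbert_space "H (s + t)" by (rule hilbert_fibre) (use that in simp)
    show ?thesis unfolding *[OF that(1,2)]
      using closed_span_superset[of "{prd s t x y | x y. x \<in> F s \<and> y \<in> F t}"] that(3,4) by blast
  qed
qed

lemma product_subsystemI:
  assumes ext: "F \<in> extensional {0<..}" and cs: "\<And>t. t > 0 \<Longrightarrow> closed_subspace (H t) (F t)"
    and span: "\<And>s t. \<lbrakk>s > 0; t > 0\<rbrakk> \<Longrightarrow> F (s + t) = closed_span (H (s + t)) {prd s t x y | x y. x \<in> F s \<and> y \<in> F t}"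
  shows "product_subsystem E F"
  unfolding product_subsystem_def
proof (intro conjI allI impI ext cs)
  fix s t :: real assume s: "s > 0" and t: "t > 0"
  have c: "x \<in> carrier (H t)" if "t > 0" "x \<in> F t" for x t
    by (rule hilbert_space.closed_subspaceD(2)[OF hilbert_fibre[OF that(1)] cs[OF that(1)] that(2)])
  let ?A = "{prd s t x y | x y. x \<in> F s \<and> y \<in> F t}"
  have A: "?A \<subseteq> carrier (H (s + t))" using prd_closed[OF s t] c s t by blast
  interpret hilbert_space "H (s + t)" by (rule hilbert_fibre) (use s t in simp)
  interpret M: tensor_model "H s" "H t" "H (s + t)" "prd s t" by (rule tensor_model_prd[OF s t])
  have "struct_map E s t ` ?A = {elem_tensor (H s) (H t) x y | x y. x \<in> F s \<and> y \<in> F t}"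
  proof (intro equalityI subsetI)
    fix z assume "z \<in> struct_map E s t ` ?A"
    then obtain x y where xy: "x \<in> F s" "y \<in> F t" "z = struct_map E s t (prd s t x y)" by blast
    then have "z = elem_tensor (H s) (H t) x y" using struct_prd[OF s t c[OF s] c[OF t]] by simp
    then show "z \<in> {elem_tensor (H s) (H t) x y | x y. x \<in> F s \<and> y \<in> F t}" using xy by blast
  next
    fix z assume "z \<in> {elem_tensor (H s) (H t) x y | x y. x \<in> F s \<and> y \<in> F t}"
    then obtain x y where xy: "x \<in> F s" "y \<in> F t" "z = elem_tensor (H s) (H t) x y" by blast
    then have "z = struct_map E s t (prd s t x y)" using struct_prd[OF s t c[OF s] c[OF t]] by simp
    then show "z \<in> struct_map E s t ` ?A" using xy by blast
  qed
  then show "struct_map E s t ` F (s + t) = tensor_subspace (H s) (H t) (F s) (F t)"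
    using unitary_image_closed_span[OF hilbert_space_axioms M.hilbert_htensor unitary_struct_map[OF s t] A]
    by (simp add: tensor_subspace_def span[OF s t])
qed

end

context arveson_system
begin

section \<open>The type I part\<close>

text \<open>Products of values of possibly different units, in any bracketing. Their closed spans
  give an explicit type I part, which is needed because \<open>generated_subsystem\<close> only
  describes a least element.\<close>

inductive unit_product :: "real \<Rightarrow> 'a \<Rightarrow> bool" where
  unit: "\<lbrakk>v \<in> units E; t > 0\<rbrakk> \<Longrightarrow> unit_product t (v t)"
| mult: "\<lbrakk>unit_product s x; unit_product t y\<rbrakk> \<Longrightarrow> unit_product (s + t) (prd s t x y)"

lemma unit_product_closed: "unit_product t x \<Longrightarrow> 0 < t \<and> x \<in> carrier (H t)"
  by (induction rule: unit_product.induct) (auto simp: unitsD prd_closed)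

text \<open>A unit is cut at s by its own multiplicativity. In a product the cut falls between the
  factors or inside one of them, and associativity moves the pieces to the proper side.\<close>

lemma unit_product_split:
  assumes "unit_product T x" "0 < s" "0 < t" "T = s + t"
  shows "\<exists>p q. unit_product s p \<and> unit_product t q \<and> x = prd s t p q"
  using assms
proof (induction arbitrary: s t rule: unit_product.induct)
  case (unit v r)
  then show ?case using unitsD(3)[OF unit(1)] unit_product.unit[OF unit(1)] by blast
next
  case (mult a x b y)
  note ab = unit_product_closed[OF mult(1)] unit_product_closed[OF mult(2)]
  consider "s = a" | "s < a" | "a < s" by linarith
  then show ?case
  proof cases
    case 1
    then show ?thesis using mult by auto
  next
    case 2
    then obtain p q where pq: "unit_product s p" "unit_product (a - s) q" "x = prd s (a - s) p q"
      using mult.IH(1)[of s "a - s"] mult.prems by auto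
    note c = unit_product_closed[OF pq(1)] unit_product_closed[OF pq(2)]
    have "prd a b x y = prd s (a - s + b) p (prd (a - s) b q y)"
      using prd_assoc[of s "a - s" b p q y] c ab pq(3) by simp
    moreover have "unit_product (a - s + b) (prd (a - s) b q y)" by (rule unit_product.mult[OF pq(2) mult(2)])
    moreover have "a - s + b = t" using mult.prems by simp
    ultimately show ?thesis using pq(1) by auto
  next
    case 3
    then obtain p q where pq: "unit_product (s - a) p" "unit_product t q" "y = prd (s - a) t p q"
      using mult.IH(2)[of "s - a" t] mult.prems by auto
    note c = unit_product_closed[OF pq(1)] unit_product_closed[OF pq(2)]
    have "b = s - a + t" using mult.prems by simp
    then have "prd a b x y = prd (a + (s - a)) t (prd a (s - a) x p) q"
      using prd_assoc[of a "s - a" t x p q] c ab pq(3) by simp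
    moreover have "unit_product (a + (s - a)) (prd a (s - a) x p)" by (rule unit_product.mult[OF mult(1) pq(1)])
    moreover have "a + (s - a) = s" by simp
    ultimately show ?thesis using pq(2) by metis
  qed
qed

definition unit_span :: "real \<Rightarrow> 'a set" where
  "unit_span = (\<lambda>t\<in>{0<..}. closed_span (H t) {x. unit_product t x})"

lemma unit_product_subset: "{x. unit_product t x} \<subseteq> carrier (H t)"
  using unit_product_closed by blast

lemma unit_span_closed_subspace: "t > 0 \<Longrightarrow> closed_subspace (H t) (unit_span t)"
  using hilbert_space.closed_span_closed_subspace[OF hilbert_fibre unit_product_subset] by (simp add: unit_span_def)

lemma unit_product_unit_span: "unit_product t x \<Longrightarrow> x \<in> unit_span t"
  using hilbert_space.closed_span_superset[OF hilbert_fibre, of t "{x. unit_product t x}"] unit_product_closed[of t x]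
  by (auto simp: unit_span_def)

text \<open>Splitting unit products gives one inclusion. For the other, closedness under products is
  extended from the generators to the closed spans, one factor at a time.\<close>

lemma product_subsystem_unit_span: "product_subsystem E unit_span"
proof (rule product_subsystemI)
  show "unit_span \<in> extensional {0<..}" by (simp add: unit_span_def)
  show "closed_subspace (H t) (unit_span t)" if "t > 0" for t by (rule unit_span_closed_subspace[OF that])
  fix s t :: real assume s: "s > 0" and t: "t > 0"
  have st: "s + t > 0" using s t by simp
  interpret hilbert_space "H (s + t)" by (rule hilbert_fibre[OF st])
  note cs = unit_span_closed_subspace[OF st]
  note us = unit_span_closed_subspace[OF s] and ut = unit_span_closed_subspace[OF t]
  let ?A = "{prd s t x y | x y. x \<in> unit_span s \<and> y \<in> unit_span t}"
  have 1: "prd s t p y \<in> unit_span (s + t)" if p: "unit_product s p" and y: "y \<in> unit_span t" for p y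
  proof (rule prd_span_right[OF s t cs unit_product_subset])
    show "y \<in> closed_span (H t) {x. unit_product t x}" using y t by (simp add: unit_span_def)
    show "p \<in> carrier (H s)" using unit_product_closed[OF p] by simp
    show "prd s t p a \<in> unit_span (s + t)" if "a \<in> {x. unit_product t x}" for a
      using unit_product_unit_span[OF unit_product.mult[OF p]] that by simp
  qed
  have 2: "prd s t x y \<in> unit_span (s + t)" if x: "x \<in> unit_span s" and y: "y \<in> unit_span t" for x y
  proof (rule prd_span_left[OF s t cs unit_product_subset])
    show "x \<in> closed_span (H s) {x. unit_product s x}" using x s by (simp add: unit_span_def)
    show "y \<in> carrier (H t)" by (rule hilbert_space.closed_subspaceD(2)[OF hilbert_fibre[OF t] ut y])
    show "prd s t a y \<in> unit_span (s + t)" if "a \<in> {x. unit_product s x}" for a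
      using 1 that y by simp
  qed
  show "unit_span (s + t) = closed_span (H (s + t)) ?A"
  proof
    have A: "?A \<subseteq> carrier (H (s + t))" using 2 closed_subspaceD(2)[OF cs] by blast
    have "{x. unit_product (s + t) x} \<subseteq> closed_span (H (s + t)) ?A"
    proof
      fix x assume "x \<in> {x. unit_product (s + t) x}"
      then obtain p q where "unit_product s p" "unit_product t q" "x = prd s t p q"
        using unit_product_split[OF _ s t refl] by blast
      then have "x \<in> ?A" using unit_product_unit_span by blast
      then show "x \<in> closed_span (H (s + t)) ?A" using closed_span_superset[of ?A] by blast
    qed
    from closed_span_minimal[OF closed_span_closed_subspace[OF A] this]
    show "unit_span (s + t) \<subseteq> closed_span (H (s + t)) ?A" using st by (simp add: unit_span_def)
    show "closed_span (H (s + t)) ?A \<subseteq> unit_span (s + t)"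
      by (rule closed_span_minimal[OF cs]) (use 2 in blast)
  qed
qed

lemma unit_in_unit_span: "\<lbrakk>v \<in> units E; t > 0\<rbrakk> \<Longrightarrow> v t \<in> unit_span t"
  by (rule unit_product_unit_span[OF unit_product.unit])

lemma unit_span_least:
  assumes G: "product_subsystem E G" and uG: "\<forall>v\<in>units E. \<forall>t>0. v t \<in> G t" and t: "t > 0"
  shows "unit_span t \<subseteq> G t"
proof -
  interpret hilbert_space "H t" by (rule hilbert_fibre[OF t])
  have "x \<in> G r" if "unit_product r x" for r x
    using that
  proof (induction rule: unit_product.induct)
    case (mult s x r y)
    then show ?case using subsystemD(4)[OF G] unit_product_closed by blast
  qed (use uG in blast)
  then have "closed_span (H t) {x. unit_product t x} \<subseteq> G t"
    by (intro closed_span_minimal subsystemD(1)[OF G t]) blast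
  then show ?thesis using t by (simp add: unit_span_def)
qed

text \<open>Two least subsystems agree at positive times, and extensionality of subsystems turns
  this into equality, as the description by \<open>THE\<close> requires.\<close>

lemma type_I_part_eq: "type_I_part E = unit_span"
  unfolding type_I_part_def generated_subsystem_def
proof (rule the_equality)
  show "product_subsystem E unit_span \<and> (\<forall>x\<in>units E. \<forall>t>0. x t \<in> unit_span t) \<and>
     (\<forall>G. product_subsystem E G \<and> (\<forall>x\<in>units E. \<forall>t>0. x t \<in> G t) \<longrightarrow> (\<forall>t>0. unit_span t \<subseteq> G t))"
    using product_subsystem_unit_span unit_in_unit_span unit_span_least by blast
next
  fix F assume F: "product_subsystem E F \<and> (\<forall>x\<in>units E. \<forall>t>0. x t \<in> F t) \<and>
     (\<forall>G. product_subsystem E G \<and> (\<forall>x\<in>units E. \<forall>t>0. x t \<in> G t) \<longrightarrow> (\<forall>t>0. F t \<subseteq> G t))"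
  have "F t = unit_span t" if t: "t > 0" for t
    using F unit_span_least[OF _ _ t, of F] product_subsystem_unit_span unit_in_unit_span t by blast
  then show "F = unit_span"
    using F by (intro ext) (metis extensional_arb product_subsystem_def product_subsystem_unit_span greaterThan_iff)
qed

end

section \<open>Subsystems containing u and its roots, or all units\<close>

context spatial_system
begin

lemma log_unit_in_subsystem:
  assumes G: "product_subsystem E G" and uG: "\<forall>t>0. u t \<in> G t" and vG: "\<forall>t>0. v t \<in> G t"
    and v: "v \<in> units E" "unital v" and t: "t > 0"
  shows "log_unit v t \<in> G t"
proof -
  have incr: "incr v h \<in> G h" if "h > 0" for h
    using hilbert_space.closed_subspace_diff[OF hilbert_fibre subsystemD(1)[OF G]] uG vG that by blast
  have sum: "log_sum v hs \<in> G (sum_list hs)" if "pos_list hs" for hs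
    using that
  proof (induction rule: pos_list_induct)
    case (Cons h hs)
    then have s: "h + sum_list hs > 0" by simp
    have "prd h (sum_list hs) (incr v h) (u (sum_list hs)) \<in> G (h + sum_list hs)"
      "prd h (sum_list hs) (u h) (log_sum v hs) \<in> G (h + sum_list hs)"
      using Cons incr uG subsystemD(4)[OF G] by blast+
    then have "prd h (sum_list hs) (incr v h) (u (sum_list hs)) \<oplus>\<^bsub>H (h + sum_list hs)\<^esub> prd h (sum_list hs) (u h) (log_sum v hs) \<in> G (h + sum_list hs)"
      by (rule hilbert_space.closed_subspaceD(4)[OF hilbert_fibre[OF s] subsystemD(1)[OF G s]])
    then show ?case using Cons by (simp add: log_sum_Cons pos_list_nonempty)
  qed (use incr in simp)
  obtain c where c: "\<And>t. t > 0 \<Longrightarrow> cip (H t) (v t) (v t) = of_real (exp (c * t))"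
    using unital_norm[OF v] by blast
  have "log_sum v (uniform_partition t n) \<in> G t" for n
    using sum[OF uniform_partition(1)[OF t]] uniform_partition(2)[OF t] by simp
  then show ?thesis
    by (rule hilbert_space.closed_subspaceD(6)[OF hilbert_fibre[OF t] subsystemD(1)[OF G t] _ log_unit_hconv[OF v(2) c t]])
qed

lemma exp_root_in_subsystem:
  assumes G: "product_subsystem E G" and uG: "\<forall>t>0. u t \<in> G t" and aG: "\<forall>t>0. a t \<in> G t"
    and a: "a \<in> roots E u" and t: "t > 0"
  shows "exp_root a t \<in> G t"
proof -
  have plus: "u_plus a h \<in> G h" if h: "h > 0" for h
    by (rule hilbert_space.closed_subspaceD(4)[OF hilbert_fibre[OF h] subsystemD(1)[OF G h]]) (use uG aG h in auto)
  have prod: "exp_prod a hs \<in> G (sum_list hs)" if "pos_list hs" for hs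
    using that
  proof (induction rule: pos_list_induct)
    case (Cons h hs)
    then show ?case using plus subsystemD(4)[OF G] by (simp add: exp_prod_Cons pos_list_nonempty)
  qed (use plus in simp)
  have "exp_prod a (uniform_partition t n) \<in> G t" for n
    using prod[OF uniform_partition(1)[OF t]] uniform_partition(2)[OF t] by simp
  then show ?thesis
    by (rule hilbert_space.closed_subspaceD(6)[OF hilbert_fibre[OF t] subsystemD(1)[OF G t] _ exp_root_facts(1)[OF rootD(2)[OF a] t]])
qed

lemma subsystem_contains_iff:
  assumes G: "product_subsystem E G"
  shows "(\<forall>x\<in>insert u (roots E u). \<forall>t>0. x t \<in> G t) \<longleftrightarrow> (\<forall>x\<in>units E. \<forall>t>0. x t \<in> G t)"
proof
  assume L: "\<forall>x\<in>insert u (roots E u). \<forall>t>0. x t \<in> G t"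
  then have uG: "\<forall>t>0. u t \<in> G t" by simp
  show "\<forall>x\<in>units E. \<forall>t>0. x t \<in> G t"
  proof (intro ballI allI impI)
    fix v and t :: real assume v: "v \<in> units E" and t: "t > 0"
    note r = rescale_unit[OF v] rescale_unital[OF v]
    note l = log_unit_root[OF r]
    have "rescale v t \<in> G t"
      using exp_root_in_subsystem[OF G uG _ l t] exp_log_unit'[OF r t] L l by simp
    then show "v t \<in> G t"
      unfolding unit_eq_rescale[OF v t]
      by (rule hilbert_space.closed_subspaceD(5)[OF hilbert_fibre[OF t] subsystemD(1)[OF G t]])
  qed
next
  assume R: "\<forall>x\<in>units E. \<forall>t>0. x t \<in> G t"
  then have uG: "\<forall>t>0. u t \<in> G t" using u_unit by blast
  have "a t \<in> G t" if a: "a \<in> roots E u" and t: "t > 0" for a t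
    using log_unit_in_subsystem[OF G uG _ exp_root_unit[OF a] t] R exp_root_unit(1)[OF a] log_exp_root'[OF a] by simp
  then show "\<forall>x\<in>insert u (roots E u). \<forall>t>0. x t \<in> G t" using uG by auto
qed

text \<open>By \<open>subsystem_contains_iff\<close> the two predicates under \<open>THE\<close>
  coincide, for the candidate as well as for its competitors, so the descriptions are equal by
  rewriting.\<close>

lemma generated_eq_type_I_part: "generated_subsystem E (insert u (roots E u)) = type_I_part E"
proof -
  have "(\<lambda>F. product_subsystem E F \<and> (\<forall>x\<in>insert u (roots E u). \<forall>t>0. x t \<in> F t) \<and>
     (\<forall>G. product_subsystem E G \<and> (\<forall>x\<in>insert u (roots E u). \<forall>t>0. x t \<in> G t) \<longrightarrow> (\<forall>t>0. F t \<subseteq> G t))) =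
    (\<lambda>F. product_subsystem E F \<and> (\<forall>x\<in>units E. \<forall>t>0. x t \<in> F t) \<and>
     (\<forall>G. product_subsystem E G \<and> (\<forall>x\<in>units E. \<forall>t>0. x t \<in> G t) \<longrightarrow> (\<forall>t>0. F t \<subseteq> G t)))"
    using subsystem_contains_iff by (intro ext) (simp cong: conj_cong)
  then show ?thesis unfolding type_I_part_def generated_subsystem_def by simp
qed

end

section \<open>Restriction to a product subsystem\<close>

context arveson_system
begin

context
  fixes F assumes F: "product_subsystem E F"
begin

abbreviation "FH t \<equiv> subsystem_fibre E F t"

lemma FH_simps [simp]:
  "carrier (FH t) = F t" "add (FH t) = add (H t)" "smult (FH t) = smult (H t)" "zero (FH t) = zero (H t)"
  "cip (FH t) = cip (H t)"
  by (simp_all add: subsystem_fibre_def)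

lemma hilbert_FH: "t > 0 \<Longrightarrow> hilbert_space (FH t)"
  unfolding subsystem_fibre_def
  by (rule hilbert_space.hilbert_space_closed_subspace[OF hilbert_fibre subsystemD(1)[OF F]])

text \<open>For totality, a vector of \<open>F (s + t)\<close> orthogonal to all products from
  \<open>F\<close> is orthogonal to their closed span, which is \<open>F (s + t)\<close>
  itself.\<close>

lemma tensor_model_FH:
  assumes s: "s > 0" and t: "t > 0" shows "tensor_model (FH s) (FH t) (FH (s + t)) (prd s t)"
proof (intro tensor_model.intro tensor_model_axioms.intro)
  have st: "s + t > 0" using s t by simp
  note c = subsystemD(2)[OF F]
  show "hilbert_space (FH s)" "hilbert_space (FH t)" "hilbert_space (FH (s + t))" by (intro hilbert_FH s t st)+
  show "prd s t x y \<in> carrier (FH (s + t))" if "x \<in> carrier (FH s)" "y \<in> carrier (FH t)" for x y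
    using subsystemD(4)[OF F s t] that by simp
  show "cip (FH (s + t)) (prd s t x y) (prd s t x' y') = cip (FH s) x x' * cip (FH t) y y'"
    if "x \<in> carrier (FH s)" "y \<in> carrier (FH t)" "x' \<in> carrier (FH s)" "y' \<in> carrier (FH t)" for x y x' y'
    using that s t c by (simp add: cip_prd)
  interpret K: hilbert_space "FH (s + t)" by (rule hilbert_FH[OF st])
  interpret hilbert_space "H (s + t)" by (rule hilbert_fibre[OF st])
  let ?A = "{prd s t x y | x y. x \<in> F s \<and> y \<in> F t}"
  have "closed_span (FH (s + t)) ?A = carrier (FH (s + t))"
  proof (rule K.closed_span_eq_carrierI)
    show "?A \<subseteq> carrier (FH (s + t))" using subsystemD(4)[OF F s t] by auto
    fix z assume z: "z \<in> carrier (FH (s + t))" and o: "\<forall>x\<in>?A. cip (FH (s + t)) x z = 0"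
    then have zF: "z \<in> F (s + t)" by simp
    have zc: "z \<in> carrier (H (s + t))" by (rule c[OF st zF])
    have Ac: "x \<in> carrier (H (s + t))" if "x \<in> ?A" for x using that prd_closed[OF s t] c s t by blast
    have "?A \<subseteq> {y \<in> carrier (H (s + t)). \<forall>x\<in>{z}. cip (H (s + t)) x y = 0}"
    proof
      fix x assume x: "x \<in> ?A"
      then have "cip (H (s + t)) x z = 0" using o by simp
      then show "x \<in> {y \<in> carrier (H (s + t)). \<forall>x\<in>{z}. cip (H (s + t)) x y = 0}"
        using cip_commute[OF Ac[OF x] zc] Ac[OF x] by simp
    qed
    from closed_span_minimal[OF closed_subspace_orthogonal this] zF zc
    have "cip (H (s + t)) z z = 0" unfolding subsystemD(3)[OF F s t] by blast
    then show "z = \<zero>\<^bsub>FH (s + t)\<^esub>" using cip_definite[OF zc] by simp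
  qed
  then show "closed_span (FH (s + t)) {prd s t x y | x y. x \<in> carrier (FH s) \<and> y \<in> carrier (FH t)} = carrier (FH (s + t))"
    by simp
qed

lemma restrict_system_simps:
  "fibre (restrict_system E F) = subsystem_fibre E F"
  "base_section (restrict_system E F) n = (\<lambda>t\<in>{0<..}. hproj (H t) (F t) (base_section E n t))"
  by (simp_all add: restrict_system_def)

text \<open>Seen in the models, the embedding of the tensor product of \<open>F s\<close> and
  \<open>F t\<close> into that of the ambient fibres is the inclusion of \<open>F (s + t)\<close>.
  Undoing it after the structure map leaves the inverse of \<open>val\<close>.\<close>

lemma restrict_struct_map:
  assumes s: "s > 0" and t: "t > 0" and z: "z \<in> F (s + t)"
  shows "struct_map (restrict_system E F) s t z =
    inv_into (carrier (htensor (FH s) (FH t))) (tensor_model.val (FH (s + t)) (prd s t)) z"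
proof -
  have st: "s + t > 0" using s t by simp
  interpret M: tensor_model "FH s" "FH t" "FH (s + t)" "prd s t" by (rule tensor_model_FH[OF s t])
  note c = subsystemD(2)[OF F]
  let ?T = "tensor_map (FH s) (FH t) (H s) (H t) (\<lambda>x. x) (\<lambda>x. x)"
  have J: "bounded_map (FH (s + t)) (H (s + t)) (\<lambda>x. x)"
    unfolding bounded_map_def linear_map_def using c[OF st] by (auto simp: hnorm_def intro!: exI[of _ 1])
  have T: "?T w \<in> carrier (htensor (H s) (H t))" "uval s t (?T w) = M.val w" if "w \<in> carrier (htensor (FH s) (FH t))" for w
    by (rule tensor_map_val[OF M.tensor_model_axioms tensor_model_prd[OF s t] J _ _ _ that]; use c s t in auto)+
  have zc: "z \<in> carrier (H (s + t))" by (rule c[OF st z])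
  have zF: "z \<in> carrier (FH (s + t))" using z by simp
  let ?w = "inv_into (carrier (htensor (FH s) (FH t))) M.val z"
  have w: "?w \<in> carrier (htensor (FH s) (FH t))" "M.val ?w = z"
    using unitary_map_inv_into(1,2)[OF M.val_unitary zF] by auto
  have "?T ?w = struct_map E s t z"
    by (rule val_inj[OF tensor_model_prd[OF s t] T(1)[OF w(1)]])
       (use unitary_mapD(1)[OF unitary_struct_map[OF s t] zc] uval_struct[OF s t zc] T(2)[OF w(1)] w(2) in auto)
  moreover have "inj_on ?T (carrier (htensor (FH s) (FH t)))"
  proof (rule inj_onI)
    fix v v' assume v: "v \<in> carrier (htensor (FH s) (FH t))" "v' \<in> carrier (htensor (FH s) (FH t))" and eq: "?T v = ?T v'"
    then have "M.val v = M.val v'" using T(2)[OF v(1)] T(2)[OF v(2)] by simp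
    then show "v = v'" by (rule val_inj[OF M.tensor_model_axioms v])
  qed
  ultimately have "inv_into (carrier (htensor (FH s) (FH t))) ?T (struct_map E s t z) = ?w"
    using inv_into_f_eq w(1) by metis
  then show ?thesis by (simp add: restrict_system_def)
qed

lemma restrict_sys_prod:
  assumes s: "s > 0" and t: "t > 0" and x: "x \<in> F s" and y: "y \<in> F t"
  shows "sys_prod (restrict_system E F) s t x y = prd s t x y"
proof -
  have st: "s + t > 0" using s t by simp
  interpret M: tensor_model "FH s" "FH t" "FH (s + t)" "prd s t" by (rule tensor_model_FH[OF s t])
  let ?S = "struct_map (restrict_system E F) s t"
  let ?i = "inv_into (carrier (htensor (FH s) (FH t))) M.val"
  note inv = unitary_map_inv[OF M.hilbert_htensor M.val_unitary]
  have eq: "?S z = ?i z" if "z \<in> carrier (FH (s + t))" for z using restrict_struct_map[OF s t] that by simp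
  have U: "unitary_map (FH (s + t)) (htensor (FH s) (FH t)) ?S"
    unfolding unitary_map_def linear_map_def
  proof (intro conjI ballI allI)
    note i = unitary_mapD[OF inv]
    show "?S \<in> carrier (FH (s + t)) \<rightarrow> carrier (htensor (FH s) (FH t))" using eq i(1) by (simp add: Pi_iff)
    show "bij_betw ?S (carrier (FH (s + t))) (carrier (htensor (FH s) (FH t)))"
      by (rule bij_betw_cong[THEN iffD2, OF eq i(5)])
    show "?S (a \<oplus>\<^bsub>FH (s + t)\<^esub> b) = ?S a \<oplus>\<^bsub>htensor (FH s) (FH t)\<^esub> ?S b" if "a \<in> carrier (FH (s + t))" "b \<in> carrier (FH (s + t))" for a b
      using eq[OF that(1)] eq[OF that(2)] eq[OF M.R.M.a_closed[OF that]] i(2)[OF that] by simp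
    show "?S (c \<odot>\<^bsub>FH (s + t)\<^esub> a) = c \<odot>\<^bsub>htensor (FH s) (FH t)\<^esub> ?S a" if "a \<in> carrier (FH (s + t))" for c a
      using eq[OF that] eq[OF M.R.smult_carrier[OF that]] i(3)[OF that] by simp
    show "cip (htensor (FH s) (FH t)) (?S a) (?S b) = cip (FH (s + t)) a b" if "a \<in> carrier (FH (s + t))" "b \<in> carrier (FH (s + t))" for a b
      using eq[OF that(1)] eq[OF that(2)] i(4)[OF that] by simp
  qed
  have xy: "x \<in> carrier (FH s)" "y \<in> carrier (FH t)" using x y by auto
  have p: "prd s t x y \<in> carrier (FH (s + t))" by (rule M.m_closed[OF xy])
  have Sp: "?S (prd s t x y) = elem_tensor (FH s) (FH t) x y"
    using eq[OF p] M.val_elem_tensor[OF xy] unitary_map_inv_into(3)[OF M.val_unitary M.elem_tensor_carrier[OF xy]] by simp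
  have "sys_prod (restrict_system E F) s t x y =
      hadjoint (FH (s + t)) (htensor (FH s) (FH t)) ?S (elem_tensor (FH s) (FH t) x y)"
    by (simp only: sys_prod_def[of "restrict_system E F"] restrict_system_simps(1))
  also have "\<dots> = inv_into (carrier (FH (s + t))) ?S (elem_tensor (FH s) (FH t) x y)"
    by (rule hadjoint_unitary[OF M.R.hilbert_space_axioms U M.elem_tensor_carrier[OF xy]])
  also have "\<dots> = prd s t x y"
    using unitary_map_inv_into(3)[OF U p] unfolding Sp .
  finally show ?thesis .
qed

lemma hproj:
  assumes t: "t > 0" and x: "x \<in> carrier (H t)"
  shows "hproj (H t) (F t) x \<in> F t" "y \<in> F t \<Longrightarrow> cip (H t) y (hproj (H t) (F t) x) = cip (H t) y x"
proof -
  interpret hilbert_space "H t" by (rule hilbert_fibre[OF t])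
  note w = closed_subspaceD[OF subsystemD(1)[OF F t]]
  obtain p where p: "p \<in> F t" "\<forall>y\<in>F t. cip (H t) y p = cip (H t) y x"
    using projection_exists[OF subsystemD(1)[OF F t] x] by blast
  have "hproj (H t) (F t) x = p" unfolding hproj_def
  proof (rule the_equality)
    fix q assume q: "q \<in> F t \<and> (\<forall>y\<in>F t. cip (H t) y q = cip (H t) y x)"
    have d: "q \<ominus>\<^bsub>H t\<^esub> p \<in> F t" by (rule closed_subspace_diff[OF subsystemD(1)[OF F t]]) (use p q in auto)
    have "cip (H t) (q \<ominus>\<^bsub>H t\<^esub> p) (q \<ominus>\<^bsub>H t\<^esub> p) = 0"
      using cip_diff_right[OF w(2)[OF d], of q p] w(2) p q d by simp
    then have "q \<ominus>\<^bsub>H t\<^esub> p = \<zero>\<^bsub>H t\<^esub>" using cip_definite w(2)[OF d] by blast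
    then show "q = p" using diff_eq_zero_iff w(2) p q by blast
  qed (use p in blast)
  then show "hproj (H t) (F t) x \<in> F t" "y \<in> F t \<Longrightarrow> cip (H t) y (hproj (H t) (F t) x) = cip (H t) y x"
    using p by auto
qed

text \<open>A vector of \<open>F t\<close> has the same inner product with a base section as with
  its projection, so both measurable structures impose the same conditions on sections of
  \<open>F\<close>.\<close>

lemma restrict_measurable_sections:
  "measurable_sections (restrict_system E F) = {x \<in> measurable_sections E. \<forall>t>0. x t \<in> F t}"
proof -
  note c = subsystemD(2)[OF F]
  have sec: "x \<in> sections (restrict_system E F) \<longleftrightarrow> x \<in> sections E \<and> (\<forall>t>0. x t \<in> F t)" for x
    unfolding sections_def restrict_system_simps using c by (auto simp: PiE_def Pi_def)
  have "(\<lambda>t. cip (FH t) (base_section (restrict_system E F) n t) (x t)) \<in> borel_measurable pos_reals \<longleftrightarrow>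
      (\<lambda>t. cip (H t) (base_section E n t) (x t)) \<in> borel_measurable pos_reals" if x: "\<forall>t>0. x t \<in> F t" for x n
  proof (rule measurable_cong)
    fix t assume "t \<in> space pos_reals"
    then have t: "t > 0" by simp
    interpret hilbert_space "H t" by (rule hilbert_fibre[OF t])
    have xF: "x t \<in> F t" using x t by blast
    note p = hproj[OF t e_closed[OF t, of n]]
    have "cip (H t) (hproj (H t) (F t) (base_section E n t)) (x t) = cnj (cip (H t) (x t) (hproj (H t) (F t) (base_section E n t)))"
      by (rule cip_commute[OF c[OF t xF] c[OF t p(1)]])
    also have "\<dots> = cnj (cip (H t) (x t) (base_section E n t))" using p(2)[OF xF] by simp
    also have "\<dots> = cip (H t) (base_section E n t) (x t)" by (rule cip_commute[OF c[OF t xF] e_closed[OF t], symmetric])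
    finally show "cip (FH t) (base_section (restrict_system E F) n t) (x t) = cip (H t) (base_section E n t) (x t)"
      using t by (simp add: restrict_system_simps)
  qed
  then show ?thesis using sec by (auto simp: measurable_sections_def restrict_system_simps(1))
qed

lemma roots_restrict_system:
  assumes u: "\<forall>t>0. u t \<in> F t"
  shows "roots (restrict_system E F) u = {a \<in> roots E u. \<forall>t>0. a t \<in> F t}"
proof -
  have "a \<in> roots (restrict_system E F) u \<longleftrightarrow> a \<in> roots E u" if a: "\<forall>t>0. a t \<in> F t" for a
    using a u by (simp add: roots_def restrict_measurable_sections restrict_system_simps(1) restrict_sys_prod)
  moreover have "\<forall>t>0. a t \<in> F t" if "a \<in> roots (restrict_system E F) u" for a
    using that by (simp add: roots_def restrict_measurable_sections)
  ultimately show ?thesis by blast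
qed

end

end

lemma (in spatial_system) roots_type_I_part: "roots E u = roots (restrict_system E (type_I_part E)) u"
proof -
  have "\<forall>x\<in>insert u (roots E u). \<forall>t>0. x t \<in> unit_span t"
    using subsystem_contains_iff[OF product_subsystem_unit_span] unit_in_unit_span by blast
  then show ?thesis
    unfolding type_I_part_eq using roots_restrict_system[OF product_subsystem_unit_span, of u] by blast
qed

section \<open>Orthonormal bases and the dimension\<close>

definition orthonormal :: "'a hspace \<Rightarrow> 'a set \<Rightarrow> bool" where
  "orthonormal H S \<longleftrightarrow> S \<subseteq> carrier H \<and> (\<forall>x\<in>S. \<forall>y\<in>S. cip H x y = (if x = y then 1 else 0))"

context hilbert_space
begin

lemma orthonormal_basis_iff: "orthonormal_basis H S \<longleftrightarrow> orthonormal H S \<and> closed_span H S = carrier H"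
  by (auto simp: orthonormal_basis_def orthonormal_def)

lemma orthonormal_basis_exists: "\<exists>S. orthonormal_basis H S"
proof -
  have "\<exists>M\<in>{S. orthonormal H S}. \<forall>X\<in>{S. orthonormal H S}. M \<subseteq> X \<longrightarrow> X = M"
  proof (rule subset_Zorn')
    fix C assume C: "subset.chain {S. orthonormal H S} C"
    have S: "orthonormal H S" if "S \<in> C" for S using C that by (auto simp: subset.chain_def)
    have "cip H x y = (if x = y then 1 else 0)" if xy: "x \<in> \<Union>C" "y \<in> \<Union>C" for x y
    proof -
      obtain A B where AB: "A \<in> C" "x \<in> A" "B \<in> C" "y \<in> B" using xy by blast
      then have "A \<subseteq> B \<or> B \<subseteq> A" using C by (auto simp: subset.chain_def)
      then obtain D where "D \<in> C" "x \<in> D" "y \<in> D" using AB by blast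
      then show ?thesis using S[of D] by (simp add: orthonormal_def)
    qed
    then show "\<Union>C \<in> {S. orthonormal H S}" using S by (fastforce simp: orthonormal_def)
  qed
  then obtain M where M: "orthonormal H M" and max: "\<And>X. \<lbrakk>orthonormal H X; M \<subseteq> X\<rbrakk> \<Longrightarrow> X = M" by blast
  have "closed_span H M = carrier H"
  proof (rule closed_span_eq_carrierI)
    show "M \<subseteq> carrier H" using M by (simp add: orthonormal_def)
    fix z assume z: "z \<in> carrier H" and o: "\<forall>x\<in>M. cip H x z = 0"
    show "z = \<zero>"
    proof (rule ccontr)
      assume "z \<noteq> \<zero>"
      then have n: "hnorm H z \<noteq> 0" using hnorm_eq_0[OF z] by simp
      define y where "y = of_real (1 / hnorm H z) \<odot> z"
      have y: "y \<in> carrier H" using z by (simp add: y_def)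
      have "hnorm H y = 1" using hnorm_smult[OF z] hnorm_ge_0[OF z] n by (simp add: y_def norm_divide)
      then have yy: "cip H y y = 1" using cip_self[OF y] by simp
      have xy: "cip H x y = 0" if "x \<in> M" for x
        using M that z o cip_smult_right[of x z] by (auto simp: y_def orthonormal_def)
      have yx: "cip H y x = 0" if "x \<in> M" for x
      proof -
        have "x \<in> carrier H" using M that by (auto simp: orthonormal_def)
        from cip_commute[OF this y] show ?thesis using xy[OF that] by simp
      qed
      have yM: "y \<notin> M" using xy[of y] yy by auto
      have "cip H a b = (if a = b then 1 else 0)" if "a \<in> insert y M" "b \<in> insert y M" for a b
      proof (cases "a = y")
        case True
        then show ?thesis using that yy yx yM by auto
      next
        case False
        then have "a \<in> M" using that by simp
        then show ?thesis using that M xy[of a] False by (cases "b = y") (auto simp: orthonormal_def)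
      qed
      then have "orthonormal H (insert y M)" using M y by (auto simp: orthonormal_def)
      then have "insert y M = M" using max by blast
      then show False using yM by blast
    qed
  qed
  then show ?thesis using M orthonormal_basis_iff by blast
qed

lemma orthonormalD:
  assumes "orthonormal H S"
  shows "S \<subseteq> carrier H" "s \<in> S \<Longrightarrow> s \<in> carrier H" "\<lbrakk>s \<in> S; t \<in> S\<rbrakk> \<Longrightarrow> cip H s t = (if s = t then 1 else 0)"
  using assms by (auto simp: orthonormal_def)

lemma finite_orthonormal_residual:
  assumes S: "orthonormal H S" and fin: "finite S" and x: "x \<in> carrier H"
  obtains p where "p \<in> carrier H" "\<And>s. s \<in> S \<Longrightarrow> cip H s (x \<ominus> p) = 0"
    "(hnorm H (x \<ominus> p))\<^sup>2 = (hnorm H x)\<^sup>2 - (\<Sum>s\<in>S. (cmod (cip H s x))\<^sup>2)"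
proof -
  note sc = orthonormalD(2)[OF S]
  define p where "p = finsum H (\<lambda>s. cip H s x \<odot> s) S"
  have c: "(\<lambda>s. cip H s x \<odot> s) \<in> S \<rightarrow> carrier H" using sc by auto
  have pc: "p \<in> carrier H" unfolding p_def by (rule finsum_closed'[OF c])
  have r: "cip H w p = (\<Sum>s\<in>S. cip H s x * cip H w s)" if w: "w \<in> carrier H" for w
    unfolding p_def using cip_finsum_right[OF fin c w] by (simp add: cip_smult_right w sc)
  have sp: "cip H s p = cip H s x" if s: "s \<in> S" for s
  proof -
    have "cip H s p = (\<Sum>t\<in>S. cip H t x * (if s = t then 1 else 0))"
      
      unfolding r[OF sc[OF s]] by (intro sum.cong refl arg_cong[of _ _ "(*) _"] orthonormalD(3)[OF S s])
    also have "\<dots> = cip H s x" using fin s by (simp add: if_distrib[of "(*) _"] sum.delta cong: if_cong)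
    finally show ?thesis .
  qed
  \<comment> \<open>Needed for y = x and for y = p, which have the same coefficients with respect to
    \<open>S\<close>.\<close>
  have q: "cip H y p = of_real (\<Sum>s\<in>S. (cmod (cip H s x))\<^sup>2)"
    if y: "y \<in> carrier H" and eq: "\<And>s. s \<in> S \<Longrightarrow> cip H s y = cip H s x" for y
  proof -
    have "cip H s x * cip H y s = of_real ((cmod (cip H s x))\<^sup>2)" if s: "s \<in> S" for s
      using cip_commute[OF sc[OF s] y] eq[OF s] by (simp only: complex_norm_square)
    then show ?thesis unfolding r[OF y] by simp
  qed
  have "(hnorm H (x \<ominus> p))\<^sup>2 = (hnorm H x)\<^sup>2 - (\<Sum>s\<in>S. (cmod (cip H s x))\<^sup>2)"
    unfolding hnorm_sq_diff[OF x pc] using q[OF x] q[OF pc sp] hnorm_sq[OF pc] by simp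
  moreover have "cip H s (x \<ominus> p) = 0" if "s \<in> S" for s
    using cip_diff_right[OF sc[OF that] x pc] sp[OF that] by simp
  ultimately show ?thesis using pc that by blast
qed

lemma bessel:
  assumes S: "orthonormal H S" and F: "finite F" "F \<subseteq> S" and x: "x \<in> carrier H"
  shows "(\<Sum>s\<in>F. (cmod (cip H s x))\<^sup>2) \<le> (hnorm H x)\<^sup>2"
proof -
  have "orthonormal H F" unfolding orthonormal_def
    using orthonormalD(1)[OF S] orthonormalD(3)[OF S] F(2) by blast
  from finite_orthonormal_residual[OF this F(1) x] show ?thesis
    by (metis diff_ge_0_iff_ge zero_le_power2)
qed

text \<open>Bessel's inequality makes the squared moduli summable, and a summable family has
  countable support.\<close>

lemma countable_nonorthogonal:
  assumes S: "orthonormal H S" and x: "x \<in> carrier H"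
  shows "countable {s \<in> S. cip H s x \<noteq> 0}"
proof -
  have "(\<lambda>s. (cmod (cip H s x))\<^sup>2) summable_on S"
  proof (rule nonneg_bdd_above_summable_on)
    show "bdd_above (sum (\<lambda>s. (cmod (cip H s x))\<^sup>2) ` {F. F \<subseteq> S \<and> finite F})"
      using bessel[OF S _ _ x] by (intro bdd_aboveI2[of _ _ "(hnorm H x)\<^sup>2"]) auto
  qed simp
  then have "countable {s \<in> S. (cmod (cip H s x))\<^sup>2 \<noteq> 0}" by (rule summable_countable_real)
  then show ?thesis by simp
qed

text \<open>The sum of the squared moduli of the inner products of s and t is counted in two ways:
  by Parseval for the finite basis it is the number of the t, by Bessel it is at most the number of
  the s.\<close>

lemma card_orthonormal_le:
  assumes S: "orthonormal_basis H S" and fin: "finite S" and T: "orthonormal H T"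
  shows "finite T \<and> card T \<le> card S"
proof -
  have So: "orthonormal H S" and St: "closed_span H S = carrier H" using S orthonormal_basis_iff by auto
  note sc = orthonormalD(2)[OF So] and tc = orthonormalD(2)[OF T]
  have n: "hnorm H r = 1" if "orthonormal H R" "r \<in> R" for R r
    using orthonormalD(3)[OF that(1,2,2)] by (simp add: hnorm_def)
  have pars: "(\<Sum>s\<in>S. (cmod (cip H s x))\<^sup>2) = (hnorm H x)\<^sup>2" if x: "x \<in> carrier H" for x
  proof -
    obtain p where p: "p \<in> carrier H" "\<And>s. s \<in> S \<Longrightarrow> cip H s (x \<ominus> p) = 0"
      "(hnorm H (x \<ominus> p))\<^sup>2 = (hnorm H x)\<^sup>2 - (\<Sum>s\<in>S. (cmod (cip H s x))\<^sup>2)"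
      using finite_orthonormal_residual[OF So fin x] by blast
    have "x \<ominus> p = \<zero>" by (rule total_orthogonal[OF St orthonormalD(1)[OF So]]) (use x p in auto)
    then show ?thesis using p(3) by simp
  qed
  have F: "card F \<le> card S" if F: "finite F" "F \<subseteq> T" for F
  proof -
    have "real (card F) = (\<Sum>t\<in>F. (hnorm H t)\<^sup>2)" using n[OF T] F(2) by (simp add: subset_iff)
    also have "\<dots> = (\<Sum>t\<in>F. \<Sum>s\<in>S. (cmod (cip H s t))\<^sup>2)"
      using pars tc F(2) by (intro sum.cong refl) (auto simp: subset_iff)
    also have "\<dots> = (\<Sum>s\<in>S. \<Sum>t\<in>F. (cmod (cip H s t))\<^sup>2)" by (rule sum.swap)
    also have "\<dots> = (\<Sum>s\<in>S. \<Sum>t\<in>F. (cmod (cip H t s))\<^sup>2)"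
    proof (intro sum.cong refl)
      fix s t assume "s \<in> S" "t \<in> F"
      then show "(cmod (cip H s t))\<^sup>2 = (cmod (cip H t s))\<^sup>2"
        using cip_commute[OF sc tc, of s t] F(2) by auto
    qed
    also have "\<dots> \<le> (\<Sum>s\<in>S. (hnorm H s)\<^sup>2)" by (intro sum_mono bessel[OF T F] sc)
    also have "\<dots> = real (card S)" using n[OF So] by simp
    finally show ?thesis by simp
  qed
  have "finite T"
  proof (rule ccontr)
    assume "infinite T"
    then obtain F where "F \<subseteq> T" "finite F" "card F = Suc (card S)" by (meson infinite_arbitrarily_large)
    then show False using F[of F] by simp
  qed
  then show ?thesis using F[of T] by simp
qed

text \<open>Makes the choice of a basis in \<open>hilbert_dim\<close> immaterial. For infinite
  \<open>T\<close>, each t is nonorthogonal to only countably many s and each s to at least one t,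
  so \<open>S\<close> is covered by |T| many countable sets.\<close>

lemma orthonormal_card_le:
  assumes S: "orthonormal_basis H S" and T: "orthonormal_basis H T"
  shows "|S| \<le>o |T|"
proof (cases "finite T")
  case True
  have So: "orthonormal H S" using S orthonormal_basis_iff by auto
  from card_orthonormal_le[OF T True So] obtain f where "inj_on f S" "f ` S \<subseteq> T"
    using True by (metis inj_on_iff_card_le)
  then show ?thesis using card_of_ordLeq by blast
next
  case False
  have So: "orthonormal H S" and To: "orthonormal H T" and Tt: "closed_span H T = carrier H"
    using S T orthonormal_basis_iff by auto
  note sc = orthonormalD(2)[OF So] and tc = orthonormalD(2)[OF To]
  have "S \<subseteq> (\<Union>t\<in>T. {s \<in> S. cip H s t \<noteq> 0})"
  proof
    fix s assume s: "s \<in> S"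
    show "s \<in> (\<Union>t\<in>T. {s \<in> S. cip H s t \<noteq> 0})"
    proof (rule ccontr)
      assume "\<not> ?thesis"
      then have z: "cip H s t = 0" if "t \<in> T" for t using s that by blast
      have "cip H t s = 0" if "t \<in> T" for t using cip_commute[OF sc[OF s] tc[OF that]] z[OF that] by simp
      then have "s = \<zero>" by (intro total_orthogonal[OF Tt orthonormalD(1)[OF To] sc[OF s]])
      then show False using orthonormalD(3)[OF So s s] by simp
    qed
  qed
  then have "|S| \<le>o |\<Union>t\<in>T. {s \<in> S. cip H s t \<noteq> 0}|" by (rule card_of_mono1)
  also have "|\<Union>t\<in>T. {s \<in> S. cip H s t \<noteq> 0}| \<le>o |T|"
  proof (rule card_of_UNION_ordLeq_infinite[OF False])
    show "|T| \<le>o |T|" by (rule ordLeq_refl) (rule card_of_Card_order)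
    show "\<forall>t\<in>T. |{s \<in> S. cip H s t \<noteq> 0}| \<le>o |T|"
    proof
      fix t assume t: "t \<in> T"
      obtain f :: "'a \<Rightarrow> nat" where f: "inj_on f {s \<in> S. cip H s t \<noteq> 0}"
        using countable_nonorthogonal[OF So tc[OF t]] by (auto simp: countable_def)
      obtain g :: "nat \<Rightarrow> 'a" where g: "inj g" "range g \<subseteq> T" using infinite_countable_subset[OF False] by blast
      have "inj_on (g \<circ> f) {s \<in> S. cip H s t \<noteq> 0}"
        by (rule comp_inj_on[OF f]) (use g(1) in \<open>auto intro: inj_on_subset\<close>)
      moreover have "(g \<circ> f) ` {s \<in> S. cip H s t \<noteq> 0} \<subseteq> T" using g(2) by auto
      ultimately show "|{s \<in> S. cip H s t \<noteq> 0}| \<le>o |T|" using card_of_ordLeq by blast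
    qed
  qed
  finally show ?thesis .
qed

end

lemma hilbert_dim_unitary:
  assumes "hilbert_space H" "hilbert_space K" "unitary_map H K T"
  shows "hilbert_dim H =o hilbert_dim K"
proof -
  interpret H: hilbert_space H by fact
  interpret K: hilbert_space K by fact
  define S where "S = (SOME S. orthonormal_basis H S)"
  define R where "R = (SOME S. orthonormal_basis K S)"
  have S: "orthonormal_basis H S" unfolding S_def by (rule someI_ex[OF H.orthonormal_basis_exists])
  have R: "orthonormal_basis K R" unfolding R_def by (rule someI_ex[OF K.orthonormal_basis_exists])
  note T = unitary_mapD[OF assms(3)]
  have Sc: "S \<subseteq> carrier H" and St: "closed_span H S = carrier H" and So: "\<And>x y. \<lbrakk>x \<in> S; y \<in> S\<rbrakk> \<Longrightarrow> cip H x y = (if x = y then 1 else 0)"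
    using S by (auto simp: orthonormal_basis_def)
  have inj: "inj_on T S" using T(5) Sc by (auto simp: bij_betw_def intro: inj_on_subset)
  have "orthonormal_basis K (T ` S)"
    unfolding orthonormal_basis_def
  proof (intro conjI ballI)
    show "T ` S \<subseteq> carrier K" using T(1) Sc by auto
    show "closed_span K (T ` S) = carrier K"
      using unitary_image_closed_span[OF assms Sc] St T(5) by (simp add: bij_betw_def)
    fix x y assume "x \<in> T ` S" "y \<in> T ` S"
    then obtain a b where ab: "a \<in> S" "x = T a" "b \<in> S" "y = T b" by blast
    then have "x = y \<longleftrightarrow> a = b" using inj by (auto dest: inj_onD)
    then show "cip K x y = (if x = y then 1 else 0)"
      using T(4)[OF subsetD[OF Sc ab(1)] subsetD[OF Sc ab(3)]] So[OF ab(1,3)] ab(2,4) by simp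
  qed
  then have "|T ` S| =o |R|"
    unfolding ordIso_iff_ordLeq using K.orthonormal_card_le R by blast
  moreover have "|S| =o |T ` S|" using inj card_of_ordIsoI[of T S "T ` S"] by (simp add: bij_betw_def)
  ultimately have "|S| =o |R|" by (rule ordIso_transitive[rotated])
  then show ?thesis by (simp add: hilbert_dim_def S_def R_def)
qed

section \<open>The index\<close>

context spatial_system
begin

abbreviation "root_of v \<equiv> log_unit (rescale v)"

lemma root_of_root: "v \<in> units E \<Longrightarrow> root_of v \<in> roots E u"
  by (rule log_unit_root[OF rescale_unit rescale_unital])

lemma root_of_exp_root: "a \<in> roots E u \<Longrightarrow> root_of (exp_root a) = a"
  using rescale_normal[OF exp_root_unit] log_exp_root' by simp

text \<open>Its squared norm is the covariance of u with itself, which is 0.\<close>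

lemma root_of_u: "root_of u = \<zero>\<^bsub>root_space E u\<^esub>"
proof -
  interpret R: hilbert_space "root_space E u" by (rule hilbert_root_space)
  have "rescale u = u" by (rule rescale_normal[OF u_unit unital_u])
  moreover have "covariance E u u = 0" by (rule covariance_eqI[OF u_unit u_unit]) (simp add: u_norm)
  ultimately have "cip (root_space E u) (root_of u) (root_of u) = 0"
    using cip_log_units[OF u_unit unital_u u_unit unital_u] by simp
  then show ?thesis using R.cip_definite[of "root_of u"] root_of_root[OF u_unit] by simp
qed

lemma covariance_commute:
  assumes v: "v \<in> units E" and w: "w \<in> units E" shows "covariance E w v = cnj (covariance E v w)"
proof (rule covariance_eqI[OF w v])
  fix t :: real assume t: "t > 0"
  have "cip (H t) (w t) (v t) = cnj (cip (H t) (v t) (w t))" by (rule cip_commute[OF t unitsD(2)[OF v t] unitsD(2)[OF w t]])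
  then show "cip (H t) (w t) (v t) = exp (of_real t * cnj (covariance E v w))"
    unfolding cip_units[OF v w t] by (simp add: exp_cnj)
qed

text \<open>Totality holds because every root a is the root attached to the unit
  \<open>exp_root a\<close>. The matrix here is the Gram matrix of the roots; the covariance defines
  the same form only on total mass zero.\<close>

sublocale index_model: free_model "root_space E u" "units E" "\<lambda>v w. cip (root_space E u) (root_of v) (root_of w)" root_of
proof (intro free_model.intro free_model_axioms.intro hilbert_root_space)
  interpret R: hilbert_space "root_space E u" by (rule hilbert_root_space)
  have "root_of ` units E = carrier (root_space E u)"
  proof (intro equalityI subsetI)
    fix a assume "a \<in> carrier (root_space E u)"
    then have a: "a \<in> roots E u" by simp
    then show "a \<in> root_of ` units E" using root_of_exp_root exp_root_unit(1) by (metis image_eqI)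
  qed (use root_of_root in auto)
  then show "closed_span (root_space E u) (root_of ` units E) = carrier (root_space E u)"
    using R.closed_span_superset[of "carrier (root_space E u)"]
      R.closed_span_minimal[OF R.closed_subspace_carrier order_refl] by auto
qed (use root_of_root in auto)

abbreviation "\<Phi> \<equiv> lincomb (root_space E u) root_of"

lemma carrier_pre_index: "f \<in> carrier (pre_index_space E) \<longleftrightarrow>
    finite {v. f v \<noteq> 0} \<and> {v. f v \<noteq> 0} \<subseteq> units E \<and> (\<Sum>v | f v \<noteq> 0. f v) = 0"
  by (auto simp: pre_index_space_def)

text \<open>On functions of total mass zero the terms \<open>\<gamma>(u, v)\<close> in the covariance cancel.\<close>

lemma cip_pre_index:
  assumes f: "f \<in> carrier (pre_index_space E)" and g: "g \<in> carrier (pre_index_space E)"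
  shows "cip (root_space E u) (\<Phi> f) (\<Phi> g) = cip (pre_index_space E) f g"
proof -
  let ?S = "{v. f v \<noteq> 0}" and ?T = "{v. g v \<noteq> 0}"
  let ?r = "\<lambda>v w. cip (root_space E u) (root_of v) (root_of w)"
  note f' = f[unfolded carrier_pre_index] and g' = g[unfolded carrier_pre_index]
  have cf: "(\<Sum>v\<in>?S. cnj (f v)) = 0" using f' by (metis cnj_sum complex_cnj_zero)
  have "cip (pre_index_space E) f g = (\<Sum>v\<in>?S. \<Sum>w\<in>?T. covariance E v w * cnj (f v) * g w)"
    by (simp add: pre_index_space_def cip_free_space)
  also have "\<dots> = (\<Sum>v\<in>?S. \<Sum>w\<in>?T. cnj (covariance E u v) * cnj (f v) * g w +
     (cnj (f v) * (covariance E u w * g w) + ?r v w * cnj (f v) * g w))"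
    by (intro sum.cong refl) (use f' g' covariance_rescale in \<open>auto simp: subset_iff algebra_simps\<close>)
  also have "\<dots> = (\<Sum>v\<in>?S. \<Sum>w\<in>?T. cnj (covariance E u v) * cnj (f v) * g w) +
     ((\<Sum>v\<in>?S. \<Sum>w\<in>?T. cnj (f v) * (covariance E u w * g w)) + (\<Sum>v\<in>?S. \<Sum>w\<in>?T. ?r v w * cnj (f v) * g w))"
    by (simp only: sum.distrib)
  also have "(\<Sum>v\<in>?S. \<Sum>w\<in>?T. cnj (covariance E u v) * cnj (f v) * g w) = 0"
    using g' by (simp flip: sum_distrib_left)
  also have "(\<Sum>v\<in>?S. \<Sum>w\<in>?T. cnj (f v) * (covariance E u w * g w)) = (\<Sum>v\<in>?S. cnj (f v)) * (\<Sum>w\<in>?T. covariance E u w * g w)"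
    by (simp only: sum_product)
  also have "\<dots> = 0" using cf by simp
  also have "(\<Sum>v\<in>?S. \<Sum>w\<in>?T. ?r v w * cnj (f v) * g w) = cip (root_space E u) (\<Phi> f) (\<Phi> g)"
    by (rule index_model.R.cip_lincomb_lincomb[symmetric]) (use f' g' root_of_root in auto)
  finally show ?thesis by simp
qed

lemma pre_index_closed:
  assumes f: "f \<in> carrier (pre_index_space E)" and g: "g \<in> carrier (pre_index_space E)"
  shows "(\<lambda>v. f v + c * g v) \<in> carrier (pre_index_space E)"
proof -
  note f' = f[unfolded carrier_pre_index] and g' = g[unfolded carrier_pre_index]
  let ?A = "{v. f v \<noteq> 0} \<union> {v. g v \<noteq> 0}"
  have A: "finite ?A" "?A \<subseteq> units E" using f' g' by auto
  have sub: "{v. f v + c * g v \<noteq> 0} \<subseteq> ?A" by auto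
  have "(\<Sum>v | f v + c * g v \<noteq> 0. f v + c * g v) = (\<Sum>v\<in>?A. f v + c * g v)"
    by (rule sum.mono_neutral_left[OF A(1) sub]) auto
  also have "\<dots> = (\<Sum>v\<in>?A. f v) + c * (\<Sum>v\<in>?A. g v)" by (simp add: sum.distrib sum_distrib_left)
  also have "(\<Sum>v\<in>?A. f v) = (\<Sum>v | f v \<noteq> 0. f v)" by (rule sum.mono_neutral_right[OF A(1)]) auto
  also have "(\<Sum>v\<in>?A. g v) = (\<Sum>v | g v \<noteq> 0. g v)" by (rule sum.mono_neutral_right[OF A(1)]) auto
  finally show ?thesis unfolding carrier_pre_index using A sub f' g' finite_subset[OF sub A(1)] by auto
qed

lemma zero_pre_index: "(\<lambda>v. 0) \<in> carrier (pre_index_space E)"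
  by (simp add: carrier_pre_index)

text \<open>Nonnegativity is read off from the isometry into the space of roots; hermitian symmetry
  holds for the covariance itself.\<close>

lemma pre_hilbert_pre_index: "pre_hilbert (pre_index_space E)"
proof -
  have "pre_hilbert ((free_space (units E) (covariance E))\<lparr>carrier := carrier (pre_index_space E)\<rparr>)"
  proof (rule pre_hilbert_free_subspace)
    show "carrier (pre_index_space E) \<subseteq> carrier (free_space (units E) (covariance E))"
      by (auto simp: pre_index_space_def)
    show "(\<lambda>x. f x + g x) \<in> carrier (pre_index_space E)" if "f \<in> carrier (pre_index_space E)" "g \<in> carrier (pre_index_space E)" for f g
      using pre_index_closed[OF that, of 1] by simp
    show "(\<lambda>x. c * f x) \<in> carrier (pre_index_space E)" if "f \<in> carrier (pre_index_space E)" for c f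
      using pre_index_closed[OF zero_pre_index that, of c] by simp
    show "0 \<le> Re (cip (free_space (units E) (covariance E)) f f)" if f: "f \<in> carrier (pre_index_space E)" for f
    proof -
      have "f \<in> carrier (free_space (units E) (\<lambda>v w. cip (root_space E u) (root_of v) (root_of w)))"
        using f by (auto simp: carrier_pre_index)
      from index_model.R.cip_nonneg[OF index_model.lincomb_carrier[OF this]] have "0 \<le> Re (cip (pre_index_space E) f f)"
        unfolding cip_pre_index[OF f f] .
      then show ?thesis by (simp add: pre_index_space_def)
    qed
  qed (rule zero_pre_index covariance_commute; assumption)+
  moreover have "(free_space (units E) (covariance E))\<lparr>carrier := carrier (pre_index_space E)\<rparr> = pre_index_space E"
    by (simp add: pre_index_space_def)
  ultimately show ?thesis by simp
qed

lemma root_in_range: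
  assumes a: "a \<in> roots E u" shows "a \<in> \<Phi> ` carrier (pre_index_space E)"
proof -
  let ?k = "\<lambda>v w. cip (root_space E u) (root_of v) (root_of w)"
  let ?d = "\<lambda>w v. if v = w then 1 else (0 :: complex)"
  let ?f = "\<lambda>v. ?d (exp_root a) v + (-1) * ?d u v"
  note ea = exp_root_unit(1)[OF a]
  have d: "?d w \<in> carrier (free_space (units E) ?k)" if "w \<in> units E" for w using that by auto
  have "\<Phi> ?f = \<Phi> (?d (exp_root a)) \<oplus>\<^bsub>root_space E u\<^esub> (-1) \<odot>\<^bsub>root_space E u\<^esub> \<Phi> (?d u)"
    using index_model.\<phi>_add[OF d[OF ea] index_model.V.smult_carrier[OF d[OF u_unit], of "-1"]]
      index_model.\<phi>_smult[OF d[OF u_unit], of "-1"] by simp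
  also have "\<dots> = root_of (exp_root a) \<oplus>\<^bsub>root_space E u\<^esub> (-1) \<odot>\<^bsub>root_space E u\<^esub> root_of u"
    using index_model.lincomb_point[OF ea] index_model.lincomb_point[OF u_unit] by simp
  also have "\<dots> = a"
    unfolding root_of_u root_of_exp_root[OF a] using index_model.R.smult_r_null[of "-1"] index_model.R.M.r_zero[of a] a
    by (simp del: root_space_simps(2-5))
  finally have 1: "\<Phi> ?f = a" .
  have sub: "{v. ?f v \<noteq> 0} \<subseteq> {exp_root a, u}" by auto
  have "(\<Sum>v | ?f v \<noteq> 0. ?f v) = (\<Sum>v\<in>{exp_root a, u}. ?f v)"
    by (rule sum.mono_neutral_left[OF _ sub]) auto
  \<comment> \<open>If \<open>exp_root a = u\<close>, the two point masses sit at the same unit and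
    cancel; otherwise the values are 1 and -1.\<close>
  also have "\<dots> = 0" by (cases "exp_root a = u") auto
  finally have 2: "(\<Sum>v | ?f v \<noteq> 0. ?f v) = 0" .
  have "finite {v. ?f v \<noteq> 0}" by (rule finite_subset[OF sub]) simp
  moreover have "{v. ?f v \<noteq> 0} \<subseteq> units E" by (rule order_trans[OF sub]) (simp add: ea u_unit)
  ultimately have "?f \<in> carrier (pre_index_space E)" unfolding carrier_pre_index using 2 by blast
  then have "\<Phi> ?f \<in> \<Phi> ` carrier (pre_index_space E)" by (rule imageI)
  then show ?thesis unfolding 1 .
qed

text \<open>The map is onto by \<open>root_in_range\<close>, which gives density; the space of roots
  is thus a model of the index space.\<close>

lemma completion_model_index: "completion_model (pre_index_space E) (root_space E u) \<Phi>"
proof (intro completion_model.intro completion_model_axioms.intro pre_hilbert_pre_index hilbert_root_space)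
  let ?k = "\<lambda>v w. cip (root_space E u) (root_of v) (root_of w)"
  have sub: "f \<in> carrier (free_space (units E) ?k)" if "f \<in> carrier (pre_index_space E)" for f
    using that by (auto simp: carrier_pre_index)
  show "linear_map (pre_index_space E) (root_space E u) \<Phi>"
    unfolding linear_map_def
  proof (intro conjI ballI allI)
    show "\<Phi> \<in> carrier (pre_index_space E) \<rightarrow> carrier (root_space E u)"
      using index_model.lincomb_carrier sub by blast
    show "\<Phi> (f \<oplus>\<^bsub>pre_index_space E\<^esub> g) = \<Phi> f \<oplus>\<^bsub>root_space E u\<^esub> \<Phi> g"
      if "f \<in> carrier (pre_index_space E)" "g \<in> carrier (pre_index_space E)" for f g
      using index_model.\<phi>_add[OF sub[OF that(1)] sub[OF that(2)]] by (simp add: pre_index_space_def)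
    show "\<Phi> (c \<odot>\<^bsub>pre_index_space E\<^esub> f) = c \<odot>\<^bsub>root_space E u\<^esub> \<Phi> f"
      if "f \<in> carrier (pre_index_space E)" for c f
      using index_model.\<phi>_smult[OF sub[OF that], of c] by (simp add: pre_index_space_def)
  qed
  have "\<Phi> ` carrier (pre_index_space E) = carrier (root_space E u)"
    using root_in_range index_model.lincomb_carrier sub by auto
  then show "closed_span (root_space E u) (\<Phi> ` carrier (pre_index_space E)) = carrier (root_space E u)"
    using index_model.R.closed_span_superset[of "carrier (root_space E u)"]
      index_model.R.closed_span_minimal[OF index_model.R.closed_subspace_carrier order_refl] by auto
qed (rule cip_pre_index)

lemma index_eq_dim: "index E =o hilbert_dim (root_space E u)"
proof -
  interpret C: completion_model "pre_index_space E" "root_space E u" \<Phi> by (rule completion_model_index)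
  show ?thesis unfolding index_def index_space_def
    by (rule hilbert_dim_unitary[OF C.hilbert_space_hcompletion hilbert_root_space C.ext_unitary])
qed

end

theorem theorem3p7:
  fixes E :: "'a arveson_data" and u :: "real \<Rightarrow> 'a"
  assumes "arveson_system E" and "spatial E" and "normalised_unit E u"
  shows "generated_subsystem E (insert u (roots E u)) = type_I_part E
    \<and> roots E u = roots (restrict_system E (type_I_part E)) u
    \<and> index E =o hilbert_dim (root_space E u)"
proof -
  interpret spatial_system E u
    by (intro spatial_system.intro spatial_system_axioms.intro assms)
  show ?thesis using generated_eq_type_I_part roots_type_I_part index_eq_dim by blast
qed

end
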